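(* The limit triplet $(\widetilde{\mathbf u},\widetilde{\mathbf w},\widetilde p)\in V_{z_3}(\Omega)^3\times V_{z_3}(\Omega)^3\times(L^2_0(\Omega)\cap H^1(\omega))$, with $\widetilde u_3=\widetilde w_3\equiv0$, defined in the context, is the unique solution of the reduced effective micropolar system $$-\partial_{z_3}^2\widetilde{\mathbf u}'(z)-2N^2\,\mathrm{rot}_{z_3}(\widetilde{\mathbf w}'(z))=\mathbf f'(z')-\nabla_{z'}\widetilde p(z')\quad\text{in }\Omega,$$ $$-R_c\,\partial_{z_3}^2\widetilde{\mathbf w}'(z)+4N^2\,\widetilde{\mathbf w}'(z)-2N^2\,\mathrm{rot}_{z_3}(\widetilde{\mathbf u}'(z))=\mathbf g'(z')\quad\text{in }\Omega,$$ with the divergence condition $$-\mathrm{div}_{z'}\Big(\int_0^{h(z')}\widetilde{\mathbf u}'(z)\,dz_3\Big)=0\quad\text{in }\omega,$$ the no-slip condition for velocity and no-spin condition for microrotation on the top boundary $$\widetilde{\mathbf u}'=0,\quad\widetilde{\mathbf w}'=0\quad\text{on }\Gamma_1,$$ and the following boundary conditions on the bottom boundary $\Gamma_0$, depending on the value of $\gamma$: - if $\gamma>-1$, perfect slip for velocity and no-spin for microrotation: $-\partial_{z_3}\widetilde{\mathbf u}'=0$, $\widetilde{\mathbf w}'=0$ on $\Gamma_0$; - if $\gamma=-1$, partial slip for velocity and no-spin for microrotation: $-\partial_{z_3}\widetilde{\mathbf u}'=-\lambda\widetilde{\mathbf u}'$, $\widetilde{\mathbf w}'=0$ on $\Gamma_0$;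 - if $\gamma<-1$, no-slip for velocity and no-spin for microrotation: $\widetilde{\mathbf u}'=0$, $\widetilde{\mathbf w}'=0$ on $\Gamma_0$.
   Context: Data: $\omega\subset\mathbb{R}^2$ is a bounded connected open set with Lipschitz boundary; $h\in W^{1,\infty}(\omega)$ with $0<h_{\min}\le h(x')<h_{\max}$; $N,R_c,\lambda>0$ with $N^2<1$; $\gamma\in\mathbb{R}$; $\mathbf f',\mathbf g'\in L^2(\omega)^2$ (functions of $x'$ only). Points are $x=(x',x_3)$, vectors $\varphi=(\varphi',\varphi_3)$. Thin domain: $\Omega^\epsilon=\{(x',x_3):x'\in\omega,\ 0<x_3<\epsilon h(x')\}$, $\Gamma_0=\omega\times\{0\}$, $\Gamma_1^\epsilon=\{(x',\epsilon h(x')):x'\in\omega\}$, $\Gamma^\epsilon_{\rm lat}=\partial\Omega^\epsilon\setminus(\Gamma_0\cup\Gamma_1^\epsilon)$. Spaces: $V^\epsilon=\{\varphi\in H^1(\Omega^\epsilon)^3:\varphi=0\text{ on }\Gamma_1^\epsilon\cup\Gamma^\epsilon_{\rm lat},\ \varphi_3=0\text{ on }\Gamma_0\}$, $V^\epsilon_0=\{\varphi\in V^\epsilon:\mathrm{div}\,\varphi=0\}$, and $L^2_0$ denotes $L^2$ functions of zero mean. $\mathrm{rot}(\varphi)=(\partial_{x_2}\varphi_3-\partial_{x_3}\varphi_2,-\partial_{x_1}\varphi_3+\partial_{x_3}\varphi_1,\partial_{x_1}\varphi_2-\partial_{x_2}\varphi_1)^t$. $(\mathbf u_\epsilon,\mathbf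 w_\epsilon,p_\epsilon)\in V^\epsilon_0\times H^1_0(\Omega^\epsilon)^3\times L^2_0(\Omega^\epsilon)$ is the unique weak solution of: for all $\varphi\in V^\epsilon$, $\psi\in H^1_0(\Omega^\epsilon)^3$, $$\int_{\Omega^\epsilon}D\mathbf u_\epsilon:D\varphi\,dx-\int_{\Omega^\epsilon}p_\epsilon\,\mathrm{div}(\varphi)\,dx-2N^2\int_{\Omega^\epsilon}\mathrm{rot}(\varphi)\cdot\mathbf w_\epsilon\,dx+\lambda\epsilon^\gamma\int_{\Gamma_0}\mathbf u'_\epsilon\cdot\varphi'\,d\sigma=\int_{\Omega^\epsilon}\mathbf f'\cdot\varphi'\,dx,$$ $$\epsilon^2R_c\int_{\Omega^\epsilon}D\mathbf w_\epsilon:D\psi\,dx+4N^2\int_{\Omega^\epsilon}\mathbf w_\epsilon\cdot\psi\,dx-2N^2\int_{\Omega^\epsilon}\mathbf u_\epsilon\cdot\mathrm{rot}(\psi)\,dx=\epsilon\int_{\Omega^\epsilon}\mathbf g'\cdot\psi'\,dx.$$ Rescaling: $\Omega=\{(z',z_3):z'\in\omega,\ 0<z_3<h(z')\}$, $\Gamma_1=\{(z',h(z')):z'\in\omega\}$, and $\widetilde{\mathbf u}_\epsilon(z',z_3)=\mathbf u_\epsilon(z',\epsilon z_3)$, $\widetilde{\mathbf w}_\epsilon(z',z_3)=\mathbf w_\epsilon(z',\epsilon z_3)$, $\widetilde p_\epsilon(z',z_3)=p_\epsilon(z',\epsilon z_3)$. $V_{z_3}(\Omega)=\{\varphi\in L^2(\Omega):\partial_{z_3}\varphi\in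 L^2(\Omega)\}$ with norm $(\|\varphi\|^2_{L^2(\Omega)}+\|\partial_{z_3}\varphi\|^2_{L^2(\Omega)})^{1/2}$. $L^2_0(\Omega)\cap H^1(\omega)$ denotes functions in $H^1(\omega)$ (independent of $z_3$) with zero mean over $\Omega$. Limit triplet: $(\widetilde{\mathbf u},\widetilde{\mathbf w},\widetilde p)$ is a limit along a subsequence $\epsilon\to0$ in the sense that $\epsilon^{-2}\widetilde{\mathbf u}_\epsilon\rightharpoonup\widetilde{\mathbf u}$ and $\epsilon^{-1}\widetilde{\mathbf w}_\epsilon\rightharpoonup\widetilde{\mathbf w}$ weakly in $V_{z_3}(\Omega)^3$, and $\widetilde p_\epsilon\to\widetilde p$ in $L^2(\Omega)$ (such subsequences exist, with limits in the stated class and $\widetilde u_3=\widetilde w_3\equiv0$). For $\varphi'=(\varphi_1,\varphi_2)$, $\mathrm{rot}_{z_3}(\varphi')=\partial_{z_3}(\varphi')^\perp$ with $(\varphi')^\perp=(-\varphi_2,\varphi_1)^t$. The system is understood in the weak sense, with boundary values on $\Gamma_0,\Gamma_1$ in the sense of traces in the $z_3$ variable.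
   Formalization: The divergence condition is tested with all of H^1(ω), so it also includes zero normal flux of ∫_0^h u' dz_3 through ∂ω; with only div = 0 in ω the pressure, and so the solution, is not unique (f'=g'=0, h constant, p = x_1 minus its mean). *)

theory Defs
  imports "HOL-Analysis.Analysis"
begin

text \<open>Points of space and three-dimensional vectors are pairs (x', x3), so that \<open>fst\<close> and
  \<open>snd\<close> are the horizontal part and the third component.\<close>

type_synonym R2 = "real ^ 2"
type_synonym R3 = "(real ^ 2) \<times> real"

definition e1 :: R3 where "e1 = (axis 1 1, 0)"
definition e2 :: R3 where "e2 = (axis 2 1, 0)"
definition e3 :: R3 where "e3 = (0, 1)"


subsection \<open>Smooth functions, weak derivatives, Sobolev spaces\<close>

definition pderiv_at :: "'a::euclidean_space \<Rightarrow> ('a \<Rightarrow> real) \<Rightarrow> 'a \<Rightarrow> real" where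
  "pderiv_at v f x = frechet_derivative f (at x) v"

primrec iter_pderiv :: "'a::euclidean_space list \<Rightarrow> ('a \<Rightarrow> real) \<Rightarrow> 'a \<Rightarrow> real" where
  "iter_pderiv [] f = f"
| "iter_pderiv (v # vs) f = pderiv_at v (iter_pderiv vs f)"

definition smooth :: "('a::euclidean_space \<Rightarrow> real) \<Rightarrow> bool" where
  "smooth f \<longleftrightarrow> (\<forall>vs x. iter_pderiv vs f differentiable at x)"

definition test_functions :: "'a::euclidean_space set \<Rightarrow> ('a \<Rightarrow> real) set" where
  "test_functions S = {\<phi>. smooth \<phi> \<and> compact (closure {x. \<phi> x \<noteq> 0}) \<and> closure {x. \<phi> x \<noteq> 0} \<subseteq> S}"

definition L2 :: "'a::euclidean_space set \<Rightarrow> ('a \<Rightarrow> real) set" where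
  "L2 S = {f. f \<in> borel_measurable (lebesgue_on S) \<and> integrable (lebesgue_on S) (\<lambda>x. (f x)\<^sup>2)}"

definition Linf :: "'a::euclidean_space set \<Rightarrow> ('a \<Rightarrow> real) set" where
  "Linf S = {f. f \<in> borel_measurable (lebesgue_on S) \<and> (\<exists>C. AE x in lebesgue_on S. \<bar>f x\<bar> \<le> C)}"

definition L1_loc :: "'a::euclidean_space set \<Rightarrow> ('a \<Rightarrow> real) set" where
  "L1_loc S = {f. f \<in> borel_measurable (lebesgue_on S) \<and>
                  (\<forall>K. compact K \<longrightarrow> K \<subseteq> S \<longrightarrow> integrable (lebesgue_on K) f)}"

definition has_weak_deriv ::
  "'a::euclidean_space set \<Rightarrow> 'a \<Rightarrow> ('a \<Rightarrow> real) \<Rightarrow> ('a \<Rightarrow> real) \<Rightarrow> bool" where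
  "has_weak_deriv S v f g \<longleftrightarrow> f \<in> L1_loc S \<and> g \<in> L1_loc S \<and>
     (\<forall>\<phi>\<in>test_functions S.
        (LINT x|lebesgue_on S. f x * pderiv_at v \<phi> x) = - (LINT x|lebesgue_on S. g x * \<phi> x))"

text \<open>The weak derivative is determined only up to a null set; \<open>wderiv\<close> picks one representative.
  It is meaningful only where a weak derivative exists.\<close>

definition wderiv :: "'a::euclidean_space set \<Rightarrow> 'a \<Rightarrow> ('a \<Rightarrow> real) \<Rightarrow> 'a \<Rightarrow> real" where
  "wderiv S v f = (SOME g. has_weak_deriv S v f g)"

definition H1 :: "'a::euclidean_space set \<Rightarrow> ('a \<Rightarrow> real) set" where
  "H1 S = {f \<in> L2 S. \<forall>v\<in>Basis. \<exists>g\<in>L2 S. has_weak_deriv S v f g}"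

definition H1_norm :: "'a::euclidean_space set \<Rightarrow> ('a \<Rightarrow> real) \<Rightarrow> real" where
  "H1_norm S f = sqrt ((LINT x|lebesgue_on S. (f x)\<^sup>2) +
                       (\<Sum>v\<in>Basis. LINT x|lebesgue_on S. (wderiv S v f x)\<^sup>2))"

definition H1_tendsto ::
  "'a::euclidean_space set \<Rightarrow> (nat \<Rightarrow> 'a \<Rightarrow> real) \<Rightarrow> ('a \<Rightarrow> real) \<Rightarrow> bool" where
  "H1_tendsto S F f \<longleftrightarrow> (\<forall>n. F n \<in> H1 S) \<and> f \<in> H1 S \<and>
     (\<lambda>n. H1_norm S (\<lambda>x. F n x - f x)) \<longlonglongrightarrow> 0"

definition H10 :: "'a::euclidean_space set \<Rightarrow> ('a \<Rightarrow> real) set" where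
  "H10 S = {f. \<exists>F. (\<forall>n. F n \<in> test_functions S) \<and> H1_tendsto S F f}"

definition W1inf :: "'a::euclidean_space set \<Rightarrow> ('a \<Rightarrow> real) set" where
  "W1inf S = {f \<in> Linf S. \<forall>v\<in>Basis. \<exists>g\<in>Linf S. has_weak_deriv S v f g}"

text \<open>H1 functions vanishing on a part \<open>\<Gamma>\<close> of the boundary: the closure of the smooth functions
  that vanish near \<open>\<Gamma>\<close>. For \<open>\<Gamma> = frontier S\<close> and \<open>S\<close> bounded this is \<open>H10 S\<close>.\<close>

definition H1_vanishing_on :: "'a::euclidean_space set \<Rightarrow> 'a set \<Rightarrow> ('a \<Rightarrow> real) set" where
  "H1_vanishing_on S \<Gamma> = {f. \<exists>F. (\<forall>n. smooth (F n) \<and> (\<exists>U. open U \<and> \<Gamma> \<subseteq> U \<and> (\<forall>x\<in>U. F n x = 0))) \<and>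
                                H1_tendsto S F f}"

text \<open>Near each boundary point, \<open>S\<close> is the set above the graph of a Lipschitz function over the
  hyperplane orthogonal to some unit vector \<open>\<nu>\<close>.\<close>

definition lipschitz_boundary :: "'a::euclidean_space set \<Rightarrow> bool" where
  "lipschitz_boundary S \<longleftrightarrow>
     (\<forall>x\<in>frontier S. \<exists>r>0. \<exists>\<nu> L. \<exists>k :: 'a \<Rightarrow> real.
        norm \<nu> = 1 \<and> L-lipschitz_on UNIV k \<and>
        S \<inter> ball x r = {y \<in> ball x r. k (y - (y \<bullet> \<nu>) *\<^sub>R \<nu>) < y \<bullet> \<nu>})"


subsection \<open>The domains and their boundary parts\<close>

text \<open>With \<open>\<epsilon> h\<close> in place of \<open>h\<close> these give the thin domain, with \<open>h\<close> the rescaled one.\<close>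

definition dom_under :: "R2 set \<Rightarrow> (R2 \<Rightarrow> real) \<Rightarrow> R3 set" where
  "dom_under \<omega> h = {(x', x3). x' \<in> \<omega> \<and> 0 < x3 \<and> x3 < h x'}"

definition \<Gamma>_bot :: "R2 set \<Rightarrow> R3 set" where
  "\<Gamma>_bot \<omega> = \<omega> \<times> {0}"

definition \<Gamma>_top :: "R2 set \<Rightarrow> (R2 \<Rightarrow> real) \<Rightarrow> R3 set" where
  "\<Gamma>_top \<omega> h = (\<lambda>x'. (x', h x')) ` \<omega>"

definition \<Gamma>_lat :: "R2 set \<Rightarrow> (R2 \<Rightarrow> real) \<Rightarrow> R3 set" where
  "\<Gamma>_lat \<omega> h = frontier (dom_under \<omega> h) - (\<Gamma>_bot \<omega> \<union> \<Gamma>_top \<omega> h)"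


subsection \<open>The micropolar problem in the thin domain\<close>

text \<open>Trace on the flat bottom of an H1 function: the extension by density of the restriction map.
  The surface measure there is the Lebesgue measure of \<open>\<omega>\<close>.\<close>

definition has_bot_trace :: "R2 set \<Rightarrow> R3 set \<Rightarrow> (R3 \<Rightarrow> real) \<Rightarrow> (R2 \<Rightarrow> real) \<Rightarrow> bool" where
  "has_bot_trace \<omega> S f t \<longleftrightarrow> t \<in> L2 \<omega> \<and>
     (\<exists>F. (\<forall>n. smooth (F n) \<and> (\<lambda>x'. F n (x', 0)) \<in> L2 \<omega>) \<and> H1_tendsto S F f \<and>
          (\<lambda>n. LINT x'|lebesgue_on \<omega>. (F n (x', 0) - t x')\<^sup>2) \<longlonglongrightarrow> 0)"

definition bot_trace :: "R2 set \<Rightarrow> R3 set \<Rightarrow> (R3 \<Rightarrow> real) \<Rightarrow> R2 \<Rightarrow> real" where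
  "bot_trace \<omega> S f = (SOME t. has_bot_trace \<omega> S f t)"

definition wdiv :: "R3 set \<Rightarrow> (R3 \<Rightarrow> R3) \<Rightarrow> R3 \<Rightarrow> real" where
  "wdiv S \<phi> x = (\<Sum>i\<in>Basis. wderiv S i (\<lambda>y. \<phi> y \<bullet> i) x)"

definition wgrad_inner :: "R3 set \<Rightarrow> (R3 \<Rightarrow> R3) \<Rightarrow> (R3 \<Rightarrow> R3) \<Rightarrow> R3 \<Rightarrow> real" where
  "wgrad_inner S u \<phi> x =
     (\<Sum>i\<in>Basis. \<Sum>j\<in>Basis. wderiv S j (\<lambda>y. u y \<bullet> i) x * wderiv S j (\<lambda>y. \<phi> y \<bullet> i) x)"

definition wrot :: "R3 set \<Rightarrow> (R3 \<Rightarrow> R3) \<Rightarrow> R3 \<Rightarrow> R3" where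
  "wrot S \<phi> x =
     (wderiv S e2 (\<lambda>y. \<phi> y \<bullet> e3) x - wderiv S e3 (\<lambda>y. \<phi> y \<bullet> e2) x) *\<^sub>R e1 +
     (- wderiv S e1 (\<lambda>y. \<phi> y \<bullet> e3) x + wderiv S e3 (\<lambda>y. \<phi> y \<bullet> e1) x) *\<^sub>R e2 +
     (wderiv S e1 (\<lambda>y. \<phi> y \<bullet> e2) x - wderiv S e2 (\<lambda>y. \<phi> y \<bullet> e1) x) *\<^sub>R e3"

definition V_space :: "R2 set \<Rightarrow> (R2 \<Rightarrow> real) \<Rightarrow> (R3 \<Rightarrow> R3) set" where
  "V_space \<omega> h = {\<phi>.
     (\<forall>i\<in>Basis. (\<lambda>x. \<phi> x \<bullet> i) \<in> H1_vanishing_on (dom_under \<omega> h) (\<Gamma>_top \<omega> h \<union> \<Gamma>_lat \<omega> h)) \<and>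
     has_bot_trace \<omega> (dom_under \<omega> h) (\<lambda>x. \<phi> x \<bullet> e3) (\<lambda>x'. 0)}"

definition V0_space :: "R2 set \<Rightarrow> (R2 \<Rightarrow> real) \<Rightarrow> (R3 \<Rightarrow> R3) set" where
  "V0_space \<omega> h = {\<phi> \<in> V_space \<omega> h. AE x in lebesgue_on (dom_under \<omega> h). wdiv (dom_under \<omega> h) \<phi> x = 0}"

definition L2_mean0 :: "R3 set \<Rightarrow> (R3 \<Rightarrow> real) set" where
  "L2_mean0 S = {q \<in> L2 S. (LINT x|lebesgue_on S. q x) = 0}"

definition micropolar_solution ::
  "R2 set \<Rightarrow> (R2 \<Rightarrow> real) \<Rightarrow> real \<Rightarrow> real \<Rightarrow> real \<Rightarrow> real \<Rightarrow> (R2 \<Rightarrow> R2) \<Rightarrow> (R2 \<Rightarrow> R2) \<Rightarrow>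
   real \<Rightarrow> (R3 \<Rightarrow> R3) \<Rightarrow> (R3 \<Rightarrow> R3) \<Rightarrow> (R3 \<Rightarrow> real) \<Rightarrow> bool" where
  "micropolar_solution \<omega> h N Rc lam \<gamma> f g \<epsilon> u w p \<longleftrightarrow>
    (let h\<epsilon> = (\<lambda>x'. \<epsilon> * h x'); \<Omega>\<epsilon> = dom_under \<omega> h\<epsilon>; dx = lebesgue_on \<Omega>\<epsilon> in
       u \<in> V0_space \<omega> h\<epsilon> \<and> (\<forall>i\<in>Basis. (\<lambda>x. w x \<bullet> i) \<in> H10 \<Omega>\<epsilon>) \<and> p \<in> L2_mean0 \<Omega>\<epsilon> \<and>
       (\<forall>\<phi>\<in>V_space \<omega> h\<epsilon>.
          (LINT x|dx. wgrad_inner \<Omega>\<epsilon> u \<phi> x) - (LINT x|dx. p x * wdiv \<Omega>\<epsilon> \<phi> x)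
          - 2 * N\<^sup>2 * (LINT x|dx. wrot \<Omega>\<epsilon> \<phi> x \<bullet> w x)
          + lam * \<epsilon> powr \<gamma> *
              (LINT x'|lebesgue_on \<omega>. (\<Sum>i\<in>Basis. bot_trace \<omega> \<Omega>\<epsilon> (\<lambda>x. fst (u x) \<bullet> i) x' *
                                                 bot_trace \<omega> \<Omega>\<epsilon> (\<lambda>x. fst (\<phi> x) \<bullet> i) x'))
          = (LINT x|dx. f (fst x) \<bullet> fst (\<phi> x))) \<and>
       (\<forall>\<psi>. (\<forall>i\<in>Basis. (\<lambda>x. \<psi> x \<bullet> i) \<in> H10 \<Omega>\<epsilon>) \<longrightarrow>
          \<epsilon>\<^sup>2 * Rc * (LINT x|dx. wgrad_inner \<Omega>\<epsilon> w \<psi> x) + 4 * N\<^sup>2 * (LINT x|dx. w x \<bullet> \<psi> x)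
          - 2 * N\<^sup>2 * (LINT x|dx. u x \<bullet> wrot \<Omega>\<epsilon> \<psi> x)
          = \<epsilon> * (LINT x|dx. g (fst x) \<bullet> fst (\<psi> x))))"

definition rescale :: "real \<Rightarrow> (R3 \<Rightarrow> 'b) \<Rightarrow> R3 \<Rightarrow> 'b" where
  "rescale \<epsilon> v = (\<lambda>(z', z3). v (z', \<epsilon> * z3))"


subsection \<open>The limit space and its weak convergence\<close>

definition V_z3 :: "R3 set \<Rightarrow> (R3 \<Rightarrow> real) set" where
  "V_z3 S = {f \<in> L2 S. \<exists>g\<in>L2 S. has_weak_deriv S e3 f g}"

definition V_z3_norm :: "R3 set \<Rightarrow> (R3 \<Rightarrow> real) \<Rightarrow> real" where
  "V_z3_norm S f =
     sqrt ((LINT z|lebesgue_on S. (f z)\<^sup>2) + (LINT z|lebesgue_on S. (wderiv S e3 f z)\<^sup>2))"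

definition V_z3_dual :: "R3 set \<Rightarrow> ((R3 \<Rightarrow> real) \<Rightarrow> real) set" where
  "V_z3_dual S = {l.
     (\<forall>f\<in>V_z3 S. \<forall>g\<in>V_z3 S. \<forall>a b. l (\<lambda>z. a * f z + b * g z) = a * l f + b * l g) \<and>
     (\<exists>C. \<forall>f\<in>V_z3 S. \<bar>l f\<bar> \<le> C * V_z3_norm S f)}"

definition V_z3_weak_tendsto :: "R3 set \<Rightarrow> (nat \<Rightarrow> R3 \<Rightarrow> real) \<Rightarrow> (R3 \<Rightarrow> real) \<Rightarrow> bool" where
  "V_z3_weak_tendsto S F f \<longleftrightarrow> (\<forall>n. F n \<in> V_z3 S) \<and> f \<in> V_z3 S \<and>
     (\<forall>l\<in>V_z3_dual S. (\<lambda>n. l (F n)) \<longlonglongrightarrow> l f)"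

definition L2_tendsto ::
  "'a::euclidean_space set \<Rightarrow> (nat \<Rightarrow> 'a \<Rightarrow> real) \<Rightarrow> ('a \<Rightarrow> real) \<Rightarrow> bool" where
  "L2_tendsto S F f \<longleftrightarrow> (\<forall>n. F n \<in> L2 S) \<and> f \<in> L2 S \<and>
     (\<lambda>n. LINT x|lebesgue_on S. (F n x - f x)\<^sup>2) \<longlonglongrightarrow> 0"

definition limit_triplet ::
  "R2 set \<Rightarrow> (R2 \<Rightarrow> real) \<Rightarrow> (nat \<Rightarrow> real) \<Rightarrow>
   (real \<Rightarrow> R3 \<Rightarrow> R3) \<Rightarrow> (real \<Rightarrow> R3 \<Rightarrow> R3) \<Rightarrow> (real \<Rightarrow> R3 \<Rightarrow> real) \<Rightarrow>
   (R3 \<Rightarrow> R3) \<Rightarrow> (R3 \<Rightarrow> R3) \<Rightarrow> (R3 \<Rightarrow> real) \<Rightarrow> bool" where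
  "limit_triplet \<omega> h \<epsilon> u\<epsilon> w\<epsilon> p\<epsilon> u w p \<longleftrightarrow>
     (let \<Omega> = dom_under \<omega> h in
       (\<forall>i\<in>Basis. V_z3_weak_tendsto \<Omega>
          (\<lambda>n z. (rescale (\<epsilon> n) (u\<epsilon> (\<epsilon> n)) z \<bullet> i) / (\<epsilon> n)\<^sup>2) (\<lambda>z. u z \<bullet> i)) \<and>
       (\<forall>i\<in>Basis. V_z3_weak_tendsto \<Omega>
          (\<lambda>n z. (rescale (\<epsilon> n) (w\<epsilon> (\<epsilon> n)) z \<bullet> i) / \<epsilon> n) (\<lambda>z. w z \<bullet> i)) \<and>
       L2_tendsto \<Omega> (\<lambda>n. rescale (\<epsilon> n) (p\<epsilon> (\<epsilon> n))) p)"

text \<open>Mean-zero pressures that do not depend on z3 and are H1 functions of z'.\<close>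

definition L2_mean0_H1 :: "R2 set \<Rightarrow> (R2 \<Rightarrow> real) \<Rightarrow> (R3 \<Rightarrow> real) set" where
  "L2_mean0_H1 \<omega> h = {p \<in> L2_mean0 (dom_under \<omega> h).
     \<exists>q\<in>H1 \<omega>. AE z in lebesgue_on (dom_under \<omega> h). p z = q (fst z)}"

definition in_limit_class ::
  "R2 set \<Rightarrow> (R2 \<Rightarrow> real) \<Rightarrow> (R3 \<Rightarrow> R3) \<Rightarrow> (R3 \<Rightarrow> R3) \<Rightarrow> (R3 \<Rightarrow> real) \<Rightarrow> bool" where
  "in_limit_class \<omega> h u w p \<longleftrightarrow>
     (let \<Omega> = dom_under \<omega> h in
       (\<forall>i\<in>Basis. (\<lambda>z. u z \<bullet> i) \<in> V_z3 \<Omega>) \<and> (\<forall>i\<in>Basis. (\<lambda>z. w z \<bullet> i) \<in> V_z3 \<Omega>) \<and>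
       p \<in> L2_mean0_H1 \<omega> h \<and>
       (AE z in lebesgue_on \<Omega>. snd (u z) = 0) \<and> (AE z in lebesgue_on \<Omega>. snd (w z) = 0))"


subsection \<open>The reduced system\<close>

text \<open>Trace in the z3 variable on the graph of \<open>\<tau>\<close> (used for \<open>\<tau> = 0\<close> and \<open>\<tau> = h\<close>): the boundary
  value of the representative of \<open>f\<close> that is continuous up to both ends of almost every vertical
  segment. Such a representative exists for \<open>f \<in> V_z3\<close>.\<close>

definition has_z3_trace ::
  "R2 set \<Rightarrow> (R2 \<Rightarrow> real) \<Rightarrow> (R2 \<Rightarrow> real) \<Rightarrow> (R3 \<Rightarrow> real) \<Rightarrow> (R2 \<Rightarrow> real) \<Rightarrow> bool" where
  "has_z3_trace \<omega> h \<tau> f t \<longleftrightarrow>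
     (\<exists>F. (AE z in lebesgue_on (dom_under \<omega> h). F z = f z) \<and>
          (AE z' in lebesgue_on \<omega>. continuous_on {0..h z'} (\<lambda>s. F (z', s)) \<and> F (z', \<tau> z') = t z'))"

definition rot_z3 :: "R3 set \<Rightarrow> (R3 \<Rightarrow> R2) \<Rightarrow> R3 \<Rightarrow> R2" where
  "rot_z3 S \<phi> z = vector [- wderiv S e3 (\<lambda>y. \<phi> y $ 2) z, wderiv S e3 (\<lambda>y. \<phi> y $ 1) z]"

text \<open>The two balance equations hold in the sense of distributions on the rescaled domain.
  The divergence condition is the weak one with all H1 test functions: this contains, besides
  the vanishing of the divergence in \<open>\<omega>\<close>, the vanishing of the normal flux through
  the boundary of \<open>\<omega>\<close>, without which the pressure is not unique.\<close>

definition reduced_equations ::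
  "R2 set \<Rightarrow> (R2 \<Rightarrow> real) \<Rightarrow> real \<Rightarrow> real \<Rightarrow> (R2 \<Rightarrow> R2) \<Rightarrow> (R2 \<Rightarrow> R2) \<Rightarrow>
   (R3 \<Rightarrow> R3) \<Rightarrow> (R3 \<Rightarrow> R3) \<Rightarrow> (R3 \<Rightarrow> real) \<Rightarrow> bool" where
  "reduced_equations \<omega> h N Rc f g u w p \<longleftrightarrow>
     (let \<Omega> = dom_under \<omega> h; dz = lebesgue_on \<Omega>; u' = (\<lambda>z. fst (u z)); w' = (\<lambda>z. fst (w z)) in
       (\<forall>\<phi>\<in>test_functions \<Omega>. \<forall>i\<in>Basis.
          (LINT z|dz. wderiv \<Omega> e3 (\<lambda>y. u' y \<bullet> i) z * pderiv_at e3 \<phi> z)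
          - 2 * N\<^sup>2 * (LINT z|dz. (rot_z3 \<Omega> w' z \<bullet> i) * \<phi> z)
          = (LINT z|dz. (f (fst z) \<bullet> i - wderiv \<Omega> (i, 0) p z) * \<phi> z)) \<and>
       (\<forall>\<phi>\<in>test_functions \<Omega>. \<forall>i\<in>Basis.
          Rc * (LINT z|dz. wderiv \<Omega> e3 (\<lambda>y. w' y \<bullet> i) z * pderiv_at e3 \<phi> z)
          + 4 * N\<^sup>2 * (LINT z|dz. (w' z \<bullet> i) * \<phi> z)
          - 2 * N\<^sup>2 * (LINT z|dz. (rot_z3 \<Omega> u' z \<bullet> i) * \<phi> z)
          = (LINT z|dz. (g (fst z) \<bullet> i) * \<phi> z)) \<and>
       (\<forall>\<theta>\<in>H1 \<omega>.
          (LINT z'|lebesgue_on \<omega>. (\<Sum>i\<in>Basis.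
             (LINT s|lebesgue_on {0..h z'}. u' (z', s) \<bullet> i) * wderiv \<omega> i \<theta> z')) = 0))"

definition top_conditions ::
  "R2 set \<Rightarrow> (R2 \<Rightarrow> real) \<Rightarrow> (R3 \<Rightarrow> R3) \<Rightarrow> (R3 \<Rightarrow> R3) \<Rightarrow> bool" where
  "top_conditions \<omega> h u w \<longleftrightarrow>
     (\<forall>i\<in>Basis. has_z3_trace \<omega> h h (\<lambda>z. fst (u z) \<bullet> i) (\<lambda>z'. 0)) \<and>
     (\<forall>i\<in>Basis. has_z3_trace \<omega> h h (\<lambda>z. fst (w z) \<bullet> i) (\<lambda>z'. 0))"

definition bot_perfect_slip :: "R2 set \<Rightarrow> (R2 \<Rightarrow> real) \<Rightarrow> (R3 \<Rightarrow> R3) \<Rightarrow> bool" where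
  "bot_perfect_slip \<omega> h u \<longleftrightarrow>
     (\<forall>i\<in>Basis. has_z3_trace \<omega> h (\<lambda>z'. 0)
        (\<lambda>z. - wderiv (dom_under \<omega> h) e3 (\<lambda>y. fst (u y) \<bullet> i) z) (\<lambda>z'. 0))"

definition bot_partial_slip :: "R2 set \<Rightarrow> (R2 \<Rightarrow> real) \<Rightarrow> real \<Rightarrow> (R3 \<Rightarrow> R3) \<Rightarrow> bool" where
  "bot_partial_slip \<omega> h lam u \<longleftrightarrow>
     (\<forall>i\<in>Basis. \<exists>t. has_z3_trace \<omega> h (\<lambda>z'. 0) (\<lambda>z. fst (u z) \<bullet> i) t \<and>
        has_z3_trace \<omega> h (\<lambda>z'. 0)
          (\<lambda>z. - wderiv (dom_under \<omega> h) e3 (\<lambda>y. fst (u y) \<bullet> i) z) (\<lambda>z'. - lam * t z'))"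

text \<open>No-slip for the velocity, no-spin for the microrotation.\<close>

definition bot_zero :: "R2 set \<Rightarrow> (R2 \<Rightarrow> real) \<Rightarrow> (R3 \<Rightarrow> R3) \<Rightarrow> bool" where
  "bot_zero \<omega> h v \<longleftrightarrow> (\<forall>i\<in>Basis. has_z3_trace \<omega> h (\<lambda>z'. 0) (\<lambda>z. fst (v z) \<bullet> i) (\<lambda>z'. 0))"

definition reduced_system ::
  "R2 set \<Rightarrow> (R2 \<Rightarrow> real) \<Rightarrow> real \<Rightarrow> real \<Rightarrow> real \<Rightarrow> real \<Rightarrow> (R2 \<Rightarrow> R2) \<Rightarrow> (R2 \<Rightarrow> R2) \<Rightarrow>
   (R3 \<Rightarrow> R3) \<Rightarrow> (R3 \<Rightarrow> R3) \<Rightarrow> (R3 \<Rightarrow> real) \<Rightarrow> bool" where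
  "reduced_system \<omega> h N Rc lam \<gamma> f g u w p \<longleftrightarrow>
     reduced_equations \<omega> h N Rc f g u w p \<and> top_conditions \<omega> h u w \<and>
     (\<gamma> > -1 \<longrightarrow> bot_perfect_slip \<omega> h u \<and> bot_zero \<omega> h w) \<and>
     (\<gamma> = -1 \<longrightarrow> bot_partial_slip \<omega> h lam u \<and> bot_zero \<omega> h w) \<and>
     (\<gamma> < -1 \<longrightarrow> bot_zero \<omega> h u \<and> bot_zero \<omega> h w)"

end

theory Submission
  imports Defs
begin

text \<open>Test the rescaled equations with \<open>\<phi> v\<close>, where \<open>\<phi>\<close> is smooth and \<open>v\<close> is a constant vector. All
  horizontal derivatives are moved onto \<open>\<phi>\<close>, so that every term with a positive power of \<open>\<epsilon>\<close> is a
  bounded functional times that power and the weak convergence of the triplet is enough to pass to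
  the limit. The bottom term carries the factor \<open>\<epsilon> powr (\<gamma> + 1)\<close>: it disappears for \<open>\<gamma> > -1\<close>,
  survives for \<open>\<gamma> = -1\<close>, and has to vanish by itself for \<open>\<gamma> < -1\<close>. Test functions supported
  inside the domain give the equations, those reaching the bottom give the boundary conditions there.

  A function with an integrable vertical weak derivative is, on almost every vertical segment, a
  constant plus the indefinite integral of that derivative. In this representation traces are
  evaluations, and integration by parts in \<open>z3\<close> is Fubini's theorem. The pressure has no vertical
  derivative; testing the limit momentum balance with a product \<open>\<eta>(z') \<zeta>(z3)\<close> exhibits its
  horizontal gradient as an integral of square-integrable functions over the column.

  For uniqueness the difference of two solutions is inserted into its own equations. The pressure
  drops out by the flux condition, and because of \<open>N\<^sup>2 < 1\<close> the coupling terms are absorbed by the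
  dissipation, so velocity and microrotation agree. Then the pressure difference has zero gradient
  and zero mean on a connected base.\<close>

text \<open>The friction term lives on the bottom, where weak convergence of the fields says nothing
  by itself. \<open>bot_trace_parts\<close> rewrites it as two volume integrals that pair a field
  and its vertical derivative with smooth functions. In this form (\<open>bottom_term\<close>) it is
  weakly continuous on \<open>V_z3\<close>, so neither convergence of traces nor an a priori
  estimate is called for. For \<gamma> < -1 its coefficient blows up, yet the product converges
  because everything else in the balance does; hence the bottom term itself tends to 0. The boundary
  values of the limit are recovered afterwards, by comparing volume identities for test functions
  that reach only one end of the columns. Weak derivatives and bottom traces are choices among
  functions equal almost everywhere, so they are compared almost everywhere or under integrals. The
  flux identity is carried along for every H1 function on the base, since the difference of two
  pressures, which has no prescribed boundary values, must be admissible in it.\<close>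

section \<open>Calculus of smooth functions and a smooth step\<close>

lemma smooth_differentiable: "smooth f \<Longrightarrow> f differentiable at x"
  unfolding smooth_def by (metis iter_pderiv.simps(1))

lemma iter_pderiv_pderiv_at: "iter_pderiv vs (pderiv_at v f) = iter_pderiv (vs @ [v]) f"
  by (induction vs) auto

lemma smooth_pderiv_at: "smooth f \<Longrightarrow> smooth (pderiv_at v f)"
  unfolding smooth_def by (simp add: iter_pderiv_pderiv_at)

text \<open>\<open>smooth\<close> speaks about all lists of directions. Naming a class that is
  stable under a single derivative replaces an induction over such lists, and each smoothness proof
  below only has to find the right class.\<close>

lemma smooth_coinduct:
  assumes "X f"
    and "\<And>f x. X f \<Longrightarrow> f differentiable at x"
    and "\<And>f v. X f \<Longrightarrow> X (pderiv_at v f)"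
  shows "smooth f"
proof -
  have "X (iter_pderiv vs f)" for vs
    by (induction vs) (auto intro: assms)
  then show ?thesis
    unfolding smooth_def using assms(2) by blast
qed

lemma smooth_continuous_on: "smooth f \<Longrightarrow> continuous_on S f"
  by (meson continuous_at_imp_continuous_on differentiable_imp_continuous_within smooth_differentiable)

lemma pderiv_at_eqI: "(f has_derivative f') (at x) \<Longrightarrow> pderiv_at v f x = f' v"
  unfolding pderiv_at_def by (metis frechet_derivative_at)

lemma smooth_has_derivative: "smooth f \<Longrightarrow> (f has_derivative (\<lambda>v. pderiv_at v f x)) (at x)"
  unfolding pderiv_at_def using frechet_derivative_works smooth_differentiable by blast

lemma differentiable_has_derivative_pderiv_at:
  "f differentiable at x \<Longrightarrow> (f has_derivative (\<lambda>v. pderiv_at v f x)) (at x)"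
  unfolding pderiv_at_def using frechet_derivative_works by blast

lemma smooth_const [simp, intro]: "smooth (\<lambda>x. c)"
proof (rule smooth_coinduct[where X = "\<lambda>f. \<exists>c. f = (\<lambda>x. c)"], goal_cases)
  case (3 f v)
  then obtain c where "f = (\<lambda>x. c)" by blast
  then have "pderiv_at v f = (\<lambda>x. 0)"
    by (auto simp: fun_eq_iff intro!: pderiv_at_eqI derivative_eq_intros)
  then show ?case by blast
qed auto

lemma pderiv_at_add:
  assumes "f differentiable at x" "g differentiable at x"
  shows "pderiv_at v (\<lambda>x. f x + g x) x = pderiv_at v f x + pderiv_at v g x"
  by (rule pderiv_at_eqI)
    (auto intro!: derivative_eq_intros assms[THEN differentiable_has_derivative_pderiv_at])

lemma pderiv_at_mult:
  assumes "f differentiable at x" "g differentiable at x"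
  shows "pderiv_at v (\<lambda>x. f x * g x) x = pderiv_at v f x * g x + f x * pderiv_at v g x"
  by (rule pderiv_at_eqI)
    (auto intro!: derivative_eq_intros assms[THEN differentiable_has_derivative_pderiv_at])

lemma pderiv_at_cmult:
  assumes "f differentiable at x"
  shows "pderiv_at v (\<lambda>x. c * f x) x = c * pderiv_at v f x"
  by (rule pderiv_at_eqI)
    (auto intro!: derivative_eq_intros assms[THEN differentiable_has_derivative_pderiv_at])

text \<open>The Leibniz rule turns one product into a sum of two, so products alone are not stable
  under differentiation; finite sums of products are.\<close>

inductive smooth_products :: "('a::euclidean_space \<Rightarrow> real) \<Rightarrow> bool" where
  "smooth f \<Longrightarrow> smooth g \<Longrightarrow> smooth_products (\<lambda>x. f x * g x)"
| "smooth_products f \<Longrightarrow> smooth_products g \<Longrightarrow> smooth_products (\<lambda>x. f x + g x)"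

lemma smooth_products_closed:
  "smooth_products f \<Longrightarrow> (\<forall>x. f differentiable at x) \<and> (\<forall>v. smooth_products (pderiv_at v f))"
proof (induction rule: smooth_products.induct)
  case (1 f g)
  then have "pderiv_at v (\<lambda>x. f x * g x) = (\<lambda>x. pderiv_at v f x * g x + f x * pderiv_at v g x)" for v
    by (auto simp: fun_eq_iff intro!: pderiv_at_mult smooth_differentiable)
  with 1 show ?case
    by (auto intro!: smooth_products.intros differentiable_mult intro: smooth_pderiv_at smooth_differentiable)
next
  case (2 f g)
  then have "pderiv_at v (\<lambda>x. f x + g x) = (\<lambda>x. pderiv_at v f x + pderiv_at v g x)" for v
    by (auto simp: fun_eq_iff intro!: pderiv_at_add)
  with 2 show ?case by (auto intro!: smooth_products.intros differentiable_add)
qed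

lemma smooth_products_smooth: "smooth_products f \<Longrightarrow> smooth f"
  by (rule smooth_coinduct[where X = smooth_products]) (use smooth_products_closed in auto)

lemma smooth_mult [intro]: "smooth f \<Longrightarrow> smooth g \<Longrightarrow> smooth (\<lambda>x. f x * g x)"
  by (auto intro!: smooth_products_smooth smooth_products.intros)

lemma smooth_add [intro]:
  assumes "smooth f" "smooth g" shows "smooth (\<lambda>x. f x + g x)"
proof -
  \<comment> \<open>Factors 1 bring a plain sum into the class of sums of products.\<close>
  have "smooth_products (\<lambda>x. f x * 1 + g x * 1)"
    by (intro smooth_products.intros assms smooth_const)
  then show ?thesis using smooth_products_smooth by simp
qed

lemma smooth_uminus [intro]: "smooth f \<Longrightarrow> smooth (\<lambda>x. - f x)"
  using smooth_mult[of "\<lambda>x. -1" f] by simp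

lemma smooth_diff [intro]: "smooth f \<Longrightarrow> smooth g \<Longrightarrow> smooth (\<lambda>x. f x - g x)"
  using smooth_add[of f "\<lambda>x. - g x"] by auto

lemma smooth_prod [intro]: "(\<And>i. i \<in> I \<Longrightarrow> smooth (f i)) \<Longrightarrow> smooth (\<lambda>x. \<Prod>i\<in>I. f i x)"
  by (induction I rule: infinite_finite_induct) auto

lemma pderiv_at_compose_affine:
  assumes "f differentiable at (L x + c)" "linear L"
  shows "pderiv_at v (\<lambda>x. f (L x + c)) x = pderiv_at (L v) f (L x + c)"
proof (rule pderiv_at_eqI)
  have "(f \<circ> (\<lambda>x. L x + c) has_derivative (\<lambda>v. pderiv_at v f (L x + c)) \<circ> L) (at x)"
    using assms(2) by (intro diff_chain_at differentiable_has_derivative_pderiv_at assms(1))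
      (auto intro!: derivative_eq_intros linear_imp_has_derivative)
  then show "((\<lambda>x. f (L x + c)) has_derivative (\<lambda>v. pderiv_at (L v) f (L x + c))) (at x)"
    by (simp add: o_def)
qed

lemma differentiable_compose_affine:
  fixes f :: "'b::euclidean_space \<Rightarrow> real" and L :: "'a::euclidean_space \<Rightarrow> 'b"
  assumes "f differentiable at (L x + c)" "linear L"
  shows "(\<lambda>x. f (L x + c)) differentiable at x"
proof -
  have "(\<lambda>x. L x + c) differentiable at x"
    using linear_imp_has_derivative[OF assms(2)]
    by (intro differentiable_add) (auto simp: differentiable_def)
  from differentiable_chain_at[OF this assms(1)] show ?thesis
    by (simp add: o_def)
qed

lemma smooth_compose_affine:
  fixes f :: "'b::euclidean_space \<Rightarrow> real" and L :: "'a::euclidean_space \<Rightarrow> 'b"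
  assumes "smooth f" "linear L"
  shows "smooth (\<lambda>x. f (L x + c))"
proof (rule smooth_coinduct[where X = "\<lambda>g. \<exists>f. smooth f \<and> g = (\<lambda>x. f (L x + c))"], goal_cases)
  case 1 with assms show ?case by blast
next
  case (2 g x)
  then obtain f where "smooth f" "g = (\<lambda>x. f (L x + c))" by blast
  with assms(2) show ?case
    using differentiable_compose_affine smooth_differentiable by blast
next
  case (3 g v)
  then obtain f where f: "smooth f" and g: "g = (\<lambda>x. f (L x + c))" by blast
  have "pderiv_at v g = (\<lambda>x. pderiv_at (L v) f (L x + c))"
    unfolding g using pderiv_at_compose_affine[OF smooth_differentiable[OF f] assms(2)] by blast
  with smooth_pderiv_at[OF f] show ?case by blast
qed

lemma smooth_compose_linear:
  fixes f :: "'b::euclidean_space \<Rightarrow> real" and L :: "'a::euclidean_space \<Rightarrow> 'b"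
  shows "smooth f \<Longrightarrow> linear L \<Longrightarrow> smooth (\<lambda>x. f (L x))"
  using smooth_compose_affine[of f L 0] by simp

lemma pderiv_at_cong_open:
  assumes "open U" "x \<in> U" "\<And>y. y \<in> U \<Longrightarrow> f y = g y" "g differentiable at x"
  shows "pderiv_at v f x = pderiv_at v g x"
  by (rule pderiv_at_eqI, rule has_derivative_transform_within_open[OF _ assms(1,2)])
    (auto simp: assms intro!: differentiable_has_derivative_pderiv_at)

text \<open>Agreement on an open set passes to derivatives, so the functions that coincide near
  every point with some smooth one form a stable class. This serves functions defined by cases, as
  in \<open>cutoff_test_function\<close>.\<close>

lemma smooth_locally:
  assumes "\<And>x. \<exists>g U. smooth g \<and> open U \<and> x \<in> U \<and> (\<forall>y\<in>U. f y = g y)"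
  shows "smooth f"
proof (rule smooth_coinduct[where X = "\<lambda>f. \<forall>x. \<exists>g U. smooth g \<and> open U \<and> x \<in> U \<and> (\<forall>y\<in>U. f y = g y)"],
    goal_cases)
  case 1 with assms show ?case by blast
next
  case (2 f x)
  then obtain g U where *: "smooth g" "open U" "x \<in> U" "\<forall>y\<in>U. f y = g y" by blast
  have "(f has_derivative (\<lambda>v. pderiv_at v g x)) (at x)"
    by (rule has_derivative_transform_within_open[OF smooth_has_derivative[OF *(1)] *(2,3)])
      (use * in auto)
  then show ?case by (auto simp: differentiable_def)
next
  case (3 f v)
  show ?case
  proof
    fix x
    from 3 obtain g U where *: "smooth g" "open U" "x \<in> U" "\<forall>y\<in>U. f y = g y" by blast
    then have "\<forall>y\<in>U. pderiv_at v f y = pderiv_at v g y"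
      using pderiv_at_cong_open[OF *(2)] smooth_differentiable[OF *(1)] by blast
    with * smooth_pderiv_at[OF *(1)] show "\<exists>g U. smooth g \<and> open U \<and> x \<in> U \<and> (\<forall>y\<in>U. pderiv_at v f y = g y)"
      by blast
  qed
qed

lemma pderiv_at_real:
  fixes f :: "real \<Rightarrow> real"
  assumes "(f has_real_derivative d) (at x)"
  shows "pderiv_at v f x = v * d"
  using pderiv_at_eqI[OF assms[unfolded has_field_derivative_def]] by simp

lemma smooth_has_real_derivative:
  fixes f :: "real \<Rightarrow> real"
  assumes "smooth f"
  shows "(f has_real_derivative pderiv_at 1 f x) (at x)"
proof -
  obtain d where d: "(f has_real_derivative d) (at x)"
    using smooth_differentiable[OF assms] by (auto simp: real_differentiable_def)
  then show ?thesis using pderiv_at_real[OF d, of 1] by simp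
qed

lemma has_real_derivative_differentiable:
  "(f has_real_derivative d) (at x) \<Longrightarrow> f differentiable at x"
  by (auto simp: differentiable_def has_field_derivative_def)

text \<open>One derivative of \<open>F\<close> is a multiple of \<open>f\<close>, hence adjoining
  \<open>F\<close> to the smooth functions gives a stable class.\<close>

lemma smooth_antiderivative:
  fixes f :: "real \<Rightarrow> real"
  assumes "smooth f" "\<And>x. (F has_real_derivative f x) (at x)"
  shows "smooth F"
proof (rule smooth_coinduct[where X = "\<lambda>g. smooth g \<or> g = F"], goal_cases)
  case (2 g x) then show ?case
    using has_real_derivative_differentiable[OF assms(2)] smooth_differentiable by blast
next
  case (3 g v)
  have "pderiv_at v F = (\<lambda>x. v * f x)"
    using pderiv_at_real[OF assms(2)] by blast
  moreover have "smooth (\<lambda>x. v * f x)" using assms(1) by (intro smooth_mult smooth_const)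
  ultimately show ?case using 3 by (metis smooth_pderiv_at)
qed auto

text \<open>The derivatives of \<open>exp (- 1 / x)\<close> are combinations of these functions.\<close>

definition exp_recip :: "nat \<Rightarrow> real \<Rightarrow> real" where
  "exp_recip k x = (if x > 0 then exp (- 1 / x) / x ^ k else 0)"

text \<open>Substituting the reciprocal turns the right-hand limit into that of a power over the
  exponential at infinity; on the left the function is 0.\<close>

lemma exp_recip_tendsto_0: "(exp_recip k \<longlongrightarrow> 0) (at 0)"
proof (rule filterlim_split_at_real)
  have "((\<lambda>y. y ^ k / exp y) \<longlongrightarrow> (0::real)) at_top" by (rule tendsto_power_div_exp_0)
  then have "((\<lambda>x. (inverse x) ^ k / exp (inverse x)) \<longlongrightarrow> (0::real)) (at_right 0)"
    by (rule filterlim_compose) (rule filterlim_inverse_at_top_right)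
  then show "(exp_recip k \<longlongrightarrow> 0) (at_right 0)"
    by (rule Lim_transform_eventually)
      (auto simp: eventually_at_filter exp_recip_def exp_minus field_simps)
  show "(exp_recip k \<longlongrightarrow> 0) (at_left 0)"
    by (rule tendsto_eventually) (auto simp: eventually_at_filter exp_recip_def)
qed

lemma exp_recip_has_derivative:
  "(exp_recip k has_real_derivative exp_recip (k + 2) x - k * exp_recip (k + 1) x) (at x)"
proof -
  consider "x < 0" | "x = 0" | "x > 0" by linarith
  then show ?thesis
  proof cases
    case 1
    have "((\<lambda>x. 0) has_real_derivative exp_recip (k + 2) x - k * exp_recip (k + 1) x) (at x)"
      using 1 by (simp add: exp_recip_def)
    then show ?thesis
      by (rule has_field_derivative_transform_within_open[where S = "{..<0}"])
        (use 1 in \<open>auto simp: exp_recip_def\<close>)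
  next
    case 2
    \<comment> \<open>At 0 the difference quotient is the next function of the family, whose limit
      there is already known to be 0.\<close>
    have "((\<lambda>y. (exp_recip k y - exp_recip k 0) / (y - 0)) \<longlongrightarrow> 0) (at 0)"
      by (rule Lim_transform_eventually[OF exp_recip_tendsto_0[of "Suc k"]])
        (auto simp: eventually_at_filter exp_recip_def field_simps)
    then show ?thesis
      using 2 by (simp add: has_field_derivative_iff exp_recip_def)
  next
    case 3
    have "(inverse has_real_derivative - (inverse x)\<^sup>2) (at x)"
      using 3 by (auto intro!: derivative_eq_intros simp: power2_eq_square)
    note d = this
    have "((\<lambda>x. exp (- inverse x) * inverse x ^ k) has_real_derivative
        exp (- inverse x) * inverse x ^ (k + 2) - k * (exp (- inverse x) * inverse x ^ (k + 1))) (at x)"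
      by (rule DERIV_cong[OF DERIV_mult[OF DERIV_fun_exp[OF DERIV_minus[OF d]] DERIV_power[OF d]]])
        (cases k; simp add: algebra_simps power2_eq_square)
    then have "((\<lambda>x. exp (- 1 / x) / x ^ k) has_real_derivative exp_recip (k + 2) x - k * exp_recip (k + 1) x) (at x)"
      using 3 by (simp add: exp_recip_def divide_inverse power_inverse)
    then show ?thesis
      by (rule has_field_derivative_transform_within_open[where S = "{0<..}"])
        (use 3 in \<open>auto simp: exp_recip_def\<close>)
  qed
qed

inductive exp_recip_span :: "(real \<Rightarrow> real) \<Rightarrow> bool" where
  "exp_recip_span (exp_recip k)"
| "exp_recip_span f \<Longrightarrow> exp_recip_span (\<lambda>x. c * f x)"
| "exp_recip_span f \<Longrightarrow> exp_recip_span g \<Longrightarrow> exp_recip_span (\<lambda>x. f x + g x)"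

lemma exp_recip_span_closed:
  "exp_recip_span f \<Longrightarrow> (\<forall>x. f differentiable at x) \<and> (\<forall>v. exp_recip_span (pderiv_at v f))"
proof (induction rule: exp_recip_span.induct)
  case (1 k)
  have "exp_recip_span (\<lambda>x. v * exp_recip (k + 2) x + (- v * k) * exp_recip (k + 1) x)" for v
    by (intro exp_recip_span.intros)
  moreover have "pderiv_at v (exp_recip k) = (\<lambda>x. v * exp_recip (k + 2) x + (- v * k) * exp_recip (k + 1) x)" for v
    using pderiv_at_real[OF exp_recip_has_derivative] by (auto simp: fun_eq_iff algebra_simps)
  ultimately show ?case
    using has_real_derivative_differentiable[OF exp_recip_has_derivative] by simp
next
  case (2 f c)
  then have "pderiv_at v (\<lambda>x. c * f x) = (\<lambda>x. c * pderiv_at v f x)" for v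
    by (auto simp: fun_eq_iff intro!: pderiv_at_cmult)
  with 2 show ?case by (auto intro!: exp_recip_span.intros differentiable_mult)
next
  case (3 f g)
  then have "pderiv_at v (\<lambda>x. f x + g x) = (\<lambda>x. pderiv_at v f x + pderiv_at v g x)" for v
    by (auto simp: fun_eq_iff intro!: pderiv_at_add)
  with 3 show ?case by (auto intro!: exp_recip_span.intros differentiable_add)
qed

text \<open>The value 1 is approached only at infinity. Cutoffs made from it therefore steepen the
  argument by a factor n and pass to the limit, instead of being equal to 1 somewhere.\<close>

definition smooth_step :: "real \<Rightarrow> real" where
  "smooth_step = exp_recip 0"

lemma smooth_smooth_step: "smooth smooth_step"
  unfolding smooth_step_def
  by (rule smooth_coinduct[where X = exp_recip_span])
    (use exp_recip_span_closed in \<open>auto intro: exp_recip_span.intros\<close>)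

lemma smooth_step_simps: "x \<le> 0 \<Longrightarrow> smooth_step x = 0" "x > 0 \<Longrightarrow> smooth_step x = exp (- 1 / x)"
  by (auto simp: smooth_step_def exp_recip_def)

lemma smooth_step_bounds: "0 \<le> smooth_step x" "smooth_step x \<le> 1"
  by (auto simp: smooth_step_def exp_recip_def)

lemma smooth_step_eq_0_iff: "smooth_step x = 0 \<longleftrightarrow> x \<le> 0"
  by (auto simp: smooth_step_def exp_recip_def)

text \<open>Offset 0 serves the bumps that converge to indicators of boxes, offset 1 the cutoff near
  the bottom of the domain.\<close>

lemma smooth_step_tendsto: 
  assumes "x > 0" shows "(\<lambda>n. smooth_step (real n * x - a)) \<longlonglongrightarrow> 1"
proof -
  have "filterlim (\<lambda>n. x * real n) at_top sequentially"
    by (rule filterlim_tendsto_pos_mult_at_top[OF tendsto_const assms filterlim_real_sequentially])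
  then have "filterlim (\<lambda>n. - a + real n * x) at_top sequentially"
    by (intro filterlim_tendsto_add_at_top[OF tendsto_const]) (simp add: mult.commute)
  then have lim: "filterlim (\<lambda>n. real n * x - a) at_top sequentially" by simp
  then have "(\<lambda>n. inverse (real n * x - a)) \<longlonglongrightarrow> 0"
    by (rule filterlim_compose[OF tendsto_inverse_0_at_top[OF filterlim_ident]])
  then have "(\<lambda>n. exp (- inverse (real n * x - a))) \<longlonglongrightarrow> exp (- 0)"
    by (intro tendsto_intros)
  moreover have "eventually (\<lambda>n. real n * x - a > 0) sequentially"
    using lim unfolding filterlim_at_top_dense by blast
  then have "eventually (\<lambda>n. exp (- inverse (real n * x - a)) = smooth_step (real n * x - a)) sequentially"
    by eventually_elim (auto simp: smooth_step_simps inverse_eq_divide)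
  ultimately show ?thesis
    using Lim_transform_eventually by fastforce
qed

section \<open>Almost-everywhere arguments for Lebesgue measure on a set\<close>

lemma borel_measurable_lebesgue_on:
  "f \<in> borel_measurable borel \<Longrightarrow> f \<in> borel_measurable (lebesgue_on S)"
  by (intro measurable_restrict_space1 measurable_completion) simp

lemma AE_lebesgue_on_iff:
  "S \<in> sets lebesgue \<Longrightarrow> (AE x in lebesgue_on S. P x) \<longleftrightarrow> (AE x in lebesgue. x \<in> S \<longrightarrow> P x)"
  by (subst AE_restrict_space_iff) auto

lemma AE_lebesgue_on_subset:
  assumes "AE x in lebesgue_on S. P x" "T \<subseteq> S" "S \<in> sets lebesgue" "T \<in> sets lebesgue"
  shows "AE x in lebesgue_on T. P x"
proof -
  have "AE x in lebesgue. x \<in> S \<longrightarrow> P x"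
    using assms(1,3) AE_lebesgue_on_iff by blast
  then have "AE x in lebesgue. x \<in> T \<longrightarrow> P x"
    by eventually_elim (use assms(2) in auto)
  then show ?thesis using assms(4) AE_lebesgue_on_iff by blast
qed

lemma borel_measurable_lebesgue_on_cong_AE:
  fixes f g :: "'a::euclidean_space \<Rightarrow> real"
  assumes "f \<in> borel_measurable (lebesgue_on S)" "AE x in lebesgue_on S. f x = g x" "S \<in> sets lebesgue"
  shows "g \<in> borel_measurable (lebesgue_on S)"
proof -
  have "AE x in lebesgue. x \<in> S \<longrightarrow> f x = g x"
    using assms(2) by (simp add: AE_lebesgue_on_iff[OF assms(3)])
  then have "AE x in lebesgue. (if x \<in> S then f x else 0) = (if x \<in> S then g x else 0)"
    by eventually_elim auto
  then have "(\<lambda>x. if x \<in> S then g x else 0) \<in> borel_measurable lebesgue"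
    by (rule borel_measurable_AE[rotated]) (simp add: borel_measurable_if[OF assms(3)] assms(1))
  then show ?thesis by (simp add: borel_measurable_if[OF assms(3)])
qed

lemma integrable_lebesgue_on_cong_AE:
  fixes f g :: "'a::euclidean_space \<Rightarrow> real"
  assumes "integrable (lebesgue_on S) f" "AE x in lebesgue_on S. f x = g x" "S \<in> sets lebesgue"
  shows "integrable (lebesgue_on S) g"
proof -
  have "g \<in> borel_measurable (lebesgue_on S)"
    by (rule borel_measurable_lebesgue_on_cong_AE[OF borel_measurable_integrable[OF assms(1)] assms(2,3)])
  from integrable_cong_AE[OF borel_measurable_integrable[OF assms(1)] this assms(2)] show ?thesis
    using assms(1) by blast
qed

text \<open>Lebesgue measure is complete, so measurability passes along equality almost everywhere.
  If it fails for one function it fails for the other, and both integrals take the default value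
  0.\<close>

lemma integral_lebesgue_on_cong_AE:
  fixes f g :: "'a::euclidean_space \<Rightarrow> real"
  assumes "AE x in lebesgue_on S. f x = g x" "S \<in> sets lebesgue"
  shows "integral\<^sup>L (lebesgue_on S) f = integral\<^sup>L (lebesgue_on S) g"
proof (cases "f \<in> borel_measurable (lebesgue_on S)")
  case True
  then show ?thesis
    by (intro integral_cong_AE borel_measurable_lebesgue_on_cong_AE[OF True assms] assms(1))
next
  case False
  moreover have "AE x in lebesgue_on S. g x = f x"
    using assms(1) by eventually_elim simp
  ultimately have "g \<notin> borel_measurable (lebesgue_on S)"
    using borel_measurable_lebesgue_on_cong_AE[OF _ _ assms(2)] by blast
  with False show ?thesis
    by (metis borel_measurable_integrable not_integrable_integral_eq)
qed

lemma integrable_lebesgue_on_subset: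
  fixes f :: "'a::euclidean_space \<Rightarrow> real"
  assumes "integrable (lebesgue_on S) f" "T \<subseteq> S" "S \<in> sets lebesgue" "T \<in> sets lebesgue"
  shows "integrable (lebesgue_on T) f"
proof -
  have "set_integrable lebesgue S f"
    using assms by (simp add: set_integrable_def integrable_restrict_space)
  then have "set_integrable lebesgue T f" using assms set_integrable_subset by blast
  then show ?thesis using assms by (simp add: set_integrable_def integrable_restrict_space)
qed

lemma integral_lebesgue_on_eq_0_outside:
  fixes f :: "'a::euclidean_space \<Rightarrow> real"
  assumes "T \<subseteq> S" "S \<in> sets lebesgue" "T \<in> sets lebesgue" "\<And>x. x \<in> S \<Longrightarrow> x \<notin> T \<Longrightarrow> f x = 0"
  shows "integral\<^sup>L (lebesgue_on S) f = integral\<^sup>L (lebesgue_on T) f"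
    "integrable (lebesgue_on S) f \<longleftrightarrow> integrable (lebesgue_on T) f"
proof -
  have eq: "(\<lambda>x. indicator S x * f x) = (\<lambda>x. indicator T x * f x)"
    using assms by (auto simp: fun_eq_iff indicator_def)
  show "integral\<^sup>L (lebesgue_on S) f = integral\<^sup>L (lebesgue_on T) f"
    "integrable (lebesgue_on S) f \<longleftrightarrow> integrable (lebesgue_on T) f"
    using assms by (simp_all add: integral_restrict_space integrable_restrict_space eq)
qed

lemma finite_measure_lebesgue_on_bounded:
  "S \<in> sets lebesgue \<Longrightarrow> bounded S \<Longrightarrow> finite_measure (lebesgue_on S)"
  by (simp add: bounded_set_imp_lmeasurable finite_measure_lebesgue_on)

lemma integrable_lebesgue_on_bounded:
  fixes f :: "'a::euclidean_space \<Rightarrow> real"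
  assumes "S \<in> sets lebesgue" "bounded S" "f \<in> borel_measurable (lebesgue_on S)"
    "\<And>x. x \<in> S \<Longrightarrow> \<bar>f x\<bar> \<le> C"
  shows "integrable (lebesgue_on S) f"
proof -
  interpret finite_measure "lebesgue_on S"
    using assms finite_measure_lebesgue_on_bounded by blast
  show ?thesis
    by (rule integrable_const_bound[where B = C]) (use assms in auto)
qed

subsection \<open>Square-integrable functions\<close>

lemma L2_measurable: "f \<in> L2 S \<Longrightarrow> f \<in> borel_measurable (lebesgue_on S)"
  and L2_square_integrable: "f \<in> L2 S \<Longrightarrow> integrable (lebesgue_on S) (\<lambda>x. (f x)\<^sup>2)"
  by (auto simp: L2_def)

lemma L2_mult_integrable:
  assumes "f \<in> L2 S" "g \<in> L2 S"
  shows "integrable (lebesgue_on S) (\<lambda>x. f x * g x)"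
proof (rule Bochner_Integration.integrable_bound)
  show "integrable (lebesgue_on S) (\<lambda>x. (f x)\<^sup>2 + (g x)\<^sup>2)"
    using assms by (auto simp: L2_def)
  show "(\<lambda>x. f x * g x) \<in> borel_measurable (lebesgue_on S)"
    using assms by (auto simp: L2_def)
  have "\<bar>a * b\<bar> \<le> a\<^sup>2 + b\<^sup>2" for a b :: real
  proof -
    have "0 \<le> (\<bar>a\<bar> - \<bar>b\<bar>)\<^sup>2" "0 \<le> \<bar>a\<bar> * \<bar>b\<bar>" by auto
    then show ?thesis unfolding power2_diff abs_mult power2_abs by linarith
  qed
  then show "AE x in lebesgue_on S. norm (f x * g x) \<le> norm ((f x)\<^sup>2 + (g x)\<^sup>2)"
    by (intro AE_I2) (simp add: abs_mult)
qed

lemma L2_linear: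
  assumes "f \<in> L2 S" "g \<in> L2 S"
  shows "(\<lambda>x. a * f x + b * g x) \<in> L2 S"
proof -
  have "integrable (lebesgue_on S) (\<lambda>x. a\<^sup>2 * (f x)\<^sup>2 + 2 * a * b * (f x * g x) + b\<^sup>2 * (g x)\<^sup>2)"
    by (intro Bochner_Integration.integrable_add integrable_mult_right L2_mult_integrable
        L2_square_integrable assms)
  moreover have "(a * f x + b * g x)\<^sup>2 = a\<^sup>2 * (f x)\<^sup>2 + 2 * a * b * (f x * g x) + b\<^sup>2 * (g x)\<^sup>2" for x
    by (simp add: power2_eq_square algebra_simps)
  ultimately show ?thesis using assms by (auto simp: L2_def)
qed

lemma L2_zero [simp]: "(\<lambda>x. 0) \<in> L2 S"
  by (auto simp: L2_def)

lemma L2_cmult: "f \<in> L2 S \<Longrightarrow> (\<lambda>x. a * f x) \<in> L2 S"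
  using L2_linear[of f S "\<lambda>x. 0" a 0] by simp

lemma L2_uminus: "f \<in> L2 S \<Longrightarrow> (\<lambda>x. - f x) \<in> L2 S"
  using L2_cmult[of f S "-1"] by simp

lemma L2_diff: "f \<in> L2 S \<Longrightarrow> g \<in> L2 S \<Longrightarrow> (\<lambda>x. f x - g x) \<in> L2 S"
  using L2_linear[of f S g 1 "-1"] by simp

lemma L2_mult_bounded:
  assumes "f \<in> L2 S" "m \<in> borel_measurable (lebesgue_on S)" "\<And>x. x \<in> S \<Longrightarrow> \<bar>m x\<bar> \<le> C"
  shows "(\<lambda>x. f x * m x) \<in> L2 S"
proof -
  have "integrable (lebesgue_on S) (\<lambda>x. (f x * m x)\<^sup>2)"
  proof (rule Bochner_Integration.integrable_bound)
    show "integrable (lebesgue_on S) (\<lambda>x. C\<^sup>2 * (f x)\<^sup>2)"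
      using assms by (auto simp: L2_def)
    have "(m x)\<^sup>2 \<le> C\<^sup>2" if "x \<in> S" for x
      using assms(3)[OF that] abs_le_square_iff[of "m x" C] by linarith
    then show "AE x in lebesgue_on S. norm ((f x * m x)\<^sup>2) \<le> norm (C\<^sup>2 * (f x)\<^sup>2)"
      by (intro AE_I2) (simp add: power_mult_distrib mult.commute[of _ "(f _)\<^sup>2"] mult_left_mono)
  qed (use assms in \<open>auto simp: L2_def\<close>)
  with assms show ?thesis by (auto simp: L2_def)
qed

lemma L2_cong_AE:
  assumes "f \<in> L2 S" "AE x in lebesgue_on S. f x = g x" "S \<in> sets lebesgue"
  shows "g \<in> L2 S"
proof -
  have "AE x in lebesgue_on S. (f x)\<^sup>2 = (g x)\<^sup>2" using assms(2) by eventually_elim simp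
  from integrable_lebesgue_on_cong_AE[OF L2_square_integrable[OF assms(1)] this assms(3)]
    borel_measurable_lebesgue_on_cong_AE[OF L2_measurable[OF assms(1)] assms(2,3)]
  show ?thesis by (simp add: L2_def)
qed

lemma L2_bounded:
  assumes "S \<in> sets lebesgue" "bounded S" "f \<in> borel_measurable (lebesgue_on S)"
    "\<And>x. x \<in> S \<Longrightarrow> \<bar>f x\<bar> \<le> C"
  shows "f \<in> L2 S"
proof -
  have "\<bar>(f x)\<^sup>2\<bar> \<le> C\<^sup>2" if "x \<in> S" for x
    using assms(4)[OF that] abs_le_square_iff[of "f x" C] by simp
  then show ?thesis
    using assms integrable_lebesgue_on_bounded[of S "\<lambda>x. (f x)\<^sup>2" "C\<^sup>2"] by (auto simp: L2_def)
qed

lemma L2_integrable: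
  assumes "f \<in> L2 S" "S \<in> sets lebesgue" "bounded S"
  shows "integrable (lebesgue_on S) f"
  using L2_mult_integrable[OF assms(1) L2_bounded[of S "\<lambda>x. 1" 1]] assms by simp

lemma L2_subset:
  assumes "f \<in> L2 S" "T \<subseteq> S" "S \<in> sets lebesgue" "T \<in> sets lebesgue"
  shows "f \<in> L2 T"
  using integrable_lebesgue_on_subset[OF L2_square_integrable[OF assms(1)] assms(2-4)]
    measurable_restrict_mono[OF L2_measurable[OF assms(1)] assms(2)]
  by (simp add: L2_def)

text \<open>The integral of the square of \<open>s f - t g\<close> is a nonnegative quadratic form
  in s and t. The choice s = B, t = D gives B times the desired inequality; B = 0 is treated
  apart.\<close>

lemma L2_Cauchy_Schwarz:
  assumes "f \<in> L2 S" "g \<in> L2 S"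
  shows "\<bar>LINT x|lebesgue_on S. f x * g x\<bar> \<le>
    sqrt (LINT x|lebesgue_on S. (f x)\<^sup>2) * sqrt (LINT x|lebesgue_on S. (g x)\<^sup>2)"
proof -
  define A where "A = (LINT x|lebesgue_on S. (f x)\<^sup>2)"
  define B where "B = (LINT x|lebesgue_on S. (g x)\<^sup>2)"
  define D where "D = (LINT x|lebesgue_on S. f x * g x)"
  note int = L2_square_integrable[OF assms(1)] L2_square_integrable[OF assms(2)] L2_mult_integrable[OF assms]
  have q: "0 \<le> s\<^sup>2 * A - 2 * s * t * D + t\<^sup>2 * B" for s t
  proof -
    have "0 \<le> (LINT x|lebesgue_on S. (s * f x - t * g x)\<^sup>2)" by simp
    also have "\<dots> = (LINT x|lebesgue_on S. s\<^sup>2 * (f x)\<^sup>2 - 2 * s * t * (f x * g x) + t\<^sup>2 * (g x)\<^sup>2)"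
      by (rule Bochner_Integration.integral_cong) (auto simp: power2_eq_square algebra_simps)
    also have "\<dots> = s\<^sup>2 * A - 2 * s * t * D + t\<^sup>2 * B"
      using int by (simp add: A_def B_def D_def)
    finally show ?thesis .
  qed
  have "A \<ge> 0" "B \<ge> 0" by (simp_all add: A_def B_def)
  have "D\<^sup>2 \<le> A * B"
  proof (cases "B = 0")
    case True
    have "D = 0"
    proof (rule ccontr)
      assume "D \<noteq> 0"
      \<comment> \<open>For B = 0 the form is affine in t, and this t gives it the value -1.\<close>
      with q[of 1 "(A + 1) / (2 * D)"] True show False by (simp add: field_simps)
    qed
    then show ?thesis using \<open>A \<ge> 0\<close> \<open>B \<ge> 0\<close> by simp
  next
    case False
    have "0 \<le> B * (A * B - D\<^sup>2)"
      using q[of B D] by (simp add: power2_eq_square algebra_simps)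
    then show ?thesis using False \<open>B \<ge> 0\<close> by (simp add: zero_le_mult_iff)
  qed
  then have "\<bar>D\<bar> \<le> sqrt (A * B)" by (metis real_le_rsqrt power2_abs)
  then show ?thesis by (simp add: A_def B_def D_def real_sqrt_mult)
qed

lemma L2_tendsto_integral_mult:
  assumes F: "\<And>n. F n \<in> L2 S" and "f \<in> L2 S" "m \<in> L2 S"
    and lim: "(\<lambda>n. LINT x|lebesgue_on S. (F n x - f x)\<^sup>2) \<longlonglongrightarrow> 0"
  shows "(\<lambda>n. LINT x|lebesgue_on S. F n x * m x) \<longlonglongrightarrow> (LINT x|lebesgue_on S. f x * m x)"
proof -
  have "(\<lambda>n. LINT x|lebesgue_on S. (F n x - f x) * m x) \<longlonglongrightarrow> 0"
  proof (rule Lim_null_comparison)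
    show "\<forall>\<^sub>F n in sequentially. norm (LINT x|lebesgue_on S. (F n x - f x) * m x)
      \<le> sqrt (LINT x|lebesgue_on S. (F n x - f x)\<^sup>2) * sqrt (LINT x|lebesgue_on S. (m x)\<^sup>2)"
      using L2_Cauchy_Schwarz[OF L2_diff[OF F assms(2)] assms(3)] by auto
    have "(\<lambda>n. sqrt (LINT x|lebesgue_on S. (F n x - f x)\<^sup>2) * sqrt (LINT x|lebesgue_on S. (m x)\<^sup>2))
      \<longlonglongrightarrow> sqrt 0 * sqrt (LINT x|lebesgue_on S. (m x)\<^sup>2)"
      by (intro tendsto_intros lim)
    then show "(\<lambda>n. sqrt (LINT x|lebesgue_on S. (F n x - f x)\<^sup>2) * sqrt (LINT x|lebesgue_on S. (m x)\<^sup>2)) \<longlonglongrightarrow> 0"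
      by simp
  qed
  then have "(\<lambda>n. (LINT x|lebesgue_on S. (F n x - f x) * m x) + (LINT x|lebesgue_on S. f x * m x))
      \<longlonglongrightarrow> 0 + (LINT x|lebesgue_on S. f x * m x)"
    by (intro tendsto_intros)
  moreover have "(LINT x|lebesgue_on S. (F n x - f x) * m x) + (LINT x|lebesgue_on S. f x * m x)
      = (LINT x|lebesgue_on S. F n x * m x)" for n
    using L2_mult_integrable[OF F assms(3)] L2_mult_integrable[OF assms(2,3)]
    by (simp add: algebra_simps)
  ultimately show ?thesis by simp
qed

subsection \<open>Test functions\<close>

lemma test_functions_smooth: "\<phi> \<in> test_functions S \<Longrightarrow> smooth \<phi>"
  by (simp add: test_functions_def)

lemma test_functions_eq_0: "\<phi> \<in> test_functions S \<Longrightarrow> x \<notin> S \<Longrightarrow> \<phi> x = 0"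
  using closure_subset[of "{x. \<phi> x \<noteq> 0}"] by (auto simp: test_functions_def)

lemma test_functions_mono: "S \<subseteq> T \<Longrightarrow> \<phi> \<in> test_functions S \<Longrightarrow> \<phi> \<in> test_functions T"
  by (auto simp: test_functions_def)

lemma test_functionsI:
  assumes "smooth \<phi>" "compact K" "K \<subseteq> S" "\<And>x. x \<notin> K \<Longrightarrow> \<phi> x = 0"
  shows "\<phi> \<in> test_functions S"
proof -
  have sub: "closure {x. \<phi> x \<noteq> 0} \<subseteq> K"
    using assms(2,4) by (intro closure_minimal) (auto simp: compact_imp_closed)
  then have "compact (closure {x. \<phi> x \<noteq> 0})"
    using assms(2) by (metis closed_closure compact_Int_closed inf.absorb2)
  with sub assms show ?thesis by (auto simp: test_functions_def)
qed

lemma test_functionsE: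
  assumes "\<phi> \<in> test_functions S"
  obtains K where "compact K" "K \<subseteq> S" "\<And>x. x \<notin> K \<Longrightarrow> \<phi> x = 0"
proof
  show "compact (closure {x. \<phi> x \<noteq> 0})" "closure {x. \<phi> x \<noteq> 0} \<subseteq> S"
    using assms by (auto simp: test_functions_def)
  show "\<And>x. x \<notin> closure {x. \<phi> x \<noteq> 0} \<Longrightarrow> \<phi> x = 0"
    using closure_subset[of "{x. \<phi> x \<noteq> 0}"] by blast
qed

lemma test_functions_mult:
  assumes "\<phi> \<in> test_functions S" "smooth m"
  shows "(\<lambda>x. m x * \<phi> x) \<in> test_functions S"
proof -
  obtain K where "compact K" "K \<subseteq> S" "\<And>x. x \<notin> K \<Longrightarrow> \<phi> x = 0"
    using test_functionsE[OF assms(1)] by blast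
  then show ?thesis
    using assms by (intro test_functionsI[of _ K]) (auto intro: test_functions_smooth)
qed

lemma test_functions_pderiv_at:
  assumes "\<phi> \<in> test_functions S"
  shows "pderiv_at v \<phi> \<in> test_functions S"
proof -
  obtain K where K: "compact K" "K \<subseteq> S" "\<And>x. x \<notin> K \<Longrightarrow> \<phi> x = 0"
    using test_functionsE[OF assms] by blast
  show ?thesis
  proof (rule test_functionsI[OF _ K(1,2)])
    show "smooth (pderiv_at v \<phi>)"
      using assms by (intro smooth_pderiv_at test_functions_smooth)
    fix x assume "x \<notin> K"
    have "pderiv_at v \<phi> x = pderiv_at v (\<lambda>x. 0) x"
      using K \<open>x \<notin> K\<close> by (intro pderiv_at_cong_open[of "- K"]) (auto intro: compact_imp_closed)
    also have "\<dots> = 0" by (rule pderiv_at_eqI) auto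
    finally show "pderiv_at v \<phi> x = 0" .
  qed
qed

lemma smooth_bounded_on:
  assumes "smooth f" "bounded S"
  obtains C where "C \<ge> 0" "\<And>x. x \<in> S \<Longrightarrow> \<bar>f x\<bar> \<le> C"
proof -
  have "compact (closure S)" using assms(2) by simp
  then have "compact (f ` closure S)"
    by (intro compact_continuous_image smooth_continuous_on assms(1))
  then obtain C where C: "\<And>y. y \<in> f ` closure S \<Longrightarrow> norm y \<le> C"
    using compact_imp_bounded bounded_iff by metis
  show ?thesis
  proof (rule that[of "max C 0"])
    fix x assume "x \<in> S"
    then have "x \<in> closure S" using closure_subset by blast
    then show "\<bar>f x\<bar> \<le> max C 0" using C[of "f x"] by auto
  qed auto
qed

lemma test_functions_bounded:
  assumes "\<phi> \<in> test_functions S"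
  obtains C where "C \<ge> 0" "\<And>x. \<bar>\<phi> x\<bar> \<le> C"
proof -
  obtain K where K: "compact K" "K \<subseteq> S" "\<And>x. x \<notin> K \<Longrightarrow> \<phi> x = 0"
    using test_functionsE[OF assms] by blast
  obtain C where C: "C \<ge> 0" "\<And>x. x \<in> K \<Longrightarrow> \<bar>\<phi> x\<bar> \<le> C"
    using smooth_bounded_on[OF test_functions_smooth[OF assms] compact_imp_bounded[OF K(1)]] by blast
  show ?thesis
    by (rule that[OF C(1)]) (use C K(3) in \<open>metis abs_zero\<close>)
qed

lemma smooth_borel_measurable: "smooth f \<Longrightarrow> f \<in> borel_measurable borel"
  by (intro borel_measurable_continuous_onI smooth_continuous_on)

lemma smooth_measurable_lebesgue_on: "smooth f \<Longrightarrow> f \<in> borel_measurable (lebesgue_on S)"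
  by (intro borel_measurable_lebesgue_on smooth_borel_measurable)

lemma test_functions_measurable: "\<phi> \<in> test_functions T \<Longrightarrow> \<phi> \<in> borel_measurable (lebesgue_on S)"
  by (intro smooth_measurable_lebesgue_on test_functions_smooth)

lemma smooth_L2:
  assumes "smooth f" "S \<in> sets lebesgue" "bounded S"
  shows "f \<in> L2 S"
  using smooth_bounded_on[OF assms(1,3)] L2_bounded[OF assms(2,3) smooth_measurable_lebesgue_on[OF assms(1)]]
  by metis

lemma L1_loc_mult_integrable:
  assumes "f \<in> L1_loc S" "S \<in> sets lebesgue" "m \<in> borel_measurable (lebesgue_on S)"
    "\<And>x. x \<in> S \<Longrightarrow> \<bar>m x\<bar> \<le> C" "compact K" "K \<subseteq> S" "\<And>x. x \<notin> K \<Longrightarrow> m x = 0"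
  shows "integrable (lebesgue_on S) (\<lambda>x. f x * m x)"
proof -
  have K: "K \<in> sets lebesgue" using assms(5) by (simp add: compact_imp_closed)
  have "integrable (lebesgue_on K) (\<lambda>x. f x * m x)"
  proof (rule Bochner_Integration.integrable_bound)
    show "integrable (lebesgue_on K) (\<lambda>x. C * f x)"
      using assms by (auto simp: L1_loc_def)
    have "f \<in> borel_measurable (lebesgue_on K)" "m \<in> borel_measurable (lebesgue_on K)"
      using assms measurable_restrict_mono[of _ lebesgue S _ K] by (auto simp: L1_loc_def)
    then show "(\<lambda>x. f x * m x) \<in> borel_measurable (lebesgue_on K)" by simp
    have "\<bar>f x * m x\<bar> \<le> \<bar>C * f x\<bar>" if "x \<in> K" for x
    proof -
      have "\<bar>m x\<bar> \<le> \<bar>C\<bar>" using assms(4)[of x] assms(6) that by fastforce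
      then show ?thesis by (simp add: abs_mult mult.commute[of _ "\<bar>f x\<bar>"] mult_left_mono)
    qed
    then show "AE x in lebesgue_on K. norm (f x * m x) \<le> norm (C * f x)"
      by (intro AE_I2) simp
  qed
  then show ?thesis
    using integral_lebesgue_on_eq_0_outside(2)[OF assms(6,2) K, of "\<lambda>x. f x * m x"] assms(7) by simp
qed

lemma L1_loc_mult_test_integrable:
  assumes "f \<in> L1_loc S" "S \<in> sets lebesgue" "\<phi> \<in> test_functions S"
  shows "integrable (lebesgue_on S) (\<lambda>x. f x * \<phi> x)"
proof -
  obtain K where K: "compact K" "K \<subseteq> S" "\<And>x. x \<notin> K \<Longrightarrow> \<phi> x = 0"
    using test_functionsE[OF assms(3)] by blast
  obtain C where "\<And>x. \<bar>\<phi> x\<bar> \<le> C" using test_functions_bounded[OF assms(3)] by blast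
  with K show ?thesis
    using assms by (intro L1_loc_mult_integrable[where C = C and K = K]) (auto intro: test_functions_measurable)
qed

lemma L2_L1_loc:
  assumes "f \<in> L2 S" "S \<in> sets lebesgue"
  shows "f \<in> L1_loc S"
proof -
  have "integrable (lebesgue_on K) f" if "compact K" "K \<subseteq> S" for K
    using L2_integrable[OF L2_subset[OF assms(1) that(2) assms(2)]] that
    by (simp add: compact_imp_bounded compact_imp_closed)
  then show ?thesis using assms(1) by (auto simp: L1_loc_def L2_def)
qed

lemma smooth_L1_loc:
  assumes "smooth f" "S \<in> sets lebesgue"
  shows "f \<in> L1_loc S"
proof -
  have "integrable (lebesgue_on K) f" if "compact K" for K
    using L2_integrable[OF smooth_L2[OF assms(1)]] that
    by (simp add: compact_imp_bounded compact_imp_closed)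
  then show ?thesis using assms smooth_measurable_lebesgue_on by (auto simp: L1_loc_def)
qed

subsection \<open>Bump functions on boxes\<close>

text \<open>Positive exactly inside the open box for n > 0, and convergent to its indicator. The
  product over coordinates lets it split over a pair of spaces (\<open>box_bump_Pair\<close>) and
  over single directions (\<open>box_bump_tensor\<close>).\<close>

definition box_bump :: "'a::euclidean_space \<Rightarrow> 'a \<Rightarrow> nat \<Rightarrow> 'a \<Rightarrow> real" where
  "box_bump a b n x =
    (\<Prod>i\<in>Basis. smooth_step (real n * (x \<bullet> i - a \<bullet> i)) * smooth_step (real n * (b \<bullet> i - x \<bullet> i)))"

lemma smooth_box_bump: "smooth (box_bump a b n)"
proof -
  have "smooth (\<lambda>x. smooth_step (real n * (x \<bullet> i) + real n * - (a \<bullet> i)) *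
      smooth_step (- real n * (x \<bullet> i) + real n * (b \<bullet> i)))" for i
    by (intro smooth_mult smooth_compose_affine smooth_smooth_step)
      (auto intro!: linearI simp: inner_simps algebra_simps)
  then have "smooth (\<lambda>x. smooth_step (real n * (x \<bullet> i - a \<bullet> i)) * smooth_step (real n * (b \<bullet> i - x \<bullet> i)))" for i
    by (simp add: algebra_simps)
  then show ?thesis unfolding box_bump_def by (intro smooth_prod)
qed

lemma box_bump_nonneg: "0 \<le> box_bump a b n x"
  and box_bump_le_1: "box_bump a b n x \<le> 1"
  unfolding box_bump_def
  by (auto intro!: prod_nonneg prod_le_1 mult_nonneg_nonneg mult_le_one simp: smooth_step_bounds)

lemma box_bump_eq_0: "x \<notin> box a b \<Longrightarrow> box_bump a b n x = 0"
proof -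
  assume "x \<notin> box a b"
  then obtain i where "i \<in> Basis" "x \<bullet> i - a \<bullet> i \<le> 0 \<or> b \<bullet> i - x \<bullet> i \<le> 0"
    by (force simp: box_def)
  then have "smooth_step (real n * (x \<bullet> i - a \<bullet> i)) * smooth_step (real n * (b \<bullet> i - x \<bullet> i)) = 0" "i \<in> Basis"
    using mult_nonneg_nonpos[of "real n"] by (auto simp: smooth_step_eq_0_iff)
  then show ?thesis unfolding box_bump_def by (intro prod_zero) auto
qed

lemma box_bump_tendsto:
  fixes x :: "'a::euclidean_space"
  shows "(\<lambda>n. box_bump a b n x) \<longlonglongrightarrow> indicator (box a b) x"
proof (cases "x \<in> box a b")
  case True
  have "(\<lambda>n. box_bump a b n x) \<longlonglongrightarrow> (\<Prod>i\<in>(Basis :: 'a set). 1 * 1)"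
    unfolding box_bump_def
    by (intro tendsto_prod tendsto_mult; use True smooth_step_tendsto[of _ 0] in \<open>simp add: box_def\<close>)
  with True show ?thesis by simp
qed (simp add: box_bump_eq_0)

lemma box_bump_test_function: "cbox a b \<subseteq> S \<Longrightarrow> box_bump a b n \<in> test_functions S"
  by (rule test_functionsI[OF smooth_box_bump compact_cbox])
    (auto intro!: box_bump_eq_0 dest: subsetD[OF box_subset_cbox])

lemma box_bump_Pair:
  "box_bump (a, a') (b, b') n (x, x') = box_bump a b n x * box_bump a' b' n x'"
  unfolding box_bump_def Basis_prod_def
  by (subst prod.union_disjoint) (auto simp: prod.reindex inj_on_def)

subsection \<open>The fundamental lemma of the calculus of variations\<close>

text \<open>The bumps lie below the indicator of the closed box, on which k is integrable, so
  dominated convergence replaces them by the indicator of the open box.\<close>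

lemma integral_box_eq_0:
  fixes k :: "'a::euclidean_space \<Rightarrow> real"
  assumes k: "k \<in> L1_loc S" and "S \<in> sets lebesgue" and sub: "cbox a b \<subseteq> S"
    and 0: "\<And>n. (LINT x|lebesgue_on S. k x * box_bump a b n x) = 0"
  shows "(LINT x|lebesgue_on S. k x * indicator (box a b) x) = 0"
proof -
  have "(\<lambda>n. LINT x|lebesgue_on S. k x * box_bump a b n x)
      \<longlonglongrightarrow> (LINT x|lebesgue_on S. k x * indicator (box a b) x)"
  proof (rule integral_dominated_convergence)
    have m: "indicator (cbox a b) \<in> borel_measurable (lebesgue_on S)"
      "indicator (box a b) \<in> borel_measurable (lebesgue_on S)"
      by (auto intro!: borel_measurable_lebesgue_on)
    show "integrable (lebesgue_on S) (\<lambda>x. \<bar>k x * indicator (cbox a b) x\<bar>)"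
      by (intro integrable_abs L1_loc_mult_integrable[OF assms(1,2) m(1), where C = 1 and K = "cbox a b"])
        (use sub in \<open>auto simp: indicator_def\<close>)
    have km: "k \<in> borel_measurable (lebesgue_on S)" using k by (simp add: L1_loc_def)
    show "(\<lambda>x. k x * indicator (box a b) x) \<in> borel_measurable (lebesgue_on S)"
      by (intro borel_measurable_times km m(2))
    show "(\<lambda>x. k x * box_bump a b n x) \<in> borel_measurable (lebesgue_on S)" for n
      by (intro borel_measurable_times km smooth_measurable_lebesgue_on[OF smooth_box_bump])
    show "AE x in lebesgue_on S. (\<lambda>n. k x * box_bump a b n x) \<longlonglongrightarrow> k x * indicator (box a b) x"
      by (intro AE_I2 tendsto_mult tendsto_const box_bump_tendsto)
    have "\<bar>k x * box_bump a b n x\<bar> \<le> \<bar>k x * indicator (cbox a b) x\<bar>" for n x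
    proof (cases "x \<in> cbox a b")
      case True
      then show ?thesis
        using box_bump_nonneg[of a b n x] box_bump_le_1[of a b n x] by (simp add: abs_mult mult_left_le)
    next
      case False
      then have "x \<notin> box a b" using box_subset_cbox by blast
      then show ?thesis by (simp add: box_bump_eq_0)
    qed
    then show "AE x in lebesgue_on S. norm (k x * box_bump a b n x) \<le> \<bar>k x * indicator (cbox a b) x\<bar>" for n
      by simp
  qed
  with 0 show ?thesis by (simp add: LIMSEQ_const_iff)
qed

text \<open>Open boxes are closed under intersection and generate the Borel sets, so vanishing of
  the integral spreads to all of them by Dynkin's argument. Complements bring in the integral over
  the whole space.\<close>

lemma AE_eq_0_of_integral_box_eq_0:
  fixes k :: "'a::euclidean_space \<Rightarrow> real"
  assumes k: "integrable lborel k" and 0: "\<And>a b. (LINT x|lborel. indicator (box a b) x * k x) = 0"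
    and UNIV: "integral\<^sup>L lborel k = 0"
  shows "AE x in lborel. k x = 0"
proof (rule sigma_finite_measure.density_zero[OF sigma_finite_lborel k])
  fix A :: "'a set" assume "A \<in> sets lborel"
  then have A: "A \<in> sigma_sets UNIV (range (\<lambda>(a, b). box a b))"
    unfolding sets_lborel borel_eq_box by simp
  have int: "set_integrable lborel A k" if "A \<in> sigma_sets UNIV (range (\<lambda>(a, b). box a b))" for A
    using that k unfolding set_integrable_def
    by (intro integrable_mult_indicator) (auto simp: borel_eq_box)
  have "Int_stable (range (\<lambda>(a, b). box a b :: 'a set))"
    unfolding Int_stable_def by (auto simp: box_Int_box image_iff)
  moreover have "range (\<lambda>(a, b). box a b) \<subseteq> Pow (UNIV :: 'a set)" by simp
  ultimately show "set_lebesgue_integral lborel A k = 0"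
    using A
  proof (induction rule: sigma_sets_induct_disjoint)
    case (basic A)
    then show ?case using 0 by (auto simp: set_lebesgue_integral_def)
  next
    case empty
    show ?case by (simp add: set_lebesgue_integral_def)
  next
    case (compl A)
    have eq: "indicator (UNIV - A) x * k x = k x - indicator A x * k x" for x
      by (auto simp: indicator_def)
    show ?case
      using compl int[OF compl(1)] k UNIV unfolding set_lebesgue_integral_def set_integrable_def
      by (simp add: eq)
  next
    case (union A)
    have "(\<Union>i. A i) \<in> sigma_sets UNIV (range (\<lambda>(a, b). box a b))"
      using union(2) by (intro sigma_sets.Union) auto
    then have "set_lebesgue_integral lborel (\<Union>i. A i) k = (\<Sum>i. set_lebesgue_integral lborel (A i) k)"
      using union by (intro lebesgue_integral_countable_add int)
        (auto simp: disjoint_family_on_def borel_eq_box)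
    then show ?case using union(3) by simp
  qed
qed

text \<open>Cut off outside the box, k becomes integrable on the whole space. Its integral over any
  other box is again an integral over a box contained in S, because boxes intersect in
  boxes.\<close>

lemma fundamental_lemma_cbox:
  fixes k :: "'a::euclidean_space \<Rightarrow> real"
  assumes k: "k \<in> L1_loc S" and S: "S \<in> sets lebesgue" and sub: "cbox c d \<subseteq> S"
    and 0: "\<And>a b n. cbox a b \<subseteq> S \<Longrightarrow> (LINT x|lebesgue_on S. k x * box_bump a b n x) = 0"
  shows "AE x in lebesgue_on (cbox c d). k x = 0"
proof -
  have box0: "(LINT x|lebesgue. indicator (box a b) x * (indicator (box c d) x * k x)) = 0" for a b
  proof -
    obtain e f where ef: "box a b \<inter> box c d = box e f"
      using box_Int_box by blast
    have "(LINT x|lebesgue. indicator (box a b) x * (indicator (box c d) x * k x)) =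
        (LINT x|lebesgue_on S. k x * indicator (box e f) x)"
      using subset_trans[OF box_subset_cbox sub] S unfolding ef[symmetric]
      by (subst integral_restrict_space)
        (auto intro!: Bochner_Integration.integral_cong simp: indicator_def subset_iff)
    also have "\<dots> = 0"
    proof (cases "box e f = {}")
      case False
      then have "cbox e f = closure (box e f)" by simp
      also have "\<dots> \<subseteq> cbox c d"
        using ef box_subset_cbox[of c d] by (intro closure_minimal) auto
      finally show ?thesis using sub by (intro integral_box_eq_0[OF k S] 0) auto
    qed simp
    finally show ?thesis .
  qed
  have "integrable (lebesgue_on S) (\<lambda>x. k x * indicator (box c d) x)"
    by (rule L1_loc_mult_integrable[OF k S, where C = 1 and K = "cbox c d"])
      (use sub in \<open>auto intro!: borel_measurable_lebesgue_on simp: indicator_def dest: subsetD[OF box_subset_cbox]\<close>)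
  then have "integrable lebesgue (\<lambda>x. indicator S x *\<^sub>R (k x * indicator (box c d) x))"
    using S by (simp add: integrable_restrict_space)
  moreover have "(\<lambda>x. indicator S x *\<^sub>R (k x * indicator (box c d) x)) = (\<lambda>x. indicator (box c d) x * k x)"
    using sub box_subset_cbox[of c d] by (auto simp: indicator_def fun_eq_iff)
  ultimately have int: "integrable lebesgue (\<lambda>x. indicator (box c d) x * k x)" by metis
  \<comment> \<open>The generator argument runs over Borel sets, so the truncated function is
    replaced by a Borel representative; its integrals do not change.\<close>
  obtain k' where k': "k' \<in> borel_measurable lborel"
    and eq: "AE x in lborel. indicator (box c d) x * k x = k' x"
    using completion_ex_borel_measurable_real[OF borel_measurable_integrable[OF int]] by blast
  have int': "integrable lborel k'"
  proof -
    have "integrable lebesgue k'"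
      by (rule integrable_cong_AE_imp[OF int]) (use AE_completion[OF eq] k' in \<open>auto intro: measurable_completion\<close>)
    then show ?thesis using k' integrable_completion by blast
  qed
  have "(LINT x|lborel. indicator (box a b) x * k' x) = 0" for a b
  proof -
    have "(LINT x|lborel. indicator (box a b) x * k' x) = (LINT x|lebesgue. indicator (box a b) x * k' x)"
      using k' by (intro integral_completion[symmetric]) auto
    also have "\<dots> = (LINT x|lebesgue. indicator (box a b) x * (indicator (box c d) x * k x))"
    proof (rule integral_cong_AE)
      show "(\<lambda>x. indicator (box a b) x * k' x) \<in> borel_measurable lebesgue"
        using k' by (intro measurable_completion) auto
      have "(\<lambda>x. indicator (box a b) x *\<^sub>R (indicator (box c d) x * k x)) \<in> borel_measurable lebesgue"
        using int by (intro borel_measurable_integrable integrable_mult_indicator) auto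
      then show "(\<lambda>x. indicator (box a b) x * (indicator (box c d) x * k x)) \<in> borel_measurable lebesgue"
        by simp
      show "AE x in lebesgue. indicator (box a b) x * k' x = indicator (box a b) x * (indicator (box c d) x * k x)"
        using eq[THEN AE_completion] by eventually_elim simp
    qed
    finally show ?thesis using box0 by simp
  qed
  moreover have "integral\<^sup>L lborel k' = 0"
  proof -
    have "integral\<^sup>L lborel k' = integral\<^sup>L lebesgue k'"
      using k' by (intro integral_completion[symmetric]) auto
    also have "\<dots> = (LINT x|lebesgue. indicator (box c d) x * k x)"
      using eq[THEN AE_completion] int k' by (intro integral_cong_AE) (auto intro: measurable_completion)
    also have "\<dots> = (LINT x|lebesgue. indicator (box c d) x * (indicator (box c d) x * k x))"
      by (intro Bochner_Integration.integral_cong) (auto simp: indicator_def)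
    finally show ?thesis using box0 by simp
  qed
  ultimately have "AE x in lborel. k' x = 0"
    by (intro AE_eq_0_of_integral_box_eq_0 int') auto
  then have 1: "AE x in lebesgue. indicator (box c d) x * k x = 0"
    using eq by (intro AE_completion) auto
  \<comment> \<open>The truncation was made at the open box; the faces of the closed one are
    null.\<close>
  have 2: "AE x in lebesgue. x \<notin> cbox c d - box c d"
    using negligible_frontier_interval[of c d] unfolding negligible_iff_null_sets by (rule AE_not_in)
  from 1 2 have "AE x in lebesgue. x \<in> cbox c d \<longrightarrow> k x = 0"
    by eventually_elim (auto simp: indicator_def split: if_splits)
  then show ?thesis by (simp add: AE_lebesgue_on_iff)
qed

text \<open>Bumps factor over coordinates, so in applications only test functions of product form
  have to be examined. An open set is a countable union of closed boxes, which collects the null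
  sets.\<close>

lemma fundamental_lemma_box_bumps:
  fixes k :: "'a::euclidean_space \<Rightarrow> real"
  assumes k: "k \<in> L1_loc S" and S: "open S"
    and 0: "\<And>a b n. cbox a b \<subseteq> S \<Longrightarrow> (LINT x|lebesgue_on S. k x * box_bump a b n x) = 0"
  shows "AE x in lebesgue_on S. k x = 0"
proof -
  obtain D where D: "countable D" "D \<subseteq> Pow S" "\<And>X. X \<in> D \<Longrightarrow> \<exists>a b. X = cbox a b" "\<Union>D = S"
    using open_countable_Union_open_cbox[OF S] by metis
  have "AE x in lebesgue. \<forall>X\<in>D. x \<in> X \<longrightarrow> k x = 0"
  proof (subst AE_ball_countable[OF D(1)], safe)
    fix X assume X: "X \<in> D"
    then obtain a b where ab: "X = cbox a b" using D(3) by blast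
    have "AE x in lebesgue_on (cbox a b). k x = 0"
      using S X D(2) ab by (intro fundamental_lemma_cbox[OF k _ _ 0]) auto
    then show "AE x in lebesgue. x \<in> X \<longrightarrow> k x = 0"
      unfolding ab by (simp add: AE_lebesgue_on_iff)
  qed
  then have "AE x in lebesgue. x \<in> S \<longrightarrow> k x = 0"
    by eventually_elim (use D(4) in blast)
  then show ?thesis using S by (simp add: AE_lebesgue_on_iff)
qed

lemma fundamental_lemma:
  fixes k :: "'a::euclidean_space \<Rightarrow> real"
  assumes "k \<in> L1_loc S" "open S" "\<And>\<phi>. \<phi> \<in> test_functions S \<Longrightarrow> (LINT x|lebesgue_on S. k x * \<phi> x) = 0"
  shows "AE x in lebesgue_on S. k x = 0"
  using assms by (intro fundamental_lemma_box_bumps) (auto intro: box_bump_test_function)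

lemma L1_loc_linear:
  assumes "f \<in> L1_loc S" "g \<in> L1_loc S"
  shows "(\<lambda>x. a * f x + b * g x) \<in> L1_loc S"
  using assms by (auto simp: L1_loc_def)

lemma L1_loc_cong_AE:
  assumes "f \<in> L1_loc S" "AE x in lebesgue_on S. f x = g x" "S \<in> sets lebesgue"
  shows "g \<in> L1_loc S"
proof -
  have "integrable (lebesgue_on K) g" if K: "compact K" "K \<subseteq> S" for K
  proof (rule integrable_lebesgue_on_cong_AE)
    show "integrable (lebesgue_on K) f" using assms(1) K by (auto simp: L1_loc_def)
    show Ks: "K \<in> sets lebesgue" using K by (simp add: compact_imp_closed)
    show "AE x in lebesgue_on K. f x = g x"
      by (rule AE_lebesgue_on_subset[OF assms(2) K(2) assms(3) Ks])
  qed
  moreover have "g \<in> borel_measurable (lebesgue_on S)"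
    using assms(1) by (intro borel_measurable_lebesgue_on_cong_AE[OF _ assms(2,3)]) (auto simp: L1_loc_def)
  ultimately show ?thesis by (auto simp: L1_loc_def)
qed

lemma fundamental_lemma_eq:
  fixes f g :: "'a::euclidean_space \<Rightarrow> real"
  assumes f: "f \<in> L1_loc S" and g: "g \<in> L1_loc S" and S: "open S"
    and eq: "\<And>\<phi>. \<phi> \<in> test_functions S \<Longrightarrow> (LINT x|lebesgue_on S. f x * \<phi> x) = (LINT x|lebesgue_on S. g x * \<phi> x)"
  shows "AE x in lebesgue_on S. f x = g x"
proof -
  have "AE x in lebesgue_on S. 1 * f x + (- 1) * g x = 0"
  proof (rule fundamental_lemma[OF L1_loc_linear[OF f g] S])
    fix \<phi> assume \<phi>: "\<phi> \<in> test_functions S"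
    have "S \<in> sets lebesgue" using S by auto
    from L1_loc_mult_test_integrable[OF f this \<phi>] L1_loc_mult_test_integrable[OF g this \<phi>] eq[OF \<phi>]
    show "(LINT x|lebesgue_on S. (1 * f x + (- 1) * g x) * \<phi> x) = 0"
      by (simp add: algebra_simps)
  qed
  then show ?thesis by eventually_elim simp
qed

subsection \<open>Weak derivatives\<close>

lemma lborel_integral_translate:
  fixes f :: "'a::euclidean_space \<Rightarrow> real"
  assumes "f \<in> borel_measurable borel"
  shows "(LINT x|lborel. f (c + x)) = integral\<^sup>L lborel f"
proof -
  have "integral\<^sup>L lborel f = integral\<^sup>L (distr lborel borel ((+) c)) f"
    by (simp add: lborel_distr_plus)
  also have "\<dots> = (LINT x|lborel. f (c + x))"
    using assms by (intro integral_distr) auto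
  finally show ?thesis by simp
qed

text \<open>The mean value inequality along a line in direction v. It supplies the dominating
  constant for the difference quotients of the next lemma.\<close>

lemma test_function_difference_bound:
  fixes \<phi> :: "'a::euclidean_space \<Rightarrow> real"
  assumes "smooth \<phi>" "\<And>x. \<bar>pderiv_at v \<phi> x\<bar> \<le> C"
  shows "\<bar>\<phi> (x + t *\<^sub>R v) - \<phi> x\<bar> \<le> C * \<bar>t\<bar>"
proof -
  have d: "((\<lambda>s. \<phi> (x + s *\<^sub>R v)) has_derivative (\<lambda>s. s * pderiv_at v \<phi> (x + s0 *\<^sub>R v))) (at s0)" for s0
  proof -
    have "(\<phi> \<circ> (\<lambda>s. x + s *\<^sub>R v) has_derivative
        (\<lambda>w. pderiv_at w \<phi> (x + s0 *\<^sub>R v)) \<circ> (\<lambda>s. s *\<^sub>R v)) (at s0)"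
      by (intro diff_chain_at smooth_has_derivative assms) (auto intro!: derivative_eq_intros)
    moreover have "pderiv_at (s *\<^sub>R v) \<phi> y = s * pderiv_at v \<phi> y" for s y
      using linear_scale[OF has_derivative_linear[OF smooth_has_derivative[OF assms(1), of y]], of s v] by simp
    ultimately show ?thesis by (simp add: o_def)
  qed
  have "norm (\<phi> (x + t *\<^sub>R v) - \<phi> (x + 0 *\<^sub>R v)) \<le> C * norm (t - 0)"
  proof (rule differentiable_bound[where S = UNIV and f' = "\<lambda>s0 s. s * pderiv_at v \<phi> (x + s0 *\<^sub>R v)"])
    show "((\<lambda>s. \<phi> (x + s *\<^sub>R v)) has_derivative (\<lambda>s. s * pderiv_at v \<phi> (x + s0 *\<^sub>R v))) (at s0 within UNIV)" for s0
      using d by simp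
    show "onorm (\<lambda>s. s * pderiv_at v \<phi> (x + s0 *\<^sub>R v)) \<le> C" for s0
      using assms(2)[of "x + s0 *\<^sub>R v"]
      by (intro onorm_le) (auto simp: abs_mult mult.commute[of C] intro!: mult_left_mono)
  qed auto
  then show ?thesis by simp
qed

text \<open>Difference quotients of a compactly supported function integrate to 0 by translation
  invariance of the measure, and they converge to the derivative, bounded on one fixed ball. Every
  direction v is treated alike, without a choice of coordinates.\<close>

lemma integral_pderiv_at_test_function:
  fixes \<phi> :: "'a::euclidean_space \<Rightarrow> real"
  assumes \<phi>: "\<phi> \<in> test_functions UNIV"
  shows "(LINT x|lebesgue. pderiv_at v \<phi> x) = 0"
proof -
  note sm = test_functions_smooth[OF \<phi>]
  obtain K where K: "compact K" "\<And>x. x \<notin> K \<Longrightarrow> \<phi> x = 0" using test_functionsE[OF \<phi>] by metis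
  obtain C where C: "C \<ge> 0" "\<And>x. \<bar>pderiv_at v \<phi> x\<bar> \<le> C"
    using test_functions_bounded[OF test_functions_pderiv_at[OF \<phi>]] by blast
  obtain D where D: "\<And>x. \<bar>\<phi> x\<bar> \<le> D" using test_functions_bounded[OF \<phi>] by blast
  obtain r where r: "r > 0" "\<And>x. x \<in> K \<Longrightarrow> norm x \<le> r"
    using compact_imp_bounded[OF K(1)] bounded_pos by blast
  have m: "\<phi> \<in> borel_measurable borel" "pderiv_at v \<phi> \<in> borel_measurable borel"
    by (intro smooth_borel_measurable sm smooth_pderiv_at)+
  \<comment> \<open>The increments are at most 1, so enlarging the radius by \<open>norm v\<close>
    keeps the supports of all shifted functions in one ball.\<close>
  define B where "B = cball (0::'a) (r + norm v)"
  have B: "integrable lborel (\<lambda>x. c * indicator B x)" for c :: real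
    unfolding B_def using emeasure_bounded_finite[OF bounded_cball]
    by (intro integrable_mult_right integrable_real_indicator) auto
  have int: "integrable lborel \<phi>"
  proof (rule Bochner_Integration.integrable_bound[OF B[of D]])
    show "AE x in lborel. norm (\<phi> x) \<le> norm (D * indicator B x)"
    proof (rule AE_I2)
      fix x
      have "x \<notin> B \<Longrightarrow> x \<notin> K" using r(2)[of x] norm_ge_zero[of v] by (auto simp: B_def)
      then show "norm (\<phi> x) \<le> norm (D * indicator B x)"
        using D[of x] K(2)[of x] by (auto simp: indicator_def)
    qed
  qed (use m in simp)
  define \<delta> where "\<delta> n = 1 / real (Suc n)" for n
  have \<delta>: "0 < \<delta> n" "\<delta> n \<le> 1" "\<delta> n \<noteq> 0" for n by (auto simp: \<delta>_def)
  have \<delta>_lim: "\<delta> \<longlonglongrightarrow> 0" unfolding \<delta>_def using LIMSEQ_inverse_real_of_nat by (simp add: inverse_eq_divide)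
  define q where "q n x = (\<phi> (x + \<delta> n *\<^sub>R v) - \<phi> x) / \<delta> n" for n x
  have int': "integrable lborel (\<lambda>x. \<phi> (x + c))" for c
    using integrable_distr[of "(+) c" lborel borel \<phi>] int by (simp add: lborel_distr_plus add.commute)
  have "integral\<^sup>L lborel (q n) = 0" for n
    unfolding q_def using int int'[of "\<delta> n *\<^sub>R v"] lborel_integral_translate[OF m(1), of "\<delta> n *\<^sub>R v"]
    by (simp add: add.commute[of "\<delta> n *\<^sub>R v"])
  moreover have "(\<lambda>n. integral\<^sup>L lborel (q n)) \<longlonglongrightarrow> integral\<^sup>L lborel (pderiv_at v \<phi>)"
  proof (rule integral_dominated_convergence[OF _ _ B[of C]])
    show "q n \<in> borel_measurable lborel" for n unfolding q_def using m(1) by simp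
    show "AE x in lborel. (\<lambda>n. q n x) \<longlonglongrightarrow> pderiv_at v \<phi> x"
    proof (rule AE_I2)
      fix x
      have "((\<lambda>s. \<phi> (x + s *\<^sub>R v)) has_derivative (\<lambda>s. s * pderiv_at v \<phi> x)) (at 0)"
      proof -
        have "(\<phi> \<circ> (\<lambda>s. x + s *\<^sub>R v) has_derivative
            (\<lambda>w. pderiv_at w \<phi> (x + 0 *\<^sub>R v)) \<circ> (\<lambda>s. s *\<^sub>R v)) (at 0)"
          by (intro diff_chain_at smooth_has_derivative sm) (auto intro!: derivative_eq_intros)
        moreover have "pderiv_at (s *\<^sub>R v) \<phi> x = s * pderiv_at v \<phi> x" for s
          using linear_scale[OF has_derivative_linear[OF smooth_has_derivative[OF sm, of x]], of s v] by simp
        ultimately show ?thesis by (simp add: o_def)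
      qed
      then have "((\<lambda>s. \<phi> (x + s *\<^sub>R v)) has_real_derivative pderiv_at v \<phi> x) (at 0)"
        by (simp add: has_field_derivative_def mult.commute[of _ "pderiv_at v \<phi> x"])
      then have "((\<lambda>s. (\<phi> (x + s *\<^sub>R v) - \<phi> x) / s) \<longlongrightarrow> pderiv_at v \<phi> x) (at 0)"
        by (simp add: has_field_derivative_iff)
      then show "(\<lambda>n. q n x) \<longlonglongrightarrow> pderiv_at v \<phi> x"
        unfolding q_def by (rule filterlim_compose) (use \<delta> \<delta>_lim in \<open>auto simp: filterlim_at\<close>)
    qed
    have "\<bar>q n x\<bar> \<le> C * indicator B x" for n x
    proof (cases "x \<in> B")
      case True
      have "\<bar>\<phi> (x + \<delta> n *\<^sub>R v) - \<phi> x\<bar> \<le> C * \<delta> n"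
        using test_function_difference_bound[OF sm C(2), of x "\<delta> n"] \<delta>(1)[of n] by simp
      then show ?thesis using True \<delta>(1)[of n] by (simp add: q_def abs_divide pos_divide_le_eq)
    next
      case False
      have "x \<notin> K" "x + \<delta> n *\<^sub>R v \<notin> K"
      proof -
        show "x \<notin> K" using False r(2)[of x] norm_ge_zero[of v] by (auto simp: B_def)
        have "norm x \<le> norm (x + \<delta> n *\<^sub>R v) + norm v"
          using norm_triangle_ineq4[of "x + \<delta> n *\<^sub>R v" "\<delta> n *\<^sub>R v"] \<delta>[of n] mult_right_mono[of "\<delta> n" 1 "norm v"]
          by simp
        then show "x + \<delta> n *\<^sub>R v \<notin> K" using False r(2)[of "x + \<delta> n *\<^sub>R v"] by (auto simp: B_def)
      qed
      then show ?thesis using K(2) False by (simp add: q_def)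
    qed
    then show "AE x in lborel. norm (q n x) \<le> C * indicator B x" for n by simp
  qed (use m in simp)
  ultimately have "integral\<^sup>L lborel (pderiv_at v \<phi>) = 0" by (simp add: LIMSEQ_const_iff)
  then show ?thesis using m(2) by (simp add: integral_completion)
qed

text \<open>Times a test function, f becomes a test function on the whole space, whose derivative
  has integral 0. The Leibniz rule splits this into integration by parts, and both terms vanish
  outside S.\<close>

lemma smooth_has_weak_deriv:
  fixes f :: "'a::euclidean_space \<Rightarrow> real"
  assumes f: "smooth f" and S: "S \<in> sets lebesgue"
  shows "has_weak_deriv S v f (pderiv_at v f)"
  unfolding has_weak_deriv_def
proof (intro conjI ballI)
  show L: "f \<in> L1_loc S" "pderiv_at v f \<in> L1_loc S"
    using assms by (auto intro!: smooth_L1_loc smooth_pderiv_at)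
  fix \<phi> assume \<phi>: "\<phi> \<in> test_functions S"
  have "(\<lambda>x. f x * \<phi> x) \<in> test_functions UNIV"
    using test_functions_mult[OF test_functions_mono[OF subset_UNIV \<phi>] f] .
  then have "(LINT x|lebesgue. pderiv_at v (\<lambda>x. f x * \<phi> x) x) = 0"
    by (rule integral_pderiv_at_test_function)
  moreover have eq: "pderiv_at v (\<lambda>x. f x * \<phi> x) x = pderiv_at v f x * \<phi> x + f x * pderiv_at v \<phi> x" for x
    by (intro pderiv_at_mult smooth_differentiable f test_functions_smooth[OF \<phi>])
  ultimately have "(LINT x|lebesgue. pderiv_at v f x * \<phi> x + f x * pderiv_at v \<phi> x) = 0" by simp
  moreover have "(LINT x|lebesgue. pderiv_at v f x * \<phi> x + f x * pderiv_at v \<phi> x) =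
      (LINT x|lebesgue_on S. pderiv_at v f x * \<phi> x + f x * pderiv_at v \<phi> x)"
    using test_functions_eq_0[OF \<phi>] test_functions_eq_0[OF test_functions_pderiv_at[OF \<phi>]]
      integral_lebesgue_on_eq_0_outside(1)[OF subset_UNIV _ S,
        of "\<lambda>x. pderiv_at v f x * \<phi> x + f x * pderiv_at v \<phi> x"]
    by (simp add: lebesgue_on_UNIV_eq)
  moreover note L1_loc_mult_test_integrable[OF L(1) S test_functions_pderiv_at[OF \<phi>]]
    L1_loc_mult_test_integrable[OF L(2) S \<phi>]
  ultimately show "(LINT x|lebesgue_on S. f x * pderiv_at v \<phi> x) = - (LINT x|lebesgue_on S. pderiv_at v f x * \<phi> x)"
    by simp
qed

lemma has_weak_derivD:
  assumes "has_weak_deriv S v f g"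
  shows "f \<in> L1_loc S" "g \<in> L1_loc S"
    "\<And>\<phi>. \<phi> \<in> test_functions S \<Longrightarrow>
      (LINT x|lebesgue_on S. f x * pderiv_at v \<phi> x) = - (LINT x|lebesgue_on S. g x * \<phi> x)"
  using assms by (auto simp: has_weak_deriv_def)

lemma has_weak_deriv_unique:
  assumes "has_weak_deriv S v f g" "has_weak_deriv S v f g'" "open S"
  shows "AE x in lebesgue_on S. g x = g' x"
  by (rule fundamental_lemma_eq[OF has_weak_derivD(2)[OF assms(1)] has_weak_derivD(2)[OF assms(2)] assms(3)])
    (metis has_weak_derivD(3)[OF assms(1)] has_weak_derivD(3)[OF assms(2)] neg_equal_iff_equal)

lemma has_weak_deriv_linear:
  assumes "has_weak_deriv S v f g" "has_weak_deriv S v f' g'" "S \<in> sets lebesgue"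
  shows "has_weak_deriv S v (\<lambda>x. a * f x + b * f' x) (\<lambda>x. a * g x + b * g' x)"
  unfolding has_weak_deriv_def
proof (intro conjI ballI)
  note D = has_weak_derivD[OF assms(1)] has_weak_derivD[OF assms(2)]
  show "(\<lambda>x. a * f x + b * f' x) \<in> L1_loc S" "(\<lambda>x. a * g x + b * g' x) \<in> L1_loc S"
    using D by (auto intro: L1_loc_linear)
  fix \<phi> assume \<phi>: "\<phi> \<in> test_functions S"
  note I = L1_loc_mult_test_integrable[OF _ assms(3)]
  note \<phi>' = test_functions_pderiv_at[OF \<phi>]
  have "(LINT x|lebesgue_on S. (a * f x + b * f' x) * pderiv_at v \<phi> x) =
      a * (LINT x|lebesgue_on S. f x * pderiv_at v \<phi> x) + b * (LINT x|lebesgue_on S. f' x * pderiv_at v \<phi> x)"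
    using I[OF D(1) \<phi>'] I[OF D(4) \<phi>'] by (simp add: distrib_right mult.assoc)
  also have "\<dots> = - (LINT x|lebesgue_on S. (a * g x + b * g' x) * \<phi> x)"
    using I[OF D(2) \<phi>] I[OF D(5) \<phi>] D(3)[OF \<phi>] D(6)[OF \<phi>] by (simp add: distrib_right mult.assoc)
  finally show "(LINT x|lebesgue_on S. (a * f x + b * f' x) * pderiv_at v \<phi> x) =
      - (LINT x|lebesgue_on S. (a * g x + b * g' x) * \<phi> x)" .
qed

lemma has_weak_deriv_cong_AE:
  assumes "has_weak_deriv S v f g" "AE x in lebesgue_on S. f x = f' x" "AE x in lebesgue_on S. g x = g' x"
    "S \<in> sets lebesgue"
  shows "has_weak_deriv S v f' g'"
  unfolding has_weak_deriv_def
proof (intro conjI ballI)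
  show "f' \<in> L1_loc S" "g' \<in> L1_loc S"
    using L1_loc_cong_AE[OF _ _ assms(4)] has_weak_derivD(1,2)[OF assms(1)] assms(2,3) by blast+
  fix \<phi> assume \<phi>: "\<phi> \<in> test_functions S"
  have "(LINT x|lebesgue_on S. f' x * pderiv_at v \<phi> x) = (LINT x|lebesgue_on S. f x * pderiv_at v \<phi> x)"
    by (rule integral_lebesgue_on_cong_AE[OF _ assms(4)]) (rule eventually_mono[OF assms(2)], simp)
  moreover have "(LINT x|lebesgue_on S. g' x * \<phi> x) = (LINT x|lebesgue_on S. g x * \<phi> x)"
    by (rule integral_lebesgue_on_cong_AE[OF _ assms(4)]) (rule eventually_mono[OF assms(3)], simp)
  ultimately show "(LINT x|lebesgue_on S. f' x * pderiv_at v \<phi> x) = - (LINT x|lebesgue_on S. g' x * \<phi> x)"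
    using has_weak_derivD(3)[OF assms(1) \<phi>] by simp
qed

lemma has_weak_deriv_wderiv: "has_weak_deriv S v f g \<Longrightarrow> has_weak_deriv S v f (wderiv S v f)"
  unfolding wderiv_def by (rule someI[of "has_weak_deriv S v f"])

lemma wderiv_AE_eq:
  "has_weak_deriv S v f g \<Longrightarrow> open S \<Longrightarrow> AE x in lebesgue_on S. wderiv S v f x = g x"
  using has_weak_deriv_unique has_weak_deriv_wderiv by blast

lemma wderiv_L2:
  assumes "has_weak_deriv S v f g" "open S" "g \<in> L2 S"
  shows "wderiv S v f \<in> L2 S"
proof (rule L2_cong_AE[OF assms(3)])
  show "AE x in lebesgue_on S. g x = wderiv S v f x"
    using wderiv_AE_eq[OF assms(1,2)] by eventually_elim simp
qed (use assms in auto)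

lemma H1_L2: "f \<in> H1 S \<Longrightarrow> f \<in> L2 S"
  by (simp add: H1_def)

lemma H1_wderiv:
  assumes "f \<in> H1 S" "v \<in> Basis" "open S"
  shows "has_weak_deriv S v f (wderiv S v f)" "wderiv S v f \<in> L2 S"
  using assms has_weak_deriv_wderiv wderiv_L2 unfolding H1_def by blast+

lemma smooth_H1:
  assumes "smooth f" "S \<in> sets lebesgue" "bounded S"
  shows "f \<in> H1 S"
  unfolding H1_def
  using smooth_L2[OF _ assms(2,3)] smooth_pderiv_at[OF assms(1)] smooth_has_weak_deriv[OF assms(1,2)] assms(1)
  by blast

lemma wderiv_smooth:
  "smooth f \<Longrightarrow> open S \<Longrightarrow> AE x in lebesgue_on S. wderiv S v f x = pderiv_at v f x"
  by (intro wderiv_AE_eq smooth_has_weak_deriv) auto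

text \<open>\<open>H1_norm\<close> applies \<open>wderiv\<close> to the difference of the two
  functions. That choice agrees with the difference of the chosen derivatives only almost
  everywhere, which is enough under the integral.\<close>

lemma H1_tendsto_L2:
  assumes "H1_tendsto S F f" "open S"
  shows "(\<lambda>n. LINT x|lebesgue_on S. (F n x - f x)\<^sup>2) \<longlonglongrightarrow> 0"
    and "v \<in> Basis \<Longrightarrow> (\<lambda>n. LINT x|lebesgue_on S. (wderiv S v (F n) x - wderiv S v f x)\<^sup>2) \<longlonglongrightarrow> 0"
proof -
  have F: "F n \<in> H1 S" and f: "f \<in> H1 S" for n using assms by (auto simp: H1_tendsto_def)
  have "(\<lambda>n. (H1_norm S (\<lambda>x. F n x - f x))\<^sup>2) \<longlonglongrightarrow> 0\<^sup>2"
    using assms(1) unfolding H1_tendsto_def by (intro tendsto_power) blast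
  moreover have "(H1_norm S (\<lambda>x. F n x - f x))\<^sup>2 = (LINT x|lebesgue_on S. (F n x - f x)\<^sup>2) +
      (\<Sum>v\<in>Basis. LINT x|lebesgue_on S. (wderiv S v (\<lambda>x. F n x - f x) x)\<^sup>2)" for n
    unfolding H1_norm_def by (intro real_sqrt_pow2 add_nonneg_nonneg sum_nonneg) auto
  ultimately have lim: "(\<lambda>n. (LINT x|lebesgue_on S. (F n x - f x)\<^sup>2) +
      (\<Sum>v\<in>Basis. LINT x|lebesgue_on S. (wderiv S v (\<lambda>x. F n x - f x) x)\<^sup>2)) \<longlonglongrightarrow> 0" by simp
  show "(\<lambda>n. LINT x|lebesgue_on S. (F n x - f x)\<^sup>2) \<longlonglongrightarrow> 0"
    by (rule Lim_null_comparison[OF _ lim]) (auto intro!: sum_nonneg always_eventually)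
  assume v: "v \<in> Basis"
  have eq: "(LINT x|lebesgue_on S. (wderiv S v (\<lambda>x. F n x - f x) x)\<^sup>2) =
      (LINT x|lebesgue_on S. (wderiv S v (F n) x - wderiv S v f x)\<^sup>2)" for n
  proof (rule integral_lebesgue_on_cong_AE)
    have "has_weak_deriv S v (\<lambda>x. 1 * F n x + (- 1) * f x) (\<lambda>x. 1 * wderiv S v (F n) x + (- 1) * wderiv S v f x)"
      using assms(2) by (intro has_weak_deriv_linear H1_wderiv[OF F v] H1_wderiv[OF f v]) auto
    then have "AE x in lebesgue_on S. wderiv S v (\<lambda>x. F n x - f x) x = wderiv S v (F n) x - wderiv S v f x"
      using wderiv_AE_eq[OF _ assms(2)] by fastforce
    then show "AE x in lebesgue_on S. (wderiv S v (\<lambda>x. F n x - f x) x)\<^sup>2 = (wderiv S v (F n) x - wderiv S v f x)\<^sup>2"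
      by eventually_elim simp
  qed (use assms(2) in auto)
  show "(\<lambda>n. LINT x|lebesgue_on S. (wderiv S v (F n) x - wderiv S v f x)\<^sup>2) \<longlonglongrightarrow> 0"
  proof (rule Lim_null_comparison[OF _ lim])
    have "(LINT x|lebesgue_on S. (wderiv S v (\<lambda>x. F n x - f x) x)\<^sup>2)
        \<le> (\<Sum>v\<in>Basis. LINT x|lebesgue_on S. (wderiv S v (\<lambda>x. F n x - f x) x)\<^sup>2)" for n
      using v by (intro member_le_sum) auto
    then show "\<forall>\<^sub>F n in sequentially. norm (LINT x|lebesgue_on S. (wderiv S v (F n) x - wderiv S v f x)\<^sup>2)
      \<le> (LINT x|lebesgue_on S. (F n x - f x)\<^sup>2) +
      (\<Sum>v\<in>Basis. LINT x|lebesgue_on S. (wderiv S v (\<lambda>x. F n x - f x) x)\<^sup>2)"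
      unfolding eq[symmetric] by (auto intro!: add_increasing always_eventually)
  qed
qed

lemma H1_tendsto_integral_mult:
  assumes "H1_tendsto S F f" "open S" "m \<in> L2 S"
  shows "(\<lambda>n. LINT x|lebesgue_on S. F n x * m x) \<longlonglongrightarrow> (LINT x|lebesgue_on S. f x * m x)"
    and "v \<in> Basis \<Longrightarrow> (\<lambda>n. LINT x|lebesgue_on S. wderiv S v (F n) x * m x)
      \<longlonglongrightarrow> (LINT x|lebesgue_on S. wderiv S v f x * m x)"
proof -
  have F: "F n \<in> H1 S" and f: "f \<in> H1 S" for n using assms by (auto simp: H1_tendsto_def)
  show "(\<lambda>n. LINT x|lebesgue_on S. F n x * m x) \<longlonglongrightarrow> (LINT x|lebesgue_on S. f x * m x)"
    by (intro L2_tendsto_integral_mult H1_L2 F f assms H1_tendsto_L2[OF assms(1,2)])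
  show "(\<lambda>n. LINT x|lebesgue_on S. wderiv S v (F n) x * m x)
      \<longlonglongrightarrow> (LINT x|lebesgue_on S. wderiv S v f x * m x)" if "v \<in> Basis"
    by (intro L2_tendsto_integral_mult H1_wderiv[OF F that] H1_wderiv[OF f that] assms
        H1_tendsto_L2(2)[OF assms(1,2) that])
qed

lemma H1_tendsto_const:
  assumes "f \<in> H1 S" "open S"
  shows "H1_tendsto S (\<lambda>n. f) f"
proof -
  \<comment> \<open>Even for f - f = 0 the chosen weak derivative is just some function that
    vanishes almost everywhere.\<close>
  have "(LINT x|lebesgue_on S. (wderiv S v (\<lambda>x. f x - f x) x)\<^sup>2) = (LINT x|lebesgue_on S. 0)" for v
  proof (rule integral_lebesgue_on_cong_AE)
    have "AE x in lebesgue_on S. wderiv S v (\<lambda>x. 0) x = pderiv_at v (\<lambda>x. 0) x"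
      by (intro wderiv_smooth assms) auto
    moreover have "pderiv_at v (\<lambda>x. 0 :: real) x = 0" for x :: 'a
      by (rule pderiv_at_eqI) auto
    ultimately show "AE x in lebesgue_on S. (wderiv S v (\<lambda>x. f x - f x) x)\<^sup>2 = 0"
      by simp
  qed (use assms in auto)
  then show ?thesis using assms by (simp add: H1_tendsto_def H1_norm_def)
qed

subsection \<open>Fubini's theorem for Lebesgue integrals\<close>

lemma AE_lebesgue_Pair:
  assumes "AE z in (lebesgue :: ('a::euclidean_space \<times> 'b::euclidean_space) measure). P z"
  shows "AE x in lebesgue. AE y in lebesgue. P (x, y)"
proof -
  have "AE z in (lborel \<Otimes>\<^sub>M lborel). P z"
    using assms unfolding AE_completion_iff lborel_prod .
  then have "AE x in lborel. AE y in lborel. P (x, y)"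
    by (rule lborel_pair.AE_pair)
  then show ?thesis by (simp add: AE_completion_iff)
qed

lemma AE_lebesgue_fst:
  assumes "AE x in lebesgue. Q x"
  shows "AE z in (lebesgue :: ('a::euclidean_space \<times> 'b::euclidean_space) measure). Q (fst z)"
proof -
  have "AE x in lborel. Q x" using assms by (simp add: AE_completion_iff)
  then obtain N where N: "N \<in> null_sets lborel" "{x. \<not> Q x} \<subseteq> N"
    by (auto elim!: AE_E simp: null_sets_def)
  have "emeasure (lborel \<Otimes>\<^sub>M lborel) (N \<times> (UNIV :: 'b set)) = emeasure lborel N * emeasure lborel (UNIV :: 'b set)"
    using N by (intro lborel.emeasure_pair_measure_Times) auto
  then have "N \<times> (UNIV :: 'b set) \<in> null_sets (lborel \<Otimes>\<^sub>M lborel)"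
    using N by (auto simp: null_sets_def)
  then have "N \<times> (UNIV :: 'b set) \<in> null_sets lborel"
    by (simp add: lborel_prod)
  then have "AE z in (lborel :: ('a \<times> 'b) measure). Q (fst z)"
    by (rule AE_I') (use N(2) in auto)
  then show ?thesis by (rule AE_completion)
qed

lemma AE_lebesgue_snd:
  assumes "AE x in lebesgue. Q x"
  shows "AE z in (lebesgue :: ('a::euclidean_space \<times> 'b::euclidean_space) measure). Q (snd z)"
proof -
  have "AE x in lborel. Q x" using assms by (simp add: AE_completion_iff)
  then obtain N where N: "N \<in> null_sets lborel" "{x. \<not> Q x} \<subseteq> N"
    by (auto elim!: AE_E simp: null_sets_def)
  have "emeasure (lborel \<Otimes>\<^sub>M lborel) ((UNIV :: 'a set) \<times> N) = emeasure lborel (UNIV :: 'a set) * emeasure lborel N"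
    using N by (intro lborel.emeasure_pair_measure_Times) auto
  then have "(UNIV :: 'a set) \<times> N \<in> null_sets (lborel \<Otimes>\<^sub>M lborel)"
    using N by (auto simp: null_sets_def)
  then have "(UNIV :: 'a set) \<times> N \<in> null_sets lborel"
    by (simp add: lborel_prod)
  then have "AE z in (lborel :: ('a \<times> 'b) measure). Q (snd z)"
    by (rule AE_I') (use N(2) in auto)
  then show ?thesis by (rule AE_completion)
qed

lemma lebesgue_integrable_borel:
  fixes f :: "'a::euclidean_space \<Rightarrow> real"
  assumes "integrable lebesgue f"
  obtains f' where "f' \<in> borel_measurable borel" "integrable lborel f'" "AE x in lebesgue. f x = f' x"
proof -
  obtain f' where f': "f' \<in> borel_measurable lborel" "AE x in lborel. f x = f' x"
    using completion_ex_borel_measurable_real[OF borel_measurable_integrable[OF assms]] by blast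
  have ae: "AE x in lebesgue. f x = f' x" using f'(2) by (rule AE_completion)
  have "integrable lebesgue f'"
    by (rule integrable_cong_AE_imp[OF assms measurable_completion[OF f'(1)] ae])
  then have "integrable lborel f'" using f'(1) integrable_completion by blast
  from that[OF _ this ae] f'(1) show ?thesis by simp
qed

text \<open>The product of two Lebesgue measures is not complete, so a Borel representative is
  integrated instead. On almost every slice it agrees with f almost everywhere.\<close>

lemma lebesgue_Fubini:
  fixes f :: "'a::euclidean_space \<times> 'b::euclidean_space \<Rightarrow> real"
  assumes f: "integrable lebesgue f"
  shows "AE x in lebesgue. integrable lebesgue (\<lambda>y. f (x, y))"
    and "integrable lebesgue (\<lambda>x. LINT y|lebesgue. f (x, y))"
    and "integral\<^sup>L lebesgue f = (LINT x|lebesgue. LINT y|lebesgue. f (x, y))"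
proof -
  obtain f' where f': "f' \<in> borel_measurable borel" "integrable lborel f'" and ae: "AE x in lebesgue. f x = f' x"
    using lebesgue_integrable_borel[OF f] by blast
  have int: "integrable (lborel \<Otimes>\<^sub>M lborel) f'" using f' by (simp add: lborel_prod)
  have m: "(\<lambda>y. f' (x, y)) \<in> borel_measurable borel" for x
    by (rule measurable_compose[OF _ f'(1)]) auto
  have ae2: "AE x in lebesgue. AE y in lebesgue. f (x, y) = f' (x, y)"
    by (rule AE_lebesgue_Pair[OF ae])
  have i1: "AE x in lebesgue. integrable lborel (\<lambda>y. f' (x, y))"
    by (rule AE_completion[OF lborel_pair.AE_integrable_fst'[OF int]])
  have slice: "integrable lebesgue (\<lambda>y. f (x, y)) \<and> (LINT y|lebesgue. f (x, y)) = (LINT y|lborel. f' (x, y))"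
    if "AE y in lebesgue. f (x, y) = f' (x, y)" "integrable lborel (\<lambda>y. f' (x, y))" for x
  proof -
    have i: "integrable lebesgue (\<lambda>y. f' (x, y))"
      using that(2) m[of x] by (simp add: integrable_completion)
    have ae': "AE y in lebesgue_on UNIV. f' (x, y) = f (x, y)"
      unfolding lebesgue_on_UNIV_eq using that(1) by eventually_elim simp
    have "integrable (lebesgue_on UNIV) (\<lambda>y. f (x, y))"
      using i by (intro integrable_lebesgue_on_cong_AE[OF _ ae']) (auto simp: lebesgue_on_UNIV_eq)
    moreover have "(LINT y|lebesgue_on UNIV. f (x, y)) = (LINT y|lebesgue_on UNIV. f' (x, y))"
      by (rule integral_lebesgue_on_cong_AE[OF ae', symmetric]) simp
    ultimately show ?thesis
      using m[of x] by (simp add: lebesgue_on_UNIV_eq integral_completion)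
  qed
  have s: "AE x in lebesgue. integrable lebesgue (\<lambda>y. f (x, y)) \<and> (LINT y|lebesgue. f (x, y)) = (LINT y|lborel. f' (x, y))"
    using ae2 i1 by eventually_elim (rule slice)
  then show "AE x in lebesgue. integrable lebesgue (\<lambda>y. f (x, y))" by eventually_elim simp
  have i2: "integrable lborel (\<lambda>x. LINT y|lborel. f' (x, y))"
    by (rule lborel_pair.integrable_fst'[OF int])
  then have i3: "integrable (lebesgue_on UNIV) (\<lambda>x. LINT y|lborel. f' (x, y))"
    using integrable_completion[OF borel_measurable_integrable[OF i2]] by (simp add: lebesgue_on_UNIV_eq)
  have ae3: "AE x in lebesgue_on UNIV. (LINT y|lborel. f' (x, y)) = (LINT y|lebesgue. f (x, y))"
    unfolding lebesgue_on_UNIV_eq using s by eventually_elim simp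
  from integrable_lebesgue_on_cong_AE[OF i3 ae3]
  show "integrable lebesgue (\<lambda>x. LINT y|lebesgue. f (x, y))" by (simp add: lebesgue_on_UNIV_eq)
  have "integral\<^sup>L lebesgue f = integral\<^sup>L lebesgue f'"
    using integral_lebesgue_on_cong_AE[where S = UNIV and f = f and g = f'] ae
    unfolding lebesgue_on_UNIV_eq by simp
  also have "\<dots> = integral\<^sup>L (lborel \<Otimes>\<^sub>M lborel) f'"
    using f' by (simp add: integral_completion lborel_prod)
  also have "\<dots> = (LINT x|lborel. LINT y|lborel. f' (x, y))"
    by (rule lborel_pair.integral_fst'[OF int, symmetric])
  also have "\<dots> = (LINT x|lebesgue. LINT y|lborel. f' (x, y))"
    by (rule integral_completion[OF borel_measurable_integrable[OF i2], symmetric])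
  also have "\<dots> = (LINT x|lebesgue. LINT y|lebesgue. f (x, y))"
    using integral_lebesgue_on_cong_AE[OF ae3] by (simp add: lebesgue_on_UNIV_eq)
  finally show "integral\<^sup>L lebesgue f = (LINT x|lebesgue. LINT y|lebesgue. f (x, y))" .
qed

lemma lebesgue_integral_swap:
  fixes f :: "'a::euclidean_space \<times> 'b::euclidean_space \<Rightarrow> real"
  assumes f: "integrable lebesgue f"
  shows "integrable lebesgue (\<lambda>z. f (snd z, fst z))"
    and "(LINT z|lebesgue. f (snd z, fst z)) = integral\<^sup>L lebesgue f"
proof -
  obtain f' where f': "f' \<in> borel_measurable borel" "integrable lborel f'" and ae: "AE x in lebesgue. f x = f' x"
    using lebesgue_integrable_borel[OF f] by blast
  have distr: "distr lborel borel (\<lambda>z. (snd z, fst z)) = (lborel :: ('a \<times> 'b) measure)"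
  proof -
    have "(lborel :: ('a \<times> 'b) measure) = distr (lborel \<Otimes>\<^sub>M lborel) (lborel \<Otimes>\<^sub>M lborel) (\<lambda>(x, y). (y, x))"
      unfolding lborel_prod[symmetric] by (rule lborel_pair.distr_pair_swap)
    also have "\<dots> = distr (lborel :: ('b \<times> 'a) measure) (lborel :: ('a \<times> 'b) measure) (\<lambda>z. (snd z, fst z))"
      by (simp add: lborel_prod case_prod_beta')
    also have "\<dots> = distr (lborel :: ('b \<times> 'a) measure) borel (\<lambda>z. (snd z, fst z))"
      by (rule distr_cong) auto
    finally show ?thesis by simp
  qed
  have mswap: "(\<lambda>z :: 'b \<times> 'a. (snd z, fst z)) \<in> borel_measurable borel"
    by (intro borel_measurable_continuous_onI continuous_intros)
  have i: "integrable lborel (\<lambda>z. f' (snd z, fst z))"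
    by (rule integrable_distr[of "\<lambda>z. (snd z, fst z)" _ borel]) (use mswap f' distr in auto)
  have "AE z in lborel. f z = f' z" using ae by (simp add: AE_completion_iff)
  \<comment> \<open>The exceptional set is enclosed in a Borel null set, since the swap map is used
    as a Borel map and pulls back Borel sets.\<close>
  then obtain N where N: "N \<in> null_sets lborel" "{z. f z \<noteq> f' z} \<subseteq> N"
    by (auto elim!: AE_E simp: null_sets_def)
  have "AE z in lborel. z \<notin> N" using N(1) by (rule AE_not_in)
  then have "AE z in distr lborel borel (\<lambda>z. (snd z, fst z)). z \<notin> N" unfolding distr .
  then have "AE z in lborel. (snd z, fst z) \<notin> N"
    by (subst (asm) AE_distr_iff) (use mswap N in auto)
  then have "AE z in lborel. f' (snd z, fst z) = f (snd z, fst z)"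
    by eventually_elim (use N(2) in force)
  then have ae': "AE z in lebesgue_on UNIV. f' (snd z, fst z) = f (snd z, fst z)"
    unfolding lebesgue_on_UNIV_eq by (rule AE_completion)
  have m: "(\<lambda>z. f' (snd z, fst z)) \<in> borel_measurable borel"
    by (rule measurable_compose[OF mswap f'(1)])
  have "integrable (lebesgue_on UNIV) (\<lambda>z. f' (snd z, fst z))"
    using i m by (simp add: lebesgue_on_UNIV_eq integrable_completion)
  from integrable_lebesgue_on_cong_AE[OF this ae']
  show "integrable lebesgue (\<lambda>z. f (snd z, fst z))" by (simp add: lebesgue_on_UNIV_eq)
  have "(LINT z|lebesgue. f (snd z, fst z)) = (LINT z|lebesgue. f' (snd z, fst z))"
    using integral_lebesgue_on_cong_AE[OF ae'] by (simp add: lebesgue_on_UNIV_eq)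
  also have "\<dots> = (LINT z|lborel. f' (snd z, fst z))" using m by (simp add: integral_completion)
  also have "\<dots> = integral\<^sup>L (distr lborel borel (\<lambda>z. (snd z, fst z))) f'"
    using mswap f' by (intro integral_distr[symmetric]) auto
  also have "\<dots> = integral\<^sup>L lebesgue f'" using f' by (simp add: distr integral_completion)
  also have "\<dots> = integral\<^sup>L lebesgue f"
    using integral_lebesgue_on_cong_AE[where S = UNIV and f = f and g = f'] ae
    unfolding lebesgue_on_UNIV_eq by simp
  finally show "(LINT z|lebesgue. f (snd z, fst z)) = integral\<^sup>L lebesgue f" .
qed

lemma lebesgue_Fubini_swapped:
  fixes f :: "'a::euclidean_space \<times> 'b::euclidean_space \<Rightarrow> real"
  assumes f: "integrable lebesgue f"
  shows "integral\<^sup>L lebesgue f = (LINT y|lebesgue. LINT x|lebesgue. f (x, y))"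
  using lebesgue_Fubini(3)[OF lebesgue_integral_swap(1)[OF f]] lebesgue_integral_swap(2)[OF f] by simp

lemma lebesgue_integrable_product:
  fixes f :: "'a::euclidean_space \<Rightarrow> real" and g :: "'b::euclidean_space \<Rightarrow> real"
  assumes f: "integrable lborel f" and g: "integrable lborel g"
  shows "integrable lborel (\<lambda>z. f (fst z) * g (snd z))"
proof -
  have m: "f \<in> borel_measurable borel" "g \<in> borel_measurable borel" using f g by auto
  have "integrable (lborel \<Otimes>\<^sub>M lborel) (\<lambda>z. f (fst z) * g (snd z))"
  proof (rule lborel_pair.Fubini_integrable)
    show "(\<lambda>z. f (fst z) * g (snd z)) \<in> borel_measurable (lborel \<Otimes>\<^sub>M lborel)"
      using m by measurable
    show "integrable lborel (\<lambda>x. LINT y|lborel. norm (f (fst (x, y)) * g (snd (x, y))))"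
      using f g by (auto simp: abs_mult)
  qed (use g in auto)
  then show ?thesis by (simp add: lborel_prod)
qed

subsection \<open>Functions of one real variable\<close>

text \<open>Vertical slices of the domain are open intervals, whereas column integrals and traces
  use closed ones. The two end points are null.\<close>

lemma lebesgue_on_Icc_Ioo:
  fixes f :: "real \<Rightarrow> real"
  shows "(LINT s|lebesgue_on {0..c}. f s) = (LINT s|lebesgue. (if 0 < s \<and> s < c then f s else 0))"
    and "integrable (lebesgue_on {0..c}) f \<longleftrightarrow> integrable lebesgue (\<lambda>s. if 0 < s \<and> s < c then f s else 0)"
proof -
  have ae: "AE s in lebesgue_on UNIV. (if s \<in> {0..c} then f s else 0) = (if 0 < s \<and> s < c then f s else 0)"
  proof -
    have "negligible {0, c}" by simp
    then have "AE s in lebesgue. s \<notin> {0, c}"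
      unfolding negligible_iff_null_sets by (rule AE_not_in)
    then show ?thesis unfolding lebesgue_on_UNIV_eq by eventually_elim auto
  qed
  have ae': "AE s in lebesgue_on UNIV. (if 0 < s \<and> s < c then f s else 0) = (if s \<in> {0..c} then f s else 0)"
    using ae by eventually_elim simp
  show "(LINT s|lebesgue_on {0..c}. f s) = (LINT s|lebesgue. (if 0 < s \<and> s < c then f s else 0))"
    using integral_lebesgue_on_cong_AE[OF ae] Lebesgue_Measure.integral_restrict_UNIV[of "{0..c}" f]
    by (simp add: lebesgue_on_UNIV_eq)
  show "integrable (lebesgue_on {0..c}) f \<longleftrightarrow> integrable lebesgue (\<lambda>s. if 0 < s \<and> s < c then f s else 0)"
  proof
    assume "integrable (lebesgue_on {0..c}) f"
    then have "integrable (lebesgue_on UNIV) (\<lambda>s. if s \<in> {0..c} then f s else 0)"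
      unfolding lebesgue_on_UNIV_eq by (subst Lebesgue_Measure.integrable_restrict_UNIV) auto
    from integrable_lebesgue_on_cong_AE[OF this ae]
    show "integrable lebesgue (\<lambda>s. if 0 < s \<and> s < c then f s else 0)"
      unfolding lebesgue_on_UNIV_eq by simp
  next
    assume "integrable lebesgue (\<lambda>s. if 0 < s \<and> s < c then f s else 0)"
    then have "integrable (lebesgue_on UNIV) (\<lambda>s. if 0 < s \<and> s < c then f s else 0)"
      unfolding lebesgue_on_UNIV_eq .
    from integrable_lebesgue_on_cong_AE[OF this ae']
    have "integrable lebesgue (\<lambda>s. if s \<in> {0..c} then f s else 0)"
      unfolding lebesgue_on_UNIV_eq by simp
    then show "integrable (lebesgue_on {0..c}) f"
      by (subst (asm) Lebesgue_Measure.integrable_restrict_UNIV) auto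
  qed
qed

lemma continuous_integrable_lebesgue_on_Icc:
  fixes f :: "real \<Rightarrow> real"
  assumes "continuous_on {a..b} f"
  shows "integrable (lebesgue_on {a..b}) f"
proof -
  have "compact (f ` {a..b})" using assms by (intro compact_continuous_image) auto
  then obtain C where "\<And>y. y \<in> f ` {a..b} \<Longrightarrow> norm y \<le> C" using compact_imp_bounded bounded_iff by metis
  moreover have "f \<in> borel_measurable (lebesgue_on {a..b})"
    using assms by (intro continuous_imp_measurable_on_sets_lebesgue) auto
  ultimately show ?thesis by (intro integrable_lebesgue_on_bounded[where C = C]) auto
qed

lemma indefinite_integral_continuous_on:
  fixes g :: "real \<Rightarrow> real"
  assumes "integrable (lebesgue_on {0..c}) g"
  shows "continuous_on {0..c} (\<lambda>s. LINT t|lebesgue_on {0..s}. g t)"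
proof -
  have hi: "(g has_integral (LINT t|lebesgue_on {0..s}. g t)) {0..s}" if "s \<in> {0..c}" for s
    by (rule has_integral_integral_lebesgue_on[OF integrable_lebesgue_on_subset[OF assms]]) (use that in auto)
  have "continuous_on {0..c} (\<lambda>s. integral {0..s} g)"
  proof (cases "0 \<le> c")
    case True
    then show ?thesis
      by (intro indefinite_integral_continuous_1 has_integral_integrable[OF hi]) auto
  qed auto
  then show ?thesis
    by (rule continuous_on_eq) (use hi in \<open>simp add: integral_unique\<close>)
qed

text \<open>Fubini's theorem on the square \<open>{0..c} \<times> {0..c}\<close>, cut along its diagonal.\<close>

lemma indefinite_integral_product:
  fixes f g :: "real \<Rightarrow> real"
  assumes f: "integrable (lebesgue_on {0..c}) f" and g: "integrable (lebesgue_on {0..c}) g"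
  shows "integrable (lebesgue_on {0..c}) (\<lambda>s. f s * (LINT t|lebesgue_on {0..s}. g t))"
    and "(LINT s|lebesgue_on {0..c}. f s * (LINT t|lebesgue_on {0..s}. g t))
       + (LINT s|lebesgue_on {0..c}. g s * (LINT t|lebesgue_on {0..s}. f t))
       = (LINT s|lebesgue_on {0..c}. f s) * (LINT s|lebesgue_on {0..c}. g s)"
proof -
  have ex: "\<exists>f'. f' \<in> borel_measurable borel \<and> integrable lborel f' \<and>
      (AE x in lebesgue. (if x \<in> {0..c} then f x else 0) = f' x)"
    if "integrable (lebesgue_on {0..c}) f" for f :: "real \<Rightarrow> real"
  proof -
    have "integrable lebesgue (\<lambda>x. if x \<in> {0..c} then f x else 0)"
      using Lebesgue_Measure.integrable_restrict_UNIV[of "{0..c}" f] that by simp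
    then show ?thesis using lebesgue_integrable_borel by blast
  qed
  obtain f' where f': "f' \<in> borel_measurable borel" "integrable lborel f'"
    and fae: "AE x in lebesgue. (if x \<in> {0..c} then f x else 0) = f' x" using ex[OF f] by blast
  obtain g' where g': "g' \<in> borel_measurable borel" "integrable lborel g'"
    and gae: "AE x in lebesgue. (if x \<in> {0..c} then g x else 0) = g' x" using ex[OF g] by blast
  define P where "P g' s = (LINT t|lborel. g' t * indicator {0..s} t)" for g' :: "real \<Rightarrow> real" and s
  have prim: "(LINT t|lebesgue_on {0..s}. g t) = P g' s"
    if "g' \<in> borel_measurable borel" "AE x in lebesgue. (if x \<in> {0..c} then g x else 0) = g' x" "s \<in> {0..c}"
    for s and g g' :: "real \<Rightarrow> real"
  proof -
    have "(LINT t|lebesgue_on {0..s}. g t) = (LINT t|lebesgue. (if t \<in> {0..s} then g t else 0))"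
      by (rule Lebesgue_Measure.integral_restrict_UNIV[symmetric]) simp
    also have "\<dots> = (LINT t|lebesgue_on UNIV. (if t \<in> {0..s} then g t else 0))"
      unfolding lebesgue_on_UNIV_eq ..
    also have "\<dots> = (LINT t|lebesgue_on UNIV. g' t * indicator {0..s} t)"
    proof (rule integral_lebesgue_on_cong_AE)
      show "AE t in lebesgue_on UNIV. (if t \<in> {0..s} then g t else 0) = g' t * indicator {0..s} t"
        unfolding lebesgue_on_UNIV_eq using that(2)
        by eventually_elim (use that(3) in \<open>auto simp: indicator_def split: if_splits\<close>)
    qed simp
    also have "\<dots> = P g' s"
      unfolding lebesgue_on_UNIV_eq P_def using that(1) by (intro integral_completion borel_measurable_times) auto
    finally show ?thesis .
  qed
  have key: "integrable lborel (\<lambda>s. f' s * P g' s) \<and>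
      (LINT s|lborel. f' s * P g' s) = (LINT z|lborel. f' (fst z) * g' (snd z) * (if 0 \<le> snd z \<and> snd z \<le> fst z then 1 else 0))"
    if f': "f' \<in> borel_measurable borel" "integrable lborel f'" and g': "g' \<in> borel_measurable borel" "integrable lborel g'"
    for f' g' :: "real \<Rightarrow> real"
  proof -
    define F where "F z = f' (fst z) * g' (snd z) * (if 0 \<le> snd z \<and> snd z \<le> fst z then 1 else 0)" for z :: "real \<times> real"
    have "integrable lborel F"
    proof (rule Bochner_Integration.integrable_bound[OF lebesgue_integrable_product[OF f'(2) g'(2)]])
      show "F \<in> borel_measurable lborel"
        unfolding F_def lborel_prod[symmetric] using f'(1) g'(1) by measurable
    qed (auto simp: F_def)
    then have int: "integrable (lborel \<Otimes>\<^sub>M lborel) F" by (simp add: lborel_prod)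
    have eq: "(LINT t|lborel. F (s, t)) = f' s * P g' s" for s
    proof -
      have "(LINT t|lborel. F (s, t)) = (LINT t|lborel. f' s * (g' t * indicator {0..s} t))"
        by (rule Bochner_Integration.integral_cong) (auto simp: F_def indicator_def)
      then show ?thesis by (simp add: P_def)
    qed
    from lborel_pair.integrable_fst'[OF int] lborel_pair.integral_fst'[OF int] show ?thesis
      unfolding eq by (simp add: lborel_prod F_def[abs_def])
  qed
  have trans: "integrable (lebesgue_on {0..c}) (\<lambda>s. f s * (LINT t|lebesgue_on {0..s}. g t)) \<and>
      (LINT s|lebesgue_on {0..c}. f s * (LINT t|lebesgue_on {0..s}. g t)) = (LINT s|lborel. f' s * P g' s)"
    if f': "f' \<in> borel_measurable borel" "integrable lborel f'"
    and fae: "AE x in lebesgue. (if x \<in> {0..c} then f x else 0) = f' x"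
    and g': "g' \<in> borel_measurable borel" "integrable lborel g'"
    and gae: "AE x in lebesgue. (if x \<in> {0..c} then g x else 0) = g' x"
    for f f' g g' :: "real \<Rightarrow> real"
  proof -
    let ?H = "\<lambda>s. f s * (LINT t|lebesgue_on {0..s}. g t)"
    have ae: "AE s in lebesgue_on UNIV. f' s * P g' s = (if s \<in> {0..c} then ?H s else 0)"
      unfolding lebesgue_on_UNIV_eq using fae
      by eventually_elim (use prim[OF g'(1) gae] in \<open>auto split: if_splits\<close>)
    have i: "integrable lborel (\<lambda>s. f' s * P g' s)" using key[OF f' g'] by simp
    then have i': "integrable (lebesgue_on UNIV) (\<lambda>s. f' s * P g' s)"
      using integrable_completion[OF borel_measurable_integrable[OF i]] by (simp add: lebesgue_on_UNIV_eq)
    have "integrable lebesgue (\<lambda>s. if s \<in> {0..c} then ?H s else 0)"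
      using integrable_lebesgue_on_cong_AE[OF i' ae] by (simp add: lebesgue_on_UNIV_eq)
    moreover have "(LINT s|lebesgue_on {0..c}. ?H s) = (LINT s|lebesgue. f' s * P g' s)"
      using integral_lebesgue_on_cong_AE[OF ae] Lebesgue_Measure.integral_restrict_UNIV[of "{0..c}" ?H]
      by (simp add: lebesgue_on_UNIV_eq)
    moreover have "(LINT s|lebesgue. f' s * P g' s) = (LINT s|lborel. f' s * P g' s)"
      by (rule integral_completion[OF borel_measurable_integrable[OF i]])
    ultimately show ?thesis using Lebesgue_Measure.integrable_restrict_UNIV[of "{0..c}" ?H] by auto
  qed
  show "integrable (lebesgue_on {0..c}) (\<lambda>s. f s * (LINT t|lebesgue_on {0..s}. g t))"
    using trans[OF f' fae g' gae] by simp
  let ?I = "\<lambda>z :: real \<times> real. if 0 \<le> snd z \<and> snd z \<le> fst z then 1 else 0 :: real"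
  let ?J = "\<lambda>z :: real \<times> real. if 0 \<le> fst z \<and> fst z \<le> snd z then 1 else 0 :: real"
  \<comment> \<open>The two triangles cover only nonnegative arguments; for negative ones the
    representatives vanish.\<close>
  have zero: "AE x in lborel. x < 0 \<longrightarrow> f' x = 0" if "AE x in lebesgue. (if x \<in> {0..c} then f x else 0) = f' x"
    for f f' :: "real \<Rightarrow> real"
    using that unfolding AE_completion_iff by eventually_elim auto
  have int2: "integrable lborel (\<lambda>z. f' (fst z) * g' (snd z) * (if 0 \<le> snd z \<and> snd z \<le> fst z then 1 else 0))"
    if f': "f' \<in> borel_measurable borel" "integrable lborel f'" and g': "g' \<in> borel_measurable borel" "integrable lborel g'"
    for f' g' :: "real \<Rightarrow> real"
  proof (rule Bochner_Integration.integrable_bound[OF lebesgue_integrable_product[OF f'(2) g'(2)]])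
    show "(\<lambda>z. f' (fst z) * g' (snd z) * (if 0 \<le> snd z \<and> snd z \<le> fst z then 1 else 0)) \<in> borel_measurable lborel"
      unfolding lborel_prod[symmetric] using f'(1) g'(1) by measurable
  qed auto
  let ?A = "\<lambda>z. f' (fst z) * g' (snd z) * ?I z" and ?B = "\<lambda>z. g' (fst z) * f' (snd z) * ?I z"
  have iB: "integrable lebesgue ?B"
    using int2[OF g' f'] integrable_completion[OF borel_measurable_integrable[OF int2[OF g' f']]] by simp
  have "(LINT s|lebesgue_on {0..c}. g s * (LINT t|lebesgue_on {0..s}. f t)) = (LINT z|lborel. ?B z)"
    using trans[OF g' gae f' fae] key[OF g' f'] by simp
  also have "\<dots> = (LINT z|lebesgue. ?B z)"
    by (rule integral_completion[OF borel_measurable_integrable[OF int2[OF g' f']], symmetric])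
  also have "\<dots> = (LINT z|lebesgue. ?B (snd z, fst z))"
    by (rule lebesgue_integral_swap(2)[OF iB, symmetric])
  also have "\<dots> = (LINT z|lebesgue. f' (fst z) * g' (snd z) * ?J z)"
    by (rule Bochner_Integration.integral_cong) auto
  finally have B: "(LINT s|lebesgue_on {0..c}. g s * (LINT t|lebesgue_on {0..s}. f t))
      = (LINT z|lebesgue. f' (fst z) * g' (snd z) * ?J z)" .
  have iA: "integrable lebesgue ?A"
    using int2[OF f' g'] integrable_completion[OF borel_measurable_integrable[OF int2[OF f' g']]] by simp
  have A: "(LINT s|lebesgue_on {0..c}. f s * (LINT t|lebesgue_on {0..s}. g t)) = (LINT z|lebesgue. ?A z)"
    using trans[OF f' fae g' gae] key[OF f' g'] integral_completion[OF borel_measurable_integrable[OF int2[OF f' g']]]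
    by simp
  have iB': "integrable lebesgue (\<lambda>z. f' (fst z) * g' (snd z) * ?J z)"
    using lebesgue_integral_swap(1)[OF iB] by (simp add: mult.commute mult.left_commute)
  have ip: "integrable lborel (\<lambda>z. f' (fst z) * g' (snd z))"
    by (rule lebesgue_integrable_product[OF f'(2) g'(2)])
  have "(LINT z|lebesgue. ?A z) + (LINT z|lebesgue. f' (fst z) * g' (snd z) * ?J z)
      = (LINT z|lebesgue. ?A z + f' (fst z) * g' (snd z) * ?J z)"
    using iA iB' by simp
  also have "\<dots> = (LINT z|lebesgue_on UNIV. ?A z + f' (fst z) * g' (snd z) * ?J z)"
    unfolding lebesgue_on_UNIV_eq ..
  also have "\<dots> = (LINT z|lebesgue_on UNIV. f' (fst z) * g' (snd z))"
  proof (rule integral_lebesgue_on_cong_AE)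
    have 1: "AE z in lborel. fst z < 0 \<longrightarrow> f' (fst z) = 0" for z :: "real \<times> real"
      using AE_lebesgue_fst[OF AE_completion[OF zero[OF fae]]] unfolding AE_completion_iff .
    have 2: "AE z in lborel. snd z < 0 \<longrightarrow> g' (snd z) = 0" for z :: "real \<times> real"
      using AE_lebesgue_snd[OF AE_completion[OF zero[OF gae]]] unfolding AE_completion_iff .
    \<comment> \<open>The triangles overlap in the diagonal, a null hyperplane.\<close>
    have "negligible {z :: real \<times> real. (1, -1) \<bullet> z = 0}"
      by (rule negligible_hyperplane) (simp add: zero_prod_def)
    then have 3: "AE z in lebesgue. fst z \<noteq> (snd z :: real)"
      unfolding negligible_iff_null_sets by (rule AE_mp[OF AE_not_in]) (auto simp: inner_prod_def)
    show "AE z in lebesgue_on UNIV. ?A z + f' (fst z) * g' (snd z) * ?J z = f' (fst z) * g' (snd z)"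
      unfolding lebesgue_on_UNIV_eq using AE_completion[OF 1] AE_completion[OF 2] 3
      by eventually_elim auto
  qed simp
  also have "\<dots> = (LINT z|(lborel \<Otimes>\<^sub>M lborel). f' (fst z) * g' (snd z))"
    unfolding lebesgue_on_UNIV_eq lborel_prod by (rule integral_completion[OF borel_measurable_integrable[OF ip]])
  also have "\<dots> = (LINT s|lborel. LINT t|lborel. f' s * g' t)"
    using lborel_pair.integral_fst'[of "\<lambda>z. f' (fst z) * g' (snd z)"] ip by (simp add: lborel_prod)
  also have "\<dots> = integral\<^sup>L lborel f' * integral\<^sup>L lborel g'" by simp
  finally have AB: "(LINT z|lebesgue. ?A z) + (LINT z|lebesgue. f' (fst z) * g' (snd z) * ?J z)
      = integral\<^sup>L lborel f' * integral\<^sup>L lborel g'" .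
  have "integral\<^sup>L lborel f' = (LINT s|lebesgue_on {0..c}. f s)"
    if "f' \<in> borel_measurable borel" "AE x in lebesgue. (if x \<in> {0..c} then f x else 0) = f' x" for f f' :: "real \<Rightarrow> real"
    using integral_lebesgue_on_cong_AE[where S = UNIV and f = "\<lambda>x. if x \<in> {0..c} then f x else 0" and g = f'] that
      Lebesgue_Measure.integral_restrict_UNIV[of "{0..c}" f]
    unfolding lebesgue_on_UNIV_eq by (simp add: integral_completion)
  from this[OF f'(1) fae] this[OF g'(1) gae] A B AB
  show "(LINT s|lebesgue_on {0..c}. f s * (LINT t|lebesgue_on {0..s}. g t))
       + (LINT s|lebesgue_on {0..c}. g s * (LINT t|lebesgue_on {0..s}. f t))
       = (LINT s|lebesgue_on {0..c}. f s) * (LINT s|lebesgue_on {0..c}. g s)"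
    by simp
qed

text \<open>The product rule for functions given as a constant plus an indefinite integral, in
  integrated form and hence without derivatives at points. After expansion only the products of
  primitives with densities remain, which is \<open>indefinite_integral_product\<close>.\<close>

lemma absolutely_continuous_product:
  fixes f g :: "real \<Rightarrow> real"
  assumes f: "integrable (lebesgue_on {0..c}) f" and g: "integrable (lebesgue_on {0..c}) g"
  shows "integrable (lebesgue_on {0..c}) (\<lambda>s. (a + (LINT t|lebesgue_on {0..s}. f t)) * g s)"
    and "(LINT s|lebesgue_on {0..c}. (a + (LINT t|lebesgue_on {0..s}. f t)) * g s + f s * (b + (LINT t|lebesgue_on {0..s}. g t)))
      = (a + (LINT t|lebesgue_on {0..c}. f t)) * (b + (LINT t|lebesgue_on {0..c}. g t)) - a * b"
proof -
  note i1 = indefinite_integral_product(1)[OF f g] and i2 = indefinite_integral_product(1)[OF g f]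
  have eq1: "(a + (LINT t|lebesgue_on {0..s}. f t)) * g s = a * g s + g s * (LINT t|lebesgue_on {0..s}. f t)" for s
    by (simp add: algebra_simps)
  show "integrable (lebesgue_on {0..c}) (\<lambda>s. (a + (LINT t|lebesgue_on {0..s}. f t)) * g s)"
    unfolding eq1 using g i2 by simp
  have eq2: "(a + (LINT t|lebesgue_on {0..s}. f t)) * g s + f s * (b + (LINT t|lebesgue_on {0..s}. g t)) =
      (a * g s + g s * (LINT t|lebesgue_on {0..s}. f t)) + (b * f s + f s * (LINT t|lebesgue_on {0..s}. g t))" for s
    by (simp add: algebra_simps)
  show "(LINT s|lebesgue_on {0..c}. (a + (LINT t|lebesgue_on {0..s}. f t)) * g s + f s * (b + (LINT t|lebesgue_on {0..s}. g t)))
      = (a + (LINT t|lebesgue_on {0..c}. f t)) * (b + (LINT t|lebesgue_on {0..c}. g t)) - a * b"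
    unfolding eq2 using f g i1 i2 indefinite_integral_product(2)[OF f g] by (simp add: algebra_simps)
qed

section \<open>Bumps, plateaus and vertical differentiation\<close>

text \<open>If the bump has integral 0, its antiderivative vanishes on both sides of the same
  interval. In this way bumps of mean zero become derivatives of test functions.\<close>

lemma bump_antiderivative:
  fixes \<rho> :: "real \<Rightarrow> real"
  assumes \<rho>: "smooth \<rho>" and 0: "\<And>s. s < a \<or> b < s \<Longrightarrow> \<rho> s = 0" and "a \<le> b"
  obtains P where "smooth P" "\<And>s. (P has_real_derivative \<rho> s) (at s)" "\<And>s. s \<le> a \<Longrightarrow> P s = 0"
    "\<And>s. b \<le> s \<Longrightarrow> P s = integral\<^sup>L lebesgue \<rho>"
proof
  \<comment> \<open>Starting one unit to the left of the support makes every s \<ge> a an interior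
    point of the interval of integration, so that the derivative there is two-sided.\<close>
  define P where "P s = integral {a - 1..s} \<rho>" for s
  have cont: "continuous_on S \<rho>" for S by (rule smooth_continuous_on[OF \<rho>])
  show d: "(P has_real_derivative \<rho> s) (at s)" for s
  proof (cases "s < a")
    case True
    have "P t = 0" if "t < a" for t
    proof -
      have "integral {a - 1..t} \<rho> = integral {a - 1..t} (\<lambda>_. 0)"
        by (rule Henstock_Kurzweil_Integration.integral_cong) (use 0 that in auto)
      then show ?thesis by (simp add: P_def)
    qed
    then have "((\<lambda>s. 0) has_real_derivative \<rho> s) (at s) \<and> (\<forall>t\<in>{..<a}. 0 = P t)"
      using 0[of s] True by simp
    then show ?thesis
      using has_field_derivative_transform_within_open[of "\<lambda>s. 0" "\<rho> s" s "{..<a}" P] True by auto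
  next
    case False
    have "((\<lambda>x. integral {a - 1..x} \<rho>) has_real_derivative \<rho> s) (at s within {a - 1..s + 1})"
      by (rule integral_has_real_derivative[OF cont]) (use False in auto)
    moreover have "at s within {a - 1..s + 1} = at s"
      by (rule at_within_interior) (use False in \<open>auto simp: interior_atLeastAtMost_real\<close>)
    ultimately show ?thesis by (simp add: P_def[abs_def])
  qed
  show "smooth P" by (rule smooth_antiderivative[OF \<rho> d])
  show "P s = 0" if "s \<le> a" for s
  proof -
    have "integral {a - 1..s} \<rho> = integral {a - 1..s} (\<lambda>_. 0)"
    proof (rule integral_spike[of "{a}"])
      show "0 = \<rho> t" if "t \<in> {a - 1..s} - {a}" for t
        using that \<open>s \<le> a\<close> 0[of t] by auto
    qed auto
    then show ?thesis by (simp add: P_def)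
  qed
  show "P s = integral\<^sup>L lebesgue \<rho>" if "b \<le> s" for s
  proof -
    have i: "integrable (lebesgue_on {a - 1..s}) \<rho>"
      by (rule continuous_integrable_lebesgue_on_Icc[OF cont])
    have "P s = integral\<^sup>L (lebesgue_on {a - 1..s}) \<rho>"
      unfolding P_def by (rule integral_unique[OF has_integral_integral_lebesgue_on[OF i]]) simp
    also have "\<dots> = integral\<^sup>L (lebesgue_on UNIV) \<rho>"
      by (rule integral_lebesgue_on_eq_0_outside(1)[symmetric]) (use 0 that in auto)
    finally show ?thesis by (simp add: lebesgue_on_UNIV_eq)
  qed
qed

lemma vertical_derivative:
  fixes \<phi> :: "R3 \<Rightarrow> real"
  assumes "smooth \<phi>"
  shows "((\<lambda>s. \<phi> (z', s)) has_real_derivative pderiv_at e3 \<phi> (z', s)) (at s)"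
proof -
  have "linear (\<lambda>s. (0 :: R2, s :: real))" by (auto intro!: linearI)
  from pderiv_at_compose_affine[OF _ this, of \<phi> s "(z', 0)" 1] smooth_has_real_derivative[OF smooth_compose_affine[OF assms this, of "(z', 0)"], of s]
  show ?thesis using smooth_differentiable[OF assms] by (simp add: e3_def)
qed

lemma vertical_FTC:
  fixes \<phi> :: "R3 \<Rightarrow> real"
  assumes "smooth \<phi>" "0 \<le> s"
  shows "\<phi> (z', s) = \<phi> (z', 0) + (LINT t|lebesgue_on {0..s}. pderiv_at e3 \<phi> (z', t))"
    and "integrable (lebesgue_on {0..s}) (\<lambda>t. pderiv_at e3 \<phi> (z', t))"
proof -
  have "continuous_on {0..s} (\<lambda>t. pderiv_at e3 \<phi> (z', t))"
    by (rule continuous_on_compose2[OF smooth_continuous_on[OF smooth_pderiv_at[OF assms(1)], of UNIV]])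
      (auto intro!: continuous_intros)
  then show i: "integrable (lebesgue_on {0..s}) (\<lambda>t. pderiv_at e3 \<phi> (z', t))"
    by (rule continuous_integrable_lebesgue_on_Icc)
  have "((\<lambda>t. pderiv_at e3 \<phi> (z', t)) has_integral (\<phi> (z', s) - \<phi> (z', 0))) {0..s}"
    by (rule fundamental_theorem_of_calculus[OF assms(2)])
      (auto intro!: has_field_derivative_at_within vertical_derivative[OF assms(1)]
        simp: has_real_derivative_iff_has_vector_derivative[symmetric])
  moreover have "((\<lambda>t. pderiv_at e3 \<phi> (z', t)) has_integral (LINT t|lebesgue_on {0..s}. pderiv_at e3 \<phi> (z', t))) {0..s}"
    by (rule has_integral_integral_lebesgue_on[OF i]) simp
  ultimately have "\<phi> (z', s) - \<phi> (z', 0) = (LINT t|lebesgue_on {0..s}. pderiv_at e3 \<phi> (z', t))"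
    by (rule has_integral_unique)
  then show "\<phi> (z', s) = \<phi> (z', 0) + (LINT t|lebesgue_on {0..s}. pderiv_at e3 \<phi> (z', t))" by simp
qed

lemma integrable_mult_bounded:
  fixes f m :: "'a::euclidean_space \<Rightarrow> real"
  assumes "integrable (lebesgue_on S) f" "m \<in> borel_measurable (lebesgue_on S)" "\<And>x. x \<in> S \<Longrightarrow> \<bar>m x\<bar> \<le> C"
  shows "integrable (lebesgue_on S) (\<lambda>x. f x * m x)"
proof (rule Bochner_Integration.integrable_bound)
  show "integrable (lebesgue_on S) (\<lambda>x. \<bar>C\<bar> * f x)" using assms(1) by simp
  show "(\<lambda>x. f x * m x) \<in> borel_measurable (lebesgue_on S)"
    using assms by (intro borel_measurable_times) auto
  have "\<bar>f x * m x\<bar> \<le> \<bar>\<bar>C\<bar> * f x\<bar>" if "x \<in> S" for x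
    using assms(3)[OF that] mult_left_mono[of "\<bar>m x\<bar>" "\<bar>C\<bar>" "\<bar>f x\<bar>"] by (simp add: abs_mult mult.commute)
  then show "AE x in lebesgue_on S. norm (f x * m x) \<le> norm (\<bar>C\<bar> * f x)"
    by (intro AE_I2) simp
qed

lemma integrable_mult_smooth:
  fixes f m :: "'a::euclidean_space \<Rightarrow> real"
  assumes "integrable (lebesgue_on S) f" "smooth m" "bounded S"
  shows "integrable (lebesgue_on S) (\<lambda>x. f x * m x)"
proof -
  obtain C where "\<And>x. x \<in> S \<Longrightarrow> \<bar>m x\<bar> \<le> C" using smooth_bounded_on[OF assms(2,3)] by blast
  then show ?thesis using assms smooth_measurable_lebesgue_on by (intro integrable_mult_bounded) auto
qed

lemma integrable_L1_loc:
  fixes f :: "'a::euclidean_space \<Rightarrow> real"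
  assumes "integrable (lebesgue_on S) f" "S \<in> sets lebesgue"
  shows "f \<in> L1_loc S"
  using assms integrable_lebesgue_on_subset[OF assms(1)] unfolding L1_loc_def
  by (auto simp: compact_imp_closed)

lemma unit_bump:
  assumes "a < (b :: real)"
  obtains \<rho> where "smooth \<rho>" "\<And>s. 0 \<le> \<rho> s" "\<And>s. s < a \<or> b < s \<Longrightarrow> \<rho> s = 0" "integral\<^sup>L lebesgue \<rho> = 1"
    "integrable lebesgue \<rho>"
proof -
  let ?b = "box_bump a b 1"
  have out: "?b s = 0" if "s \<notin> {a..b}" for s
    using that box_subset_cbox[of a b] by (intro box_bump_eq_0) auto
  have "integrable (lebesgue_on {a..b}) ?b"
    by (intro continuous_integrable_lebesgue_on_Icc smooth_continuous_on smooth_box_bump)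
  then have int: "integrable lebesgue ?b"
    using integral_lebesgue_on_eq_0_outside(2)[of "{a..b}" UNIV ?b] out by (simp add: lebesgue_on_UNIV_eq)
  have "integral\<^sup>L lebesgue ?b \<noteq> 0"
  proof
    assume "integral\<^sup>L lebesgue ?b = 0"
    then have "AE s in lebesgue. ?b s = 0"
      by (subst (asm) integral_nonneg_eq_0_iff_AE[OF int]) (simp_all add: box_bump_nonneg)
    moreover have "?b s \<noteq> 0" if "s \<in> box a b" for s
      using that by (simp add: box_bump_def smooth_step_eq_0_iff)
    ultimately have "AE s in lebesgue. s \<notin> box a b"
      by (rule_tac eventually_mono) auto
    then have "box a b \<in> null_sets lebesgue"
      by (subst AE_iff_null_sets) auto
    then have "negligible (box a b)" by (simp add: negligible_iff_null_sets)
    then have "box a b = {}" by (simp add: negligible_interval del: box_real)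
    then show False using assms by simp
  qed
  then have pos: "integral\<^sup>L lebesgue ?b > 0"
    using Bochner_Integration.integral_nonneg[of lebesgue ?b, OF box_bump_nonneg] by (simp add: less_le)
  show ?thesis
  proof (rule that[of "\<lambda>s. inverse (integral\<^sup>L lebesgue ?b) * ?b s"])
    show "smooth (\<lambda>s. inverse (integral\<^sup>L lebesgue ?b) * ?b s)"
      by (intro smooth_mult smooth_const smooth_box_bump)
  qed (use pos box_bump_nonneg[of a b 1] out int in \<open>auto intro!: mult_nonneg_nonneg simp: less_imp_le\<close>)
qed

text \<open>A smooth rise from 0 to 1 between a and b, minus its translate by c: the function is 1
  from b to c and has returned to 0 from b + c onwards.\<close>

lemma smooth_plateau:
  assumes "0 < a" "a < b" "b < (c :: real)"
  obtains \<xi> d where "smooth \<xi>" "\<And>s. s \<le> a \<Longrightarrow> \<xi> s = 0" "\<And>s. b \<le> s \<Longrightarrow> s \<le> c \<Longrightarrow> \<xi> s = 1"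
    "\<And>s. d \<le> s \<Longrightarrow> \<xi> s = 0"
proof -
  obtain \<rho> where \<rho>: "smooth \<rho>" "\<And>s. s < a \<or> b < s \<Longrightarrow> \<rho> s = 0" "integral\<^sup>L lebesgue \<rho> = 1"
    using unit_bump[OF assms(2)] by metis
  obtain P where P: "smooth P" "\<And>s. s \<le> a \<Longrightarrow> P s = 0" "\<And>s. b \<le> s \<Longrightarrow> P s = 1"
    using bump_antiderivative[OF \<rho>(1,2)] assms \<rho>(3) by (metis less_imp_le)
  show ?thesis
  proof (rule that[of "\<lambda>s. P s - P (s - c)" "b + c"])
    have "smooth (\<lambda>s. P (s + (- c)))"
      by (rule smooth_compose_affine[OF P(1)]) (auto intro: linearI)
    then show "smooth (\<lambda>s. P s - P (s - c))" using P(1) by (intro smooth_diff) auto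
    show "\<And>s. s \<le> a \<Longrightarrow> P s - P (s - c) = 0" using P assms by auto
    show "\<And>s. b \<le> s \<Longrightarrow> s \<le> c \<Longrightarrow> P s - P (s - c) = 1" using P assms by auto
    show "\<And>s. b + c \<le> s \<Longrightarrow> P s - P (s - c) = 0" using P(3) assms by auto
  qed
qed

lemma smooth_fst_snd:
  fixes \<eta> :: "'a::euclidean_space \<Rightarrow> real" and \<zeta> :: "'b::euclidean_space \<Rightarrow> real"
  assumes "smooth \<eta>" "smooth \<zeta>"
  shows "smooth (\<lambda>z. \<eta> (fst z) * \<zeta> (snd z))"
  by (intro smooth_mult smooth_compose_linear[OF assms(1) linear_fst] smooth_compose_linear[OF assms(2) linear_snd])

lemma pderiv_at_fst_snd:
  fixes \<eta> :: "'a::euclidean_space \<Rightarrow> real" and \<zeta> :: "'b::euclidean_space \<Rightarrow> real"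
  assumes "smooth \<eta>" "smooth \<zeta>"
  shows "pderiv_at v (\<lambda>z. \<eta> (fst z) * \<zeta> (snd z)) z
    = pderiv_at (fst v) \<eta> (fst z) * \<zeta> (snd z) + \<eta> (fst z) * pderiv_at (snd v) \<zeta> (snd z)"
proof -
  have s: "smooth (\<lambda>z :: 'a \<times> 'b. \<eta> (fst z))" "smooth (\<lambda>z :: 'a \<times> 'b. \<zeta> (snd z))"
    by (rule smooth_compose_linear[OF assms(1) linear_fst] smooth_compose_linear[OF assms(2) linear_snd])+
  have "pderiv_at v (\<lambda>z :: 'a \<times> 'b. \<eta> (fst z)) z = pderiv_at (fst v) \<eta> (fst z)"
    "pderiv_at v (\<lambda>z :: 'a \<times> 'b. \<zeta> (snd z)) z = pderiv_at (snd v) \<zeta> (snd z)"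
    using pderiv_at_compose_affine[OF _ linear_fst, of \<eta> z 0 v] pderiv_at_compose_affine[OF _ linear_snd, of \<zeta> z 0 v]
      smooth_differentiable[OF assms(1)] smooth_differentiable[OF assms(2)] by auto
  then show ?thesis
    using pderiv_at_mult[OF smooth_differentiable[OF s(1)] smooth_differentiable[OF s(2)], of v z] by simp
qed

lemma pderiv_at_0: "smooth f \<Longrightarrow> pderiv_at 0 f x = 0"
  using linear_0[OF has_derivative_linear[OF smooth_has_derivative]] by blast

subsection \<open>Column domains\<close>

text \<open>The rescaled domain and each thin domain are both instances, so every fact on columns,
  traces and fluxes is proved once and used at both scales.\<close>

locale column_domain =
  fixes \<omega> :: "R2 set" and h :: "R2 \<Rightarrow> real" and hmin hmax :: real
  assumes open_base: "open \<omega>" and bounded_base: "bounded \<omega>" and continuous_height: "continuous_on \<omega> h"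
    and hmin_pos: "0 < hmin" and hmin_le: "z' \<in> \<omega> \<Longrightarrow> hmin \<le> h z'" and less_hmax: "z' \<in> \<omega> \<Longrightarrow> h z' < hmax"
begin

abbreviation \<Omega> :: "R3 set" where "\<Omega> \<equiv> dom_under \<omega> h"

text \<open>Test functions on this set are those allowed to reach the bottom of the domain.\<close>

definition below_top :: "R3 set" where
  "below_top = {z. fst z \<in> \<omega> \<and> snd z < h (fst z)}"

definition col_prim :: "(R3 \<Rightarrow> real) \<Rightarrow> R3 \<Rightarrow> real" where
  "col_prim g z = (LINT t|lebesgue_on {0..snd z}. g (fst z, t))"

text \<open>Absolute continuity along vertical lines, in integral form: \<open>c\<close> is the
  trace on the bottom and \<open>g\<close> the vertical weak derivative.\<close>

definition has_column_rep :: "(R3 \<Rightarrow> real) \<Rightarrow> (R2 \<Rightarrow> real) \<Rightarrow> (R3 \<Rightarrow> real) \<Rightarrow> bool" where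
  "has_column_rep f c g \<longleftrightarrow> integrable (lebesgue_on \<Omega>) g \<and> integrable (lebesgue_on \<omega>) c \<and>
     (AE z in lebesgue_on \<Omega>. f z = c (fst z) + col_prim g z)"

text \<open>The trace on the top, that is the value of the absolutely continuous representative at
  the upper end of the column.\<close>

definition col_top :: "(R2 \<Rightarrow> real) \<Rightarrow> (R3 \<Rightarrow> real) \<Rightarrow> R2 \<Rightarrow> real" where
  "col_top c g z' = c z' + col_prim g (z', h z')"

lemma mem_dom: "z \<in> \<Omega> \<longleftrightarrow> fst z \<in> \<omega> \<and> 0 < snd z \<and> snd z < h (fst z)"
  by (auto simp: dom_under_def)

lemma open_below_top: "open below_top"
proof -
  have "continuous_on (fst -` \<omega>) (\<lambda>z. h (fst z) - snd z)"
    by (intro continuous_intros continuous_on_compose2[OF continuous_height]) auto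
  moreover have "open (fst -` \<omega> :: R3 set)" by (intro open_vimage_fst open_base)
  ultimately have "open (fst -` \<omega> \<inter> (\<lambda>z. h (fst z) - snd z) -` {0<..})"
    by (rule continuous_open_preimage) simp
  moreover have "fst -` \<omega> \<inter> (\<lambda>z. h (fst z) - snd z) -` {0<..} = below_top"
    by (auto simp: below_top_def)
  ultimately show ?thesis by simp
qed

lemma open_dom: "open \<Omega>"
proof -
  have "\<Omega> = below_top \<inter> snd -` {0<..}" by (auto simp: below_top_def mem_dom)
  then show ?thesis using open_below_top by (simp add: open_Int open_vimage_snd)
qed

lemma dom_subset_below_top: "\<Omega> \<subseteq> below_top"
  by (auto simp: below_top_def mem_dom)

lemma bounded_dom: "bounded \<Omega>"
proof (rule bounded_subset)
  show "bounded (\<omega> \<times> {0..hmax})" by (intro bounded_Times bounded_base) auto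
  show "\<Omega> \<subseteq> \<omega> \<times> {0..hmax}" using less_hmax by (fastforce simp: mem_dom)
qed

lemma lebesgue_dom [simp]: "\<Omega> \<in> sets lebesgue" "\<omega> \<in> sets lebesgue"
  using open_dom open_base by auto

lemma height_pos: "z' \<in> \<omega> \<Longrightarrow> 0 < h z'"
  using hmin_pos hmin_le by fastforce

lemma column_AE:
  assumes "AE z in lebesgue_on \<Omega>. P z"
  shows "AE z' in lebesgue_on \<omega>. AE s in lebesgue_on {0..h z'}. P (z', s)"
proof -
  have "AE z in lebesgue. z \<in> \<Omega> \<longrightarrow> P z" using assms by (simp add: AE_lebesgue_on_iff)
  then have "AE z' in lebesgue. AE s in lebesgue. (z', s) \<in> \<Omega> \<longrightarrow> P (z', s)"
    by (rule AE_lebesgue_Pair)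
  then have "AE z' in lebesgue. z' \<in> \<omega> \<longrightarrow> (AE s in lebesgue_on {0..h z'}. P (z', s))"
  proof eventually_elim
    case (elim z')
    show ?case
    proof
      assume z': "z' \<in> \<omega>"
      have "negligible {0, h z'}" by simp
      then have "AE s in lebesgue. s \<notin> {0, h z'}" unfolding negligible_iff_null_sets by (rule AE_not_in)
      with elim have "AE s in lebesgue. s \<in> {0..h z'} \<longrightarrow> P (z', s)"
        by eventually_elim (use z' in \<open>auto simp: mem_dom\<close>)
      then show "AE s in lebesgue_on {0..h z'}. P (z', s)" by (simp add: AE_lebesgue_on_iff)
    qed
  qed
  then show ?thesis by (simp add: AE_lebesgue_on_iff)
qed

lemma column_AE_fst:
  assumes "AE z' in lebesgue_on \<omega>. Q z'"
  shows "AE z in lebesgue_on \<Omega>. Q (fst z)"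
proof -
  have "AE z' in lebesgue. z' \<in> \<omega> \<longrightarrow> Q z'" using assms by (simp add: AE_lebesgue_on_iff)
  then have "AE z :: R3 in lebesgue. fst z \<in> \<omega> \<longrightarrow> Q (fst z)" by (rule AE_lebesgue_fst)
  then have "AE z in lebesgue. z \<in> \<Omega> \<longrightarrow> Q (fst z)"
    by eventually_elim (auto simp: mem_dom)
  then show ?thesis by (simp add: AE_lebesgue_on_iff)
qed

lemma column_Fubini:
  fixes f :: "R3 \<Rightarrow> real"
  assumes "integrable (lebesgue_on \<Omega>) f"
  shows "AE z' in lebesgue_on \<omega>. integrable (lebesgue_on {0..h z'}) (\<lambda>s. f (z', s))"
    and "integrable (lebesgue_on \<omega>) (\<lambda>z'. LINT s|lebesgue_on {0..h z'}. f (z', s))"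
    and "integral\<^sup>L (lebesgue_on \<Omega>) f = (LINT z'|lebesgue_on \<omega>. LINT s|lebesgue_on {0..h z'}. f (z', s))"
proof -
  define F where "F z = (if z \<in> \<Omega> then f z else 0)" for z
  have F: "integrable lebesgue F"
    unfolding F_def by (rule iffD2[OF Lebesgue_Measure.integrable_restrict_UNIV[OF lebesgue_dom(1)] assms])
  have slice: "(\<lambda>s. F (z', s)) = (if z' \<in> \<omega> then (\<lambda>s. if 0 < s \<and> s < h z' then f (z', s) else 0) else (\<lambda>s. 0))" for z'
    by (auto simp: F_def mem_dom fun_eq_iff)
  have "AE z' in lebesgue. integrable lebesgue (\<lambda>s. F (z', s))" by (rule lebesgue_Fubini(1)[OF F])
  then have "AE z' in lebesgue. z' \<in> \<omega> \<longrightarrow> integrable (lebesgue_on {0..h z'}) (\<lambda>s. f (z', s))"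
    by eventually_elim (auto simp: slice lebesgue_on_Icc_Ioo(2))
  then show "AE z' in lebesgue_on \<omega>. integrable (lebesgue_on {0..h z'}) (\<lambda>s. f (z', s))"
    by (simp add: AE_lebesgue_on_iff)
  have J: "(LINT s|lebesgue. F (z', s)) = (if z' \<in> \<omega> then (LINT s|lebesgue_on {0..h z'}. f (z', s)) else 0)" for z'
    by (simp add: slice lebesgue_on_Icc_Ioo(1))
  have "integrable lebesgue (\<lambda>z'. if z' \<in> \<omega> then (LINT s|lebesgue_on {0..h z'}. f (z', s)) else 0)"
    using lebesgue_Fubini(2)[OF F] unfolding J .
  then show "integrable (lebesgue_on \<omega>) (\<lambda>z'. LINT s|lebesgue_on {0..h z'}. f (z', s))"
    by (rule iffD1[OF Lebesgue_Measure.integrable_restrict_UNIV[OF lebesgue_dom(2)]])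
  have "integral\<^sup>L (lebesgue_on \<Omega>) f = integral\<^sup>L lebesgue F"
    unfolding F_def by (rule Lebesgue_Measure.integral_restrict_UNIV[symmetric]) simp
  also have "\<dots> = (LINT z'|lebesgue. (if z' \<in> \<omega> then (LINT s|lebesgue_on {0..h z'}. f (z', s)) else 0))"
    using lebesgue_Fubini(3)[OF F] unfolding J .
  also have "\<dots> = (LINT z'|lebesgue_on \<omega>. LINT s|lebesgue_on {0..h z'}. f (z', s))"
    by (rule Lebesgue_Measure.integral_restrict_UNIV) simp
  finally show "integral\<^sup>L (lebesgue_on \<Omega>) f = (LINT z'|lebesgue_on \<omega>. LINT s|lebesgue_on {0..h z'}. f (z', s))" .
qed

lemma fst_integrable:
  fixes A :: "R2 \<Rightarrow> real"
  assumes "integrable (lebesgue_on \<omega>) A"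
  shows "integrable (lebesgue_on \<Omega>) (\<lambda>z. A (fst z))"
proof -
  have "integrable lebesgue (\<lambda>z'. if z' \<in> \<omega> then A z' else 0)"
    by (rule iffD2[OF Lebesgue_Measure.integrable_restrict_UNIV[OF lebesgue_dom(2)] assms])
  then obtain A' where A': "A' \<in> borel_measurable borel" "integrable lborel A'"
    and ae: "AE z' in lebesgue. (if z' \<in> \<omega> then A z' else 0) = A' z'"
    using lebesgue_integrable_borel by blast
  have "integrable lborel (\<lambda>s. indicator {0..hmax} s :: real)"
    using emeasure_bounded_finite[of "{0..hmax}"] by (intro integrable_real_indicator) auto
  from lebesgue_integrable_product[OF A'(2) this]
  have i: "integrable lborel (\<lambda>z. A' (fst z) * indicator {0..hmax} (snd z) :: real)" .
  have "integrable (lebesgue_on UNIV) (\<lambda>z. A' (fst z) * indicator {0..hmax} (snd z) :: real)"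
    unfolding lebesgue_on_UNIV_eq using integrable_completion[OF borel_measurable_integrable[OF i]] i by blast
  then have "integrable (lebesgue_on \<Omega>) (\<lambda>z. A' (fst z) * indicator {0..hmax} (snd z))"
    by (rule integrable_lebesgue_on_subset) auto
  moreover have "AE z in lebesgue_on \<Omega>. A' (fst z) * indicator {0..hmax} (snd z) = A (fst z)"
  proof -
    have "AE z :: R3 in lebesgue. (if fst z \<in> \<omega> then A (fst z) else 0) = A' (fst z)"
      by (rule AE_lebesgue_fst[OF ae])
    then have "AE z :: R3 in lebesgue. z \<in> \<Omega> \<longrightarrow> A' (fst z) * indicator {0..hmax} (snd z) = A (fst z)"
    proof eventually_elim
      case (elim z)
      then show ?case using less_hmax[of "fst z"] by (auto simp: mem_dom)
    qed
    then show ?thesis by (simp add: AE_lebesgue_on_iff)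
  qed
  ultimately show ?thesis by (rule integrable_lebesgue_on_cong_AE) simp
qed

text \<open>Joint measurability in base point and height is the issue. The primitive of a Borel
  representative is a parameter integral, hence Borel, and it coincides with
  \<open>col_prim g\<close> at almost every point.\<close>

lemma col_prim_integrable:
  assumes g: "integrable (lebesgue_on \<Omega>) g"
  shows "integrable (lebesgue_on \<Omega>) (col_prim g)"
proof -
  have "integrable lebesgue (\<lambda>z. if z \<in> \<Omega> then g z else 0)"
    by (rule iffD2[OF Lebesgue_Measure.integrable_restrict_UNIV[OF lebesgue_dom(1)] g])
  then obtain g' where g': "g' \<in> borel_measurable borel" "integrable lborel g'"
    and ae: "AE z in lebesgue. (if z \<in> \<Omega> then g z else 0) = g' z"
    using lebesgue_integrable_borel by blast
  define Q where "Q z = (LINT t|lborel. g' (fst z, t) * (if 0 \<le> t \<and> t \<le> snd z then 1 else 0))" for z :: R3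
  have "Q \<in> borel_measurable lborel"
    unfolding Q_def
  proof (rule lborel.borel_measurable_lebesgue_integral)
    have "(\<lambda>p :: R3 \<times> real. (fst (fst p), snd p)) \<in> borel_measurable borel"
      by (intro borel_measurable_continuous_onI continuous_intros)
    from measurable_compose[OF this g'(1)]
    have "(\<lambda>p :: R3 \<times> real. g' (fst (fst p), snd p)) \<in> borel_measurable (lborel \<Otimes>\<^sub>M lborel)"
      by (simp add: lborel_prod)
    moreover have "(\<lambda>p :: R3 \<times> real. if 0 \<le> snd p \<and> snd p \<le> snd (fst p) then 1 else 0 :: real) \<in> borel_measurable (lborel \<Otimes>\<^sub>M lborel)"
    proof -
      have "closed {p :: R3 \<times> real. 0 \<le> snd p \<and> snd p \<le> snd (fst p)}"
        by (intro closed_Collect_conj closed_Collect_le continuous_intros)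
      then have "indicator {p :: R3 \<times> real. 0 \<le> snd p \<and> snd p \<le> snd (fst p)} \<in> (borel_measurable borel :: (R3 \<times> real \<Rightarrow> real) set)"
        by auto
      moreover have "indicator {p :: R3 \<times> real. 0 \<le> snd p \<and> snd p \<le> snd (fst p)} = (\<lambda>p. if 0 \<le> snd p \<and> snd p \<le> snd (fst p) then 1 else 0 :: real)"
        by (auto simp: indicator_def fun_eq_iff)
      ultimately show ?thesis by (simp add: lborel_prod)
    qed
    ultimately have "(\<lambda>p :: R3 \<times> real. g' (fst (fst p), snd p) * (if 0 \<le> snd p \<and> snd p \<le> snd (fst p) then 1 else 0)) \<in> borel_measurable (lborel \<Otimes>\<^sub>M lborel)"
      by (rule borel_measurable_times)
    then show "(\<lambda>(z :: R3, t). g' (fst z, t) * (if 0 \<le> t \<and> t \<le> snd z then 1 else 0)) \<in> borel_measurable (lborel \<Otimes>\<^sub>M lborel)"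
      by (simp add: case_prod_beta')
  qed
  then have Qm: "Q \<in> borel_measurable (lebesgue_on \<Omega>)" by (intro borel_measurable_lebesgue_on) simp
  have "AE z' in lebesgue. AE t in lebesgue. (if (z', t) \<in> \<Omega> then g (z', t) else 0) = g' (z', t)"
    by (rule AE_lebesgue_Pair[OF ae])
  then have ae2: "AE z :: R3 in lebesgue. AE t in lebesgue. (if (fst z, t) \<in> \<Omega> then g (fst z, t) else 0) = g' (fst z, t)"
    by (rule AE_lebesgue_fst)
  have eq: "Q z = col_prim g z" if z: "z \<in> \<Omega>"
    and ae: "AE t in lebesgue. (if (fst z, t) \<in> \<Omega> then g (fst z, t) else 0) = g' (fst z, t)" for z
  proof -
    have "negligible {0 :: real}" by simp
    then have "AE t in lebesgue. t \<notin> {0 :: real}" unfolding negligible_iff_null_sets by (rule AE_not_in)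
    with ae have ae': "AE t in lebesgue_on UNIV. g' (fst z, t) * (if 0 \<le> t \<and> t \<le> snd z then 1 else 0)
        = (if t \<in> {0..snd z} then g (fst z, t) else 0)"
      unfolding lebesgue_on_UNIV_eq by eventually_elim (use z in \<open>auto simp: mem_dom split: if_splits\<close>)
    have m: "(\<lambda>t. g' (fst z, t) * (if 0 \<le> t \<and> t \<le> snd z then 1 else 0)) \<in> borel_measurable borel"
    proof (rule borel_measurable_times)
      show "(\<lambda>t. g' (fst z, t)) \<in> borel_measurable borel" by (rule measurable_compose[OF _ g'(1)]) auto
      have "(\<lambda>t. if 0 \<le> t \<and> t \<le> snd z then 1 else 0 :: real) = indicator {0..snd z}"
        by (auto simp: indicator_def fun_eq_iff)
      then show "(\<lambda>t. if 0 \<le> t \<and> t \<le> snd z then 1 else 0 :: real) \<in> borel_measurable borel" by simp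
    qed
    have "Q z = (LINT t|lebesgue_on UNIV. g' (fst z, t) * (if 0 \<le> t \<and> t \<le> snd z then 1 else 0))"
      unfolding Q_def lebesgue_on_UNIV_eq using m by (intro integral_completion[symmetric]) simp
    also have "\<dots> = (LINT t|lebesgue_on UNIV. (if t \<in> {0..snd z} then g (fst z, t) else 0))"
      by (rule integral_lebesgue_on_cong_AE[OF ae']) simp
    also have "\<dots> = col_prim g z"
      unfolding col_prim_def lebesgue_on_UNIV_eq by (rule Lebesgue_Measure.integral_restrict_UNIV) simp
    finally show ?thesis .
  qed
  have "AE z in lebesgue. z \<in> \<Omega> \<longrightarrow> Q z = col_prim g z"
    using ae2 by eventually_elim (use eq in blast)
  then have aeQ: "AE z in lebesgue_on \<Omega>. Q z = col_prim g z"
    by (simp add: AE_lebesgue_on_iff)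
  from borel_measurable_lebesgue_on_cong_AE[OF Qm aeQ]
  have m: "col_prim g \<in> borel_measurable (lebesgue_on \<Omega>)" by simp
  \<comment> \<open>The integral of |g| over the whole column dominates the primitive at every
    height of that column.\<close>
  define A where "A z' = (LINT t|lebesgue_on {0..h z'}. \<bar>g (z', t)\<bar>)" for z'
  have "integrable (lebesgue_on \<omega>) A"
    unfolding A_def using g by (intro column_Fubini(2)) simp
  then have A: "integrable (lebesgue_on \<Omega>) (\<lambda>z. A (fst z))" by (rule fst_integrable)
  have "AE z in lebesgue_on \<Omega>. integrable (lebesgue_on {0..h (fst z)}) (\<lambda>s. g (fst z, s))"
    by (rule column_AE_fst[OF column_Fubini(1)[OF g]])
  moreover have "AE z in lebesgue_on \<Omega>. z \<in> \<Omega>"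
    by (simp add: AE_lebesgue_on_iff)
  ultimately have bd: "AE z in lebesgue_on \<Omega>. norm (col_prim g z) \<le> norm (A (fst z))"
  proof eventually_elim
    case (elim z)
    then have le: "snd z \<le> h (fst z)" by (simp add: mem_dom)
    have i: "integrable (lebesgue_on {0..snd z}) (\<lambda>t. g (fst z, t))"
      by (rule integrable_lebesgue_on_subset[OF elim(1)]) (use le in auto)
    have "\<bar>col_prim g z\<bar> \<le> (LINT t|lebesgue_on {0..snd z}. \<bar>g (fst z, t)\<bar>)"
      unfolding col_prim_def using integral_norm_bound[of "lebesgue_on {0..snd z}" "\<lambda>t. g (fst z, t)"] by simp
    also have "\<dots> \<le> A (fst z)"
      unfolding A_def using elim(1) le by (intro integral_mono_lebesgue_on_AE) auto
    finally show ?case by simp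
  qed
  show ?thesis by (rule Bochner_Integration.integrable_bound[OF A m bd])
qed

lemma has_column_rep_integrable:
  assumes "has_column_rep f c g"
  shows "integrable (lebesgue_on \<Omega>) f"
proof (rule integrable_lebesgue_on_cong_AE)
  show "integrable (lebesgue_on \<Omega>) (\<lambda>z. c (fst z) + col_prim g z)"
    using assms by (auto simp: has_column_rep_def intro: fst_integrable col_prim_integrable)
  show "AE z in lebesgue_on \<Omega>. c (fst z) + col_prim g z = f z"
    using assms unfolding has_column_rep_def by (auto elim: eventually_mono)
qed simp

lemma has_column_rep_smooth:
  assumes "smooth \<phi>"
  shows "has_column_rep \<phi> (\<lambda>z'. \<phi> (z', 0)) (pderiv_at e3 \<phi>)"
    and "0 \<le> s \<Longrightarrow> \<phi> (z', 0) + col_prim (pderiv_at e3 \<phi>) (z', s) = \<phi> (z', s)"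
    and "z' \<in> \<omega> \<Longrightarrow> col_top (\<lambda>z'. \<phi> (z', 0)) (pderiv_at e3 \<phi>) z' = \<phi> (z', h z')"
proof -
  show eq: "0 \<le> s \<Longrightarrow> \<phi> (z', 0) + col_prim (pderiv_at e3 \<phi>) (z', s) = \<phi> (z', s)" for z' s
    using vertical_FTC(1)[OF assms, of s z'] by (simp add: col_prim_def)
  show "col_top (\<lambda>z'. \<phi> (z', 0)) (pderiv_at e3 \<phi>) z' = \<phi> (z', h z')" if "z' \<in> \<omega>"
    using eq[of "h z'" z'] height_pos[OF that] by (simp add: col_top_def)
  have "linear (\<lambda>z' :: R2. (z', 0 :: real))" by (auto intro!: linearI)
  then have "smooth (\<lambda>z'. \<phi> (z', 0))" using smooth_compose_linear[OF assms] by blast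
  moreover have "AE z in lebesgue_on \<Omega>. \<phi> z = \<phi> (fst z, 0) + col_prim (pderiv_at e3 \<phi>) z"
  proof (rule AE_I2)
    fix z assume "z \<in> space (lebesgue_on \<Omega>)"
    then show "\<phi> z = \<phi> (fst z, 0) + col_prim (pderiv_at e3 \<phi>) z"
      using eq[of "snd z" "fst z"] by (simp add: mem_dom)
  qed
  ultimately show "has_column_rep \<phi> (\<lambda>z'. \<phi> (z', 0)) (pderiv_at e3 \<phi>)"
    unfolding has_column_rep_def
    using L2_integrable[OF smooth_L2[OF smooth_pderiv_at[OF assms] lebesgue_dom(1) bounded_dom] lebesgue_dom(1) bounded_dom]
      L2_integrable[OF smooth_L2[OF _ lebesgue_dom(2) bounded_base] lebesgue_dom(2) bounded_base]
    by auto
qed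

text \<open>Fubini reduces the claim to \<open>absolutely_continuous_product\<close> on almost every
  column. Both factors may be rough: with a test function as one factor the formula identifies
  traces, with two solutions it gives the energy identities.\<close>

lemma column_product:
  assumes 1: "has_column_rep f1 c1 g1" and 2: "has_column_rep f2 c2 g2"
    and int: "integrable (lebesgue_on \<Omega>) (\<lambda>z. f1 z * g2 z)" "integrable (lebesgue_on \<Omega>) (\<lambda>z. g1 z * f2 z)"
  shows "(LINT z|lebesgue_on \<Omega>. f1 z * g2 z + g1 z * f2 z)
    = (LINT z'|lebesgue_on \<omega>. col_top c1 g1 z' * col_top c2 g2 z' - c1 z' * c2 z')"
proof -
  have "(LINT z|lebesgue_on \<Omega>. f1 z * g2 z + g1 z * f2 z)
      = (LINT z'|lebesgue_on \<omega>. LINT s|lebesgue_on {0..h z'}. f1 (z', s) * g2 (z', s) + g1 (z', s) * f2 (z', s))"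
    using int by (intro column_Fubini(3)) simp
  also have "\<dots> = (LINT z'|lebesgue_on \<omega>. col_top c1 g1 z' * col_top c2 g2 z' - c1 z' * c2 z')"
  proof (rule integral_lebesgue_on_cong_AE)
    have i: "integrable (lebesgue_on \<Omega>) g1" "integrable (lebesgue_on \<Omega>) g2"
      and ae: "AE z in lebesgue_on \<Omega>. f1 z = c1 (fst z) + col_prim g1 z"
        "AE z in lebesgue_on \<Omega>. f2 z = c2 (fst z) + col_prim g2 z"
      using 1 2 by (auto simp: has_column_rep_def)
    show "AE z' in lebesgue_on \<omega>. (LINT s|lebesgue_on {0..h z'}. f1 (z', s) * g2 (z', s) + g1 (z', s) * f2 (z', s))
        = col_top c1 g1 z' * col_top c2 g2 z' - c1 z' * c2 z'"
      using column_Fubini(1)[OF i(1)] column_Fubini(1)[OF i(2)] column_AE[OF ae(1)] column_AE[OF ae(2)]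
    proof eventually_elim
      case (elim z')
      have "(LINT s|lebesgue_on {0..h z'}. f1 (z', s) * g2 (z', s) + g1 (z', s) * f2 (z', s))
        = (LINT s|lebesgue_on {0..h z'}. (c1 z' + (LINT t|lebesgue_on {0..s}. g1 (z', t))) * g2 (z', s)
            + g1 (z', s) * (c2 z' + (LINT t|lebesgue_on {0..s}. g2 (z', t))))"
        by (rule integral_lebesgue_on_cong_AE, use elim(3,4) in eventually_elim)
          (auto simp: col_prim_def)
      also have "\<dots> = col_top c1 g1 z' * col_top c2 g2 z' - c1 z' * c2 z'"
        unfolding absolutely_continuous_product(2)[OF elim(1,2)] by (simp add: col_top_def col_prim_def)
      finally show ?case .
    qed
  qed simp
  finally show ?thesis .
qed

lemma column_integration_by_parts:
  assumes f: "has_column_rep f c g" and \<phi>: "smooth \<phi>"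
  shows "(LINT z|lebesgue_on \<Omega>. f z * pderiv_at e3 \<phi> z) + (LINT z|lebesgue_on \<Omega>. g z * \<phi> z)
    = (LINT z'|lebesgue_on \<omega>. col_top c g z' * \<phi> (z', h z') - c z' * \<phi> (z', 0))"
proof -
  have i: "integrable (lebesgue_on \<Omega>) (\<lambda>z. f z * pderiv_at e3 \<phi> z)" "integrable (lebesgue_on \<Omega>) (\<lambda>z. g z * \<phi> z)"
    using f has_column_rep_integrable[OF f]
    by (auto intro!: integrable_mult_smooth bounded_dom smooth_pderiv_at \<phi> simp: has_column_rep_def)
  have "(LINT z|lebesgue_on \<Omega>. f z * pderiv_at e3 \<phi> z) + (LINT z|lebesgue_on \<Omega>. g z * \<phi> z)
      = (LINT z|lebesgue_on \<Omega>. f z * pderiv_at e3 \<phi> z + g z * \<phi> z)"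
    using i by simp
  also have "\<dots> = (LINT z'|lebesgue_on \<omega>. col_top c g z' * col_top (\<lambda>z'. \<phi> (z', 0)) (pderiv_at e3 \<phi>) z' - c z' * \<phi> (z', 0))"
    by (rule column_product[OF f has_column_rep_smooth(1)[OF \<phi>] i])
  also have "\<dots> = (LINT z'|lebesgue_on \<omega>. col_top c g z' * \<phi> (z', h z') - c z' * \<phi> (z', 0))"
    by (rule Bochner_Integration.integral_cong) (auto simp: has_column_rep_smooth(3)[OF \<phi>])
  finally show ?thesis .
qed

lemma product_test_function:
  fixes \<zeta> :: "real \<Rightarrow> real"
  assumes "cbox a b \<subseteq> \<omega>" "smooth \<zeta>" "\<And>s. s < lo \<or> hi < s \<Longrightarrow> \<zeta> s = 0" "cbox a b \<times> {lo..hi} \<subseteq> S"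
  shows "(\<lambda>z. box_bump a b n (fst z) * \<zeta> (snd z)) \<in> test_functions S"
proof (rule test_functionsI)
  show "smooth (\<lambda>z. box_bump a b n (fst z) * \<zeta> (snd z))"
    by (intro smooth_fst_snd smooth_box_bump assms)
  show "compact (cbox a b \<times> {lo..hi})" using compact_cbox[of lo hi] by (intro compact_Times compact_cbox) simp
  show "cbox a b \<times> {lo..hi} \<subseteq> S" by fact
  fix z assume "z \<notin> cbox a b \<times> {lo..hi}"
  then have "fst z \<notin> cbox a b \<or> snd z < lo \<or> hi < snd z" by (cases z) auto
  then show "box_bump a b n (fst z) * \<zeta> (snd z) = 0"
    using assms(3) box_bump_eq_0[of "fst z" a b n] box_subset_cbox[of a b] by auto
qed

text \<open>The du Bois-Reymond argument in the vertical variable. The candidate for the constant is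
  the average over the column against one fixed unit bump; any other bump minus its mass times the
  unit bump is the derivative of a test function, so k does not distinguish the two.\<close>

lemma vertically_constant:
  assumes k: "integrable (lebesgue_on \<Omega>) k"
    and 0: "\<And>\<phi>. \<phi> \<in> test_functions \<Omega> \<Longrightarrow> (LINT z|lebesgue_on \<Omega>. k z * pderiv_at e3 \<phi> z) = 0"
  obtains c where "integrable (lebesgue_on \<omega>) c" "AE z in lebesgue_on \<Omega>. k z = c (fst z)"
proof -
  \<comment> \<open>An interval of heights that lies inside every column, whatever its base
    point.\<close>
  define a0 b0 where "a0 = hmin / 4" and "b0 = hmin / 2"
  have ab0: "0 < a0" "a0 < b0" "b0 < hmin" using hmin_pos by (auto simp: a0_def b0_def)
  obtain \<rho> where \<rho>: "smooth \<rho>" "\<And>s. s < a0 \<or> b0 < s \<Longrightarrow> \<rho> s = 0" "integral\<^sup>L lebesgue \<rho> = 1"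
    "integrable lebesgue \<rho>"
    using unit_bump[OF ab0(2)] by metis
  have s\<rho>: "smooth (\<lambda>z :: R3. \<rho> (snd z))" using smooth_compose_linear[OF \<rho>(1) linear_snd] .
  have k\<rho>: "integrable (lebesgue_on \<Omega>) (\<lambda>z. k z * \<rho> (snd z))"
    by (rule integrable_mult_smooth[OF k s\<rho> bounded_dom])
  define c where "c z' = (LINT s|lebesgue_on {0..h z'}. k (z', s) * \<rho> s)" for z'
  have c: "integrable (lebesgue_on \<omega>) c"
    unfolding c_def using column_Fubini(2)[OF k\<rho>] by simp
  have c': "integrable (lebesgue_on \<Omega>) (\<lambda>z. c (fst z))" by (rule fst_integrable[OF c])
  have "AE z in lebesgue_on \<Omega>. k z - c (fst z) = 0"
  proof (rule fundamental_lemma_box_bumps[OF integrable_L1_loc open_dom])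
    show "integrable (lebesgue_on \<Omega>) (\<lambda>z. k z - c (fst z))" using k c' by simp
    fix p q :: R3 and n assume sub: "cbox p q \<subseteq> \<Omega>"
    show "(LINT z|lebesgue_on \<Omega>. (k z - c (fst z)) * box_bump p q n z) = 0"
    proof (cases "cbox p q = {}")
      case True
      then have "box_bump p q n z = 0" for z
        using box_subset_cbox[of p q] by (intro box_bump_eq_0) blast
      then show ?thesis by simp
    next
      case False
      obtain a a3 b b3 where pq: "p = (a, a3)" "q = (b, b3)" by (cases p, cases q)
      have cb: "cbox p q = cbox a b \<times> {a3..b3}" by (simp add: pq cbox_Pair_eq)
      with False have ne: "cbox a b \<noteq> {}" "a3 \<le> b3" by auto
      let ?\<eta> = "box_bump a b n" and ?\<psi> = "box_bump a3 b3 n"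
      have in\<omega>: "cbox a b \<subseteq> \<omega>" and pos: "0 < a3" and lt: "z' \<in> cbox a b \<Longrightarrow> b3 < h z'" for z'
        using sub ne unfolding cb by (fastforce simp: mem_dom subset_iff)+
      have \<psi>0: "?\<psi> s = 0" if "s < a3 \<or> b3 < s" for s
        by (rule box_bump_eq_0) (use that in auto)
      have \<eta>0: "?\<eta> z' = 0" if "z' \<notin> cbox a b" for z'
        by (rule box_bump_eq_0) (use that box_subset_cbox[of a b] in auto)
      have "integrable (lebesgue_on {a3..b3}) ?\<psi>"
        by (intro continuous_integrable_lebesgue_on_Icc smooth_continuous_on smooth_box_bump)
      then have int\<psi>: "integrable lebesgue ?\<psi>"
        using integral_lebesgue_on_eq_0_outside(2)[of "{a3..b3}" UNIV ?\<psi>] \<psi>0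
        by (simp add: lebesgue_on_UNIV_eq not_le)
      \<comment> \<open>Subtracting m times the unit bump makes the vertical profile have mean zero,
        so that its antiderivative P is compactly supported within the columns over the box.\<close>
      define m where "m = integral\<^sup>L lebesgue ?\<psi>"
      define lo hi where "lo = min a3 a0" and "hi = max b3 b0"
      have sm: "smooth (\<lambda>s. ?\<psi> s - m * \<rho> s)"
        by (intro smooth_diff smooth_mult smooth_const smooth_box_bump \<rho>)
      have out: "?\<psi> s - m * \<rho> s = 0" if "s < lo \<or> hi < s" for s
        using that \<psi>0[of s] \<rho>(2)[of s] by (auto simp: lo_def hi_def)
      have int0: "integral\<^sup>L lebesgue (\<lambda>s. ?\<psi> s - m * \<rho> s) = 0"
        using int\<psi> \<rho>(3,4) by (simp add: m_def)
      have "lo \<le> hi" using ne(2) ab0 by (auto simp: lo_def hi_def)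
      from bump_antiderivative[OF sm out this, unfolded int0] obtain P where P: "smooth P" "\<And>s. (P has_real_derivative ?\<psi> s - m * \<rho> s) (at s)"
        "\<And>s. s \<le> lo \<Longrightarrow> P s = 0" "\<And>s. hi \<le> s \<Longrightarrow> P s = 0"
        by blast
      let ?\<phi> = "\<lambda>z :: R3. ?\<eta> (fst z) * P (snd z)"
      have "?\<phi> \<in> test_functions \<Omega>"
      proof (rule product_test_function[OF in\<omega> P(1)])
        show "P s = 0" if "s < lo \<or> hi < s" for s using that P(3,4) by auto
        show "cbox a b \<times> {lo..hi} \<subseteq> \<Omega>"
          using in\<omega> lt pos ab0 hmin_le by (fastforce simp: mem_dom lo_def hi_def)
      qed
      moreover have "pderiv_at e3 ?\<phi> z = ?\<eta> (fst z) * (?\<psi> (snd z) - m * \<rho> (snd z))" for z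
        unfolding pderiv_at_fst_snd[OF smooth_box_bump P(1)]
        by (simp add: pderiv_at_real[OF P(2)] pderiv_at_0[OF smooth_box_bump] e3_def)
      ultimately have "(LINT z|lebesgue_on \<Omega>. k z * (?\<eta> (fst z) * (?\<psi> (snd z) - m * \<rho> (snd z)))) = 0"
        using 0[of ?\<phi>] by simp
      moreover have i1: "integrable (lebesgue_on \<Omega>) (\<lambda>z. k z * (?\<eta> (fst z) * ?\<psi> (snd z)))"
        by (intro integrable_mult_smooth k smooth_fst_snd smooth_box_bump bounded_dom)
      moreover have i2: "integrable (lebesgue_on \<Omega>) (\<lambda>z. k z * (?\<eta> (fst z) * \<rho> (snd z)))"
        by (intro integrable_mult_smooth k smooth_fst_snd smooth_box_bump bounded_dom \<rho>)
      ultimately have e1: "(LINT z|lebesgue_on \<Omega>. k z * (?\<eta> (fst z) * ?\<psi> (snd z)))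
          = m * (LINT z|lebesgue_on \<Omega>. k z * (?\<eta> (fst z) * \<rho> (snd z)))"
        by (simp add: right_diff_distrib mult.left_commute[of _ m])
      have e2: "(LINT z|lebesgue_on \<Omega>. k z * (?\<eta> (fst z) * \<rho> (snd z))) = (LINT z'|lebesgue_on \<omega>. ?\<eta> z' * c z')"
        unfolding column_Fubini(3)[OF i2] c_def integral_mult_right_zero[symmetric] by (simp add: mult_ac)
      have i3: "integrable (lebesgue_on \<Omega>) (\<lambda>z. c (fst z) * (?\<eta> (fst z) * ?\<psi> (snd z)))"
        by (intro integrable_mult_smooth c' smooth_fst_snd smooth_box_bump bounded_dom)
      have "(LINT s|lebesgue_on {0..h z'}. ?\<eta> z' * ?\<psi> s) = ?\<eta> z' * m" for z'
      proof (cases "z' \<in> cbox a b")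
        case True
        have "(LINT s|lebesgue_on {0..h z'}. ?\<psi> s) = integral\<^sup>L (lebesgue_on UNIV) ?\<psi>"
          by (rule integral_lebesgue_on_eq_0_outside(1)[symmetric]) (use \<psi>0 pos lt[OF True] in auto)
        then show ?thesis by (simp add: m_def lebesgue_on_UNIV_eq)
      qed (simp add: \<eta>0)
      then have e3: "(LINT z|lebesgue_on \<Omega>. c (fst z) * (?\<eta> (fst z) * ?\<psi> (snd z))) = m * (LINT z'|lebesgue_on \<omega>. ?\<eta> z' * c z')"
      proof -
        assume *: "(LINT s|lebesgue_on {0..h z'}. ?\<eta> z' * ?\<psi> s) = ?\<eta> z' * m" for z'
        have **: "(LINT s|lebesgue_on {0..h z'}. c z' * (?\<eta> z' * ?\<psi> s)) = m * (?\<eta> z' * c z')" for z'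
          using *[of z'] by (simp only: integral_mult_right_zero) (simp add: mult_ac)
        show ?thesis unfolding column_Fubini(3)[OF i3] fst_conv snd_conv ** by simp
      qed
      have "(LINT z|lebesgue_on \<Omega>. (k z - c (fst z)) * box_bump p q n z)
          = (LINT z|lebesgue_on \<Omega>. k z * (?\<eta> (fst z) * ?\<psi> (snd z)) - c (fst z) * (?\<eta> (fst z) * ?\<psi> (snd z)))"
        by (rule Bochner_Integration.integral_cong) (auto simp: pq box_bump_Pair left_diff_distrib)
      also have "\<dots> = 0" using i1 i3 e1 e2 e3 by simp
      finally show ?thesis .
    qed
  qed auto
  then have "AE z in lebesgue_on \<Omega>. k z = c (fst z)" by eventually_elim simp
  with c show ?thesis by (rule that)
qed

text \<open>The primitive of g satisfies the same identity by integration by parts, so f minus this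
  primitive has vanishing vertical derivative and is a function of the base point.\<close>

lemma has_column_rep_exists:
  assumes f: "integrable (lebesgue_on \<Omega>) f" and g: "integrable (lebesgue_on \<Omega>) g"
    and eq: "\<And>\<phi>. \<phi> \<in> test_functions \<Omega> \<Longrightarrow>
      (LINT z|lebesgue_on \<Omega>. f z * pderiv_at e3 \<phi> z) = - (LINT z|lebesgue_on \<Omega>. g z * \<phi> z)"
  obtains c where "has_column_rep f c g"
proof -
  have p: "has_column_rep (col_prim g) (\<lambda>z'. 0) g" using g by (simp add: has_column_rep_def)
  have k: "integrable (lebesgue_on \<Omega>) (\<lambda>z. f z - col_prim g z)"
    using f col_prim_integrable[OF g] by simp
  have "(LINT z|lebesgue_on \<Omega>. (f z - col_prim g z) * pderiv_at e3 \<phi> z) = 0" if \<phi>: "\<phi> \<in> test_functions \<Omega>" for \<phi>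
  proof -
    have sm: "smooth \<phi>" "smooth (pderiv_at e3 \<phi>)"
      using test_functions_smooth[OF \<phi>] by (auto intro: smooth_pderiv_at)
    have "\<phi> (z', 0) = 0" "\<phi> (z', h z') = 0" for z'
      by (intro test_functions_eq_0[OF \<phi>]; simp add: mem_dom)+
    with column_integration_by_parts[OF p sm(1)] eq[OF \<phi>]
    have "(LINT z|lebesgue_on \<Omega>. f z * pderiv_at e3 \<phi> z) = (LINT z|lebesgue_on \<Omega>. col_prim g z * pderiv_at e3 \<phi> z)"
      by simp
    then show ?thesis
      using integrable_mult_smooth[OF f sm(2) bounded_dom] integrable_mult_smooth[OF col_prim_integrable[OF g] sm(2) bounded_dom]
      by (simp add: left_diff_distrib)
  qed
  from vertically_constant[OF k this] obtain c where c: "integrable (lebesgue_on \<omega>) c"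
    "AE z in lebesgue_on \<Omega>. f z - col_prim g z = c (fst z)" by blast
  have "AE z in lebesgue_on \<Omega>. f z = c (fst z) + col_prim g z"
    using c(2) by eventually_elim simp
  with c g show ?thesis by (intro that[of c]) (auto simp: has_column_rep_def)
qed

lemma has_column_rep_weak_deriv:
  assumes "has_column_rep f c g"
  shows "has_weak_deriv \<Omega> e3 f g"
  unfolding has_weak_deriv_def
proof (intro conjI ballI)
  show "f \<in> L1_loc \<Omega>" "g \<in> L1_loc \<Omega>"
    using assms has_column_rep_integrable[OF assms] by (auto intro!: integrable_L1_loc simp: has_column_rep_def)
  fix \<phi> assume \<phi>: "\<phi> \<in> test_functions \<Omega>"
  have "\<phi> (z', 0) = 0" "\<phi> (z', h z') = 0" for z'
    by (intro test_functions_eq_0[OF \<phi>]; simp add: mem_dom)+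
  with column_integration_by_parts[OF assms test_functions_smooth[OF \<phi>]]
  show "(LINT z|lebesgue_on \<Omega>. f z * pderiv_at e3 \<phi> z) = - (LINT z|lebesgue_on \<Omega>. g z * \<phi> z)" by simp
qed

text \<open>Test functions on \<open>below_top\<close> see the lower end of a column but not the
  upper one, so the boundary term consists of the bottom trace alone and the fundamental lemma on
  the base identifies it.\<close>

lemma column_rep_bottom:
  assumes f: "has_column_rep f c g" and t: "integrable (lebesgue_on \<omega>) t"
    and eq: "\<And>\<phi>. \<phi> \<in> test_functions below_top \<Longrightarrow>
      (LINT z|lebesgue_on \<Omega>. f z * pderiv_at e3 \<phi> z) + (LINT z|lebesgue_on \<Omega>. g z * \<phi> z)
        = - (LINT z'|lebesgue_on \<omega>. t z' * \<phi> (z', 0))"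
  shows "AE z' in lebesgue_on \<omega>. c z' = t z'"
proof -
  have c: "integrable (lebesgue_on \<omega>) c" using f by (simp add: has_column_rep_def)
  \<comment> \<open>Any interval around 0 that ends below \<open>hmin\<close> would do: the profile
    is nonzero at height 0 and has vanished before the top of every column.\<close>
  let ?\<beta> = "box_bump (-1) (hmin / 2) 1"
  have \<beta>0: "?\<beta> 0 \<noteq> 0" using hmin_pos by (simp add: box_bump_def smooth_step_eq_0_iff)
  have out: "?\<beta> s = 0" if "s < -1 \<or> hmin / 2 < s" for s
    by (rule box_bump_eq_0) (use that in auto)
  have "AE z' in lebesgue_on \<omega>. c z' - t z' = 0"
  proof (rule fundamental_lemma_box_bumps[OF integrable_L1_loc open_base])
    show "integrable (lebesgue_on \<omega>) (\<lambda>z'. c z' - t z')" using c t by simp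
    fix a b n assume sub: "cbox a b \<subseteq> \<omega>"
    let ?\<phi> = "\<lambda>z :: R3. box_bump a b n (fst z) * ?\<beta> (snd z)"
    have \<phi>: "?\<phi> \<in> test_functions below_top"
      using sub hmin_pos hmin_le
      by (intro product_test_function[OF sub smooth_box_bump out]) (fastforce simp: below_top_def)+
    have top: "?\<beta> (h z') = 0" if "z' \<in> \<omega>" for z'
      using hmin_le[OF that] hmin_pos by (intro out) auto
    have i: "integrable (lebesgue_on \<omega>) (\<lambda>z'. c z' * box_bump a b n z')" "integrable (lebesgue_on \<omega>) (\<lambda>z'. t z' * box_bump a b n z')"
      by (intro integrable_mult_smooth c t smooth_box_bump bounded_base)+
    have "- (LINT z'|lebesgue_on \<omega>. t z' * ?\<phi> (z', 0)) =
        (LINT z'|lebesgue_on \<omega>. col_top c g z' * ?\<phi> (z', h z') - c z' * ?\<phi> (z', 0))"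
      using eq[OF \<phi>] column_integration_by_parts[OF f test_functions_smooth[OF \<phi>]] by simp
    also have "\<dots> = (LINT z'|lebesgue_on \<omega>. - (c z' * ?\<phi> (z', 0)))"
      by (rule Bochner_Integration.integral_cong) (simp_all add: top del: One_nat_def)
    finally have "(LINT z'|lebesgue_on \<omega>. t z' * box_bump a b n z') * ?\<beta> 0 = (LINT z'|lebesgue_on \<omega>. c z' * box_bump a b n z') * ?\<beta> 0"
      by (simp add: mult.assoc[symmetric])
    then show "(LINT z'|lebesgue_on \<omega>. (c z' - t z') * box_bump a b n z') = 0"
      using i \<beta>0 by (simp add: left_diff_distrib)
  qed auto
  then show ?thesis by eventually_elim simp
qed

text \<open>The height is merely continuous, so smooth test functions cannot follow the top graph.
  Their vertical factor equals 1 on all heights from \<open>hmin / 2\<close> to \<open>hmax\<close>,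
  and hence at the top of every column; for this they must be allowed to leave the domain
  upwards.\<close>

lemma column_rep_top:
  assumes f: "has_column_rep f c g"
    and eq: "\<And>\<phi>. \<phi> \<in> test_functions (\<omega> \<times> {0<..}) \<Longrightarrow>
      (LINT z|lebesgue_on \<Omega>. f z * pderiv_at e3 \<phi> z) + (LINT z|lebesgue_on \<Omega>. g z * \<phi> z) = 0"
  shows "AE z' in lebesgue_on \<omega>. col_top c g z' = 0"
proof (cases "\<omega> = {}")
  case True
  then show ?thesis by (simp add: AE_lebesgue_on_iff)
next
  case False
  then obtain z0 where "z0 \<in> \<omega>" by blast
  then have hh: "hmin < hmax" using hmin_le less_hmax by fastforce
  obtain \<xi> d where \<xi>: "smooth \<xi>" "\<And>s. s \<le> hmin / 4 \<Longrightarrow> \<xi> s = 0"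
    "\<And>s. hmin / 2 \<le> s \<Longrightarrow> s \<le> hmax \<Longrightarrow> \<xi> s = 1" "\<And>s. d \<le> s \<Longrightarrow> \<xi> s = 0"
    using smooth_plateau[of "hmin / 4" "hmin / 2" hmax] hmin_pos hh by auto
  have g: "integrable (lebesgue_on \<Omega>) g" using f by (simp add: has_column_rep_def)
  have i: "integrable (lebesgue_on \<omega>) (col_top c g)"
  proof -
    have "integrable (lebesgue_on \<omega>) (\<lambda>z'. c z' + (LINT s|lebesgue_on {0..h z'}. g (z', s)))"
      using f column_Fubini(2)[OF g] by (auto simp: has_column_rep_def)
    then show ?thesis by (simp add: col_top_def[abs_def] col_prim_def)
  qed
  show ?thesis
  proof (rule fundamental_lemma_box_bumps[OF integrable_L1_loc[OF i] open_base])
    fix a b n assume sub: "cbox a b \<subseteq> \<omega>"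
    let ?\<phi> = "\<lambda>z :: R3. box_bump a b n (fst z) * \<xi> (snd z)"
    have \<phi>: "?\<phi> \<in> test_functions (\<omega> \<times> {0<..})"
    proof (rule product_test_function[OF sub \<xi>(1)])
      show "\<xi> s = 0" if "s < hmin / 4 \<or> d < s" for s using that \<xi>(2,4) by auto
      show "cbox a b \<times> {hmin / 4..d} \<subseteq> \<omega> \<times> {0<..}" using sub hmin_pos by auto
    qed
    have "0 = (LINT z'|lebesgue_on \<omega>. col_top c g z' * ?\<phi> (z', h z') - c z' * ?\<phi> (z', 0))"
      using eq[OF \<phi>] column_integration_by_parts[OF f test_functions_smooth[OF \<phi>]] by simp
    also have "\<dots> = (LINT z'|lebesgue_on \<omega>. col_top c g z' * box_bump a b n z')"
    proof (rule Bochner_Integration.integral_cong)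
      fix z' assume "z' \<in> space (lebesgue_on \<omega>)"
      then have "\<xi> (h z') = 1" "\<xi> 0 = 0"
        using \<xi>(2)[of 0] \<xi>(3)[of "h z'"] hmin_pos hmin_le[of z'] less_hmax[of z'] by auto
      then show "col_top c g z' * ?\<phi> (z', h z') - c z' * ?\<phi> (z', 0) = col_top c g z' * box_bump a b n z'" by simp
    qed simp
    finally show "(LINT z'|lebesgue_on \<omega>. col_top c g z' * box_bump a b n z') = 0" by simp
  qed simp
qed

lemma column_continuous:
  assumes "integrable (lebesgue_on \<Omega>) g"
  shows "AE z' in lebesgue_on \<omega>. continuous_on {0..h z'} (\<lambda>s. c (fst (z', s)) + col_prim g (z', s))"
  using column_Fubini(1)[OF assms]
proof eventually_elim
  case (elim z')
  show ?case
    using indefinite_integral_continuous_on[OF elim]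
    by (auto simp: col_prim_def intro!: continuous_on_add)
qed

text \<open>The function in the definition of the trace is any column-continuous representative. Two
  continuous functions on a column that agree almost everywhere agree everywhere, so the value does
  not depend on the choice and can be read off the column representation.\<close>

lemma has_z3_trace_iff:
  assumes f: "has_column_rep f c g" and \<tau>: "\<And>z'. z' \<in> \<omega> \<Longrightarrow> 0 \<le> \<tau> z' \<and> \<tau> z' \<le> h z'"
  shows "has_z3_trace \<omega> h \<tau> f t \<longleftrightarrow> (AE z' in lebesgue_on \<omega>. c z' + col_prim g (z', \<tau> z') = t z')"
proof
  have g: "integrable (lebesgue_on \<Omega>) g" and ae: "AE z in lebesgue_on \<Omega>. f z = c (fst z) + col_prim g z"
    using f by (auto simp: has_column_rep_def)
  let ?F = "\<lambda>z. c (fst z) + col_prim g z"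
  have mem: "AE z' in lebesgue_on \<omega>. z' \<in> \<omega>" by (simp add: AE_lebesgue_on_iff)
  show "has_z3_trace \<omega> h \<tau> f t" if t: "AE z' in lebesgue_on \<omega>. c z' + col_prim g (z', \<tau> z') = t z'"
    unfolding has_z3_trace_def
  proof (intro exI[of _ ?F] conjI)
    show "AE z in lebesgue_on \<Omega>. ?F z = f z" using ae by eventually_elim simp
    show "AE z' in lebesgue_on \<omega>. continuous_on {0..h z'} (\<lambda>s. ?F (z', s)) \<and> ?F (z', \<tau> z') = t z'"
      using column_continuous[OF g] t by eventually_elim simp
  qed
  assume "has_z3_trace \<omega> h \<tau> f t"
  then obtain F where F: "AE z in lebesgue_on \<Omega>. F z = f z"
    "AE z' in lebesgue_on \<omega>. continuous_on {0..h z'} (\<lambda>s. F (z', s)) \<and> F (z', \<tau> z') = t z'"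
    unfolding has_z3_trace_def by blast
  have "AE z in lebesgue_on \<Omega>. F z = ?F z" using F(1) ae by eventually_elim simp
  from column_AE[OF this] F(2) column_continuous[OF g, of c] mem
  show "AE z' in lebesgue_on \<omega>. c z' + col_prim g (z', \<tau> z') = t z'"
  proof eventually_elim
    case (elim z')
    define D where "D s = F (z', s) - ?F (z', s)" for s
    have cont: "continuous_on {0..h z'} D"
      unfolding D_def using elim by (intro continuous_on_diff) auto
    have "AE s in lebesgue. s \<in> {0..h z'} \<longrightarrow> D s = 0"
      using elim(1) by (simp add: AE_lebesgue_on_iff D_def)
    then have neg: "negligible {s \<in> {0..h z'}. D s \<noteq> 0}"
      unfolding negligible_iff_null_sets completion.null_sets_iff_AE by (auto elim: eventually_mono)
    have "D (\<tau> z') = 0"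
    proof (rule ccontr)
      assume D: "D (\<tau> z') \<noteq> 0"
      have "\<tau> z' \<in> {0..h z'}" using \<tau>[OF elim(4)] by auto
      then obtain e where e: "e > 0" "\<And>s. s \<in> {0..h z'} \<Longrightarrow> dist s (\<tau> z') < e \<Longrightarrow> dist (D s) (D (\<tau> z')) < \<bar>D (\<tau> z')\<bar>"
        using cont D unfolding continuous_on_iff by (metis zero_less_abs_iff)
      have "{0..h z'} \<inter> {\<tau> z' - e<..<\<tau> z' + e} \<subseteq> {s \<in> {0..h z'}. D s \<noteq> 0}"
        using e(2) by (fastforce simp: dist_real_def)
      \<comment> \<open>The part of the column within distance e of the evaluation point contains an
        open interval, also when that point is an end of the column.\<close>
      then have "negligible (box (max 0 (\<tau> z' - e)) (min (h z') (\<tau> z' + e)))"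
        by (intro negligible_subset[OF neg]) (auto simp: subset_iff)
      then have "box (max 0 (\<tau> z' - e)) (min (h z') (\<tau> z' + e)) = {}"
        by (simp add: negligible_interval del: box_real)
      then show False
        using \<open>e > 0\<close> \<tau>[OF elim(4)] height_pos[OF elim(4)] by (auto simp: not_less)
    qed
    then show ?case using elim(2) by (simp add: D_def)
  qed
qed

lemma has_z3_trace_bottom:
  assumes "has_column_rep f c g"
  shows "has_z3_trace \<omega> h (\<lambda>z'. 0) f t \<longleftrightarrow> (AE z' in lebesgue_on \<omega>. c z' = t z')"
proof -
  have "col_prim g (z', 0) = 0" for z'
  proof -
    have "negligible {0 :: real}" by simp
    then show ?thesis
      unfolding col_prim_def negligible_iff_null_sets by (simp add: integral_eq_zero_null_sets)
  qed
  then show ?thesis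
    using has_z3_trace_iff[OF assms, of "\<lambda>z'. 0" t] height_pos by (auto simp: less_imp_le)
qed

lemma has_z3_trace_top:
  assumes "has_column_rep f c g"
  shows "has_z3_trace \<omega> h h f t \<longleftrightarrow> (AE z' in lebesgue_on \<omega>. col_top c g z' = t z')"
  using has_z3_trace_iff[OF assms, of h t] height_pos by (auto simp: less_imp_le col_top_def)

end

section \<open>Sobolev functions on column domains: traces, integration by parts and flux\<close>

lemma e3_Basis: "e3 \<in> Basis"
  by (simp add: e3_def Basis_prod_def)

lemma horizontal_Basis: "i \<in> Basis \<Longrightarrow> (i, 0) \<in> (Basis :: R3 set)"
  by (simp add: Basis_prod_def)

lemma Basis_R3: "(Basis :: R3 set) = (\<lambda>i. (i, 0)) ` Basis \<union> {e3}"
  by (simp add: Basis_prod_def e3_def)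

lemma sum_Basis_R3: "(\<Sum>v\<in>(Basis :: R3 set). F v) = (\<Sum>i\<in>Basis. F (i, 0)) + F e3"
  unfolding Basis_R3 by (subst sum.union_disjoint) (auto simp: e3_def sum.reindex inj_on_def)

lemma dominated_cutoff:
  fixes f :: "'a::euclidean_space \<Rightarrow> real"
  assumes f: "integrable (lebesgue_on S) f" and m: "\<And>n. \<kappa> n \<in> borel_measurable (lebesgue_on S)"
    and bd: "\<And>n x. \<bar>\<kappa> n x\<bar> \<le> 1" and lim: "\<And>x. x \<in> S \<Longrightarrow> (\<lambda>n. \<kappa> n x) \<longlonglongrightarrow> 1"
  shows "(\<lambda>n. LINT x|lebesgue_on S. f x * \<kappa> n x) \<longlonglongrightarrow> integral\<^sup>L (lebesgue_on S) f"
proof (rule integral_dominated_convergence)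
  show "f \<in> borel_measurable (lebesgue_on S)" using f by auto
  then show "(\<lambda>x. f x * \<kappa> n x) \<in> borel_measurable (lebesgue_on S)" for n
    by (intro borel_measurable_times m)
  show "integrable (lebesgue_on S) (\<lambda>x. \<bar>f x\<bar>)" using f by simp
  have "(\<lambda>n. f x * \<kappa> n x) \<longlonglongrightarrow> f x" if "x \<in> S" for x
    using tendsto_mult[OF tendsto_const[of "f x"] lim[OF that]] by simp
  then show "AE x in lebesgue_on S. (\<lambda>n. f x * \<kappa> n x) \<longlonglongrightarrow> f x"
    by (intro AE_I2) simp
  show "AE x in lebesgue_on S. norm (f x * \<kappa> n x) \<le> \<bar>f x\<bar>" for n
    using mult_left_le[OF bd] by (auto simp: abs_mult)
qed

context column_domain begin

definition top_lateral :: "R3 set" where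
  "top_lateral = \<Gamma>_top \<omega> h \<union> \<Gamma>_lat \<omega> h"

lemma closure_dom_cases:
  assumes "z \<in> closure \<Omega>" "z \<notin> \<Omega>" "0 < snd z"
  shows "z \<in> top_lateral"
proof -
  have "z \<in> frontier \<Omega>" using assms open_dom by (simp add: frontier_def interior_open)
  moreover have "z \<notin> \<Gamma>_bot \<omega>" using assms(3) by (auto simp: \<Gamma>_bot_def)
  ultimately show ?thesis by (auto simp: top_lateral_def \<Gamma>_lat_def)
qed

text \<open>A frontier point below the top graph and over the base has height 0, hence lies on the
  bottom. Test functions on \<open>below_top\<close> therefore satisfy the Dirichlet conditions of
  \<open>V_space\<close>.\<close>

lemma below_top_top_lateral: "below_top \<inter> top_lateral = {}"
proof -
  have False if z: "z \<in> below_top" "z \<in> \<Gamma>_lat \<omega> h" for z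
  proof -
    have fr: "z \<in> closure \<Omega>" "z \<notin> \<Omega>" "z \<notin> \<Gamma>_bot \<omega>"
      using z(2) open_dom by (auto simp: \<Gamma>_lat_def frontier_def interior_open)
    have "closure \<Omega> \<subseteq> {z. 0 \<le> snd z}"
      by (intro closure_minimal closed_Collect_le continuous_intros) (auto simp: mem_dom)
    with fr have "0 \<le> snd z" by auto
    with fr z(1) show False by (cases z) (auto simp: below_top_def mem_dom \<Gamma>_bot_def)
  qed
  then show ?thesis by (auto simp: top_lateral_def \<Gamma>_top_def below_top_def)
qed

text \<open>The smooth functions whose H1 limits make up the space with zero values on the top and
  lateral boundary.\<close>

definition vanishes_near_top :: "(R3 \<Rightarrow> real) \<Rightarrow> bool" where
  "vanishes_near_top F \<longleftrightarrow> smooth F \<and> (\<exists>U. open U \<and> top_lateral \<subseteq> U \<and> (\<forall>x\<in>U. F x = 0))"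

lemma vanishes_near_topD:
  assumes "vanishes_near_top F"
  shows "smooth F" "z' \<in> \<omega> \<Longrightarrow> F (z', h z') = 0"
  using assms by (auto simp: vanishes_near_top_def top_lateral_def \<Gamma>_top_def)

lemma below_top_vanishes_near_top:
  assumes "\<phi> \<in> test_functions below_top"
  shows "vanishes_near_top \<phi>"
proof -
  obtain K where K: "compact K" "K \<subseteq> below_top" "\<And>x. x \<notin> K \<Longrightarrow> \<phi> x = 0"
    using test_functionsE[OF assms] by blast
  have "open (- K)" using K(1) by (simp add: compact_imp_closed open_Compl)
  moreover have "top_lateral \<subseteq> - K" using K(2) below_top_top_lateral by blast
  ultimately show ?thesis
    unfolding vanishes_near_top_def using K(3) test_functions_smooth[OF assms] by blast
qed

lemma vanishes_near_top_H1:
  assumes "vanishes_near_top F"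
  shows "F \<in> H1_vanishing_on \<Omega> (\<Gamma>_top \<omega> h \<union> \<Gamma>_lat \<omega> h)"
  unfolding H1_vanishing_on_def
proof (intro CollectI exI[of _ "\<lambda>n. F"] conjI allI)
  show "smooth F" "\<exists>U. open U \<and> \<Gamma>_top \<omega> h \<union> \<Gamma>_lat \<omega> h \<subseteq> U \<and> (\<forall>x\<in>U. F x = 0)"
    using assms by (auto simp: vanishes_near_top_def top_lateral_def)
  show "H1_tendsto \<Omega> (\<lambda>n. F) F"
    using assms by (intro H1_tendsto_const smooth_H1 bounded_dom open_dom) (auto simp: vanishes_near_top_def)
qed

text \<open>It depends on the height alone, so horizontal derivatives pass through it. Its vertical
  derivative, which grows with n, never occurs.\<close>

definition bottom_cutoff :: "nat \<Rightarrow> R3 \<Rightarrow> real" where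
  "bottom_cutoff n z = smooth_step (real n * snd z - 1)"

lemma smooth_bottom_cutoff: "smooth (bottom_cutoff n)"
proof -
  have "smooth (\<lambda>z :: R3. smooth_step (real n * snd z + (- 1)))"
    by (rule smooth_compose_affine[OF smooth_smooth_step]) (auto intro!: linearI simp: algebra_simps)
  then show ?thesis by (simp add: bottom_cutoff_def[abs_def])
qed

lemma bottom_cutoff_horizontal: "pderiv_at (i, 0) (bottom_cutoff n) z = 0"
proof -
  have l: "linear (\<lambda>z :: R3. real n * snd z)" by (auto intro!: linearI simp: algebra_simps)
  have "pderiv_at (i, 0) (\<lambda>z :: R3. smooth_step (real n * snd z + (- 1))) z
      = pderiv_at (real n * snd (i, 0 :: real)) smooth_step (real n * snd z + (- 1))"
    by (rule pderiv_at_compose_affine[OF smooth_differentiable[OF smooth_smooth_step] l])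
  then show ?thesis by (simp add: bottom_cutoff_def[abs_def] pderiv_at_0[OF smooth_smooth_step])
qed

text \<open>F may be nonzero outside the domain, hence the truncation. It stays smooth because the
  function is 0 near every point outside: F vanishes near the top and lateral boundary, the cutoff
  vanishes near the bottom, and the complement of the closure is open.\<close>

lemma cutoff_test_function:
  assumes "vanishes_near_top F"
  shows "(\<lambda>z. if z \<in> \<Omega> then bottom_cutoff n z * F z else 0) \<in> test_functions \<Omega>"
proof -
  obtain U where F: "smooth F" and U: "open U" "top_lateral \<subseteq> U" "\<And>x. x \<in> U \<Longrightarrow> F x = 0"
    using assms by (auto simp: vanishes_near_top_def)
  have low: "bottom_cutoff n z = 0" if "real n * snd z < 1" for z
    using that by (simp add: bottom_cutoff_def smooth_step_eq_0_iff)
  have pos: "0 < snd z" if "1 \<le> real n * snd z" for z :: R3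
  proof (rule ccontr)
    assume "\<not> 0 < snd z"
    then have "real n * snd z \<le> 0" by (simp add: mult_nonneg_nonpos)
    with that show False by simp
  qed
  define K where "K = (closure \<Omega> \<inter> {z. 1 \<le> real n * snd z}) - U"
  show ?thesis
  proof (rule test_functionsI)
    have "closed {z :: R3. 1 \<le> real n * snd z}" by (intro closed_Collect_le continuous_intros)
    then show "compact K"
      unfolding K_def using bounded_dom U(1) by (intro compact_diff compact_Int_closed) auto
    show "K \<subseteq> \<Omega>"
      unfolding K_def using closure_dom_cases pos U(2) by blast
    show "(if z \<in> \<Omega> then bottom_cutoff n z * F z else 0) = 0" if "z \<notin> K" for z
      using that low[of z] U(3)[of z] closure_subset[of \<Omega>] by (fastforce simp: K_def not_le)
    show "smooth (\<lambda>z. if z \<in> \<Omega> then bottom_cutoff n z * F z else 0)"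
    proof (rule smooth_locally)
      fix z
      consider "z \<in> \<Omega>" | "z \<in> U" | "real n * snd z < 1" | "z \<in> - closure \<Omega>"
        using closure_dom_cases[of z] pos[of z] U(2) by fastforce
      then show "\<exists>g U. smooth g \<and> open U \<and> z \<in> U \<and>
          (\<forall>y\<in>U. (if y \<in> \<Omega> then bottom_cutoff n y * F y else 0) = g y)"
      proof cases
        case 1
        then show ?thesis
          by (intro exI[of _ "\<lambda>z. bottom_cutoff n z * F z"] exI[of _ \<Omega>])
            (auto intro!: smooth_mult smooth_bottom_cutoff F open_dom)
      next
        case 2
        then show ?thesis using U by (intro exI[of _ "\<lambda>z. 0"] exI[of _ U]) auto
      next
        case 3
        have "open {z :: R3. real n * snd z < 1}" by (intro open_Collect_less continuous_intros)
        with 3 show ?thesis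
          by (intro exI[of _ "\<lambda>z. 0"] exI[of _ "{z. real n * snd z < 1}"]) (auto simp: low)
      next
        case 4
        then show ?thesis using closure_subset[of \<Omega>]
          by (intro exI[of _ "\<lambda>z. 0"] exI[of _ "- closure \<Omega>"]) auto
      qed
    qed
  qed
qed

text \<open>F may reach the bottom and is then not a test function of the domain. The bottom is
  horizontal, so no boundary term arises there: cut F off, use the weak derivative, and let the
  cutoff tend to 1.\<close>

lemma horizontal_integration_by_parts:
  assumes wd: "has_weak_deriv \<Omega> (i, 0) f g" and f: "integrable (lebesgue_on \<Omega>) f"
    and g: "integrable (lebesgue_on \<Omega>) g" and F: "vanishes_near_top F"
  shows "(LINT z|lebesgue_on \<Omega>. f z * pderiv_at (i, 0) F z) = - (LINT z|lebesgue_on \<Omega>. g z * F z)"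
proof -
  note sF = vanishes_near_topD(1)[OF F]
  let ?\<phi> = "\<lambda>n z. if z \<in> \<Omega> then bottom_cutoff n z * F z else 0"
  have d: "pderiv_at (i, 0) (?\<phi> n) z = bottom_cutoff n z * pderiv_at (i, 0) F z" if "z \<in> \<Omega>" for n z
  proof -
    have "pderiv_at (i, 0) (?\<phi> n) z = pderiv_at (i, 0) (\<lambda>z. bottom_cutoff n z * F z) z"
      using that by (intro pderiv_at_cong_open[OF open_dom] smooth_differentiable smooth_mult smooth_bottom_cutoff sF) auto
    also have "\<dots> = bottom_cutoff n z * pderiv_at (i, 0) F z"
      by (subst pderiv_at_mult) (auto intro!: smooth_differentiable smooth_bottom_cutoff sF simp: bottom_cutoff_horizontal)
    finally show ?thesis .
  qed
  have "(LINT z|lebesgue_on \<Omega>. f z * pderiv_at (i, 0) (?\<phi> n) z) = - (LINT z|lebesgue_on \<Omega>. g z * ?\<phi> n z)" for n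
    by (rule has_weak_derivD(3)[OF wd cutoff_test_function[OF F]])
  moreover have "(LINT z|lebesgue_on \<Omega>. f z * pderiv_at (i, 0) (?\<phi> n) z)
      = (LINT z|lebesgue_on \<Omega>. (f z * pderiv_at (i, 0) F z) * bottom_cutoff n z)" for n
    by (rule Bochner_Integration.integral_cong) (auto simp: d)
  moreover have "(LINT z|lebesgue_on \<Omega>. g z * ?\<phi> n z) = (LINT z|lebesgue_on \<Omega>. (g z * F z) * bottom_cutoff n z)" for n
    by (rule Bochner_Integration.integral_cong) auto
  ultimately have eq: "(LINT z|lebesgue_on \<Omega>. (f z * pderiv_at (i, 0) F z) * bottom_cutoff n z)
      = - (LINT z|lebesgue_on \<Omega>. (g z * F z) * bottom_cutoff n z)" for n by simp
  have lim: "(\<lambda>n. LINT z|lebesgue_on \<Omega>. m z * bottom_cutoff n z) \<longlonglongrightarrow> integral\<^sup>L (lebesgue_on \<Omega>) m"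
    if "integrable (lebesgue_on \<Omega>) m" for m
  proof (rule dominated_cutoff[OF that])
    show "bottom_cutoff n \<in> borel_measurable (lebesgue_on \<Omega>)" for n
      by (intro smooth_measurable_lebesgue_on smooth_bottom_cutoff)
    show "\<bar>bottom_cutoff n z\<bar> \<le> 1" for n z
      using smooth_step_bounds by (simp add: bottom_cutoff_def)
    show "(\<lambda>n. bottom_cutoff n z) \<longlonglongrightarrow> 1" if "z \<in> \<Omega>" for z
      unfolding bottom_cutoff_def using that by (intro smooth_step_tendsto) (simp add: mem_dom)
  qed
  have "(\<lambda>n. - (LINT z|lebesgue_on \<Omega>. (g z * F z) * bottom_cutoff n z)) \<longlonglongrightarrow> - (LINT z|lebesgue_on \<Omega>. g z * F z)"
    by (intro tendsto_minus lim integrable_mult_smooth g sF bounded_dom)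
  then have "(\<lambda>n. LINT z|lebesgue_on \<Omega>. (f z * pderiv_at (i, 0) F z) * bottom_cutoff n z) \<longlonglongrightarrow> - (LINT z|lebesgue_on \<Omega>. g z * F z)"
    unfolding eq .
  moreover have "(\<lambda>n. LINT z|lebesgue_on \<Omega>. (f z * pderiv_at (i, 0) F z) * bottom_cutoff n z)
      \<longlonglongrightarrow> (LINT z|lebesgue_on \<Omega>. f z * pderiv_at (i, 0) F z)"
    by (intro lim integrable_mult_smooth f smooth_pderiv_at sF bounded_dom)
  ultimately show ?thesis by (rule LIMSEQ_unique[rotated])
qed

lemma L2_dom_integrable: "f \<in> L2 \<Omega> \<Longrightarrow> integrable (lebesgue_on \<Omega>) f"
  by (intro L2_integrable bounded_dom) auto

lemma L2_base_integrable: "f \<in> L2 \<omega> \<Longrightarrow> integrable (lebesgue_on \<omega>) f"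
  by (intro L2_integrable bounded_base) auto

lemma has_column_rep_of_weak_deriv:
  assumes "f \<in> L2 \<Omega>" "g \<in> L2 \<Omega>" "has_weak_deriv \<Omega> e3 f g"
  obtains c where "has_column_rep f c g"
  using has_column_rep_exists[OF L2_dom_integrable[OF assms(1)] L2_dom_integrable[OF assms(2)]]
    has_weak_derivD(3)[OF assms(3)] by blast

lemma smooth_vertical_parts:
  assumes F: "smooth F" and \<phi>: "smooth \<phi>"
  shows "(LINT z|lebesgue_on \<Omega>. F z * pderiv_at e3 \<phi> z) + (LINT z|lebesgue_on \<Omega>. wderiv \<Omega> e3 F z * \<phi> z)
    = (LINT z'|lebesgue_on \<omega>. F (z', h z') * \<phi> (z', h z') - F (z', 0) * \<phi> (z', 0))"
proof -
  have "(LINT z|lebesgue_on \<Omega>. wderiv \<Omega> e3 F z * \<phi> z) = (LINT z|lebesgue_on \<Omega>. pderiv_at e3 F z * \<phi> z)"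
    by (rule integral_lebesgue_on_cong_AE[OF eventually_mono[OF wderiv_smooth[OF F open_dom, where v = e3]]]) auto
  then have "(LINT z|lebesgue_on \<Omega>. F z * pderiv_at e3 \<phi> z) + (LINT z|lebesgue_on \<Omega>. wderiv \<Omega> e3 F z * \<phi> z)
    = (LINT z'|lebesgue_on \<omega>. col_top (\<lambda>z'. F (z', 0)) (pderiv_at e3 F) z' * \<phi> (z', h z') - F (z', 0) * \<phi> (z', 0))"
    using column_integration_by_parts[OF has_column_rep_smooth(1)[OF F] \<phi>] by simp
  also have "\<dots> = (LINT z'|lebesgue_on \<omega>. F (z', h z') * \<phi> (z', h z') - F (z', 0) * \<phi> (z', 0))"
    by (rule Bochner_Integration.integral_cong) (auto simp: has_column_rep_smooth(3)[OF F])
  finally show ?thesis .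
qed

lemma H1_tendsto_vertical_parts:
  assumes "H1_tendsto \<Omega> F f" "smooth \<phi>"
  shows "(\<lambda>n. (LINT z|lebesgue_on \<Omega>. F n z * pderiv_at e3 \<phi> z) + (LINT z|lebesgue_on \<Omega>. wderiv \<Omega> e3 (F n) z * \<phi> z))
    \<longlonglongrightarrow> (LINT z|lebesgue_on \<Omega>. f z * pderiv_at e3 \<phi> z) + (LINT z|lebesgue_on \<Omega>. wderiv \<Omega> e3 f z * \<phi> z)"
  by (intro tendsto_add H1_tendsto_integral_mult[OF assms(1) open_dom] e3_Basis smooth_L2 assms(2)
      smooth_pderiv_at bounded_dom lebesgue_dom)

lemma H1_column_rep:
  assumes "f \<in> H1 \<Omega>"
  obtains c where "has_column_rep f c (wderiv \<Omega> e3 f)"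
  using has_column_rep_of_weak_deriv[OF H1_L2[OF assms] H1_wderiv(2,1)[OF assms e3_Basis open_dom]] by blast

lemma H1_vanishing_on_H1: "f \<in> H1_vanishing_on S \<Gamma> \<Longrightarrow> f \<in> H1 S"
  by (auto simp: H1_vanishing_on_def H1_tendsto_def)

lemma H10_H1: "f \<in> H10 S \<Longrightarrow> f \<in> H1 S"
  by (auto simp: H10_def H1_tendsto_def)

lemma H1_vanishing_sequence:
  assumes "f \<in> H1_vanishing_on \<Omega> (\<Gamma>_top \<omega> h \<union> \<Gamma>_lat \<omega> h)"
  obtains F where "\<And>n. vanishes_near_top (F n)" "H1_tendsto \<Omega> F f"
  using assms unfolding H1_vanishing_on_def vanishes_near_top_def top_lateral_def by blast

text \<open>Smooth approximants vanish on the top graph and the test function vanishes on the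
  bottom, so there is no boundary term, and this survives the H1 limit.\<close>

lemma vanishing_top_parts:
  assumes "f \<in> H1_vanishing_on \<Omega> (\<Gamma>_top \<omega> h \<union> \<Gamma>_lat \<omega> h)" and \<phi>: "\<phi> \<in> test_functions (\<omega> \<times> {0<..})"
  shows "(LINT z|lebesgue_on \<Omega>. f z * pderiv_at e3 \<phi> z) + (LINT z|lebesgue_on \<Omega>. wderiv \<Omega> e3 f z * \<phi> z) = 0"
proof -
  note sm = test_functions_smooth[OF \<phi>]
  obtain F where F: "\<And>n. vanishes_near_top (F n)" "H1_tendsto \<Omega> F f"
    using H1_vanishing_sequence[OF assms(1)] by blast
  have "\<phi> (z', 0) = 0" for z' by (rule test_functions_eq_0[OF \<phi>]) auto
  then have "(LINT z|lebesgue_on \<Omega>. F n z * pderiv_at e3 \<phi> z) + (LINT z|lebesgue_on \<Omega>. wderiv \<Omega> e3 (F n) z * \<phi> z)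
      = (LINT z'|lebesgue_on \<omega>. 0)" for n
    unfolding smooth_vertical_parts[OF vanishes_near_topD(1)[OF F(1)] sm]
    by (intro Bochner_Integration.integral_cong) (auto simp: vanishes_near_topD(2)[OF F(1)])
  with H1_tendsto_vertical_parts[OF F(2) sm] show ?thesis
    by (simp add: LIMSEQ_const_iff)
qed

lemma vanishing_col_top:
  assumes "f \<in> H1_vanishing_on \<Omega> (\<Gamma>_top \<omega> h \<union> \<Gamma>_lat \<omega> h)" "has_column_rep f c (wderiv \<Omega> e3 f)"
  shows "AE z' in lebesgue_on \<omega>. col_top c (wderiv \<Omega> e3 f) z' = 0"
  by (rule column_rep_top[OF assms(2) vanishing_top_parts[OF assms(1)]])

text \<open>Green's formula in the vertical direction for the approximants of the trace, followed by
  the limit. It trades a surface integral for volume integrals, the only form in which the friction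
  term is handled later.\<close>

lemma bot_trace_parts:
  assumes tr: "has_bot_trace \<omega> \<Omega> f t" and \<phi>: "\<phi> \<in> test_functions below_top"
  shows "(LINT z|lebesgue_on \<Omega>. f z * pderiv_at e3 \<phi> z) + (LINT z|lebesgue_on \<Omega>. wderiv \<Omega> e3 f z * \<phi> z)
    = - (LINT z'|lebesgue_on \<omega>. t z' * \<phi> (z', 0))"
proof -
  note sm = test_functions_smooth[OF \<phi>]
  obtain F where t: "t \<in> L2 \<omega>" and F: "\<And>n. smooth (F n)" "\<And>n. (\<lambda>x'. F n (x', 0)) \<in> L2 \<omega>" "H1_tendsto \<Omega> F f"
    "(\<lambda>n. LINT x'|lebesgue_on \<omega>. (F n (x', 0) - t x')\<^sup>2) \<longlonglongrightarrow> 0"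
    using tr unfolding has_bot_trace_def by blast
  have top: "\<phi> (z', h z') = 0" if "z' \<in> \<omega>" for z'
    by (rule vanishes_near_topD(2)[OF below_top_vanishes_near_top[OF \<phi>] that])
  have "linear (\<lambda>z' :: R2. (z', 0 :: real))" by (auto intro!: linearI)
  then have \<phi>0: "(\<lambda>z'. \<phi> (z', 0)) \<in> L2 \<omega>"
    using smooth_compose_linear[OF sm] by (intro smooth_L2 bounded_base) auto
  have "(LINT z|lebesgue_on \<Omega>. F n z * pderiv_at e3 \<phi> z) + (LINT z|lebesgue_on \<Omega>. wderiv \<Omega> e3 (F n) z * \<phi> z)
      = (LINT z'|lebesgue_on \<omega>. - (F n (z', 0) * \<phi> (z', 0)))" for n
    unfolding smooth_vertical_parts[OF F(1) sm]
    by (intro Bochner_Integration.integral_cong) (auto simp: top)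
  then have "(\<lambda>n. - (LINT z'|lebesgue_on \<omega>. F n (z', 0) * \<phi> (z', 0)))
    \<longlonglongrightarrow> (LINT z|lebesgue_on \<Omega>. f z * pderiv_at e3 \<phi> z) + (LINT z|lebesgue_on \<Omega>. wderiv \<Omega> e3 f z * \<phi> z)"
    using H1_tendsto_vertical_parts[OF F(3) sm] by simp
  moreover have "(\<lambda>n. - (LINT z'|lebesgue_on \<omega>. F n (z', 0) * \<phi> (z', 0)))
    \<longlonglongrightarrow> - (LINT z'|lebesgue_on \<omega>. t z' * \<phi> (z', 0))"
    by (intro tendsto_minus L2_tendsto_integral_mult F t \<phi>0)
  ultimately show ?thesis by (rule LIMSEQ_unique)
qed

lemma bot_trace_column_rep:
  assumes tr: "has_bot_trace \<omega> \<Omega> f t" and "has_column_rep f c (wderiv \<Omega> e3 f)"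
  shows "AE z' in lebesgue_on \<omega>. c z' = t z'"
proof (rule column_rep_bottom[OF assms(2)])
  show "integrable (lebesgue_on \<omega>) t" using tr by (auto simp: has_bot_trace_def intro: L2_base_integrable)
qed (rule bot_trace_parts[OF tr])

text \<open>Cauchy-Schwarz against the constant 1 on each column; the length of the column is
  bounded by \<open>hmax\<close>.\<close>

lemma column_integral_L2:
  assumes m: "m \<in> L2 \<Omega>"
  shows "(\<lambda>z'. LINT s|lebesgue_on {0..h z'}. m (z', s)) \<in> L2 \<omega>"
    and "(LINT z'|lebesgue_on \<omega>. (LINT s|lebesgue_on {0..h z'}. m (z', s))\<^sup>2) \<le> hmax * (LINT z|lebesgue_on \<Omega>. (m z)\<^sup>2)"
proof -
  let ?M = "\<lambda>z'. LINT s|lebesgue_on {0..h z'}. m (z', s)" and ?Q = "\<lambda>z'. LINT s|lebesgue_on {0..h z'}. (m (z', s))\<^sup>2"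
  note i = L2_dom_integrable[OF m] and q = L2_square_integrable[OF m]
  have mem: "AE z' in lebesgue_on \<omega>. z' \<in> \<omega>" by (simp add: AE_lebesgue_on_iff)
  have bd: "AE z' in lebesgue_on \<omega>. (?M z')\<^sup>2 \<le> hmax * ?Q z'"
    using column_Fubini(1)[OF i] column_Fubini(1)[OF q] mem
  proof eventually_elim
    case (elim z')
    have L: "(\<lambda>s. m (z', s)) \<in> L2 {0..h z'}" using elim(1,2) by (auto simp: L2_def)
    have "(\<lambda>s. 1) \<in> L2 {0..h z'}" by (rule L2_bounded[where C = 1]) auto
    from L2_Cauchy_Schwarz[OF L this] height_pos[OF elim(3)]
    have "\<bar>?M z'\<bar> \<le> sqrt (?Q z') * sqrt (h z')" by (simp add: measure_restrict_space)
    then have "(?M z')\<^sup>2 \<le> (sqrt (?Q z') * sqrt (h z'))\<^sup>2"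
      by (metis abs_ge_zero power2_abs power_mono)
    also have "\<dots> = h z' * ?Q z'"
      using height_pos[OF elim(3)] by (simp add: power_mult_distrib)
    also have "\<dots> \<le> hmax * ?Q z'"
      using less_hmax[OF elim(3)] by (intro mult_right_mono) auto
    finally show ?case .
  qed
  have mM: "?M \<in> borel_measurable (lebesgue_on \<omega>)"
    using column_Fubini(2)[OF i] by (rule borel_measurable_integrable)
  have iQ: "integrable (lebesgue_on \<omega>) (\<lambda>z'. hmax * ?Q z')" using column_Fubini(2)[OF q] by simp
  have iM: "integrable (lebesgue_on \<omega>) (\<lambda>z'. (?M z')\<^sup>2)"
  proof (rule Bochner_Integration.integrable_bound[OF iQ])
    show "(\<lambda>z'. (?M z')\<^sup>2) \<in> borel_measurable (lebesgue_on \<omega>)" using mM by (rule borel_measurable_power)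
    show "AE z' in lebesgue_on \<omega>. norm ((?M z')\<^sup>2) \<le> norm (hmax * ?Q z')"
      using bd by eventually_elim auto
  qed
  then show "?M \<in> L2 \<omega>" using mM by (simp add: L2_def)
  have "(LINT z'|lebesgue_on \<omega>. (?M z')\<^sup>2) \<le> (LINT z'|lebesgue_on \<omega>. hmax * ?Q z')"
    by (rule integral_mono_AE[OF iM iQ bd])
  also have "\<dots> = hmax * (LINT z|lebesgue_on \<Omega>. (m z)\<^sup>2)"
    using column_Fubini(3)[OF q] by simp
  finally show "(LINT z'|lebesgue_on \<omega>. (?M z')\<^sup>2) \<le> hmax * (LINT z|lebesgue_on \<Omega>. (m z)\<^sup>2)" .
qed

text \<open>The trace is minus the integral of the vertical derivative over the column, because the
  function vanishes at the top.\<close>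

lemma has_bot_trace_exists:
  assumes "f \<in> H1_vanishing_on \<Omega> (\<Gamma>_top \<omega> h \<union> \<Gamma>_lat \<omega> h)"
  shows "has_bot_trace \<omega> \<Omega> f (bot_trace \<omega> \<Omega> f)"
proof -
  obtain F where F: "\<And>n. vanishes_near_top (F n)" "H1_tendsto \<Omega> F f"
    using H1_vanishing_sequence[OF assms(1)] by blast
  note sF = vanishes_near_topD(1)[OF F(1)]
  let ?g = "wderiv \<Omega> e3 f"
  let ?t = "\<lambda>z'. - (LINT s|lebesgue_on {0..h z'}. ?g (z', s))"
  have g: "?g \<in> L2 \<Omega>" by (rule H1_wderiv(2)[OF H1_vanishing_on_H1[OF assms] e3_Basis open_dom])
  have "linear (\<lambda>z' :: R2. (z', 0 :: real))" by (auto intro!: linearI)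
  then have F0: "(\<lambda>z'. F n (z', 0)) \<in> L2 \<omega>" for n
    using smooth_compose_linear[OF sF] by (intro smooth_L2 bounded_base) auto
  \<comment> \<open>By \<open>column_integral_L2\<close>, convergence of the vertical derivatives in
    the domain forces convergence of the bottom values on the base.\<close>
  have bound: "(LINT z'|lebesgue_on \<omega>. (F n (z', 0) - ?t z')\<^sup>2)
      \<le> hmax * (LINT z|lebesgue_on \<Omega>. (wderiv \<Omega> e3 (F n) z - ?g z)\<^sup>2)" for n
  proof -
    let ?m = "\<lambda>z. pderiv_at e3 (F n) z - ?g z"
    have d: "pderiv_at e3 (F n) \<in> L2 \<Omega>" by (intro smooth_L2 smooth_pderiv_at sF bounded_dom) auto
    have m: "?m \<in> L2 \<Omega>" by (rule L2_diff[OF d g])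
    have "(LINT z'|lebesgue_on \<omega>. (F n (z', 0) - ?t z')\<^sup>2) = (LINT z'|lebesgue_on \<omega>. (LINT s|lebesgue_on {0..h z'}. ?m (z', s))\<^sup>2)"
    proof (rule integral_lebesgue_on_cong_AE)
      have mem: "AE z' in lebesgue_on \<omega>. z' \<in> \<omega>" by (simp add: AE_lebesgue_on_iff)
      show "AE z' in lebesgue_on \<omega>. (F n (z', 0) - ?t z')\<^sup>2 = (LINT s|lebesgue_on {0..h z'}. ?m (z', s))\<^sup>2"
        using column_Fubini(1)[OF L2_dom_integrable[OF g]] mem
      proof eventually_elim
        case (elim z')
        have "0 = F n (z', 0) + (LINT t|lebesgue_on {0..h z'}. pderiv_at e3 (F n) (z', t))"
          using vertical_FTC(1)[OF sF[of n], where s = "h z'" and z' = z'] vanishes_near_topD(2)[OF F(1) elim(2)] height_pos[OF elim(2)] by simp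
        moreover have "integrable (lebesgue_on {0..h z'}) (\<lambda>t. pderiv_at e3 (F n) (z', t))"
          using vertical_FTC(2)[OF sF] height_pos[OF elim(2)] by simp
        ultimately have "F n (z', 0) - ?t z' = - (LINT s|lebesgue_on {0..h z'}. ?m (z', s))"
          using elim(1) by simp
        then show ?case by (simp only: power2_minus)
      qed
    qed simp
    also have "\<dots> \<le> hmax * (LINT z|lebesgue_on \<Omega>. (?m z)\<^sup>2)" by (rule column_integral_L2(2)[OF m])
    also have "(LINT z|lebesgue_on \<Omega>. (?m z)\<^sup>2) = (LINT z|lebesgue_on \<Omega>. (wderiv \<Omega> e3 (F n) z - ?g z)\<^sup>2)"
      by (rule integral_lebesgue_on_cong_AE[OF eventually_mono[OF wderiv_smooth[OF sF[of n] open_dom, where v = e3]]]) auto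
    finally show ?thesis .
  qed
  have "(\<lambda>n. LINT z'|lebesgue_on \<omega>. (F n (z', 0) - ?t z')\<^sup>2) \<longlonglongrightarrow> 0"
  proof (rule Lim_null_comparison)
    show "\<forall>\<^sub>F n in sequentially. norm (LINT z'|lebesgue_on \<omega>. (F n (z', 0) - ?t z')\<^sup>2)
        \<le> hmax * (LINT z|lebesgue_on \<Omega>. (wderiv \<Omega> e3 (F n) z - ?g z)\<^sup>2)"
      using bound by (intro always_eventually) simp
    show "(\<lambda>n. hmax * (LINT z|lebesgue_on \<Omega>. (wderiv \<Omega> e3 (F n) z - ?g z)\<^sup>2)) \<longlonglongrightarrow> 0"
      using tendsto_mult[OF tendsto_const[of hmax] H1_tendsto_L2(2)[OF F(2) open_dom e3_Basis]] by simp
  qed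
  moreover have "?t \<in> L2 \<omega>" by (intro L2_uminus column_integral_L2(1) g)
  ultimately have "has_bot_trace \<omega> \<Omega> f ?t"
    unfolding has_bot_trace_def using sF F0 F(2) by blast
  then show ?thesis unfolding bot_trace_def by (rule someI[of "has_bot_trace \<omega> \<Omega> f"])
qed

text \<open>\<open>bot_trace\<close> is some admissible trace. Since Green's formula holds for it as
  well as for the restriction, \<open>column_rep_bottom\<close> makes the two agree almost
  everywhere.\<close>

lemma bot_trace_smooth:
  assumes \<phi>: "\<phi> \<in> test_functions below_top"
  shows "AE z' in lebesgue_on \<omega>. bot_trace \<omega> \<Omega> \<phi> z' = \<phi> (z', 0)"
proof -
  note sm = test_functions_smooth[OF \<phi>]
  have tr: "has_bot_trace \<omega> \<Omega> \<phi> (bot_trace \<omega> \<Omega> \<phi>)"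
    by (intro has_bot_trace_exists vanishes_near_top_H1 below_top_vanishes_near_top \<phi>)
  have t: "integrable (lebesgue_on \<omega>) (bot_trace \<omega> \<Omega> \<phi>)"
    using tr by (auto simp: has_bot_trace_def intro: L2_base_integrable)
  have "AE z' in lebesgue_on \<omega>. \<phi> (z', 0) = bot_trace \<omega> \<Omega> \<phi> z'"
  proof (rule column_rep_bottom[OF has_column_rep_smooth(1)[OF sm] t])
    fix \<psi> assume \<psi>: "\<psi> \<in> test_functions below_top"
    have "(LINT z|lebesgue_on \<Omega>. wderiv \<Omega> e3 \<phi> z * \<psi> z) = (LINT z|lebesgue_on \<Omega>. pderiv_at e3 \<phi> z * \<psi> z)"
      by (rule integral_lebesgue_on_cong_AE[OF eventually_mono[OF wderiv_smooth[OF sm open_dom, where v = e3]]]) auto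
    then show "(LINT z|lebesgue_on \<Omega>. \<phi> z * pderiv_at e3 \<psi> z) + (LINT z|lebesgue_on \<Omega>. pderiv_at e3 \<phi> z * \<psi> z)
        = - (LINT z'|lebesgue_on \<omega>. bot_trace \<omega> \<Omega> \<phi> z' * \<psi> (z', 0))"
      using bot_trace_parts[OF tr \<psi>] by simp
  qed
  then show ?thesis by eventually_elim simp
qed

text \<open>The smooth factor may be nonzero on the whole boundary. The identity thus encodes that
  both vertical traces of f are 0, in a form stable under weak limits.\<close>

lemma H10_vertical_parts:
  assumes "f \<in> H10 \<Omega>" and sm: "smooth \<phi>"
  shows "(LINT z|lebesgue_on \<Omega>. f z * pderiv_at e3 \<phi> z) + (LINT z|lebesgue_on \<Omega>. wderiv \<Omega> e3 f z * \<phi> z) = 0"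
proof -
  obtain F where F: "\<And>n. F n \<in> test_functions \<Omega>" "H1_tendsto \<Omega> F f"
    using assms(1) unfolding H10_def by blast
  have "F n (z', 0) = 0" "F n (z', h z') = 0" for z' n
    by (intro test_functions_eq_0[OF F(1)]; simp add: mem_dom)+
  then have "(LINT z|lebesgue_on \<Omega>. F n z * pderiv_at e3 \<phi> z) + (LINT z|lebesgue_on \<Omega>. wderiv \<Omega> e3 (F n) z * \<phi> z) = 0" for n
    unfolding smooth_vertical_parts[OF test_functions_smooth[OF F(1)] sm] by simp
  with H1_tendsto_vertical_parts[OF F(2) sm] show ?thesis
    by (simp add: LIMSEQ_const_iff)
qed

lemma test_function_H10: "\<phi> \<in> test_functions \<Omega> \<Longrightarrow> \<phi> \<in> H10 \<Omega>"
  unfolding H10_def using H1_tendsto_const[OF smooth_H1[OF test_functions_smooth lebesgue_dom(1) bounded_dom] open_dom]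
  by (intro CollectI exI[of _ "\<lambda>n. \<phi>"]) auto

lemma fst_L2:
  assumes "\<theta> \<in> L2 \<omega>"
  shows "(\<lambda>z. \<theta> (fst z)) \<in> L2 \<Omega>"
  using fst_integrable[OF L2_base_integrable[OF assms]] fst_integrable[OF L2_square_integrable[OF assms]]
  by (auto simp: L2_def)

lemma slice_test_function:
  fixes s :: real
  assumes \<phi>: "\<phi> \<in> test_functions \<Omega>"
  shows "(\<lambda>z'. \<phi> (z', s)) \<in> test_functions \<omega>"
    and "pderiv_at i (\<lambda>z'. \<phi> (z', s)) z' = pderiv_at (i, 0) \<phi> (z', s)"
proof -
  have l: "linear (\<lambda>z' :: R2. (z', 0 :: real))" by (auto intro!: linearI)
  note sm = test_functions_smooth[OF \<phi>]
  obtain K where K: "compact K" "K \<subseteq> \<Omega>" "\<And>x. x \<notin> K \<Longrightarrow> \<phi> x = 0"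
    using test_functionsE[OF \<phi>] by blast
  show "(\<lambda>z'. \<phi> (z', s)) \<in> test_functions \<omega>"
  proof (rule test_functionsI)
    show "smooth (\<lambda>z'. \<phi> (z', s))" using smooth_compose_affine[OF sm l, of "(0, s)"] by simp
    show "compact (fst ` K)" by (intro compact_continuous_image continuous_intros K)
    show "fst ` K \<subseteq> \<omega>" using K(2) by (auto simp: mem_dom)
    show "\<phi> (z', s) = 0" if "z' \<notin> fst ` K" for z' using that by (intro K(3)) force
  qed
  show "pderiv_at i (\<lambda>z'. \<phi> (z', s)) z' = pderiv_at (i, 0) \<phi> (z', s)"
    using pderiv_at_compose_affine[OF smooth_differentiable[OF sm] l, where v = i and x = z' and c = "(0, s)"] by simp
qed

text \<open>Fubini with the height as outer variable: each horizontal slice of a test function is a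
  test function on the whole base, even where the slice of the domain is smaller, because the
  function vanishes outside the domain.\<close>

lemma fst_has_weak_deriv:
  assumes \<theta>: "\<theta> \<in> L2 \<omega>" and \<theta>': "\<theta>' \<in> L2 \<omega>" and wd: "has_weak_deriv \<omega> i \<theta> \<theta>'"
  shows "has_weak_deriv \<Omega> (i, 0) (\<lambda>z. \<theta> (fst z)) (\<lambda>z. \<theta>' (fst z))"
  unfolding has_weak_deriv_def
proof (intro conjI ballI)
  show "(\<lambda>z. \<theta> (fst z)) \<in> L1_loc \<Omega>" "(\<lambda>z. \<theta>' (fst z)) \<in> L1_loc \<Omega>"
    by (intro L2_L1_loc fst_L2 \<theta> \<theta>' lebesgue_dom)+
  fix \<phi> assume \<phi>: "\<phi> \<in> test_functions \<Omega>"
  have slices: "(LINT z|lebesgue_on \<Omega>. a (fst z) * b z) = (LINT s|lebesgue. LINT z'|lebesgue_on \<omega>. a z' * b (z', s))"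
    if a: "a \<in> L2 \<omega>" and b: "b \<in> test_functions \<Omega>" for a b
  proof -
    let ?H = "\<lambda>z. if z \<in> \<Omega> then a (fst z) * b z else 0"
    have i: "integrable (lebesgue_on \<Omega>) (\<lambda>z. a (fst z) * b z)"
      by (intro integrable_mult_smooth L2_dom_integrable fst_L2 a test_functions_smooth[OF b] bounded_dom)
    have "integrable lebesgue ?H"
      by (rule iffD2[OF Lebesgue_Measure.integrable_restrict_UNIV[OF lebesgue_dom(1)] i])
    then have "integral\<^sup>L lebesgue ?H = (LINT s|lebesgue. LINT z'|lebesgue. ?H (z', s))"
      by (rule lebesgue_Fubini_swapped)
    moreover have "(LINT z'|lebesgue. ?H (z', s)) = (LINT z'|lebesgue_on \<omega>. a z' * b (z', s))" for s
    proof -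
      have "(\<lambda>z'. ?H (z', s)) = (\<lambda>z'. if z' \<in> \<omega> then a z' * b (z', s) else 0)"
        using test_functions_eq_0[OF b] by (auto simp: fun_eq_iff mem_dom)
      then show ?thesis by (simp add: Lebesgue_Measure.integral_restrict_UNIV)
    qed
    ultimately show ?thesis by (simp add: Lebesgue_Measure.integral_restrict_UNIV)
  qed
  show "(LINT z|lebesgue_on \<Omega>. \<theta> (fst z) * pderiv_at (i, 0) \<phi> z) = - (LINT z|lebesgue_on \<Omega>. \<theta>' (fst z) * \<phi> z)"
    unfolding slices[OF \<theta> test_functions_pderiv_at[OF \<phi>]] slices[OF \<theta>' \<phi>]
    using has_weak_derivD(3)[OF wd slice_test_function(1)[OF \<phi>]] slice_test_function(2)[OF \<phi>] by simp
qed

lemma has_column_rep_fst: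
  assumes "\<theta> \<in> L2 \<omega>"
  shows "has_column_rep (\<lambda>z. \<theta> (fst z)) \<theta> (\<lambda>z. 0)"
  using L2_base_integrable[OF assms] by (auto simp: has_column_rep_def col_prim_def)

text \<open>The vanishing divergence is multiplied by a function of the base point. The vertical
  part drops out since u \<bullet> e3 is 0 at both ends of the columns; the horizontal parts produce
  no lateral term since u vanishes there. So the normal flux through the boundary of the base is
  zero as well.\<close>

lemma divergence_free_flux:
  assumes u: "u \<in> V0_space \<omega> h" and \<theta>: "\<theta> \<in> H1 \<omega>"
  shows "(\<Sum>i\<in>Basis. LINT z|lebesgue_on \<Omega>. (u z \<bullet> (i, 0)) * wderiv \<omega> i \<theta> (fst z)) = 0"
proof -
  have van: "(\<lambda>z. u z \<bullet> v) \<in> H1_vanishing_on \<Omega> (\<Gamma>_top \<omega> h \<union> \<Gamma>_lat \<omega> h)" if "v \<in> Basis" for v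
    using u that by (auto simp: V0_space_def V_space_def)
  note H = H1_vanishing_on_H1[OF van] and W = H1_wderiv[OF H1_vanishing_on_H1[OF van] _ open_dom]
  note \<theta>L = H1_L2[OF \<theta>]
  have \<theta>m: "(\<lambda>z. \<theta> (fst z)) \<in> L2 \<Omega>" by (rule fst_L2[OF \<theta>L])
  have int: "integrable (lebesgue_on \<Omega>) (\<lambda>z. wderiv \<Omega> v (\<lambda>z. u z \<bullet> v) z * \<theta> (fst z))" if "v \<in> Basis" for v
    by (intro L2_mult_integrable W that \<theta>m)
  have hor: "(LINT z|lebesgue_on \<Omega>. wderiv \<Omega> (i, 0) (\<lambda>z. u z \<bullet> (i, 0)) z * \<theta> (fst z))
      = - (LINT z|lebesgue_on \<Omega>. (u z \<bullet> (i, 0)) * wderiv \<omega> i \<theta> (fst z))" if i: "i \<in> Basis" for i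
  proof -
    note i3 = horizontal_Basis[OF i] and \<theta>W = H1_wderiv[OF \<theta> i open_base]
    \<comment> \<open>It is u that is approximated, since \<open>\<theta>\<close> carries no
      boundary condition.\<close>
    obtain F where F: "\<And>n. vanishes_near_top (F n)" "H1_tendsto \<Omega> F (\<lambda>z. u z \<bullet> (i, 0))"
      using H1_vanishing_sequence[OF van[OF i3]] by blast
    have "(LINT z|lebesgue_on \<Omega>. wderiv \<Omega> (i, 0) (F n) z * \<theta> (fst z))
        = - (LINT z|lebesgue_on \<Omega>. F n z * wderiv \<omega> i \<theta> (fst z))" for n
    proof -
      have "(LINT z|lebesgue_on \<Omega>. wderiv \<Omega> (i, 0) (F n) z * \<theta> (fst z))
          = (LINT z|lebesgue_on \<Omega>. \<theta> (fst z) * pderiv_at (i, 0) (F n) z)"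
        by (rule integral_lebesgue_on_cong_AE[OF eventually_mono[OF wderiv_smooth[OF vanishes_near_topD(1)[OF F(1)[of n]] open_dom, where v = "(i, 0)"]]])
          auto
      also have "\<dots> = - (LINT z|lebesgue_on \<Omega>. wderiv \<omega> i \<theta> (fst z) * F n z)"
        by (intro horizontal_integration_by_parts fst_has_weak_deriv \<theta>L \<theta>W L2_dom_integrable fst_L2 F)
      finally show ?thesis by (simp add: mult.commute)
    qed
    then have "(\<lambda>n. - (LINT z|lebesgue_on \<Omega>. F n z * wderiv \<omega> i \<theta> (fst z)))
        \<longlonglongrightarrow> (LINT z|lebesgue_on \<Omega>. wderiv \<Omega> (i, 0) (\<lambda>z. u z \<bullet> (i, 0)) z * \<theta> (fst z))"
      using H1_tendsto_integral_mult(2)[OF F(2) open_dom \<theta>m i3] by simp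
    moreover have "(\<lambda>n. - (LINT z|lebesgue_on \<Omega>. F n z * wderiv \<omega> i \<theta> (fst z)))
        \<longlonglongrightarrow> - (LINT z|lebesgue_on \<Omega>. (u z \<bullet> (i, 0)) * wderiv \<omega> i \<theta> (fst z))"
      by (intro tendsto_minus H1_tendsto_integral_mult(1)[OF F(2) open_dom] fst_L2 \<theta>W)
    ultimately show ?thesis by (rule LIMSEQ_unique)
  qed
  \<comment> \<open>A function of the base point has column representation with density 0, so the
    column product formula leaves only the end values of u \<bullet> e3.\<close>
  have ver: "(LINT z|lebesgue_on \<Omega>. wderiv \<Omega> e3 (\<lambda>z. u z \<bullet> e3) z * \<theta> (fst z)) = 0"
  proof -
    let ?g = "wderiv \<Omega> e3 (\<lambda>z. u z \<bullet> e3)"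
    obtain c where c: "has_column_rep (\<lambda>z. u z \<bullet> e3) c ?g" using H1_column_rep[OF H[OF e3_Basis]] by blast
    have "has_bot_trace \<omega> \<Omega> (\<lambda>z. u z \<bullet> e3) (\<lambda>z'. 0)"
      using u by (simp add: V0_space_def V_space_def)
    from bot_trace_column_rep[OF this c] have "AE z' in lebesgue_on \<omega>. c z' = 0" .
    moreover note vanishing_col_top[OF van[OF e3_Basis] c]
    ultimately have "AE z' in lebesgue_on \<omega>. col_top c ?g z' * col_top \<theta> (\<lambda>z. 0) z' - c z' * \<theta> z' = 0"
      by eventually_elim simp
    moreover have "(LINT z|lebesgue_on \<Omega>. (u z \<bullet> e3) * 0 + ?g z * \<theta> (fst z))
        = (LINT z'|lebesgue_on \<omega>. col_top c ?g z' * col_top \<theta> (\<lambda>z. 0) z' - c z' * \<theta> z')"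
      by (rule column_product[OF c has_column_rep_fst[OF \<theta>L]]) (use int[OF e3_Basis] in simp_all)
    ultimately show ?thesis
      by (simp add: integral_eq_zero_AE)
  qed
  have "(LINT z|lebesgue_on \<Omega>. wdiv \<Omega> u z * \<theta> (fst z)) = (LINT z|lebesgue_on \<Omega>. 0)"
    by (rule integral_lebesgue_on_cong_AE) (use u in \<open>auto simp: V0_space_def elim: eventually_mono\<close>)
  moreover have "(LINT z|lebesgue_on \<Omega>. wdiv \<Omega> u z * \<theta> (fst z))
      = (\<Sum>v\<in>Basis. LINT z|lebesgue_on \<Omega>. wderiv \<Omega> v (\<lambda>z. u z \<bullet> v) z * \<theta> (fst z))"
    unfolding wdiv_def sum_distrib_right by (rule Bochner_Integration.integral_sum) (rule int)
  ultimately have "(\<Sum>v\<in>Basis. LINT z|lebesgue_on \<Omega>. wderiv \<Omega> v (\<lambda>z. u z \<bullet> v) z * \<theta> (fst z)) = 0" by simp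
  then have "(\<Sum>i\<in>Basis. - (LINT z|lebesgue_on \<Omega>. (u z \<bullet> (i, 0)) * wderiv \<omega> i \<theta> (fst z))) = 0"
    unfolding sum_Basis_R3 ver by (simp add: hor)
  then show ?thesis by (simp add: sum_negf)
qed

end

subsection \<open>Testing the equations\<close>

text \<open>The rotation of \<open>\<phi> v\<close> is split into its horizontal derivatives here
  and its vertical ones in \<open>test_rot_z3\<close>, because under rescaling the latter gain a
  factor 1 / \<epsilon>.\<close>

definition test_rot :: "(R3 \<Rightarrow> real) \<Rightarrow> R3 \<Rightarrow> R3 \<Rightarrow> R3" where
  "test_rot \<phi> v x =
     ((v \<bullet> e3) * pderiv_at e2 \<phi> x) *\<^sub>R e1 - ((v \<bullet> e3) * pderiv_at e1 \<phi> x) *\<^sub>R e2 +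
     ((v \<bullet> e2) * pderiv_at e1 \<phi> x - (v \<bullet> e1) * pderiv_at e2 \<phi> x) *\<^sub>R e3"

definition test_rot_z3 :: "(R3 \<Rightarrow> real) \<Rightarrow> R3 \<Rightarrow> R3 \<Rightarrow> R3" where
  "test_rot_z3 \<phi> v x = pderiv_at e3 \<phi> x *\<^sub>R (- (v \<bullet> e2) *\<^sub>R e1 + (v \<bullet> e1) *\<^sub>R e2)"

lemma wderiv_test_vector:
  assumes "open S" "smooth \<phi>"
  shows "AE x in lebesgue_on S. wderiv S j (\<lambda>y. (\<phi> y *\<^sub>R v) \<bullet> i) x = (v \<bullet> i) * pderiv_at j \<phi> x"
proof -
  have sm: "smooth (\<lambda>y. (v \<bullet> i) * \<phi> y)" by (intro smooth_mult smooth_const assms)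
  have eq: "(\<lambda>y. (\<phi> y *\<^sub>R v) \<bullet> i) = (\<lambda>y. (v \<bullet> i) * \<phi> y)" by (auto simp: mult.commute)
  have "pderiv_at j (\<lambda>y. (v \<bullet> i) * \<phi> y) x = (v \<bullet> i) * pderiv_at j \<phi> x" for x
    by (intro pderiv_at_cmult smooth_differentiable assms)
  with wderiv_smooth[OF sm assms(1), where v = j] show ?thesis unfolding eq by simp
qed

lemma wrot_test_vector:
  assumes "open S" "smooth \<phi>"
  shows "AE x in lebesgue_on S. wrot S (\<lambda>y. \<phi> y *\<^sub>R v) x = test_rot \<phi> v x + test_rot_z3 \<phi> v x"
proof -
  note W = wderiv_test_vector[OF assms, where v = v]
  show ?thesis
    using W[of e2 e3] W[of e3 e2] W[of e1 e3] W[of e3 e1] W[of e1 e2] W[of e2 e1]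
    by eventually_elim (simp add: wrot_def test_rot_def test_rot_z3_def algebra_simps)
qed

lemma pderiv_at_scaleR_dir: "smooth \<phi> \<Longrightarrow> pderiv_at (c *\<^sub>R v) \<phi> x = c * pderiv_at v \<phi> x"
  using linear_scale[OF has_derivative_linear[OF smooth_has_derivative]] by force

context column_domain begin

text \<open>For a basis vector v only the component of a along v meets the test field. Its
  horizontal derivatives are moved onto \<open>\<phi>\<close>, because convergence in
  \<open>V_z3\<close> controls the vertical derivative only.\<close>

lemma test_gradient:
  assumes a: "\<And>i. i \<in> Basis \<Longrightarrow> (\<lambda>x. a x \<bullet> i) \<in> H1 \<Omega>" and \<phi>: "\<phi> \<in> test_functions below_top" and v: "v \<in> Basis"
  shows "(LINT x|lebesgue_on \<Omega>. wgrad_inner \<Omega> a (\<lambda>y. \<phi> y *\<^sub>R v) x) =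
    - (\<Sum>i\<in>Basis. LINT x|lebesgue_on \<Omega>. (a x \<bullet> v) * pderiv_at (i, 0) (pderiv_at (i, 0) \<phi>) x)
    + (LINT x|lebesgue_on \<Omega>. wderiv \<Omega> e3 (\<lambda>x. a x \<bullet> v) x * pderiv_at e3 \<phi> x)"
proof -
  note sm = test_functions_smooth[OF \<phi>]
  note W = H1_wderiv[OF a[OF v] _ open_dom]
  have "AE x in lebesgue_on \<Omega>. \<forall>i\<in>Basis. \<forall>j\<in>Basis. wderiv \<Omega> j (\<lambda>y. (\<phi> y *\<^sub>R v) \<bullet> i) x = (v \<bullet> i) * pderiv_at j \<phi> x"
    by (intro AE_ball_countable[THEN iffD2] ballI countable_finite finite_Basis wderiv_test_vector[OF open_dom sm])
  then have "AE x in lebesgue_on \<Omega>. wgrad_inner \<Omega> a (\<lambda>y. \<phi> y *\<^sub>R v) x = (\<Sum>j\<in>Basis. wderiv \<Omega> j (\<lambda>x. a x \<bullet> v) x * pderiv_at j \<phi> x)"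
  proof eventually_elim
    case (elim x)
    have "wgrad_inner \<Omega> a (\<lambda>y. \<phi> y *\<^sub>R v) x
        = (\<Sum>i\<in>Basis. (v \<bullet> i) * (\<Sum>j\<in>Basis. wderiv \<Omega> j (\<lambda>x. a x \<bullet> i) x * pderiv_at j \<phi> x))"
      unfolding wgrad_inner_def sum_distrib_left using elim by (intro sum.cong) (auto simp: mult_ac)
    also have "\<dots> = (\<Sum>i\<in>Basis. if i = v then (\<Sum>j\<in>Basis. wderiv \<Omega> j (\<lambda>x. a x \<bullet> v) x * pderiv_at j \<phi> x) else 0)"
      using v by (intro sum.cong) (auto simp: inner_Basis)
    finally show ?case using v by simp
  qed
  then have "(LINT x|lebesgue_on \<Omega>. wgrad_inner \<Omega> a (\<lambda>y. \<phi> y *\<^sub>R v) x)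
      = (LINT x|lebesgue_on \<Omega>. (\<Sum>j\<in>Basis. wderiv \<Omega> j (\<lambda>x. a x \<bullet> v) x * pderiv_at j \<phi> x))"
    by (rule integral_lebesgue_on_cong_AE) simp
  also have "\<dots> = (\<Sum>j\<in>Basis. LINT x|lebesgue_on \<Omega>. wderiv \<Omega> j (\<lambda>x. a x \<bullet> v) x * pderiv_at j \<phi> x)"
    by (intro Bochner_Integration.integral_sum integrable_mult_smooth L2_dom_integrable W smooth_pderiv_at sm bounded_dom)
  also have "\<dots> = (\<Sum>i\<in>Basis. - (LINT x|lebesgue_on \<Omega>. (a x \<bullet> v) * pderiv_at (i, 0) (pderiv_at (i, 0) \<phi>) x))
    + (LINT x|lebesgue_on \<Omega>. wderiv \<Omega> e3 (\<lambda>x. a x \<bullet> v) x * pderiv_at e3 \<phi> x)"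
    unfolding sum_Basis_R3
  proof (intro arg_cong2[where f = "(+)"] sum.cong refl)
    fix i :: R2 assume i: "i \<in> Basis"
    note i3 = horizontal_Basis[OF i]
    show "(LINT x|lebesgue_on \<Omega>. wderiv \<Omega> (i, 0) (\<lambda>x. a x \<bullet> v) x * pderiv_at (i, 0) \<phi> x)
        = - (LINT x|lebesgue_on \<Omega>. (a x \<bullet> v) * pderiv_at (i, 0) (pderiv_at (i, 0) \<phi>) x)"
      using horizontal_integration_by_parts[OF W(1)[OF i3] L2_dom_integrable[OF H1_L2[OF a[OF v]]]
          L2_dom_integrable[OF W(2)[OF i3]] below_top_vanishes_near_top[OF test_functions_pderiv_at[OF \<phi>]]]
      by simp
  qed
  finally show ?thesis by (simp add: sum_negf)
qed

text \<open>Membership requires a vanishing vertical component on the bottom: either v is horizontal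
  or \<open>\<phi>\<close> is 0 there. The second hypothesis covers both.\<close>

lemma test_vector_V_space:
  assumes \<phi>: "\<phi> \<in> test_functions below_top" and 0: "\<And>x'. (v \<bullet> e3) * \<phi> (x', 0) = 0"
  shows "(\<lambda>x. \<phi> x *\<^sub>R v) \<in> V_space \<omega> h"
proof -
  have eq: "(\<lambda>x. (\<phi> x *\<^sub>R v) \<bullet> i) = (\<lambda>x. (v \<bullet> i) * \<phi> x)" for i by (auto simp: mult.commute)
  have sm: "smooth (\<lambda>x. (v \<bullet> e3) * \<phi> x)" by (intro smooth_mult smooth_const test_functions_smooth[OF \<phi>])
  have "has_bot_trace \<omega> \<Omega> (\<lambda>x. (\<phi> x *\<^sub>R v) \<bullet> e3) (\<lambda>x'. 0)"
    unfolding has_bot_trace_def eq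
    by (intro conjI exI[of _ "\<lambda>n x. (v \<bullet> e3) * \<phi> x"] allI H1_tendsto_const smooth_H1 open_dom bounded_dom sm)
      (simp_all add: 0)
  moreover have "(\<lambda>x. (\<phi> x *\<^sub>R v) \<bullet> i) \<in> H1_vanishing_on \<Omega> (\<Gamma>_top \<omega> h \<union> \<Gamma>_lat \<omega> h)" for i
    unfolding eq by (intro vanishes_near_top_H1 below_top_vanishes_near_top test_functions_mult \<phi> smooth_const)
  ultimately show ?thesis by (simp add: V_space_def)
qed

text \<open>The weak form after all horizontal derivatives of u and the surface integral are gone.
  What remains pairs u, its vertical derivative, p and w with fixed smooth functions. The minus sign
  before B comes from \<open>bot_trace_parts\<close>.\<close>

lemma momentum_tested:
  assumes u: "u \<in> V_space \<omega> h" and \<phi>: "\<phi> \<in> test_functions below_top" and v: "v \<in> Basis"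
    and 0: "\<And>x'. (v \<bullet> e3) * \<phi> (x', 0) = 0"
    and eq: "\<And>\<psi>. \<psi> \<in> V_space \<omega> h \<Longrightarrow>
      (LINT x|lebesgue_on \<Omega>. wgrad_inner \<Omega> u \<psi> x) - (LINT x|lebesgue_on \<Omega>. p x * wdiv \<Omega> \<psi> x)
      - C * (LINT x|lebesgue_on \<Omega>. wrot \<Omega> \<psi> x \<bullet> w x)
      + B * (LINT x'|lebesgue_on \<omega>. (\<Sum>i\<in>Basis. bot_trace \<omega> \<Omega> (\<lambda>x. fst (u x) \<bullet> i) x' * bot_trace \<omega> \<Omega> (\<lambda>x. fst (\<psi> x) \<bullet> i) x'))
      = (LINT x|lebesgue_on \<Omega>. f (fst x) \<bullet> fst (\<psi> x))"
  shows "- (\<Sum>i\<in>Basis. LINT x|lebesgue_on \<Omega>. (u x \<bullet> v) * pderiv_at (i, 0) (pderiv_at (i, 0) \<phi>) x)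
    + (LINT x|lebesgue_on \<Omega>. wderiv \<Omega> e3 (\<lambda>x. u x \<bullet> v) x * pderiv_at e3 \<phi> x)
    - (LINT x|lebesgue_on \<Omega>. p x * pderiv_at v \<phi> x)
    - C * (LINT x|lebesgue_on \<Omega>. (test_rot \<phi> v x + test_rot_z3 \<phi> v x) \<bullet> w x)
    - B * (\<Sum>i\<in>Basis. (fst v \<bullet> i) * ((LINT x|lebesgue_on \<Omega>. (u x \<bullet> (i, 0)) * pderiv_at e3 \<phi> x)
          + (LINT x|lebesgue_on \<Omega>. wderiv \<Omega> e3 (\<lambda>x. u x \<bullet> (i, 0)) x * \<phi> x)))
    = (LINT x|lebesgue_on \<Omega>. (f (fst x) \<bullet> fst v) * \<phi> x)"
proof -
  note sm = test_functions_smooth[OF \<phi>]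
  let ?\<psi> = "\<lambda>x. \<phi> x *\<^sub>R v"
  have van: "(\<lambda>x. u x \<bullet> i) \<in> H1_vanishing_on \<Omega> (\<Gamma>_top \<omega> h \<union> \<Gamma>_lat \<omega> h)" if "i \<in> Basis" for i
    using u that by (simp add: V_space_def)
  have grad: "(LINT x|lebesgue_on \<Omega>. wgrad_inner \<Omega> u ?\<psi> x) =
    - (\<Sum>i\<in>Basis. LINT x|lebesgue_on \<Omega>. (u x \<bullet> v) * pderiv_at (i, 0) (pderiv_at (i, 0) \<phi>) x)
    + (LINT x|lebesgue_on \<Omega>. wderiv \<Omega> e3 (\<lambda>x. u x \<bullet> v) x * pderiv_at e3 \<phi> x)"
    by (rule test_gradient[OF H1_vanishing_on_H1[OF van] \<phi> v])
  have "AE x in lebesgue_on \<Omega>. \<forall>i\<in>Basis. wderiv \<Omega> i (\<lambda>y. (\<phi> y *\<^sub>R v) \<bullet> i) x = (v \<bullet> i) * pderiv_at i \<phi> x"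
    by (intro AE_ball_countable[THEN iffD2] ballI countable_finite finite_Basis wderiv_test_vector[OF open_dom sm])
  then have "AE x in lebesgue_on \<Omega>. p x * wdiv \<Omega> ?\<psi> x = p x * pderiv_at v \<phi> x"
  proof eventually_elim
    case (elim x)
    have "wdiv \<Omega> ?\<psi> x = (\<Sum>i\<in>Basis. (v \<bullet> i) * pderiv_at i \<phi> x)"
      unfolding wdiv_def using elim by (intro sum.cong) auto
    also have "\<dots> = (\<Sum>i\<in>Basis. if i = v then pderiv_at v \<phi> x else 0)"
      using v by (intro sum.cong) (auto simp: inner_Basis)
    finally show ?case using v by simp
  qed
  then have div: "(LINT x|lebesgue_on \<Omega>. p x * wdiv \<Omega> ?\<psi> x) = (LINT x|lebesgue_on \<Omega>. p x * pderiv_at v \<phi> x)"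
    by (rule integral_lebesgue_on_cong_AE) simp
  have rot: "(LINT x|lebesgue_on \<Omega>. wrot \<Omega> ?\<psi> x \<bullet> w x) = (LINT x|lebesgue_on \<Omega>. (test_rot \<phi> v x + test_rot_z3 \<phi> v x) \<bullet> w x)"
    by (rule integral_lebesgue_on_cong_AE[OF eventually_mono[OF wrot_test_vector[OF open_dom sm, where v = v]]]) auto
  have tr: "has_bot_trace \<omega> \<Omega> (\<lambda>x. fst (u x) \<bullet> i) (bot_trace \<omega> \<Omega> (\<lambda>x. fst (u x) \<bullet> i))" if "i \<in> Basis" for i
    using has_bot_trace_exists[OF van[OF horizontal_Basis[OF that]]] by (simp add: inner_prod_def)
  have sm0: "smooth (\<lambda>x'. \<phi> (x', 0))"
  proof -
    have "linear (\<lambda>z' :: R2. (z', 0 :: real))" by (auto intro!: linearI)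
    then show ?thesis using smooth_compose_linear[OF sm] by blast
  qed
  have "AE x' in lebesgue_on \<omega>. \<forall>i\<in>Basis. bot_trace \<omega> \<Omega> (\<lambda>x. fst (?\<psi> x) \<bullet> i) x' = (fst v \<bullet> i) * \<phi> (x', 0)"
  proof (intro AE_ball_countable[THEN iffD2] ballI countable_finite finite_Basis)
    fix i :: R2
    have "(\<lambda>x. fst (?\<psi> x) \<bullet> i) = (\<lambda>x. (fst v \<bullet> i) * \<phi> x)" by (auto simp: mult.commute)
    then show "AE x' in lebesgue_on \<omega>. bot_trace \<omega> \<Omega> (\<lambda>x. fst (?\<psi> x) \<bullet> i) x' = (fst v \<bullet> i) * \<phi> (x', 0)"
      using bot_trace_smooth[OF test_functions_mult[OF \<phi> smooth_const[of "fst v \<bullet> i"]]] by simp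
  qed
  then have "AE x' in lebesgue_on \<omega>. (\<Sum>i\<in>Basis. bot_trace \<omega> \<Omega> (\<lambda>x. fst (u x) \<bullet> i) x' * bot_trace \<omega> \<Omega> (\<lambda>x. fst (?\<psi> x) \<bullet> i) x')
      = (\<Sum>i\<in>Basis. (fst v \<bullet> i) * (bot_trace \<omega> \<Omega> (\<lambda>x. fst (u x) \<bullet> i) x' * \<phi> (x', 0)))"
    by eventually_elim (auto intro!: sum.cong)
  then have "(LINT x'|lebesgue_on \<omega>. (\<Sum>i\<in>Basis. bot_trace \<omega> \<Omega> (\<lambda>x. fst (u x) \<bullet> i) x' * bot_trace \<omega> \<Omega> (\<lambda>x. fst (?\<psi> x) \<bullet> i) x'))
      = (LINT x'|lebesgue_on \<omega>. (\<Sum>i\<in>Basis. (fst v \<bullet> i) * (bot_trace \<omega> \<Omega> (\<lambda>x. fst (u x) \<bullet> i) x' * \<phi> (x', 0))))"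
    by (rule integral_lebesgue_on_cong_AE) simp
  also have "\<dots> = (\<Sum>i\<in>Basis. LINT x'|lebesgue_on \<omega>. (fst v \<bullet> i) * (bot_trace \<omega> \<Omega> (\<lambda>x. fst (u x) \<bullet> i) x' * \<phi> (x', 0)))"
  proof (rule Bochner_Integration.integral_sum)
    fix i :: R2 assume "i \<in> Basis"
    then have "bot_trace \<omega> \<Omega> (\<lambda>x. fst (u x) \<bullet> i) \<in> L2 \<omega>" using tr by (auto simp: has_bot_trace_def)
    then show "integrable (lebesgue_on \<omega>) (\<lambda>x'. (fst v \<bullet> i) * (bot_trace \<omega> \<Omega> (\<lambda>x. fst (u x) \<bullet> i) x' * \<phi> (x', 0)))"
      by (intro integrable_mult_right integrable_mult_smooth L2_base_integrable sm0 bounded_base)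
  qed
  also have "\<dots> = - (\<Sum>i\<in>Basis. (fst v \<bullet> i) * ((LINT x|lebesgue_on \<Omega>. (u x \<bullet> (i, 0)) * pderiv_at e3 \<phi> x)
          + (LINT x|lebesgue_on \<Omega>. wderiv \<Omega> e3 (\<lambda>x. u x \<bullet> (i, 0)) x * \<phi> x)))"
    unfolding sum_negf[symmetric]
  proof (rule sum.cong)
    fix i :: R2 assume "i \<in> Basis"
    from bot_trace_parts[OF tr[OF this] \<phi>]
    show "(LINT x'|lebesgue_on \<omega>. (fst v \<bullet> i) * (bot_trace \<omega> \<Omega> (\<lambda>x. fst (u x) \<bullet> i) x' * \<phi> (x', 0)))
      = - ((fst v \<bullet> i) * ((LINT x|lebesgue_on \<Omega>. (u x \<bullet> (i, 0)) * pderiv_at e3 \<phi> x)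
          + (LINT x|lebesgue_on \<Omega>. wderiv \<Omega> e3 (\<lambda>x. u x \<bullet> (i, 0)) x * \<phi> x)))"
      by (simp add: inner_prod_def)
  qed simp
  finally have bdry: "(LINT x'|lebesgue_on \<omega>. (\<Sum>i\<in>Basis. bot_trace \<omega> \<Omega> (\<lambda>x. fst (u x) \<bullet> i) x' * bot_trace \<omega> \<Omega> (\<lambda>x. fst (?\<psi> x) \<bullet> i) x'))
      = - (\<Sum>i\<in>Basis. (fst v \<bullet> i) * ((LINT x|lebesgue_on \<Omega>. (u x \<bullet> (i, 0)) * pderiv_at e3 \<phi> x)
          + (LINT x|lebesgue_on \<Omega>. wderiv \<Omega> e3 (\<lambda>x. u x \<bullet> (i, 0)) x * \<phi> x)))" .
  have rhs: "(LINT x|lebesgue_on \<Omega>. f (fst x) \<bullet> fst (?\<psi> x)) = (LINT x|lebesgue_on \<Omega>. (f (fst x) \<bullet> fst v) * \<phi> x)"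
    by (simp add: mult.commute)
  show ?thesis
    using eq[OF test_vector_V_space[OF \<phi> 0]] unfolding grad div rot bdry rhs by simp
qed

lemma spin_tested:
  assumes w: "\<And>i. i \<in> Basis \<Longrightarrow> (\<lambda>x. w x \<bullet> i) \<in> H10 \<Omega>" and \<phi>: "\<phi> \<in> test_functions \<Omega>" and v: "v \<in> Basis"
    and eq: "\<And>\<psi>. (\<And>i. i \<in> Basis \<Longrightarrow> (\<lambda>x. \<psi> x \<bullet> i) \<in> H10 \<Omega>) \<Longrightarrow>
      A * (LINT x|lebesgue_on \<Omega>. wgrad_inner \<Omega> w \<psi> x) + C * (LINT x|lebesgue_on \<Omega>. w x \<bullet> \<psi> x)
      - D * (LINT x|lebesgue_on \<Omega>. u x \<bullet> wrot \<Omega> \<psi> x) = E * (LINT x|lebesgue_on \<Omega>. g (fst x) \<bullet> fst (\<psi> x))"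
  shows "A * (- (\<Sum>i\<in>Basis. LINT x|lebesgue_on \<Omega>. (w x \<bullet> v) * pderiv_at (i, 0) (pderiv_at (i, 0) \<phi>) x)
    + (LINT x|lebesgue_on \<Omega>. wderiv \<Omega> e3 (\<lambda>x. w x \<bullet> v) x * pderiv_at e3 \<phi> x))
    + C * (LINT x|lebesgue_on \<Omega>. (w x \<bullet> v) * \<phi> x)
    - D * (LINT x|lebesgue_on \<Omega>. (test_rot \<phi> v x + test_rot_z3 \<phi> v x) \<bullet> u x)
    = E * (LINT x|lebesgue_on \<Omega>. (g (fst x) \<bullet> fst v) * \<phi> x)"
proof -
  note sm = test_functions_smooth[OF \<phi>]
  let ?\<psi> = "\<lambda>x. \<phi> x *\<^sub>R v"
  have eq': "(\<lambda>x. ?\<psi> x \<bullet> i) = (\<lambda>x. (v \<bullet> i) * \<phi> x)" for i by (auto simp: mult.commute)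
  have \<psi>: "(\<lambda>x. ?\<psi> x \<bullet> i) \<in> H10 \<Omega>" for i
    unfolding eq' by (intro test_function_H10 test_functions_mult \<phi> smooth_const)
  have grad: "(LINT x|lebesgue_on \<Omega>. wgrad_inner \<Omega> w ?\<psi> x) =
    - (\<Sum>i\<in>Basis. LINT x|lebesgue_on \<Omega>. (w x \<bullet> v) * pderiv_at (i, 0) (pderiv_at (i, 0) \<phi>) x)
    + (LINT x|lebesgue_on \<Omega>. wderiv \<Omega> e3 (\<lambda>x. w x \<bullet> v) x * pderiv_at e3 \<phi> x)"
    by (rule test_gradient[OF H10_H1[OF w] test_functions_mono[OF dom_subset_below_top \<phi>] v])
  have rot: "(LINT x|lebesgue_on \<Omega>. u x \<bullet> wrot \<Omega> ?\<psi> x) = (LINT x|lebesgue_on \<Omega>. (test_rot \<phi> v x + test_rot_z3 \<phi> v x) \<bullet> u x)"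
    by (rule integral_lebesgue_on_cong_AE[OF eventually_mono[OF wrot_test_vector[OF open_dom sm, where v = v]]])
      (auto simp: inner_commute)
  show ?thesis
    using eq[OF \<psi>] unfolding grad rot by (simp add: mult.commute[of "\<phi> _"])
qed

lemma divergence_tested:
  assumes u: "u \<in> V0_space \<omega> h" and \<phi>: "\<phi> \<in> test_functions \<Omega>"
  shows "(\<Sum>v\<in>Basis. LINT x|lebesgue_on \<Omega>. (u x \<bullet> v) * pderiv_at v \<phi> x) = 0"
proof -
  note sm = test_functions_smooth[OF \<phi>]
  have W: "has_weak_deriv \<Omega> v (\<lambda>x. u x \<bullet> v) (wderiv \<Omega> v (\<lambda>x. u x \<bullet> v))" "wderiv \<Omega> v (\<lambda>x. u x \<bullet> v) \<in> L2 \<Omega>"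
    if "v \<in> Basis" for v
    using u that by (auto simp: V0_space_def V_space_def intro!: H1_wderiv open_dom dest!: H1_vanishing_on_H1)
  have "(LINT x|lebesgue_on \<Omega>. wdiv \<Omega> u x * \<phi> x) = (LINT x|lebesgue_on \<Omega>. 0)"
    by (rule integral_lebesgue_on_cong_AE) (use u in \<open>auto simp: V0_space_def elim: eventually_mono\<close>)
  moreover have "(LINT x|lebesgue_on \<Omega>. wdiv \<Omega> u x * \<phi> x)
      = (\<Sum>v\<in>Basis. LINT x|lebesgue_on \<Omega>. wderiv \<Omega> v (\<lambda>x. u x \<bullet> v) x * \<phi> x)"
    unfolding wdiv_def sum_distrib_right
    by (intro Bochner_Integration.integral_sum integrable_mult_smooth L2_dom_integrable W sm bounded_dom)
  moreover have "(LINT x|lebesgue_on \<Omega>. (u x \<bullet> v) * pderiv_at v \<phi> x) = - (LINT x|lebesgue_on \<Omega>. wderiv \<Omega> v (\<lambda>x. u x \<bullet> v) x * \<phi> x)"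
    if "v \<in> Basis" for v by (rule has_weak_derivD(3)[OF W(1)[OF that] \<phi>])
  ultimately show ?thesis by (simp add: sum_negf)
qed

end

subsection \<open>Rescaling\<close>

lemma rescale_eq: "rescale e F z = F (fst z, e * snd z)"
  by (simp add: rescale_def case_prod_beta)

lemma rescale_mult: "rescale e (\<lambda>x. f x * g x) = (\<lambda>z. rescale e f z * rescale e g z)"
  by (auto simp: rescale_eq fun_eq_iff)

text \<open>The vertical stretching, put into the diagonal affine form over the basis for which the
  change of variables is known.\<close>

lemma vertical_scaling_eq:
  "(\<lambda>z :: R3. 0 + (\<Sum>j\<in>Basis. ((if j = e3 then e else 1) * (z \<bullet> j)) *\<^sub>R j)) = (\<lambda>z. (fst z, e * snd z))"
proof (rule ext)
  fix z :: R3
  have "(\<Sum>i\<in>Basis. (fst z \<bullet> i) *\<^sub>R (i, 0 :: real)) = (fst z, 0)"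
  proof -
    have "(\<Sum>i\<in>Basis. (fst z \<bullet> i) *\<^sub>R (i, 0 :: real)) = (\<Sum>i\<in>Basis. (fst z \<bullet> i) *\<^sub>R i, 0)"
      by (simp add: prod_eq_iff fst_sum snd_sum)
    then show ?thesis by (simp add: euclidean_representation)
  qed
  moreover have "(i, 0) \<noteq> e3" for i by (simp add: e3_def)
  ultimately show "0 + (\<Sum>j\<in>Basis. ((if j = e3 then e else 1) * (z \<bullet> j)) *\<^sub>R j) = (fst z, e * snd z)"
    unfolding sum_Basis_R3 by (simp add: inner_prod_def e3_def prod_eq_iff)
qed

lemma vertical_scaling_measurable:
  assumes "e \<noteq> 0" shows "(\<lambda>z :: R3. (fst z, e * snd z)) \<in> lebesgue \<rightarrow>\<^sub>M lebesgue"
  using lebesgue_affine_measurable[of "\<lambda>j. if j = e3 then e else 1" 0] assms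
  unfolding vertical_scaling_eq by simp

lemma vertical_scaling_density:
  assumes "0 < e"
  shows "lebesgue = density (distr lebesgue lebesgue (\<lambda>z :: R3. (fst z, e * snd z))) (\<lambda>_. ennreal e)"
proof -
  have "(\<Prod>j\<in>(Basis :: R3 set). ennreal \<bar>if j = e3 then e else 1\<bar>) = ennreal e"
  proof -
    have "(\<Prod>j\<in>(Basis :: R3 set). ennreal \<bar>if j = e3 then e else 1\<bar>) = (\<Prod>j\<in>(Basis :: R3 set). if j = e3 then ennreal e else 1)"
      using assms by (intro prod.cong) auto
    then show ?thesis using e3_Basis by simp
  qed
  then have "(\<lambda>_ :: R3. \<Prod>j\<in>(Basis :: R3 set). ennreal \<bar>if j = e3 then e else 1\<bar>) = (\<lambda>_. ennreal e)" by simp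
  with lebesgue_affine_euclidean[of "\<lambda>j. if j = e3 then e else 1" "0 :: R3"] assms
  show ?thesis unfolding vertical_scaling_eq by (simp add: prod_ennreal)
qed

lemma vertical_scaling_borel:
  fixes F :: "R3 \<Rightarrow> real"
  assumes "0 < e"
  shows "F \<in> borel_measurable lebesgue \<longleftrightarrow> (\<lambda>z. F (fst z, e * snd z)) \<in> borel_measurable lebesgue"
proof
  assume "F \<in> borel_measurable lebesgue"
  then show "(\<lambda>z. F (fst z, e * snd z)) \<in> borel_measurable lebesgue"
    using measurable_compose[OF vertical_scaling_measurable[of e]] assms by simp
next
  assume "(\<lambda>z. F (fst z, e * snd z)) \<in> borel_measurable lebesgue"
  from measurable_compose[OF vertical_scaling_measurable[of "1 / e"] this] assms
  show "F \<in> borel_measurable lebesgue" by simp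
qed

lemma vertical_scaling_integral:
  fixes F :: "R3 \<Rightarrow> real"
  assumes e: "0 < e"
  shows "integrable lebesgue F \<longleftrightarrow> integrable lebesgue (\<lambda>z. F (fst z, e * snd z))"
    and "integral\<^sup>L lebesgue F = e * (LINT z|lebesgue. F (fst z, e * snd z))"
proof -
  let ?S = "\<lambda>z :: R3. (fst z, e * snd z)"
  have m: "?S \<in> lebesgue \<rightarrow>\<^sub>M lebesgue" using vertical_scaling_measurable[of e] e by simp
  have main: "(integrable lebesgue F \<longleftrightarrow> integrable lebesgue (\<lambda>z. F (fst z, e * snd z)))
      \<and> integral\<^sup>L lebesgue F = e * (LINT z|lebesgue. F (fst z, e * snd z))"
    if F: "F \<in> borel_measurable lebesgue"
  proof
    have "integrable lebesgue F \<longleftrightarrow> integrable (density (distr lebesgue lebesgue ?S) (\<lambda>_. ennreal e)) F"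
      by (subst vertical_scaling_density[OF e]) simp
    also have "\<dots> \<longleftrightarrow> integrable (distr lebesgue lebesgue ?S) (\<lambda>x. e *\<^sub>R F x)"
      using F e by (intro integrable_density) auto
    also have "\<dots> \<longleftrightarrow> integrable lebesgue (\<lambda>z. e *\<^sub>R F (?S z))"
      using F m by (intro integrable_distr_eq) auto
    finally show "integrable lebesgue F \<longleftrightarrow> integrable lebesgue (\<lambda>z. F (fst z, e * snd z))" using e by simp
    have "integral\<^sup>L lebesgue F = integral\<^sup>L (density (distr lebesgue lebesgue ?S) (\<lambda>_. ennreal e)) F"
      by (subst vertical_scaling_density[OF e]) simp
    also have "\<dots> = integral\<^sup>L (distr lebesgue lebesgue ?S) (\<lambda>x. e *\<^sub>R F x)"
      using F e by (intro integral_density) auto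
    also have "\<dots> = (LINT z|lebesgue. e *\<^sub>R F (?S z))"
      using F m by (intro integral_distr) auto
    finally show "integral\<^sup>L lebesgue F = e * (LINT z|lebesgue. F (fst z, e * snd z))" by simp
  qed
  \<comment> \<open>Measurability is the same on both sides of the scaling; without it both
    integrals are 0 by convention.\<close>
  have non: "\<not> integrable lebesgue F \<and> \<not> integrable lebesgue (\<lambda>z. F (fst z, e * snd z))"
    if "F \<notin> borel_measurable lebesgue"
    using that vertical_scaling_borel[OF e, of F] by auto
  show "integrable lebesgue F \<longleftrightarrow> integrable lebesgue (\<lambda>z. F (fst z, e * snd z))"
    using main non by blast
  show "integral\<^sup>L lebesgue F = e * (LINT z|lebesgue. F (fst z, e * snd z))"
  proof (cases "F \<in> borel_measurable lebesgue")
    case False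
    then show ?thesis using non not_integrable_integral_eq[of lebesgue F]
      not_integrable_integral_eq[of lebesgue "\<lambda>z. F (fst z, e * snd z)"] by simp
  qed (use main in simp)
qed

text \<open>The thin domain is itself a column domain with height and bounds multiplied by e. Facts
  with prefix \<open>thin\<close> refer to it, those without prefix to the rescaled domain.\<close>

locale thin_column_domain = column_domain +
  fixes e :: real
  assumes e_pos: "0 < e"
begin

sublocale thin: column_domain \<omega> "\<lambda>x'. e * h x'" "e * hmin" "e * hmax"
  using e_pos hmin_pos hmin_le less_hmax
  by unfold_locales (auto intro!: open_base bounded_base continuous_intros continuous_height)

abbreviation \<Omega>e :: "R3 set" where "\<Omega>e \<equiv> dom_under \<omega> (\<lambda>x'. e * h x')"

lemma scale_mem: "(fst z, e * snd z) \<in> \<Omega>e \<longleftrightarrow> z \<in> \<Omega>"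
  using e_pos by (simp add: mem_dom thin.mem_dom zero_less_mult_iff)

lemma scale_integral:
  fixes F :: "R3 \<Rightarrow> real"
  shows "integrable (lebesgue_on \<Omega>e) F \<longleftrightarrow> integrable (lebesgue_on \<Omega>) (rescale e F)"
    and "integral\<^sup>L (lebesgue_on \<Omega>e) F = e * integral\<^sup>L (lebesgue_on \<Omega>) (rescale e F)"
proof -
  let ?F = "\<lambda>x. if x \<in> \<Omega>e then F x else 0"
  have eq: "(\<lambda>z. ?F (fst z, e * snd z)) = (\<lambda>z. if z \<in> \<Omega> then rescale e F z else 0)"
    by (auto simp: fun_eq_iff scale_mem rescale_eq)
  have "integrable (lebesgue_on \<Omega>e) F \<longleftrightarrow> integrable lebesgue ?F"
    by (rule Lebesgue_Measure.integrable_restrict_UNIV[symmetric]) simp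
  also have "\<dots> \<longleftrightarrow> integrable lebesgue (\<lambda>z. if z \<in> \<Omega> then rescale e F z else 0)"
    using vertical_scaling_integral(1)[OF e_pos, of ?F] unfolding eq .
  also have "\<dots> \<longleftrightarrow> integrable (lebesgue_on \<Omega>) (rescale e F)"
    by (rule Lebesgue_Measure.integrable_restrict_UNIV) simp
  finally show "integrable (lebesgue_on \<Omega>e) F \<longleftrightarrow> integrable (lebesgue_on \<Omega>) (rescale e F)" .
  have "integral\<^sup>L (lebesgue_on \<Omega>e) F = integral\<^sup>L lebesgue ?F"
    by (rule Lebesgue_Measure.integral_restrict_UNIV[symmetric]) simp
  also have "\<dots> = e * integral\<^sup>L lebesgue (\<lambda>z. if z \<in> \<Omega> then rescale e F z else 0)"
    using vertical_scaling_integral(2)[OF e_pos, of ?F] unfolding eq .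
  also have "integral\<^sup>L lebesgue (\<lambda>z. if z \<in> \<Omega> then rescale e F z else 0) = integral\<^sup>L (lebesgue_on \<Omega>) (rescale e F)"
    by (rule Lebesgue_Measure.integral_restrict_UNIV) simp
  finally show "integral\<^sup>L (lebesgue_on \<Omega>e) F = e * integral\<^sup>L (lebesgue_on \<Omega>) (rescale e F)" .
qed

lemma rescale_L2:
  assumes "F \<in> L2 \<Omega>e"
  shows "rescale e F \<in> L2 \<Omega>"
proof -
  have "integrable (lebesgue_on \<Omega>) (rescale e F)"
    using thin.L2_dom_integrable[OF assms] scale_integral(1) by blast
  moreover have "integrable (lebesgue_on \<Omega>) (rescale e (\<lambda>x. (F x)\<^sup>2))"
    using L2_square_integrable[OF assms] scale_integral(1) by blast
  ultimately show ?thesis by (auto simp: L2_def rescale_eq[abs_def])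
qed

text \<open>The inverse of rescaling, applied to test functions: the test function on the rescaled
  domain stays fixed while the one on the thin domain shrinks with it.\<close>

definition thin_test :: "(R3 \<Rightarrow> real) \<Rightarrow> R3 \<Rightarrow> real" where
  "thin_test \<phi> x = \<phi> (fst x, snd x / e)"

lemma rescale_thin_test: "rescale e (thin_test \<phi>) = \<phi>"
  using e_pos by (auto simp: rescale_eq thin_test_def fun_eq_iff)

lemma linear_thin: "linear (\<lambda>x :: R3. (fst x, snd x / e))"
  by (auto intro!: linearI simp: add_divide_distrib)

lemma smooth_thin_test: "smooth \<phi> \<Longrightarrow> smooth (thin_test \<phi>)"
  unfolding thin_test_def[abs_def] by (rule smooth_compose_linear[OF _ linear_thin])

lemma pderiv_at_thin_test:
  assumes "smooth \<phi>"
  shows "pderiv_at v (thin_test \<phi>) = thin_test (pderiv_at (fst v, snd v / e) \<phi>)"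
  using pderiv_at_compose_affine[OF smooth_differentiable[OF assms] linear_thin, where c = 0 and v = v]
  by (auto simp: thin_test_def[abs_def] fun_eq_iff)

lemma pderiv_at_thin_test_e3:
  assumes "smooth \<phi>"
  shows "pderiv_at e3 (thin_test \<phi>) = (\<lambda>x. thin_test (pderiv_at e3 \<phi>) x / e)"
proof -
  have "(fst e3, snd e3 / e) = (1 / e) *\<^sub>R e3" by (simp add: e3_def)
  then show ?thesis
    unfolding pderiv_at_thin_test[OF assms]
    by (simp only: thin_test_def pderiv_at_scaleR_dir[OF assms] fun_eq_iff) (simp add: thin_test_def)
qed

lemma thin_test_functions:
  assumes "\<phi> \<in> test_functions S" "\<And>z. z \<in> S \<Longrightarrow> (fst z, e * snd z) \<in> T"
  shows "thin_test \<phi> \<in> test_functions T"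
proof -
  obtain K where K: "compact K" "K \<subseteq> S" "\<And>x. x \<notin> K \<Longrightarrow> \<phi> x = 0"
    using test_functionsE[OF assms(1)] by blast
  show ?thesis
  proof (rule test_functionsI)
    show "smooth (thin_test \<phi>)" by (rule smooth_thin_test[OF test_functions_smooth[OF assms(1)]])
    show "compact ((\<lambda>z. (fst z, e * snd z)) ` K)" by (intro compact_continuous_image continuous_intros K)
    show "(\<lambda>z. (fst z, e * snd z)) ` K \<subseteq> T" using K(2) assms(2) by auto
    show "thin_test \<phi> x = 0" if "x \<notin> (\<lambda>z. (fst z, e * snd z)) ` K" for x
    proof -
      have "(fst x, snd x / e) \<notin> K"
      proof
        assume "(fst x, snd x / e) \<in> K"
        then have "(fst x, e * (snd x / e)) \<in> (\<lambda>z. (fst z, e * snd z)) ` K"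
          by (intro image_eqI[of _ _ "(fst x, snd x / e)"]) auto
        with that e_pos show False by simp
      qed
      then show ?thesis unfolding thin_test_def by (rule K(3))
    qed
  qed
qed

lemma thin_test_dom: "\<phi> \<in> test_functions \<Omega> \<Longrightarrow> thin_test \<phi> \<in> test_functions \<Omega>e"
  by (erule thin_test_functions) (simp add: scale_mem)

lemma thin_test_below_top: "\<phi> \<in> test_functions below_top \<Longrightarrow> thin_test \<phi> \<in> test_functions thin.below_top"
  by (erule thin_test_functions) (use e_pos in \<open>simp add: below_top_def thin.below_top_def\<close>)

lemma rescale_has_weak_deriv:
  assumes f: "f \<in> L2 \<Omega>e" and g: "g \<in> L2 \<Omega>e" and wd: "has_weak_deriv \<Omega>e e3 f g"
  shows "has_weak_deriv \<Omega> e3 (rescale e f) (\<lambda>z. e * rescale e g z)"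
  unfolding has_weak_deriv_def
proof (intro conjI ballI)
  show "rescale e f \<in> L1_loc \<Omega>" "(\<lambda>z. e * rescale e g z) \<in> L1_loc \<Omega>"
    by (intro L2_L1_loc rescale_L2 L2_cmult f g lebesgue_dom)+
  fix \<phi> assume \<phi>: "\<phi> \<in> test_functions \<Omega>"
  note sm = test_functions_smooth[OF \<phi>]
  have 1: "(LINT x|lebesgue_on \<Omega>e. f x * pderiv_at e3 (thin_test \<phi>) x) = (LINT z|lebesgue_on \<Omega>. rescale e f z * pderiv_at e3 \<phi> z)"
  proof -
    have "rescale e (\<lambda>x. f x * pderiv_at e3 (thin_test \<phi>) x) = (\<lambda>z. (rescale e f z * pderiv_at e3 \<phi> z) / e)"
      using e_pos unfolding pderiv_at_thin_test_e3[OF sm] by (auto simp: rescale_eq thin_test_def fun_eq_iff)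
    then show ?thesis unfolding scale_integral(2) using e_pos by simp
  qed
  have 2: "(LINT x|lebesgue_on \<Omega>e. g x * thin_test \<phi> x) = (LINT z|lebesgue_on \<Omega>. (e * rescale e g z) * \<phi> z)"
  proof -
    have "rescale e (\<lambda>x. g x * thin_test \<phi> x) = (\<lambda>z. rescale e g z * \<phi> z)"
      using e_pos by (auto simp: rescale_eq thin_test_def fun_eq_iff)
    then show ?thesis unfolding scale_integral(2) by (simp add: mult.assoc)
  qed
  show "(LINT z|lebesgue_on \<Omega>. rescale e f z * pderiv_at e3 \<phi> z) = - (LINT z|lebesgue_on \<Omega>. (e * rescale e g z) * \<phi> z)"
    using has_weak_derivD(3)[OF wd thin_test_dom[OF \<phi>]] unfolding 1 2 .
qed

lemma rescale_wderiv:
  assumes "f \<in> H1 \<Omega>e"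
  shows "AE z in lebesgue_on \<Omega>. rescale e (wderiv \<Omega>e e3 f) z = wderiv \<Omega> e3 (rescale e f) z / e"
    and "rescale e f \<in> L2 \<Omega>" "has_weak_deriv \<Omega> e3 (rescale e f) (wderiv \<Omega> e3 (rescale e f))"
    "wderiv \<Omega> e3 (rescale e f) \<in> L2 \<Omega>"
proof -
  note W = H1_wderiv[OF assms e3_Basis thin.open_dom]
  note R = rescale_has_weak_deriv[OF H1_L2[OF assms] W(2,1)]
  show "AE z in lebesgue_on \<Omega>. rescale e (wderiv \<Omega>e e3 f) z = wderiv \<Omega> e3 (rescale e f) z / e"
    using wderiv_AE_eq[OF R open_dom] by eventually_elim (use e_pos in simp)
  show "rescale e f \<in> L2 \<Omega>" by (rule rescale_L2[OF H1_L2[OF assms]])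
  show "has_weak_deriv \<Omega> e3 (rescale e f) (wderiv \<Omega> e3 (rescale e f))" by (rule has_weak_deriv_wderiv[OF R])
  show "wderiv \<Omega> e3 (rescale e f) \<in> L2 \<Omega>" by (rule wderiv_L2[OF R open_dom]) (intro L2_cmult rescale_L2 W)
qed

lemma scale_vertical_derivative:
  assumes "f \<in> H1 \<Omega>e"
  shows "(LINT x|lebesgue_on \<Omega>e. wderiv \<Omega>e e3 f x * thin_test \<phi> x) = (LINT z|lebesgue_on \<Omega>. wderiv \<Omega> e3 (rescale e f) z * \<phi> z)"
proof -
  have "(LINT x|lebesgue_on \<Omega>e. wderiv \<Omega>e e3 f x * thin_test \<phi> x) = e * (LINT z|lebesgue_on \<Omega>. rescale e (wderiv \<Omega>e e3 f) z * \<phi> z)"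
    unfolding scale_integral(2) rescale_mult rescale_thin_test ..
  also have "(LINT z|lebesgue_on \<Omega>. rescale e (wderiv \<Omega>e e3 f) z * \<phi> z) = (LINT z|lebesgue_on \<Omega>. (wderiv \<Omega> e3 (rescale e f) z * \<phi> z) / e)"
    by (rule integral_lebesgue_on_cong_AE[OF eventually_mono[OF rescale_wderiv(1)[OF assms]]]) auto
  finally show ?thesis using e_pos by simp
qed

lemma scale_mult_test:
  "(LINT x|lebesgue_on \<Omega>e. f x * thin_test \<phi> x) = e * (LINT z|lebesgue_on \<Omega>. rescale e f z * \<phi> z)"
  unfolding scale_integral(2) rescale_mult rescale_thin_test ..

lemma scale_mult_pderiv_e3:
  assumes "smooth \<phi>"
  shows "(LINT x|lebesgue_on \<Omega>e. f x * pderiv_at e3 (thin_test \<phi>) x) = (LINT z|lebesgue_on \<Omega>. rescale e f z * pderiv_at e3 \<phi> z)"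
  unfolding pderiv_at_thin_test_e3[OF assms] using scale_mult_test[of f "pderiv_at e3 \<phi>"] e_pos by simp

lemma scale_vertical_parts:
  assumes "f \<in> H1 \<Omega>e" "smooth \<phi>"
  shows "(LINT x|lebesgue_on \<Omega>e. f x * pderiv_at e3 (thin_test \<phi>) x) + (LINT x|lebesgue_on \<Omega>e. wderiv \<Omega>e e3 f x * thin_test \<phi> x)
    = (LINT z|lebesgue_on \<Omega>. rescale e f z * pderiv_at e3 \<phi> z) + (LINT z|lebesgue_on \<Omega>. wderiv \<Omega> e3 (rescale e f) z * \<phi> z)"
  unfolding scale_vertical_derivative[OF assms(1)] scale_mult_pderiv_e3[OF assms(2)] ..

lemma scale_test_rot:
  assumes "smooth \<phi>"
  shows "rescale e (\<lambda>x. (test_rot (thin_test \<phi>) v x + test_rot_z3 (thin_test \<phi>) v x) \<bullet> w x)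
    = (\<lambda>z. (test_rot \<phi> v z + (1 / e) *\<^sub>R test_rot_z3 \<phi> v z) \<bullet> rescale e w z)"
proof -
  have "pderiv_at e1 (thin_test \<phi>) = thin_test (pderiv_at e1 \<phi>)" "pderiv_at e2 (thin_test \<phi>) = thin_test (pderiv_at e2 \<phi>)"
    unfolding pderiv_at_thin_test[OF assms] by (simp_all add: e1_def e2_def)
  then show ?thesis
    using e_pos unfolding test_rot_def test_rot_z3_def pderiv_at_thin_test_e3[OF assms]
    by (auto simp: rescale_eq thin_test_def fun_eq_iff)
qed

text \<open>Each volume integral contributes a factor e and each vertical derivative a factor 1 / e,
  while the bottom term is scale invariant. Multiplication by e normalises the vertical diffusion to
  coefficient 1 and leaves the friction term with B e.\<close>

lemma scale_momentum:
  assumes u: "u \<in> V_space \<omega> (\<lambda>x'. e * h x')" and \<phi>: "\<phi> \<in> test_functions below_top" and v: "v \<in> Basis"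
    and 0: "\<And>x'. (v \<bullet> e3) * \<phi> (x', 0) = 0"
    and eq: "\<And>\<psi>. \<psi> \<in> V_space \<omega> (\<lambda>x'. e * h x') \<Longrightarrow>
      (LINT x|lebesgue_on \<Omega>e. wgrad_inner \<Omega>e u \<psi> x) - (LINT x|lebesgue_on \<Omega>e. p x * wdiv \<Omega>e \<psi> x)
      - C * (LINT x|lebesgue_on \<Omega>e. wrot \<Omega>e \<psi> x \<bullet> w x)
      + B * (LINT x'|lebesgue_on \<omega>. (\<Sum>i\<in>Basis. bot_trace \<omega> \<Omega>e (\<lambda>x. fst (u x) \<bullet> i) x' * bot_trace \<omega> \<Omega>e (\<lambda>x. fst (\<psi> x) \<bullet> i) x'))
      = (LINT x|lebesgue_on \<Omega>e. f (fst x) \<bullet> fst (\<psi> x))"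
  shows "- e\<^sup>2 * (\<Sum>i\<in>Basis. LINT z|lebesgue_on \<Omega>. (rescale e u z \<bullet> v) * pderiv_at (i, 0) (pderiv_at (i, 0) \<phi>) z)
    + (LINT z|lebesgue_on \<Omega>. wderiv \<Omega> e3 (\<lambda>z. rescale e u z \<bullet> v) z * pderiv_at e3 \<phi> z)
    - e\<^sup>2 * (LINT z|lebesgue_on \<Omega>. rescale e p z * pderiv_at (fst v, snd v / e) \<phi> z)
    - C * e\<^sup>2 * (LINT z|lebesgue_on \<Omega>. (test_rot \<phi> v z + (1 / e) *\<^sub>R test_rot_z3 \<phi> v z) \<bullet> rescale e w z)
    - B * e * (\<Sum>i\<in>Basis. (fst v \<bullet> i) * ((LINT z|lebesgue_on \<Omega>. (rescale e u z \<bullet> (i, 0)) * pderiv_at e3 \<phi> z)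
          + (LINT z|lebesgue_on \<Omega>. wderiv \<Omega> e3 (\<lambda>z. rescale e u z \<bullet> (i, 0)) z * \<phi> z)))
    = e\<^sup>2 * (LINT z|lebesgue_on \<Omega>. (f (fst z) \<bullet> fst v) * \<phi> z)"
proof -
  note sm = test_functions_smooth[OF \<phi>]
  have H: "(\<lambda>x. u x \<bullet> i) \<in> H1 \<Omega>e" if "i \<in> Basis" for i
    using u that by (auto simp: V_space_def dest!: H1_vanishing_on_H1)
  have r: "rescale e (\<lambda>x. u x \<bullet> i) = (\<lambda>z. rescale e u z \<bullet> i)" for i by (auto simp: rescale_eq fun_eq_iff)
  have thin0: "(v \<bullet> e3) * thin_test \<phi> (x', 0) = 0" for x' using 0 by (simp add: thin_test_def)
  have a: "(LINT x|lebesgue_on \<Omega>e. (u x \<bullet> v) * pderiv_at (i, 0) (pderiv_at (i, 0) (thin_test \<phi>)) x)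
      = e * (LINT z|lebesgue_on \<Omega>. (rescale e u z \<bullet> v) * pderiv_at (i, 0) (pderiv_at (i, 0) \<phi>) z)" for i
  proof -
    have "pderiv_at (i, 0) (pderiv_at (i, 0) (thin_test \<phi>)) = thin_test (pderiv_at (i, 0) (pderiv_at (i, 0) \<phi>))"
      using pderiv_at_thin_test[OF sm, of "(i, 0)"] pderiv_at_thin_test[OF smooth_pderiv_at[OF sm], of "(i, 0)" "(i, 0)"]
      by simp
    then show ?thesis using scale_mult_test by (simp add: r)
  qed
  have b: "(LINT x|lebesgue_on \<Omega>e. wderiv \<Omega>e e3 (\<lambda>x. u x \<bullet> v) x * pderiv_at e3 (thin_test \<phi>) x)
      = (LINT z|lebesgue_on \<Omega>. wderiv \<Omega> e3 (\<lambda>z. rescale e u z \<bullet> v) z * pderiv_at e3 \<phi> z) / e"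
    unfolding pderiv_at_thin_test_e3[OF sm] using scale_vertical_derivative[OF H[OF v], of "pderiv_at e3 \<phi>"] by (simp add: r)
  have c: "(LINT x|lebesgue_on \<Omega>e. p x * pderiv_at v (thin_test \<phi>) x)
      = e * (LINT z|lebesgue_on \<Omega>. rescale e p z * pderiv_at (fst v, snd v / e) \<phi> z)"
    unfolding pderiv_at_thin_test[OF sm] by (rule scale_mult_test)
  have d: "(LINT x|lebesgue_on \<Omega>e. (test_rot (thin_test \<phi>) v x + test_rot_z3 (thin_test \<phi>) v x) \<bullet> w x)
      = e * (LINT z|lebesgue_on \<Omega>. (test_rot \<phi> v z + (1 / e) *\<^sub>R test_rot_z3 \<phi> v z) \<bullet> rescale e w z)"
    unfolding scale_integral(2) scale_test_rot[OF sm] ..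
  have b': "(\<Sum>i\<in>Basis. (fst v \<bullet> i) * ((LINT x|lebesgue_on \<Omega>e. (u x \<bullet> (i, 0)) * pderiv_at e3 (thin_test \<phi>) x)
          + (LINT x|lebesgue_on \<Omega>e. wderiv \<Omega>e e3 (\<lambda>x. u x \<bullet> (i, 0)) x * thin_test \<phi> x)))
      = (\<Sum>i\<in>Basis. (fst v \<bullet> i) * ((LINT z|lebesgue_on \<Omega>. (rescale e u z \<bullet> (i, 0)) * pderiv_at e3 \<phi> z)
          + (LINT z|lebesgue_on \<Omega>. wderiv \<Omega> e3 (\<lambda>z. rescale e u z \<bullet> (i, 0)) z * \<phi> z)))"
    by (intro sum.cong refl) (simp add: scale_vertical_parts[OF H[OF horizontal_Basis] sm] r)
  have f: "(LINT x|lebesgue_on \<Omega>e. (f (fst x) \<bullet> fst v) * thin_test \<phi> x) = e * (LINT z|lebesgue_on \<Omega>. (f (fst z) \<bullet> fst v) * \<phi> z)"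
    unfolding scale_mult_test by (simp add: rescale_eq)
  from thin.momentum_tested[OF u thin_test_below_top[OF \<phi>] v thin0 eq]
  have "e * (- (\<Sum>i\<in>Basis. LINT x|lebesgue_on \<Omega>e. (u x \<bullet> v) * pderiv_at (i, 0) (pderiv_at (i, 0) (thin_test \<phi>)) x)
    + (LINT x|lebesgue_on \<Omega>e. wderiv \<Omega>e e3 (\<lambda>x. u x \<bullet> v) x * pderiv_at e3 (thin_test \<phi>) x)
    - (LINT x|lebesgue_on \<Omega>e. p x * pderiv_at v (thin_test \<phi>) x)
    - C * (LINT x|lebesgue_on \<Omega>e. (test_rot (thin_test \<phi>) v x + test_rot_z3 (thin_test \<phi>) v x) \<bullet> w x)
    - B * (\<Sum>i\<in>Basis. (fst v \<bullet> i) * ((LINT x|lebesgue_on \<Omega>e. (u x \<bullet> (i, 0)) * pderiv_at e3 (thin_test \<phi>) x)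
          + (LINT x|lebesgue_on \<Omega>e. wderiv \<Omega>e e3 (\<lambda>x. u x \<bullet> (i, 0)) x * thin_test \<phi> x))))
    = e * (LINT x|lebesgue_on \<Omega>e. (f (fst x) \<bullet> fst v) * thin_test \<phi> x)" by simp
  then show ?thesis
    unfolding a b c d b' f sum_distrib_left[symmetric] using e_pos by (simp add: algebra_simps power2_eq_square)
qed

lemma scale_spin:
  assumes w: "\<And>i. i \<in> Basis \<Longrightarrow> (\<lambda>x. w x \<bullet> i) \<in> H10 \<Omega>e" and \<phi>: "\<phi> \<in> test_functions \<Omega>" and v: "v \<in> Basis"
    and eq: "\<And>\<psi>. (\<And>i. i \<in> Basis \<Longrightarrow> (\<lambda>x. \<psi> x \<bullet> i) \<in> H10 \<Omega>e) \<Longrightarrow>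
      e\<^sup>2 * A * (LINT x|lebesgue_on \<Omega>e. wgrad_inner \<Omega>e w \<psi> x) + C * (LINT x|lebesgue_on \<Omega>e. w x \<bullet> \<psi> x)
      - D * (LINT x|lebesgue_on \<Omega>e. u x \<bullet> wrot \<Omega>e \<psi> x) = e * (LINT x|lebesgue_on \<Omega>e. g (fst x) \<bullet> fst (\<psi> x))"
  shows "- A * e\<^sup>2 * (\<Sum>i\<in>Basis. LINT z|lebesgue_on \<Omega>. (rescale e w z \<bullet> v) * pderiv_at (i, 0) (pderiv_at (i, 0) \<phi>) z)
    + A * (LINT z|lebesgue_on \<Omega>. wderiv \<Omega> e3 (\<lambda>z. rescale e w z \<bullet> v) z * pderiv_at e3 \<phi> z)
    + C * (LINT z|lebesgue_on \<Omega>. (rescale e w z \<bullet> v) * \<phi> z)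
    - D * (LINT z|lebesgue_on \<Omega>. (test_rot \<phi> v z + (1 / e) *\<^sub>R test_rot_z3 \<phi> v z) \<bullet> rescale e u z)
    = e * (LINT z|lebesgue_on \<Omega>. (g (fst z) \<bullet> fst v) * \<phi> z)"
proof -
  note sm = test_functions_smooth[OF \<phi>]
  have H: "(\<lambda>x. w x \<bullet> i) \<in> H1 \<Omega>e" if "i \<in> Basis" for i by (rule H10_H1[OF w[OF that]])
  have r: "rescale e (\<lambda>x. w x \<bullet> i) = (\<lambda>z. rescale e w z \<bullet> i)" for i by (auto simp: rescale_eq fun_eq_iff)
  have a: "(LINT x|lebesgue_on \<Omega>e. (w x \<bullet> v) * pderiv_at (i, 0) (pderiv_at (i, 0) (thin_test \<phi>)) x)
      = e * (LINT z|lebesgue_on \<Omega>. (rescale e w z \<bullet> v) * pderiv_at (i, 0) (pderiv_at (i, 0) \<phi>) z)" for i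
  proof -
    have "pderiv_at (i, 0) (pderiv_at (i, 0) (thin_test \<phi>)) = thin_test (pderiv_at (i, 0) (pderiv_at (i, 0) \<phi>))"
      using pderiv_at_thin_test[OF sm, of "(i, 0)"] pderiv_at_thin_test[OF smooth_pderiv_at[OF sm], of "(i, 0)" "(i, 0)"]
      by simp
    then show ?thesis using scale_mult_test by (simp add: r)
  qed
  have b: "(LINT x|lebesgue_on \<Omega>e. wderiv \<Omega>e e3 (\<lambda>x. w x \<bullet> v) x * pderiv_at e3 (thin_test \<phi>) x)
      = (LINT z|lebesgue_on \<Omega>. wderiv \<Omega> e3 (\<lambda>z. rescale e w z \<bullet> v) z * pderiv_at e3 \<phi> z) / e"
    unfolding pderiv_at_thin_test_e3[OF sm] using scale_vertical_derivative[OF H[OF v], of "pderiv_at e3 \<phi>"] by (simp add: r)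
  have c: "(LINT x|lebesgue_on \<Omega>e. (w x \<bullet> v) * thin_test \<phi> x) = e * (LINT z|lebesgue_on \<Omega>. (rescale e w z \<bullet> v) * \<phi> z)"
    using scale_mult_test by (simp add: r)
  have d: "(LINT x|lebesgue_on \<Omega>e. (test_rot (thin_test \<phi>) v x + test_rot_z3 (thin_test \<phi>) v x) \<bullet> u x)
      = e * (LINT z|lebesgue_on \<Omega>. (test_rot \<phi> v z + (1 / e) *\<^sub>R test_rot_z3 \<phi> v z) \<bullet> rescale e u z)"
    unfolding scale_integral(2) scale_test_rot[OF sm] ..
  have f: "(LINT x|lebesgue_on \<Omega>e. (g (fst x) \<bullet> fst v) * thin_test \<phi> x) = e * (LINT z|lebesgue_on \<Omega>. (g (fst z) \<bullet> fst v) * \<phi> z)"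
    unfolding scale_mult_test by (simp add: rescale_eq)
  \<comment> \<open>Every term contains one factor e, the vertical diffusion in the form e^2 / e; it
    is divided out.\<close>
  have cancel: "- A * e\<^sup>2 * S + A * X + C * s - D * t = e * F"
    if "e\<^sup>2 * A * (- (e * S) + X / e) + C * (e * s) - D * (e * t) = e * (e * F)" for S X s t F
  proof -
    have "(e * e) * (- A * e\<^sup>2 * S + A * X + C * s - D * t) = (e * e) * (e * F)"
      using that e_pos by (simp add: field_simps power2_eq_square)
    then show ?thesis using e_pos by simp
  qed
  show ?thesis
    using thin.spin_tested[OF w thin_test_dom[OF \<phi>] v eq]
    unfolding a b c d f sum_distrib_left[symmetric] by (rule cancel)
qed

lemma scale_divergence:
  assumes u: "u \<in> V0_space \<omega> (\<lambda>x'. e * h x')" and \<phi>: "\<phi> \<in> test_functions \<Omega>"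
  shows "e * (\<Sum>i\<in>Basis. LINT z|lebesgue_on \<Omega>. (rescale e u z \<bullet> (i, 0)) * pderiv_at (i, 0) \<phi> z)
    + (LINT z|lebesgue_on \<Omega>. (rescale e u z \<bullet> e3) * pderiv_at e3 \<phi> z) = 0"
proof -
  note sm = test_functions_smooth[OF \<phi>]
  have r: "rescale e (\<lambda>x. u x \<bullet> i) = (\<lambda>z. rescale e u z \<bullet> i)" for i by (auto simp: rescale_eq fun_eq_iff)
  have "(LINT x|lebesgue_on \<Omega>e. (u x \<bullet> (i, 0)) * pderiv_at (i, 0) (thin_test \<phi>) x)
      = e * (LINT z|lebesgue_on \<Omega>. (rescale e u z \<bullet> (i, 0)) * pderiv_at (i, 0) \<phi> z)" for i
    unfolding pderiv_at_thin_test[OF sm] using scale_mult_test by (simp add: r)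
  then show ?thesis
    using thin.divergence_tested[OF u thin_test_dom[OF \<phi>]] scale_mult_pderiv_e3[OF sm, of "\<lambda>x. u x \<bullet> e3"]
    by (simp add: sum_Basis_R3 r sum_distrib_left)
qed

lemma scale_flux:
  assumes u: "u \<in> V0_space \<omega> (\<lambda>x'. e * h x')" and \<theta>: "\<theta> \<in> H1 \<omega>"
  shows "(\<Sum>i\<in>Basis. LINT z|lebesgue_on \<Omega>. (rescale e u z \<bullet> (i, 0)) * wderiv \<omega> i \<theta> (fst z)) = 0"
proof -
  have "rescale e (\<lambda>z. (u z \<bullet> (i, 0)) * wderiv \<omega> i \<theta> (fst z)) = (\<lambda>z. (rescale e u z \<bullet> (i, 0)) * wderiv \<omega> i \<theta> (fst z))" for i
    by (auto simp: rescale_eq fun_eq_iff)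
  then show ?thesis
    using thin.divergence_free_flux[OF u \<theta>] e_pos unfolding scale_integral(2)
    by (simp add: sum_distrib_left[symmetric])
qed

lemma scale_top:
  assumes "f \<in> H1_vanishing_on \<Omega>e (\<Gamma>_top \<omega> (\<lambda>x'. e * h x') \<union> \<Gamma>_lat \<omega> (\<lambda>x'. e * h x'))"
    and \<phi>: "\<phi> \<in> test_functions (\<omega> \<times> {0<..})"
  shows "(LINT z|lebesgue_on \<Omega>. rescale e f z * pderiv_at e3 \<phi> z) + (LINT z|lebesgue_on \<Omega>. wderiv \<Omega> e3 (rescale e f) z * \<phi> z) = 0"
proof -
  have "thin_test \<phi> \<in> test_functions (\<omega> \<times> {0<..})"
    using \<phi> by (rule thin_test_functions) (use e_pos in auto)
  from thin.vanishing_top_parts[OF assms(1) this] show ?thesis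
    unfolding scale_vertical_parts[OF H1_vanishing_on_H1[OF assms(1)] test_functions_smooth[OF \<phi>]] .
qed

lemma scale_H10:
  assumes "f \<in> H10 \<Omega>e" "smooth \<phi>"
  shows "(LINT z|lebesgue_on \<Omega>. rescale e f z * pderiv_at e3 \<phi> z) + (LINT z|lebesgue_on \<Omega>. wderiv \<Omega> e3 (rescale e f) z * \<phi> z) = 0"
  using thin.H10_vertical_parts[OF assms(1) smooth_thin_test[OF assms(2)]]
  unfolding scale_vertical_parts[OF H10_H1[OF assms(1)] assms(2)] .

end

subsection \<open>Weak convergence\<close>

context column_domain begin

lemma V_z3_wderiv:
  assumes "f \<in> V_z3 \<Omega>"
  shows "f \<in> L2 \<Omega>" "has_weak_deriv \<Omega> e3 f (wderiv \<Omega> e3 f)" "wderiv \<Omega> e3 f \<in> L2 \<Omega>"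
  using assms has_weak_deriv_wderiv wderiv_L2 open_dom unfolding V_z3_def by blast+

lemma wderiv_linear:
  assumes "f \<in> V_z3 \<Omega>" "g \<in> V_z3 \<Omega>"
  shows "AE z in lebesgue_on \<Omega>. wderiv \<Omega> e3 (\<lambda>z. a * f z + b * g z) z = a * wderiv \<Omega> e3 f z + b * wderiv \<Omega> e3 g z"
  by (rule wderiv_AE_eq[OF has_weak_deriv_linear[OF V_z3_wderiv(2)[OF assms(1)] V_z3_wderiv(2)[OF assms(2)] lebesgue_dom(1)] open_dom])

text \<open>Weak convergence is tested with all bounded functionals on \<open>V_z3\<close>. These
  two kinds, pairing a function or its vertical derivative with a square-integrable weight, are the
  ones used to pass to the limit.\<close>

lemma V_z3_dualI:
  assumes m: "m \<in> L2 \<Omega>"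
  shows "(\<lambda>f. LINT z|lebesgue_on \<Omega>. f z * m z) \<in> V_z3_dual \<Omega>"
    and "(\<lambda>f. LINT z|lebesgue_on \<Omega>. wderiv \<Omega> e3 f z * m z) \<in> V_z3_dual \<Omega>"
proof -
  let ?C = "sqrt (LINT z|lebesgue_on \<Omega>. (m z)\<^sup>2)"
  have C: "0 \<le> ?C" by simp
  have norm: "sqrt (LINT z|lebesgue_on \<Omega>. (f z)\<^sup>2) \<le> V_z3_norm \<Omega> f"
    "sqrt (LINT z|lebesgue_on \<Omega>. (wderiv \<Omega> e3 f z)\<^sup>2) \<le> V_z3_norm \<Omega> f" for f
    unfolding V_z3_norm_def by simp_all
  show "(\<lambda>f. LINT z|lebesgue_on \<Omega>. f z * m z) \<in> V_z3_dual \<Omega>"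
    unfolding V_z3_dual_def
  proof (intro CollectI conjI ballI allI exI[of _ ?C])
    fix f assume f: "f \<in> V_z3 \<Omega>"
    show "\<bar>LINT z|lebesgue_on \<Omega>. f z * m z\<bar> \<le> ?C * V_z3_norm \<Omega> f"
      using L2_Cauchy_Schwarz[OF V_z3_wderiv(1)[OF f] m] mult_left_mono[OF norm(1)[of f] C] by (simp add: mult.commute)
    fix g a b assume g: "g \<in> V_z3 \<Omega>"
    show "(LINT z|lebesgue_on \<Omega>. (a * f z + b * g z) * m z)
        = a * (LINT z|lebesgue_on \<Omega>. f z * m z) + b * (LINT z|lebesgue_on \<Omega>. g z * m z)"
      using L2_mult_integrable[OF V_z3_wderiv(1)[OF f] m] L2_mult_integrable[OF V_z3_wderiv(1)[OF g] m]
      by (simp add: distrib_right mult.assoc)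
  qed
  show "(\<lambda>f. LINT z|lebesgue_on \<Omega>. wderiv \<Omega> e3 f z * m z) \<in> V_z3_dual \<Omega>"
    unfolding V_z3_dual_def
  proof (intro CollectI conjI ballI allI exI[of _ ?C])
    fix f assume f: "f \<in> V_z3 \<Omega>"
    show "\<bar>LINT z|lebesgue_on \<Omega>. wderiv \<Omega> e3 f z * m z\<bar> \<le> ?C * V_z3_norm \<Omega> f"
      using L2_Cauchy_Schwarz[OF V_z3_wderiv(3)[OF f] m] mult_left_mono[OF norm(2)[of f] C] by (simp add: mult.commute)
    fix g a b assume g: "g \<in> V_z3 \<Omega>"
    have "(LINT z|lebesgue_on \<Omega>. wderiv \<Omega> e3 (\<lambda>z. a * f z + b * g z) z * m z)
        = (LINT z|lebesgue_on \<Omega>. (a * wderiv \<Omega> e3 f z + b * wderiv \<Omega> e3 g z) * m z)"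
      by (rule integral_lebesgue_on_cong_AE[OF eventually_mono[OF wderiv_linear[OF f g]]]) auto
    then show "(LINT z|lebesgue_on \<Omega>. wderiv \<Omega> e3 (\<lambda>z. a * f z + b * g z) z * m z)
        = a * (LINT z|lebesgue_on \<Omega>. wderiv \<Omega> e3 f z * m z) + b * (LINT z|lebesgue_on \<Omega>. wderiv \<Omega> e3 g z * m z)"
      using L2_mult_integrable[OF V_z3_wderiv(3)[OF f] m] L2_mult_integrable[OF V_z3_wderiv(3)[OF g] m]
      by (simp add: distrib_right mult.assoc)
  qed
qed

lemma weak_limit:
  assumes "V_z3_weak_tendsto \<Omega> F f" "m \<in> L2 \<Omega>"
  shows "(\<lambda>n. LINT z|lebesgue_on \<Omega>. F n z * m z) \<longlonglongrightarrow> (LINT z|lebesgue_on \<Omega>. f z * m z)"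
    and "(\<lambda>n. LINT z|lebesgue_on \<Omega>. wderiv \<Omega> e3 (F n) z * m z) \<longlonglongrightarrow> (LINT z|lebesgue_on \<Omega>. wderiv \<Omega> e3 f z * m z)"
proof -
  have *: "(\<lambda>n. l (F n)) \<longlonglongrightarrow> l f" if "l \<in> V_z3_dual \<Omega>" for l
    using assms(1) that unfolding V_z3_weak_tendsto_def by blast
  from *[OF V_z3_dualI(1)[OF assms(2)]] *[OF V_z3_dualI(2)[OF assms(2)]]
  show "(\<lambda>n. LINT z|lebesgue_on \<Omega>. F n z * m z) \<longlonglongrightarrow> (LINT z|lebesgue_on \<Omega>. f z * m z)"
    "(\<lambda>n. LINT z|lebesgue_on \<Omega>. wderiv \<Omega> e3 (F n) z * m z) \<longlonglongrightarrow> (LINT z|lebesgue_on \<Omega>. wderiv \<Omega> e3 f z * m z)"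
    by simp_all
qed

lemma smooth_dom_L2: "smooth \<phi> \<Longrightarrow> \<phi> \<in> L2 \<Omega>"
  by (intro smooth_L2 bounded_dom lebesgue_dom)

lemma weak_limit_vector:
  assumes A: "\<And>i. i \<in> Basis \<Longrightarrow> V_z3_weak_tendsto \<Omega> (\<lambda>n z. A n z \<bullet> i) (\<lambda>z. a z \<bullet> i)"
    and R: "\<And>i. i \<in> Basis \<Longrightarrow> (\<lambda>z. R z \<bullet> i) \<in> L2 \<Omega>"
  shows "integrable (lebesgue_on \<Omega>) (\<lambda>z. R z \<bullet> A n z)"
    and "(\<lambda>n. LINT z|lebesgue_on \<Omega>. R z \<bullet> A n z) \<longlonglongrightarrow> (LINT z|lebesgue_on \<Omega>. R z \<bullet> a z)"
proof -
  have V: "(\<lambda>z. A n z \<bullet> i) \<in> V_z3 \<Omega>" "(\<lambda>z. a z \<bullet> i) \<in> V_z3 \<Omega>" if "i \<in> Basis" for i n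
    using A[OF that] by (auto simp: V_z3_weak_tendsto_def)
  have eq: "(\<lambda>z. R z \<bullet> A n z) = (\<lambda>z. \<Sum>i\<in>Basis. (A n z \<bullet> i) * (R z \<bullet> i))"
    "(\<lambda>z. R z \<bullet> a z) = (\<lambda>z. \<Sum>i\<in>Basis. (a z \<bullet> i) * (R z \<bullet> i))" for n
    by (subst euclidean_inner, simp add: mult.commute)+
  have int: "integrable (lebesgue_on \<Omega>) (\<lambda>z. (A n z \<bullet> i) * (R z \<bullet> i))"
    "integrable (lebesgue_on \<Omega>) (\<lambda>z. (a z \<bullet> i) * (R z \<bullet> i))" if "i \<in> Basis" for i n
    by (intro L2_mult_integrable V_z3_wderiv(1) V that R)+
  show "integrable (lebesgue_on \<Omega>) (\<lambda>z. R z \<bullet> A n z)"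
    unfolding eq using int by (intro Bochner_Integration.integrable_sum)
  have "(\<lambda>n. \<Sum>i\<in>Basis. LINT z|lebesgue_on \<Omega>. (A n z \<bullet> i) * (R z \<bullet> i)) \<longlonglongrightarrow> (\<Sum>i\<in>Basis. LINT z|lebesgue_on \<Omega>. (a z \<bullet> i) * (R z \<bullet> i))"
    by (intro tendsto_sum weak_limit(1)[OF A] R)
  then show "(\<lambda>n. LINT z|lebesgue_on \<Omega>. R z \<bullet> A n z) \<longlonglongrightarrow> (LINT z|lebesgue_on \<Omega>. R z \<bullet> a z)"
    unfolding eq using int by (simp add: Bochner_Integration.integral_sum)
qed

end

section \<open>Passage to the limit in the rescaled equations\<close>

lemma test_rot_smooth:
  assumes "smooth \<phi>"
  shows "smooth (\<lambda>z. test_rot \<phi> v z \<bullet> i)" "smooth (\<lambda>z. test_rot_z3 \<phi> v z \<bullet> i)"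
  unfolding test_rot_def test_rot_z3_def inner_add_left inner_diff_left inner_scaleR_left
  by (intro smooth_add smooth_diff smooth_mult smooth_const smooth_pderiv_at assms)+

locale thin_film_limit = column_domain +
  fixes N Rc lam \<gamma> :: real and f g :: "R2 \<Rightarrow> R2"
    and u\<epsilon> w\<epsilon> :: "real \<Rightarrow> R3 \<Rightarrow> R3" and p\<epsilon> :: "real \<Rightarrow> R3 \<Rightarrow> real"
    and \<epsilon> :: "nat \<Rightarrow> real" and u w :: "R3 \<Rightarrow> R3" and p :: "R3 \<Rightarrow> real"
  assumes lam_pos: "0 < lam" and Rc_pos: "0 < Rc"
    and f_L2: "i \<in> Basis \<Longrightarrow> (\<lambda>x'. f x' \<bullet> i) \<in> L2 \<omega>" and g_L2: "i \<in> Basis \<Longrightarrow> (\<lambda>x'. g x' \<bullet> i) \<in> L2 \<omega>"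
    and solution: "0 < e \<Longrightarrow> micropolar_solution \<omega> h N Rc lam \<gamma> f g e (u\<epsilon> e) (w\<epsilon> e) (p\<epsilon> e)"
    and eps_pos: "0 < \<epsilon> n" and eps_lim: "\<epsilon> \<longlonglongrightarrow> 0"
    and triplet: "limit_triplet \<omega> h \<epsilon> u\<epsilon> w\<epsilon> p\<epsilon> u w p"
begin

lemma thin_domain: "thin_column_domain \<omega> h hmin hmax (\<epsilon> n)"
  by unfold_locales (rule eps_pos)

definition U :: "nat \<Rightarrow> R3 \<Rightarrow> R3" where "U n z = (1 / (\<epsilon> n)\<^sup>2) *\<^sub>R rescale (\<epsilon> n) (u\<epsilon> (\<epsilon> n)) z"
definition W :: "nat \<Rightarrow> R3 \<Rightarrow> R3" where "W n z = (1 / \<epsilon> n) *\<^sub>R rescale (\<epsilon> n) (w\<epsilon> (\<epsilon> n)) z"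
definition P :: "nat \<Rightarrow> R3 \<Rightarrow> real" where "P n = rescale (\<epsilon> n) (p\<epsilon> (\<epsilon> n))"

lemma U_lim: "i \<in> Basis \<Longrightarrow> V_z3_weak_tendsto \<Omega> (\<lambda>n z. U n z \<bullet> i) (\<lambda>z. u z \<bullet> i)"
  and W_lim: "i \<in> Basis \<Longrightarrow> V_z3_weak_tendsto \<Omega> (\<lambda>n z. W n z \<bullet> i) (\<lambda>z. w z \<bullet> i)"
  and P_lim: "L2_tendsto \<Omega> P p"
  using triplet unfolding limit_triplet_def Let_def U_def W_def P_def[abs_def] by simp_all

lemma U_V_z3: "i \<in> Basis \<Longrightarrow> (\<lambda>z. U n z \<bullet> i) \<in> V_z3 \<Omega>" "i \<in> Basis \<Longrightarrow> (\<lambda>z. u z \<bullet> i) \<in> V_z3 \<Omega>"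
  and W_V_z3: "i \<in> Basis \<Longrightarrow> (\<lambda>z. W n z \<bullet> i) \<in> V_z3 \<Omega>" "i \<in> Basis \<Longrightarrow> (\<lambda>z. w z \<bullet> i) \<in> V_z3 \<Omega>"
  using U_lim W_lim unfolding V_z3_weak_tendsto_def by blast+

lemma rescale_u: "rescale (\<epsilon> n) (u\<epsilon> (\<epsilon> n)) z = (\<epsilon> n)\<^sup>2 *\<^sub>R U n z"
  and rescale_w: "rescale (\<epsilon> n) (w\<epsilon> (\<epsilon> n)) z = \<epsilon> n *\<^sub>R W n z"
  using eps_pos[of n] by (simp_all add: U_def W_def)

lemma wderiv_rescale_u:
  assumes "i \<in> Basis"
  shows "(LINT z|lebesgue_on \<Omega>. wderiv \<Omega> e3 (\<lambda>z. rescale (\<epsilon> n) (u\<epsilon> (\<epsilon> n)) z \<bullet> i) z * m z)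
    = (\<epsilon> n)\<^sup>2 * (LINT z|lebesgue_on \<Omega>. wderiv \<Omega> e3 (\<lambda>z. U n z \<bullet> i) z * m z)"
proof -
  have "AE z in lebesgue_on \<Omega>. wderiv \<Omega> e3 (\<lambda>z. (\<epsilon> n)\<^sup>2 * (U n z \<bullet> i)) z = (\<epsilon> n)\<^sup>2 * wderiv \<Omega> e3 (\<lambda>z. U n z \<bullet> i) z"
    using wderiv_linear[OF U_V_z3(1)[OF assms] U_V_z3(1)[OF assms], where a = "(\<epsilon> n)\<^sup>2" and b = 0] by simp
  then have "AE z in lebesgue_on \<Omega>. wderiv \<Omega> e3 (\<lambda>z. (\<epsilon> n)\<^sup>2 * (U n z \<bullet> i)) z * m z
      = (\<epsilon> n)\<^sup>2 * (wderiv \<Omega> e3 (\<lambda>z. U n z \<bullet> i) z * m z)"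
    by eventually_elim simp
  from integral_lebesgue_on_cong_AE[OF this lebesgue_dom(1)] show ?thesis by (simp add: rescale_u)
qed

lemma wderiv_rescale_w:
  assumes "i \<in> Basis"
  shows "(LINT z|lebesgue_on \<Omega>. wderiv \<Omega> e3 (\<lambda>z. rescale (\<epsilon> n) (w\<epsilon> (\<epsilon> n)) z \<bullet> i) z * m z)
    = \<epsilon> n * (LINT z|lebesgue_on \<Omega>. wderiv \<Omega> e3 (\<lambda>z. W n z \<bullet> i) z * m z)"
proof -
  have "AE z in lebesgue_on \<Omega>. wderiv \<Omega> e3 (\<lambda>z. \<epsilon> n * (W n z \<bullet> i)) z = \<epsilon> n * wderiv \<Omega> e3 (\<lambda>z. W n z \<bullet> i) z"
    using wderiv_linear[OF W_V_z3(1)[OF assms] W_V_z3(1)[OF assms], where a = "\<epsilon> n" and b = 0] by simp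
  then have "AE z in lebesgue_on \<Omega>. wderiv \<Omega> e3 (\<lambda>z. \<epsilon> n * (W n z \<bullet> i)) z * m z
      = \<epsilon> n * (wderiv \<Omega> e3 (\<lambda>z. W n z \<bullet> i) z * m z)"
    by eventually_elim simp
  from integral_lebesgue_on_cong_AE[OF this lebesgue_dom(1)] show ?thesis by (simp add: rescale_w)
qed

lemma solution_V0: "u\<epsilon> (\<epsilon> n) \<in> V0_space \<omega> (\<lambda>x'. \<epsilon> n * h x')"
  and solution_H10: "i \<in> Basis \<Longrightarrow> (\<lambda>x. w\<epsilon> (\<epsilon> n) x \<bullet> i) \<in> H10 (dom_under \<omega> (\<lambda>x'. \<epsilon> n * h x'))"
  and solution_mean0: "p\<epsilon> (\<epsilon> n) \<in> L2_mean0 (dom_under \<omega> (\<lambda>x'. \<epsilon> n * h x'))"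
  using solution[OF eps_pos[of n]] unfolding micropolar_solution_def Let_def by blast+

lemma solution_vanishing:
  "i \<in> Basis \<Longrightarrow> (\<lambda>x. u\<epsilon> (\<epsilon> n) x \<bullet> i) \<in> H1_vanishing_on (dom_under \<omega> (\<lambda>x'. \<epsilon> n * h x'))
     (\<Gamma>_top \<omega> (\<lambda>x'. \<epsilon> n * h x') \<union> \<Gamma>_lat \<omega> (\<lambda>x'. \<epsilon> n * h x'))"
  using solution_V0[of n] unfolding V0_space_def V_space_def by blast

text \<open>For a velocity in the solution space this is minus the integral over the bottom of its
  horizontal trace against \<open>\<phi> v\<close>. Written with volume integrals it makes sense in
  \<open>V_z3\<close> and is weakly continuous.\<close>

definition bottom_term :: "(R3 \<Rightarrow> R3) \<Rightarrow> (R3 \<Rightarrow> real) \<Rightarrow> R3 \<Rightarrow> real" where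
  "bottom_term a \<phi> v = (\<Sum>i\<in>Basis. (fst v \<bullet> i) * ((LINT z|lebesgue_on \<Omega>. (a z \<bullet> (i, 0)) * pderiv_at e3 \<phi> z)
          + (LINT z|lebesgue_on \<Omega>. wderiv \<Omega> e3 (\<lambda>z. a z \<bullet> (i, 0)) z * \<phi> z)))"

text \<open>With u = \<epsilon>^2 U and w = \<epsilon> W every term contains \<epsilon>^2, which is
  divided out. The friction keeps one power beyond \<gamma>, because the bottom, unlike the volume,
  does not shrink; hence the threshold \<gamma> = -1.\<close>

lemma rescaled_momentum:
  assumes \<phi>: "\<phi> \<in> test_functions below_top" and v: "v \<in> Basis" and 0: "\<And>x'. (v \<bullet> e3) * \<phi> (x', 0) = 0"
  shows "- (\<epsilon> n)\<^sup>2 * (\<Sum>i\<in>Basis. LINT z|lebesgue_on \<Omega>. (U n z \<bullet> v) * pderiv_at (i, 0) (pderiv_at (i, 0) \<phi>) z)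
    + (LINT z|lebesgue_on \<Omega>. wderiv \<Omega> e3 (\<lambda>z. U n z \<bullet> v) z * pderiv_at e3 \<phi> z)
    - (LINT z|lebesgue_on \<Omega>. P n z * pderiv_at (fst v, snd v / \<epsilon> n) \<phi> z)
    - 2 * N\<^sup>2 * (\<epsilon> n * (LINT z|lebesgue_on \<Omega>. test_rot \<phi> v z \<bullet> W n z) + (LINT z|lebesgue_on \<Omega>. test_rot_z3 \<phi> v z \<bullet> W n z))
    - lam * \<epsilon> n powr (\<gamma> + 1) * bottom_term (U n) \<phi> v
    = (LINT z|lebesgue_on \<Omega>. (f (fst z) \<bullet> fst v) * \<phi> z)"
proof -
  interpret thin_column_domain \<omega> h hmin hmax "\<epsilon> n" by (rule thin_domain)
  note e = e_pos
  note sm = test_functions_smooth[OF \<phi>]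
  have u: "u\<epsilon> (\<epsilon> n) \<in> V_space \<omega> (\<lambda>x'. \<epsilon> n * h x')" using solution_V0[of n] by (simp add: V0_space_def)
  note int = weak_limit_vector(1)[of W w "test_rot \<phi> v" n, OF W_lim smooth_dom_L2[OF test_rot_smooth(1)[OF sm]]]
    weak_limit_vector(1)[of W w "test_rot_z3 \<phi> v" n, OF W_lim smooth_dom_L2[OF test_rot_smooth(2)[OF sm]]]
  have rot: "(LINT z|lebesgue_on \<Omega>. (test_rot \<phi> v z + (1 / \<epsilon> n) *\<^sub>R test_rot_z3 \<phi> v z) \<bullet> rescale (\<epsilon> n) (w\<epsilon> (\<epsilon> n)) z)
      = \<epsilon> n * (LINT z|lebesgue_on \<Omega>. test_rot \<phi> v z \<bullet> W n z) + (LINT z|lebesgue_on \<Omega>. test_rot_z3 \<phi> v z \<bullet> W n z)"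
  proof -
    have "(test_rot \<phi> v z + (1 / \<epsilon> n) *\<^sub>R test_rot_z3 \<phi> v z) \<bullet> rescale (\<epsilon> n) (w\<epsilon> (\<epsilon> n)) z
        = \<epsilon> n * (test_rot \<phi> v z \<bullet> W n z) + test_rot_z3 \<phi> v z \<bullet> W n z" for z
      using e by (simp add: rescale_w inner_add_left distrib_left)
    then show ?thesis using int by simp
  qed
  have lap: "(LINT z|lebesgue_on \<Omega>. (rescale (\<epsilon> n) (u\<epsilon> (\<epsilon> n)) z \<bullet> v) * m z) = (\<epsilon> n)\<^sup>2 * (LINT z|lebesgue_on \<Omega>. (U n z \<bullet> v) * m z)" for m v
    by (simp add: rescale_u mult.assoc)
  have bt: "(\<Sum>i\<in>Basis. (fst v \<bullet> i) * ((LINT z|lebesgue_on \<Omega>. (rescale (\<epsilon> n) (u\<epsilon> (\<epsilon> n)) z \<bullet> (i, 0)) * pderiv_at e3 \<phi> z)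
          + (LINT z|lebesgue_on \<Omega>. wderiv \<Omega> e3 (\<lambda>z. rescale (\<epsilon> n) (u\<epsilon> (\<epsilon> n)) z \<bullet> (i, 0)) z * \<phi> z)))
      = (\<epsilon> n)\<^sup>2 * bottom_term (U n) \<phi> v"
    unfolding bottom_term_def sum_distrib_left
    by (intro sum.cong refl) (simp only: wderiv_rescale_u[OF horizontal_Basis] lap, simp add: algebra_simps)
  have "- (\<epsilon> n)\<^sup>2 * (\<Sum>i\<in>Basis. LINT z|lebesgue_on \<Omega>. (rescale (\<epsilon> n) (u\<epsilon> (\<epsilon> n)) z \<bullet> v) * pderiv_at (i, 0) (pderiv_at (i, 0) \<phi>) z)
    + (LINT z|lebesgue_on \<Omega>. wderiv \<Omega> e3 (\<lambda>z. rescale (\<epsilon> n) (u\<epsilon> (\<epsilon> n)) z \<bullet> v) z * pderiv_at e3 \<phi> z)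
    - (\<epsilon> n)\<^sup>2 * (LINT z|lebesgue_on \<Omega>. rescale (\<epsilon> n) (p\<epsilon> (\<epsilon> n)) z * pderiv_at (fst v, snd v / \<epsilon> n) \<phi> z)
    - 2 * N\<^sup>2 * (\<epsilon> n)\<^sup>2 * (LINT z|lebesgue_on \<Omega>. (test_rot \<phi> v z + (1 / \<epsilon> n) *\<^sub>R test_rot_z3 \<phi> v z) \<bullet> rescale (\<epsilon> n) (w\<epsilon> (\<epsilon> n)) z)
    - lam * \<epsilon> n powr \<gamma> * \<epsilon> n * (\<Sum>i\<in>Basis. (fst v \<bullet> i) * ((LINT z|lebesgue_on \<Omega>. (rescale (\<epsilon> n) (u\<epsilon> (\<epsilon> n)) z \<bullet> (i, 0)) * pderiv_at e3 \<phi> z)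
          + (LINT z|lebesgue_on \<Omega>. wderiv \<Omega> e3 (\<lambda>z. rescale (\<epsilon> n) (u\<epsilon> (\<epsilon> n)) z \<bullet> (i, 0)) z * \<phi> z)))
    = (\<epsilon> n)\<^sup>2 * (LINT z|lebesgue_on \<Omega>. (f (fst z) \<bullet> fst v) * \<phi> z)"
  proof (rule scale_momentum[OF u \<phi> v 0])
    fix \<psi> assume "\<psi> \<in> V_space \<omega> (\<lambda>x'. \<epsilon> n * h x')"
    then show "(LINT x|lebesgue_on \<Omega>e. wgrad_inner \<Omega>e (u\<epsilon> (\<epsilon> n)) \<psi> x) - (LINT x|lebesgue_on \<Omega>e. p\<epsilon> (\<epsilon> n) x * wdiv \<Omega>e \<psi> x)
      - 2 * N\<^sup>2 * (LINT x|lebesgue_on \<Omega>e. wrot \<Omega>e \<psi> x \<bullet> w\<epsilon> (\<epsilon> n) x)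
      + lam * \<epsilon> n powr \<gamma> * (LINT x'|lebesgue_on \<omega>. (\<Sum>i\<in>Basis. bot_trace \<omega> \<Omega>e (\<lambda>x. fst (u\<epsilon> (\<epsilon> n) x) \<bullet> i) x' * bot_trace \<omega> \<Omega>e (\<lambda>x. fst (\<psi> x) \<bullet> i) x'))
      = (LINT x|lebesgue_on \<Omega>e. f (fst x) \<bullet> fst (\<psi> x))"
      using solution[OF e] unfolding micropolar_solution_def Let_def by blast
  qed
  moreover have "\<epsilon> n powr (\<gamma> + 1) = \<epsilon> n powr \<gamma> * \<epsilon> n" using e by (simp add: powr_add)
  ultimately have "(\<epsilon> n)\<^sup>2 * (- (\<epsilon> n)\<^sup>2 * (\<Sum>i\<in>Basis. LINT z|lebesgue_on \<Omega>. (U n z \<bullet> v) * pderiv_at (i, 0) (pderiv_at (i, 0) \<phi>) z)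
    + (LINT z|lebesgue_on \<Omega>. wderiv \<Omega> e3 (\<lambda>z. U n z \<bullet> v) z * pderiv_at e3 \<phi> z)
    - (LINT z|lebesgue_on \<Omega>. P n z * pderiv_at (fst v, snd v / \<epsilon> n) \<phi> z)
    - 2 * N\<^sup>2 * (\<epsilon> n * (LINT z|lebesgue_on \<Omega>. test_rot \<phi> v z \<bullet> W n z) + (LINT z|lebesgue_on \<Omega>. test_rot_z3 \<phi> v z \<bullet> W n z))
    - lam * \<epsilon> n powr (\<gamma> + 1) * bottom_term (U n) \<phi> v)
    = (\<epsilon> n)\<^sup>2 * (LINT z|lebesgue_on \<Omega>. (f (fst z) \<bullet> fst v) * \<phi> z)"
    unfolding bt unfolding rot lap wderiv_rescale_u[OF v] P_def[symmetric] sum_distrib_left[symmetric]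
    by (simp add: algebra_simps)
  then show ?thesis using e by simp
qed

text \<open>The limit of the whole balance except friction. It is left unevaluated until the limit
  of the friction term is known.\<close>

definition momentum_residual :: "(R3 \<Rightarrow> real) \<Rightarrow> R3 \<Rightarrow> real" where
  "momentum_residual \<phi> v = (LINT z|lebesgue_on \<Omega>. wderiv \<Omega> e3 (\<lambda>z. u z \<bullet> v) z * pderiv_at e3 \<phi> z)
    - (LINT z|lebesgue_on \<Omega>. p z * pderiv_at v \<phi> z)
    - 2 * N\<^sup>2 * (LINT z|lebesgue_on \<Omega>. test_rot_z3 \<phi> v z \<bullet> w z)
    - (LINT z|lebesgue_on \<Omega>. (f (fst z) \<bullet> fst v) * \<phi> z)"

lemma eps_times_tendsto_0:
  assumes "X \<longlonglongrightarrow> x"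
  shows "(\<lambda>n. \<epsilon> n * X n) \<longlonglongrightarrow> 0" "(\<lambda>n. (\<epsilon> n)\<^sup>2 * X n) \<longlonglongrightarrow> 0"
  using tendsto_mult[OF eps_lim assms] tendsto_mult[OF tendsto_power[OF eps_lim, of 2] assms] by simp_all

lemma P_mult_lim: "m \<in> L2 \<Omega> \<Longrightarrow> (\<lambda>n. LINT z|lebesgue_on \<Omega>. P n z * m z) \<longlonglongrightarrow> (LINT z|lebesgue_on \<Omega>. p z * m z)"
  using P_lim by (intro L2_tendsto_integral_mult) (auto simp: L2_tendsto_def)

lemma bottom_term_lim:
  assumes "smooth \<phi>"
  shows "(\<lambda>n. bottom_term (U n) \<phi> v) \<longlonglongrightarrow> bottom_term u \<phi> v"
  unfolding bottom_term_def
  by (intro tendsto_sum tendsto_mult tendsto_const tendsto_add weak_limit U_lim horizontal_Basis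
      smooth_dom_L2 smooth_pderiv_at assms)

lemma laplacian_lim:
  assumes "smooth \<phi>" "v \<in> Basis"
  shows "(\<lambda>n. (\<epsilon> n)\<^sup>2 * (\<Sum>i\<in>Basis. LINT z|lebesgue_on \<Omega>. (U n z \<bullet> v) * pderiv_at (i, 0) (pderiv_at (i, 0) \<phi>) z)) \<longlonglongrightarrow> 0"
    and "(\<lambda>n. (\<epsilon> n)\<^sup>2 * (\<Sum>i\<in>Basis. LINT z|lebesgue_on \<Omega>. (W n z \<bullet> v) * pderiv_at (i, 0) (pderiv_at (i, 0) \<phi>) z)) \<longlonglongrightarrow> 0"
proof -
  have d: "pderiv_at (i, 0) (pderiv_at (i, 0) \<phi>) \<in> L2 \<Omega>" for i
    by (intro smooth_dom_L2 smooth_pderiv_at assms)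
  show "(\<lambda>n. (\<epsilon> n)\<^sup>2 * (\<Sum>i\<in>Basis. LINT z|lebesgue_on \<Omega>. (U n z \<bullet> v) * pderiv_at (i, 0) (pderiv_at (i, 0) \<phi>) z)) \<longlonglongrightarrow> 0"
    by (rule eps_times_tendsto_0(2)[OF tendsto_sum[OF weak_limit(1)[OF U_lim[OF assms(2)] d]]])
  show "(\<lambda>n. (\<epsilon> n)\<^sup>2 * (\<Sum>i\<in>Basis. LINT z|lebesgue_on \<Omega>. (W n z \<bullet> v) * pderiv_at (i, 0) (pderiv_at (i, 0) \<phi>) z)) \<longlonglongrightarrow> 0"
    by (rule eps_times_tendsto_0(2)[OF tendsto_sum[OF weak_limit(1)[OF W_lim[OF assms(2)] d]]])
qed

lemma test_rot_lim:
  assumes "smooth \<phi>"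
  shows "(\<lambda>n. \<epsilon> n * (LINT z|lebesgue_on \<Omega>. test_rot \<phi> v z \<bullet> W n z) + (LINT z|lebesgue_on \<Omega>. test_rot_z3 \<phi> v z \<bullet> W n z))
      \<longlonglongrightarrow> 0 + (LINT z|lebesgue_on \<Omega>. test_rot_z3 \<phi> v z \<bullet> w z)"
    and "(\<lambda>n. \<epsilon> n * (LINT z|lebesgue_on \<Omega>. test_rot \<phi> v z \<bullet> U n z) + (LINT z|lebesgue_on \<Omega>. test_rot_z3 \<phi> v z \<bullet> U n z))
      \<longlonglongrightarrow> 0 + (LINT z|lebesgue_on \<Omega>. test_rot_z3 \<phi> v z \<bullet> u z)"
proof -
  note R = smooth_dom_L2[OF test_rot_smooth(1)[OF assms]] smooth_dom_L2[OF test_rot_smooth(2)[OF assms]]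
  show "(\<lambda>n. \<epsilon> n * (LINT z|lebesgue_on \<Omega>. test_rot \<phi> v z \<bullet> W n z) + (LINT z|lebesgue_on \<Omega>. test_rot_z3 \<phi> v z \<bullet> W n z))
      \<longlonglongrightarrow> 0 + (LINT z|lebesgue_on \<Omega>. test_rot_z3 \<phi> v z \<bullet> w z)"
    by (rule tendsto_add[OF eps_times_tendsto_0(1)[OF weak_limit_vector(2)[where A = W, OF W_lim R(1)]]
          weak_limit_vector(2)[where A = W, OF W_lim R(2)]])
  show "(\<lambda>n. \<epsilon> n * (LINT z|lebesgue_on \<Omega>. test_rot \<phi> v z \<bullet> U n z) + (LINT z|lebesgue_on \<Omega>. test_rot_z3 \<phi> v z \<bullet> U n z))
      \<longlonglongrightarrow> 0 + (LINT z|lebesgue_on \<Omega>. test_rot_z3 \<phi> v z \<bullet> u z)"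
    by (rule tendsto_add[OF eps_times_tendsto_0(1)[OF weak_limit_vector(2)[where A = U, OF U_lim R(1)]]
          weak_limit_vector(2)[where A = U, OF U_lim R(2)]])
qed

text \<open>Every other term of the balance has a limit, so the friction term, power of \<epsilon>
  included, has one for every \<gamma>. The regimes differ only in what is concluded from
  this.\<close>

lemma momentum_lim:
  assumes \<phi>: "\<phi> \<in> test_functions below_top" and i: "i \<in> Basis"
  shows "(\<lambda>n. lam * \<epsilon> n powr (\<gamma> + 1) * bottom_term (U n) \<phi> (i, 0)) \<longlonglongrightarrow> momentum_residual \<phi> (i, 0)"
proof -
  note sm = test_functions_smooth[OF \<phi>] and i3 = horizontal_Basis[OF i]
  let ?v = "(i, 0) :: R3"
  have "lam * \<epsilon> n powr (\<gamma> + 1) * bottom_term (U n) \<phi> ?v =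
     - ((\<epsilon> n)\<^sup>2 * (\<Sum>i\<in>Basis. LINT z|lebesgue_on \<Omega>. (U n z \<bullet> ?v) * pderiv_at (i, 0) (pderiv_at (i, 0) \<phi>) z))
    + (LINT z|lebesgue_on \<Omega>. wderiv \<Omega> e3 (\<lambda>z. U n z \<bullet> ?v) z * pderiv_at e3 \<phi> z)
    - (LINT z|lebesgue_on \<Omega>. P n z * pderiv_at ?v \<phi> z)
    - 2 * N\<^sup>2 * (\<epsilon> n * (LINT z|lebesgue_on \<Omega>. test_rot \<phi> ?v z \<bullet> W n z) + (LINT z|lebesgue_on \<Omega>. test_rot_z3 \<phi> ?v z \<bullet> W n z))
    - (LINT z|lebesgue_on \<Omega>. (f (fst z) \<bullet> fst ?v) * \<phi> z)" for n
    using rescaled_momentum[OF \<phi> i3, of n] by (simp add: e3_def inner_prod_def)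
  moreover have "(\<lambda>n. - ((\<epsilon> n)\<^sup>2 * (\<Sum>i\<in>Basis. LINT z|lebesgue_on \<Omega>. (U n z \<bullet> ?v) * pderiv_at (i, 0) (pderiv_at (i, 0) \<phi>) z))
    + (LINT z|lebesgue_on \<Omega>. wderiv \<Omega> e3 (\<lambda>z. U n z \<bullet> ?v) z * pderiv_at e3 \<phi> z)
    - (LINT z|lebesgue_on \<Omega>. P n z * pderiv_at ?v \<phi> z)
    - 2 * N\<^sup>2 * (\<epsilon> n * (LINT z|lebesgue_on \<Omega>. test_rot \<phi> ?v z \<bullet> W n z) + (LINT z|lebesgue_on \<Omega>. test_rot_z3 \<phi> ?v z \<bullet> W n z))
    - (LINT z|lebesgue_on \<Omega>. (f (fst z) \<bullet> fst ?v) * \<phi> z)) \<longlonglongrightarrow>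
    - 0 + (LINT z|lebesgue_on \<Omega>. wderiv \<Omega> e3 (\<lambda>z. u z \<bullet> ?v) z * pderiv_at e3 \<phi> z)
    - (LINT z|lebesgue_on \<Omega>. p z * pderiv_at ?v \<phi> z)
    - 2 * N\<^sup>2 * (0 + (LINT z|lebesgue_on \<Omega>. test_rot_z3 \<phi> ?v z \<bullet> w z))
    - (LINT z|lebesgue_on \<Omega>. (f (fst z) \<bullet> fst ?v) * \<phi> z)"
    by (intro tendsto_add[OF tendsto_minus[OF laplacian_lim(1)[OF sm i3]]] tendsto_diff
        tendsto_mult[OF tendsto_const test_rot_lim(1)[OF sm]] tendsto_const
        weak_limit[OF U_lim[OF i3]] P_mult_lim smooth_dom_L2 smooth_pderiv_at sm)
  ultimately show ?thesis by (simp add: momentum_residual_def)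
qed

text \<open>For test functions supported inside the domain the bottom term is 0 already before the
  limit: it is the defining identity of the vertical weak derivative.\<close>

lemma momentum_interior:
  assumes \<phi>: "\<phi> \<in> test_functions \<Omega>" and i: "i \<in> Basis"
  shows "momentum_residual \<phi> (i, 0) = 0"
proof -
  have "bottom_term (U n) \<phi> v = 0" for n v
    unfolding bottom_term_def
    using has_weak_derivD(3)[OF V_z3_wderiv(2)[OF U_V_z3(1)[OF horizontal_Basis]] \<phi>]
    by (intro sum.neutral) simp
  with momentum_lim[OF test_functions_mono[OF dom_subset_below_top \<phi>] i] show ?thesis
    by (simp add: LIMSEQ_const_iff)
qed

lemma momentum_slip:
  assumes \<phi>: "\<phi> \<in> test_functions below_top" and i: "i \<in> Basis" and \<gamma>: "\<gamma> \<ge> -1"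
  shows "momentum_residual \<phi> (i, 0) = (if \<gamma> = -1 then lam else 0) * bottom_term u \<phi> (i, 0)"
proof -
  have "(\<lambda>n. \<epsilon> n powr (\<gamma> + 1)) \<longlonglongrightarrow> (if \<gamma> = -1 then 1 else 0)"
  proof (cases "\<gamma> = -1")
    case True
    then show ?thesis using eps_pos by (simp add: less_imp_neq[THEN not_sym])
  next
    case False
    with \<gamma> have "0 < \<gamma> + 1" by simp
    then show ?thesis
      using False eps_pos by (auto intro!: tendsto_zero_powrI[OF eps_lim tendsto_const] simp: less_imp_le)
  qed
  then have "(\<lambda>n. lam * \<epsilon> n powr (\<gamma> + 1) * bottom_term (U n) \<phi> (i, 0)) \<longlonglongrightarrow> lam * (if \<gamma> = -1 then 1 else 0) * bottom_term u \<phi> (i, 0)"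
    by (intro tendsto_mult tendsto_const bottom_term_lim test_functions_smooth[OF \<phi>])
  from LIMSEQ_unique[OF momentum_lim[OF \<phi> i] this] show ?thesis by simp
qed

text \<open>The friction term converges while its coefficient is a negative power of \<epsilon>.
  Multiplying by the inverse power, which tends to 0, leaves the bottom term with limit 0.\<close>

lemma momentum_noslip:
  assumes \<phi>: "\<phi> \<in> test_functions below_top" and i: "i \<in> Basis" and \<gamma>: "\<gamma> < -1"
  shows "bottom_term u \<phi> (i, 0) = 0"
proof -
  have "0 < - (\<gamma> + 1)" using \<gamma> by simp
  then have "(\<lambda>n. \<epsilon> n powr (- (\<gamma> + 1))) \<longlonglongrightarrow> 0"
    using eps_pos by (auto intro!: tendsto_zero_powrI[OF eps_lim tendsto_const] simp: less_imp_le)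
  from tendsto_mult[OF this momentum_lim[OF \<phi> i]]
  have "(\<lambda>n. \<epsilon> n powr (- (\<gamma> + 1)) * (lam * \<epsilon> n powr (\<gamma> + 1) * bottom_term (U n) \<phi> (i, 0))) \<longlonglongrightarrow> 0" by simp
  moreover have "(\<lambda>n. \<epsilon> n powr (- (\<gamma> + 1)) * (lam * \<epsilon> n powr (\<gamma> + 1) * bottom_term (U n) \<phi> (i, 0)))
      = (\<lambda>n. lam * bottom_term (U n) \<phi> (i, 0))"
  proof
    fix n
    have "\<epsilon> n powr (- (\<gamma> + 1)) * \<epsilon> n powr (\<gamma> + 1) = 1"
      using eps_pos[of n] by (simp only: powr_add[symmetric]) simp
    then show "\<epsilon> n powr (- (\<gamma> + 1)) * (lam * \<epsilon> n powr (\<gamma> + 1) * bottom_term (U n) \<phi> (i, 0)) = lam * bottom_term (U n) \<phi> (i, 0)"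
      by algebra
  qed
  ultimately have "(\<lambda>n. lam * bottom_term (U n) \<phi> (i, 0)) \<longlonglongrightarrow> 0" by metis
  moreover have "(\<lambda>n. lam * bottom_term (U n) \<phi> (i, 0)) \<longlonglongrightarrow> lam * bottom_term u \<phi> (i, 0)"
    by (intro tendsto_mult tendsto_const bottom_term_lim test_functions_smooth[OF \<phi>])
  ultimately have "lam * bottom_term u \<phi> (i, 0) = 0" using LIMSEQ_unique by blast
  then show ?thesis using lam_pos by simp
qed

text \<open>For the vertical test direction the pressure is differentiated along e3 / \<epsilon>,
  while all other terms stay bounded. Multiplied by \<epsilon>, the balance retains only the
  pressure.\<close>

lemma pressure_vertical:
  assumes \<phi>: "\<phi> \<in> test_functions \<Omega>"
  shows "(LINT z|lebesgue_on \<Omega>. p z * pderiv_at e3 \<phi> z) = 0"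
proof -
  note sm = test_functions_smooth[OF \<phi>]
  have 0: "\<phi> (x', 0) = 0" for x' by (rule test_functions_eq_0[OF \<phi>]) (simp add: mem_dom)
  let ?X = "\<lambda>n. - ((\<epsilon> n)\<^sup>2 * (\<Sum>i\<in>Basis. LINT z|lebesgue_on \<Omega>. (U n z \<bullet> e3) * pderiv_at (i, 0) (pderiv_at (i, 0) \<phi>) z))
    + (LINT z|lebesgue_on \<Omega>. wderiv \<Omega> e3 (\<lambda>z. U n z \<bullet> e3) z * pderiv_at e3 \<phi> z)
    - 2 * N\<^sup>2 * (\<epsilon> n * (LINT z|lebesgue_on \<Omega>. test_rot \<phi> e3 z \<bullet> W n z) + (LINT z|lebesgue_on \<Omega>. test_rot_z3 \<phi> e3 z \<bullet> W n z))"
  have "(LINT z|lebesgue_on \<Omega>. P n z * pderiv_at e3 \<phi> z) = \<epsilon> n * ?X n" for n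
  proof -
    have "(fst e3, snd e3 / \<epsilon> n) = (1 / \<epsilon> n) *\<^sub>R e3" by (simp add: e3_def)
    then have "pderiv_at (fst e3, snd e3 / \<epsilon> n) \<phi> z = pderiv_at e3 \<phi> z / \<epsilon> n" for z
      by (simp only: pderiv_at_scaleR_dir[OF sm]) simp
    moreover have "fst e3 = 0" "bottom_term a \<phi> e3 = 0" for a by (simp_all add: bottom_term_def e3_def)
    ultimately have "?X n = (LINT z|lebesgue_on \<Omega>. P n z * pderiv_at e3 \<phi> z) / \<epsilon> n"
      using rescaled_momentum[OF test_functions_mono[OF dom_subset_below_top \<phi>] e3_Basis, of n] 0 by simp
    then show ?thesis using eps_pos[of n] by simp
  qed
  moreover have "?X \<longlonglongrightarrow> - 0 + (LINT z|lebesgue_on \<Omega>. wderiv \<Omega> e3 (\<lambda>z. u z \<bullet> e3) z * pderiv_at e3 \<phi> z)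
      - 2 * N\<^sup>2 * (0 + (LINT z|lebesgue_on \<Omega>. test_rot_z3 \<phi> e3 z \<bullet> w z))"
    by (intro tendsto_add[OF tendsto_minus[OF laplacian_lim(1)[OF sm e3_Basis]]] tendsto_diff
        tendsto_mult[OF tendsto_const test_rot_lim(1)[OF sm]] tendsto_const
        weak_limit[OF U_lim[OF e3_Basis]] smooth_dom_L2 smooth_pderiv_at sm)
  then have "(\<lambda>n. \<epsilon> n * ?X n) \<longlonglongrightarrow> 0" by (rule eps_times_tendsto_0)
  moreover have "(\<lambda>n. LINT z|lebesgue_on \<Omega>. P n z * pderiv_at e3 \<phi> z) \<longlonglongrightarrow> (LINT z|lebesgue_on \<Omega>. p z * pderiv_at e3 \<phi> z)"
    by (intro P_mult_lim smooth_dom_L2 smooth_pderiv_at sm)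
  ultimately show ?thesis using LIMSEQ_unique by fastforce
qed

lemma spin_interior:
  assumes \<phi>: "\<phi> \<in> test_functions \<Omega>" and v: "v \<in> Basis"
  shows "Rc * (LINT z|lebesgue_on \<Omega>. wderiv \<Omega> e3 (\<lambda>z. w z \<bullet> v) z * pderiv_at e3 \<phi> z)
    + 4 * N\<^sup>2 * (LINT z|lebesgue_on \<Omega>. (w z \<bullet> v) * \<phi> z)
    - 2 * N\<^sup>2 * (LINT z|lebesgue_on \<Omega>. test_rot_z3 \<phi> v z \<bullet> u z)
    = (LINT z|lebesgue_on \<Omega>. (g (fst z) \<bullet> fst v) * \<phi> z)"
proof -
  note sm = test_functions_smooth[OF \<phi>]
  let ?G = "LINT z|lebesgue_on \<Omega>. (g (fst z) \<bullet> fst v) * \<phi> z"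
  let ?X = "\<lambda>n. - Rc * ((\<epsilon> n)\<^sup>2 * (\<Sum>i\<in>Basis. LINT z|lebesgue_on \<Omega>. (W n z \<bullet> v) * pderiv_at (i, 0) (pderiv_at (i, 0) \<phi>) z))
    + Rc * (LINT z|lebesgue_on \<Omega>. wderiv \<Omega> e3 (\<lambda>z. W n z \<bullet> v) z * pderiv_at e3 \<phi> z)
    + 4 * N\<^sup>2 * (LINT z|lebesgue_on \<Omega>. (W n z \<bullet> v) * \<phi> z)
    - 2 * N\<^sup>2 * (\<epsilon> n * (LINT z|lebesgue_on \<Omega>. test_rot \<phi> v z \<bullet> U n z) + (LINT z|lebesgue_on \<Omega>. test_rot_z3 \<phi> v z \<bullet> U n z))"
  have "?X n = ?G" for n
  proof -
    interpret thin_column_domain \<omega> h hmin hmax "\<epsilon> n" by (rule thin_domain)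
    note e = e_pos
    note int = weak_limit_vector(1)[of U u "test_rot \<phi> v" n, OF U_lim smooth_dom_L2[OF test_rot_smooth(1)[OF sm]]]
      weak_limit_vector(1)[of U u "test_rot_z3 \<phi> v" n, OF U_lim smooth_dom_L2[OF test_rot_smooth(2)[OF sm]]]
    have rot: "(LINT z|lebesgue_on \<Omega>. (test_rot \<phi> v z + (1 / \<epsilon> n) *\<^sub>R test_rot_z3 \<phi> v z) \<bullet> rescale (\<epsilon> n) (u\<epsilon> (\<epsilon> n)) z)
        = \<epsilon> n * (\<epsilon> n * (LINT z|lebesgue_on \<Omega>. test_rot \<phi> v z \<bullet> U n z) + (LINT z|lebesgue_on \<Omega>. test_rot_z3 \<phi> v z \<bullet> U n z))"
    proof -
      have "(test_rot \<phi> v z + (1 / \<epsilon> n) *\<^sub>R test_rot_z3 \<phi> v z) \<bullet> rescale (\<epsilon> n) (u\<epsilon> (\<epsilon> n)) z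
          = \<epsilon> n * (\<epsilon> n * (test_rot \<phi> v z \<bullet> U n z) + test_rot_z3 \<phi> v z \<bullet> U n z)" for z
        using e by (simp add: rescale_u inner_add_left power2_eq_square algebra_simps)
      then show ?thesis using int by simp
    qed
    have lap: "(LINT z|lebesgue_on \<Omega>. (rescale (\<epsilon> n) (w\<epsilon> (\<epsilon> n)) z \<bullet> v) * m z) = \<epsilon> n * (LINT z|lebesgue_on \<Omega>. (W n z \<bullet> v) * m z)" for m
      by (simp add: rescale_w mult.assoc)
    have "- Rc * (\<epsilon> n)\<^sup>2 * (\<Sum>i\<in>Basis. LINT z|lebesgue_on \<Omega>. (rescale (\<epsilon> n) (w\<epsilon> (\<epsilon> n)) z \<bullet> v) * pderiv_at (i, 0) (pderiv_at (i, 0) \<phi>) z)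
      + Rc * (LINT z|lebesgue_on \<Omega>. wderiv \<Omega> e3 (\<lambda>z. rescale (\<epsilon> n) (w\<epsilon> (\<epsilon> n)) z \<bullet> v) z * pderiv_at e3 \<phi> z)
      + 4 * N\<^sup>2 * (LINT z|lebesgue_on \<Omega>. (rescale (\<epsilon> n) (w\<epsilon> (\<epsilon> n)) z \<bullet> v) * \<phi> z)
      - 2 * N\<^sup>2 * (LINT z|lebesgue_on \<Omega>. (test_rot \<phi> v z + (1 / \<epsilon> n) *\<^sub>R test_rot_z3 \<phi> v z) \<bullet> rescale (\<epsilon> n) (u\<epsilon> (\<epsilon> n)) z)
      = \<epsilon> n * ?G"
    proof (rule scale_spin[OF solution_H10 \<phi> v])
      fix \<psi> :: "R3 \<Rightarrow> R3" assume "\<And>i. i \<in> Basis \<Longrightarrow> (\<lambda>x. \<psi> x \<bullet> i) \<in> H10 \<Omega>e"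
      then show "(\<epsilon> n)\<^sup>2 * Rc * (LINT x|lebesgue_on \<Omega>e. wgrad_inner \<Omega>e (w\<epsilon> (\<epsilon> n)) \<psi> x) + 4 * N\<^sup>2 * (LINT x|lebesgue_on \<Omega>e. w\<epsilon> (\<epsilon> n) x \<bullet> \<psi> x)
        - 2 * N\<^sup>2 * (LINT x|lebesgue_on \<Omega>e. u\<epsilon> (\<epsilon> n) x \<bullet> wrot \<Omega>e \<psi> x) = \<epsilon> n * (LINT x|lebesgue_on \<Omega>e. g (fst x) \<bullet> fst (\<psi> x))"
        using solution[OF e] unfolding micropolar_solution_def Let_def by blast
    qed
    then have "\<epsilon> n * ?X n = \<epsilon> n * ?G"
      unfolding rot lap wderiv_rescale_w[OF v] sum_distrib_left[symmetric] by (simp add: algebra_simps)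
    then show ?thesis using e by simp
  qed
  moreover have "?X \<longlonglongrightarrow> - Rc * 0 + Rc * (LINT z|lebesgue_on \<Omega>. wderiv \<Omega> e3 (\<lambda>z. w z \<bullet> v) z * pderiv_at e3 \<phi> z)
    + 4 * N\<^sup>2 * (LINT z|lebesgue_on \<Omega>. (w z \<bullet> v) * \<phi> z)
    - 2 * N\<^sup>2 * (0 + (LINT z|lebesgue_on \<Omega>. test_rot_z3 \<phi> v z \<bullet> u z))"
    by (intro tendsto_add tendsto_diff tendsto_mult[OF tendsto_const laplacian_lim(2)[OF sm v]]
        tendsto_mult[OF tendsto_const test_rot_lim(2)[OF sm]]
        tendsto_mult[OF tendsto_const weak_limit(1)[OF W_lim[OF v]]]
        tendsto_mult[OF tendsto_const weak_limit(2)[OF W_lim[OF v]]] smooth_dom_L2 smooth_pderiv_at sm)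
  ultimately show ?thesis by (simp add: LIMSEQ_const_iff)
qed

text \<open>Rescaling leaves a factor \<epsilon> before the horizontal part of the divergence, so in
  the limit the vertical part vanishes alone.\<close>

lemma velocity_vertical:
  assumes \<phi>: "\<phi> \<in> test_functions \<Omega>"
  shows "(LINT z|lebesgue_on \<Omega>. (u z \<bullet> e3) * pderiv_at e3 \<phi> z) = 0"
proof -
  note sm = test_functions_smooth[OF \<phi>]
  have "(LINT z|lebesgue_on \<Omega>. (U n z \<bullet> e3) * pderiv_at e3 \<phi> z)
      = - (\<epsilon> n * (\<Sum>i\<in>Basis. LINT z|lebesgue_on \<Omega>. (U n z \<bullet> (i, 0)) * pderiv_at (i, 0) \<phi> z))" for n
  proof -
    interpret thin_column_domain \<omega> h hmin hmax "\<epsilon> n" by (rule thin_domain)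
    have r: "(LINT z|lebesgue_on \<Omega>. (rescale (\<epsilon> n) (u\<epsilon> (\<epsilon> n)) z \<bullet> v) * m z) = (\<epsilon> n)\<^sup>2 * (LINT z|lebesgue_on \<Omega>. (U n z \<bullet> v) * m z)" for m v
      by (simp add: rescale_u mult.assoc)
    have "(\<epsilon> n)\<^sup>2 * ((\<epsilon> n * (\<Sum>i\<in>Basis. LINT z|lebesgue_on \<Omega>. (U n z \<bullet> (i, 0)) * pderiv_at (i, 0) \<phi> z))
        + (LINT z|lebesgue_on \<Omega>. (U n z \<bullet> e3) * pderiv_at e3 \<phi> z)) = 0"
      using scale_divergence[OF solution_V0 \<phi>] unfolding r sum_distrib_left[symmetric] by (simp add: algebra_simps)
    then show ?thesis using e_pos by simp
  qed
  moreover have "(\<lambda>n. - (\<epsilon> n * (\<Sum>i\<in>Basis. LINT z|lebesgue_on \<Omega>. (U n z \<bullet> (i, 0)) * pderiv_at (i, 0) \<phi> z))) \<longlonglongrightarrow> - 0"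
    by (rule tendsto_minus[OF eps_times_tendsto_0(1)[OF tendsto_sum[OF weak_limit(1)[OF U_lim[OF horizontal_Basis]]]]])
      (auto intro!: smooth_dom_L2 smooth_pderiv_at sm)
  moreover have "(\<lambda>n. LINT z|lebesgue_on \<Omega>. (U n z \<bullet> e3) * pderiv_at e3 \<phi> z) \<longlonglongrightarrow> (LINT z|lebesgue_on \<Omega>. (u z \<bullet> e3) * pderiv_at e3 \<phi> z)"
    by (intro weak_limit U_lim e3_Basis smooth_dom_L2 smooth_pderiv_at sm)
  ultimately show ?thesis using LIMSEQ_unique by fastforce
qed

lemma flux_limit:
  assumes \<theta>: "\<theta> \<in> H1 \<omega>"
  shows "(\<Sum>i\<in>Basis. LINT z|lebesgue_on \<Omega>. (u z \<bullet> (i, 0)) * wderiv \<omega> i \<theta> (fst z)) = 0"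
proof -
  have "(\<Sum>i\<in>Basis. LINT z|lebesgue_on \<Omega>. (U n z \<bullet> (i, 0)) * wderiv \<omega> i \<theta> (fst z)) = 0" for n
  proof -
    interpret thin_column_domain \<omega> h hmin hmax "\<epsilon> n" by (rule thin_domain)
    have r: "(LINT z|lebesgue_on \<Omega>. (rescale (\<epsilon> n) (u\<epsilon> (\<epsilon> n)) z \<bullet> v) * m z) = (\<epsilon> n)\<^sup>2 * (LINT z|lebesgue_on \<Omega>. (U n z \<bullet> v) * m z)" for m v
      by (simp add: rescale_u mult.assoc)
    show ?thesis
      using scale_flux[OF solution_V0 \<theta>] e_pos unfolding r sum_distrib_left[symmetric] by simp
  qed
  moreover have "(\<lambda>n. \<Sum>i\<in>Basis. LINT z|lebesgue_on \<Omega>. (U n z \<bullet> (i, 0)) * wderiv \<omega> i \<theta> (fst z))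
      \<longlonglongrightarrow> (\<Sum>i\<in>Basis. LINT z|lebesgue_on \<Omega>. (u z \<bullet> (i, 0)) * wderiv \<omega> i \<theta> (fst z))"
    by (intro tendsto_sum weak_limit U_lim horizontal_Basis fst_L2 H1_wderiv[OF \<theta> _ open_base])
  ultimately show ?thesis by (simp add: LIMSEQ_const_iff)
qed

lemma velocity_top:
  assumes \<phi>: "\<phi> \<in> test_functions (\<omega> \<times> {0<..})" and v: "v \<in> Basis"
  shows "(LINT z|lebesgue_on \<Omega>. (u z \<bullet> v) * pderiv_at e3 \<phi> z) + (LINT z|lebesgue_on \<Omega>. wderiv \<Omega> e3 (\<lambda>z. u z \<bullet> v) z * \<phi> z) = 0"
proof -
  note sm = test_functions_smooth[OF \<phi>]
  have "(LINT z|lebesgue_on \<Omega>. (U n z \<bullet> v) * pderiv_at e3 \<phi> z) + (LINT z|lebesgue_on \<Omega>. wderiv \<Omega> e3 (\<lambda>z. U n z \<bullet> v) z * \<phi> z) = 0" for n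
  proof -
    interpret thin_column_domain \<omega> h hmin hmax "\<epsilon> n" by (rule thin_domain)
    have r: "(LINT z|lebesgue_on \<Omega>. (rescale (\<epsilon> n) (u\<epsilon> (\<epsilon> n)) z \<bullet> v) * m z) = (\<epsilon> n)\<^sup>2 * (LINT z|lebesgue_on \<Omega>. (U n z \<bullet> v) * m z)" for m
      by (simp add: rescale_u mult.assoc)
    have "rescale (\<epsilon> n) (\<lambda>x. u\<epsilon> (\<epsilon> n) x \<bullet> v) = (\<lambda>z. rescale (\<epsilon> n) (u\<epsilon> (\<epsilon> n)) z \<bullet> v)"
      by (auto simp: rescale_eq fun_eq_iff)
    with scale_top[OF solution_vanishing[OF v] \<phi>]
    have "(\<epsilon> n)\<^sup>2 * ((LINT z|lebesgue_on \<Omega>. (U n z \<bullet> v) * pderiv_at e3 \<phi> z) + (LINT z|lebesgue_on \<Omega>. wderiv \<Omega> e3 (\<lambda>z. U n z \<bullet> v) z * \<phi> z)) = 0"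
      using r[of "pderiv_at e3 \<phi>"] wderiv_rescale_u[OF v, of n \<phi>] by (simp add: distrib_left)
    then show ?thesis using e_pos by simp
  qed
  moreover have "(\<lambda>n. (LINT z|lebesgue_on \<Omega>. (U n z \<bullet> v) * pderiv_at e3 \<phi> z) + (LINT z|lebesgue_on \<Omega>. wderiv \<Omega> e3 (\<lambda>z. U n z \<bullet> v) z * \<phi> z))
      \<longlonglongrightarrow> (LINT z|lebesgue_on \<Omega>. (u z \<bullet> v) * pderiv_at e3 \<phi> z) + (LINT z|lebesgue_on \<Omega>. wderiv \<Omega> e3 (\<lambda>z. u z \<bullet> v) z * \<phi> z)"
    by (intro tendsto_add weak_limit[OF U_lim[OF v]] smooth_dom_L2 smooth_pderiv_at sm)
  ultimately show ?thesis by (simp add: LIMSEQ_const_iff)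
qed

text \<open>With smooth factors free at both ends this yields zero traces of w on bottom and top at
  once.\<close>

lemma spin_boundary:
  assumes sm: "smooth \<phi>" and v: "v \<in> Basis"
  shows "(LINT z|lebesgue_on \<Omega>. (w z \<bullet> v) * pderiv_at e3 \<phi> z) + (LINT z|lebesgue_on \<Omega>. wderiv \<Omega> e3 (\<lambda>z. w z \<bullet> v) z * \<phi> z) = 0"
proof -
  have "(LINT z|lebesgue_on \<Omega>. (W n z \<bullet> v) * pderiv_at e3 \<phi> z) + (LINT z|lebesgue_on \<Omega>. wderiv \<Omega> e3 (\<lambda>z. W n z \<bullet> v) z * \<phi> z) = 0" for n
  proof -
    interpret thin_column_domain \<omega> h hmin hmax "\<epsilon> n" by (rule thin_domain)
    have r: "(LINT z|lebesgue_on \<Omega>. (rescale (\<epsilon> n) (w\<epsilon> (\<epsilon> n)) z \<bullet> v) * m z) = \<epsilon> n * (LINT z|lebesgue_on \<Omega>. (W n z \<bullet> v) * m z)" for m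
      by (simp add: rescale_w mult.assoc)
    have "rescale (\<epsilon> n) (\<lambda>x. w\<epsilon> (\<epsilon> n) x \<bullet> v) = (\<lambda>z. rescale (\<epsilon> n) (w\<epsilon> (\<epsilon> n)) z \<bullet> v)"
      by (auto simp: rescale_eq fun_eq_iff)
    with scale_H10[OF solution_H10[OF v] sm]
    have "\<epsilon> n * ((LINT z|lebesgue_on \<Omega>. (W n z \<bullet> v) * pderiv_at e3 \<phi> z) + (LINT z|lebesgue_on \<Omega>. wderiv \<Omega> e3 (\<lambda>z. W n z \<bullet> v) z * \<phi> z)) = 0"
      using r[of "pderiv_at e3 \<phi>"] wderiv_rescale_w[OF v, of n \<phi>] by (simp add: distrib_left)
    then show ?thesis using e_pos by simp
  qed
  moreover have "(\<lambda>n. (LINT z|lebesgue_on \<Omega>. (W n z \<bullet> v) * pderiv_at e3 \<phi> z) + (LINT z|lebesgue_on \<Omega>. wderiv \<Omega> e3 (\<lambda>z. W n z \<bullet> v) z * \<phi> z))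
      \<longlonglongrightarrow> (LINT z|lebesgue_on \<Omega>. (w z \<bullet> v) * pderiv_at e3 \<phi> z) + (LINT z|lebesgue_on \<Omega>. wderiv \<Omega> e3 (\<lambda>z. w z \<bullet> v) z * \<phi> z)"
    by (intro tendsto_add weak_limit[OF W_lim[OF v]] smooth_dom_L2 smooth_pderiv_at sm)
  ultimately show ?thesis by (simp add: LIMSEQ_const_iff)
qed

lemma pressure_mean0: "p \<in> L2_mean0 \<Omega>"
proof -
  have p: "p \<in> L2 \<Omega>" using P_lim by (simp add: L2_tendsto_def)
  have "(LINT z|lebesgue_on \<Omega>. P n z * 1) = 0" for n
  proof -
    interpret thin_column_domain \<omega> h hmin hmax "\<epsilon> n" by (rule thin_domain)
    have "\<epsilon> n * (LINT z|lebesgue_on \<Omega>. P n z) = 0"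
      using solution_mean0[of n] scale_integral(2)[of "p\<epsilon> (\<epsilon> n)"] by (simp add: L2_mean0_def P_def)
    then show ?thesis using e_pos by simp
  qed
  with P_mult_lim[OF smooth_dom_L2[OF smooth_const[of 1]]] have "(LINT z|lebesgue_on \<Omega>. p z) = 0"
    by (simp add: LIMSEQ_const_iff)
  with p show ?thesis by (simp add: L2_mean0_def)
qed

end

subsection \<open>Functions with vanishing weak gradient\<close>

definition tensor :: "('a::euclidean_space \<Rightarrow> real \<Rightarrow> real) \<Rightarrow> 'a \<Rightarrow> real" where
  "tensor b x = (\<Prod>i\<in>Basis. b i (x \<bullet> i))"

lemma smooth_tensor:
  assumes "\<And>i. i \<in> Basis \<Longrightarrow> smooth (b i)"
  shows "smooth (tensor b)"
  unfolding tensor_def[abs_def]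
  by (intro smooth_prod smooth_compose_linear[OF assms]) (auto intro: linearI simp: inner_simps)

lemma tensor_split:
  assumes "j \<in> Basis"
  shows "tensor (b(j := P)) x = P (x \<bullet> j) * (\<Prod>i\<in>Basis - {j}. b i (x \<bullet> i))"
  unfolding tensor_def using assms by (subst prod.remove[of _ j]) (auto intro!: prod.cong)

lemma pderiv_at_translation_invariant:
  assumes "smooth G" "\<And>s. G (s *\<^sub>R j + x) = G x"
  shows "pderiv_at j G x = 0"
proof -
  have l: "linear (\<lambda>s :: real. s *\<^sub>R j)" by (auto intro: linearI simp: algebra_simps)
  have "pderiv_at (1 *\<^sub>R j) G (0 *\<^sub>R j + x) = pderiv_at 1 (\<lambda>s. G (s *\<^sub>R j + x)) 0"
    using smooth_differentiable[OF assms(1)] by (intro pderiv_at_compose_affine[symmetric] l)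
  also have "\<dots> = 0" unfolding assms(2) by (rule pderiv_at_eqI) auto
  finally show ?thesis by simp
qed

lemma pderiv_at_tensor:
  assumes b: "\<And>i. i \<in> Basis \<Longrightarrow> smooth (b i)" and P: "smooth P" "\<And>s. (P has_real_derivative P' s) (at s)" and j: "j \<in> Basis"
  shows "pderiv_at j (tensor (b(j := P))) x = tensor (b(j := P')) x"
proof -
  let ?G = "\<lambda>x. \<Prod>i\<in>Basis - {j}. b i (x \<bullet> i)"
  have l: "linear (\<lambda>x. x \<bullet> i)" for i :: 'a by (auto intro: linearI simp: inner_simps)
  have G: "smooth ?G" by (intro smooth_prod smooth_compose_linear[OF b l]) auto
  have P1: "smooth (\<lambda>x. P (x \<bullet> j))" by (rule smooth_compose_linear[OF P(1) l])
  have "?G (s *\<^sub>R j + x) = ?G x" for s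
    using j by (intro prod.cong) (auto simp: inner_simps inner_Basis)
  then have "pderiv_at j ?G x = 0" by (rule pderiv_at_translation_invariant[OF G])
  moreover have "pderiv_at j (\<lambda>x. P (x \<bullet> j)) x = P' (x \<bullet> j)"
    using pderiv_at_compose_affine[OF smooth_differentiable[OF P(1)] l, where c = 0 and v = j and x = x]
      pderiv_at_real[OF P(2)] j by simp
  moreover have "tensor (b(j := P)) = (\<lambda>x. P (x \<bullet> j) * ?G x)" using tensor_split[OF j] by blast
  ultimately show ?thesis
    using pderiv_at_mult[OF smooth_differentiable[OF P1] smooth_differentiable[OF G], of j x] tensor_split[OF j, of b P' x]
    by simp
qed

lemma box_bump_tensor:
  "box_bump a b n = tensor (\<lambda>i s. smooth_step (real n * (s - a \<bullet> i)) * smooth_step (real n * (b \<bullet> i - s)))"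
  by (auto simp: box_bump_def tensor_def)

lemma tensor_test_function:
  fixes c d :: "'a::euclidean_space"
  assumes b: "\<And>i. i \<in> Basis \<Longrightarrow> smooth (b i)" and 0: "\<And>i s. i \<in> Basis \<Longrightarrow> s < c \<bullet> i \<or> d \<bullet> i < s \<Longrightarrow> b i s = 0"
    and sub: "cbox c d \<subseteq> S"
  shows "tensor b \<in> test_functions S"
proof (rule test_functionsI[OF smooth_tensor[OF b] compact_cbox sub])
  fix x assume "x \<notin> cbox c d"
  then obtain i where "i \<in> Basis" "x \<bullet> i < c \<bullet> i \<or> d \<bullet> i < x \<bullet> i" by (auto simp: mem_box not_le)
  then show "tensor b x = 0" unfolding tensor_def using 0 by (intro prod_zero) auto
qed

text \<open>One factor of a tensor product of bumps is exchanged for a fixed unit bump at a time.\<close>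

lemma weak_gradient_zero_tensor:
  fixes f :: "'a::euclidean_space \<Rightarrow> real"
  assumes f: "f \<in> L1_loc S" and S: "open S" and sub: "cbox c d \<subseteq> S" and cd: "\<And>i. i \<in> Basis \<Longrightarrow> c \<bullet> i < d \<bullet> i"
    and grad: "\<And>i \<phi>. i \<in> Basis \<Longrightarrow> \<phi> \<in> test_functions S \<Longrightarrow> (LINT x|lebesgue_on S. f x * pderiv_at i \<phi> x) = 0"
    and \<rho>: "\<And>i. i \<in> Basis \<Longrightarrow> smooth (\<rho> i)" "\<And>i s. i \<in> Basis \<Longrightarrow> s < c \<bullet> i \<or> d \<bullet> i < s \<Longrightarrow> \<rho> i s = 0"
      "\<And>i. i \<in> Basis \<Longrightarrow> integral\<^sup>L lebesgue (\<rho> i) = 1"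
    and b: "\<And>i. i \<in> Basis \<Longrightarrow> smooth (b i)" "\<And>i s. i \<in> Basis \<Longrightarrow> s < c \<bullet> i \<or> d \<bullet> i < s \<Longrightarrow> b i s = 0"
  shows "(LINT x|lebesgue_on S. f x * tensor b x) = (\<Prod>i\<in>Basis. integral\<^sup>L lebesgue (b i)) * (LINT x|lebesgue_on S. f x * tensor \<rho> x)"
proof -
  have Sl: "S \<in> sets lebesgue" using S by auto
  have step: "(LINT x|lebesgue_on S. f x * tensor b x) = integral\<^sup>L lebesgue (b j) * (LINT x|lebesgue_on S. f x * tensor (b(j := \<rho> j)) x)"
    if b: "\<And>i. i \<in> Basis \<Longrightarrow> smooth (b i)" "\<And>i s. i \<in> Basis \<Longrightarrow> s < c \<bullet> i \<or> d \<bullet> i < s \<Longrightarrow> b i s = 0" and j: "j \<in> Basis" for b j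
  proof -
    \<comment> \<open>As in one variable: the j-th factor minus m times the unit bump has mean zero,
      hence is the derivative of a function supported in the same interval, and f annihilates the
      resulting tensor.\<close>
    define m where "m = integral\<^sup>L lebesgue (b j)"
    let ?r = "\<lambda>s. b j s - m * \<rho> j s"
    have int: "integrable lebesgue k" if "smooth k" "\<And>s. s < c \<bullet> j \<or> d \<bullet> j < s \<Longrightarrow> k s = 0" for k :: "real \<Rightarrow> real"
    proof -
      have "integrable (lebesgue_on {c \<bullet> j..d \<bullet> j}) k"
        by (intro continuous_integrable_lebesgue_on_Icc smooth_continuous_on that)
      then show ?thesis
        using integral_lebesgue_on_eq_0_outside(2)[of "{c \<bullet> j..d \<bullet> j}" UNIV k] that(2) by (simp add: lebesgue_on_UNIV_eq not_le)
    qed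
    have sm: "smooth ?r" by (intro smooth_diff smooth_mult smooth_const b \<rho> j)
    have out: "?r s = 0" if "s < c \<bullet> j \<or> d \<bullet> j < s" for s using b(2)[OF j that] \<rho>(2)[OF j that] by simp
    have int0: "integral\<^sup>L lebesgue ?r = 0"
      using int[OF b(1)[OF j] b(2)[OF j]] int[OF \<rho>(1)[OF j] \<rho>(2)[OF j]] \<rho>(3)[OF j] by (simp add: m_def)
    from bump_antiderivative[OF sm out less_imp_le[OF cd[OF j]], unfolded int0]
    obtain P where P: "smooth P" "\<And>s. (P has_real_derivative ?r s) (at s)" "\<And>s. s \<le> c \<bullet> j \<Longrightarrow> P s = 0" "\<And>s. d \<bullet> j \<le> s \<Longrightarrow> P s = 0"
      by blast
    have "tensor (b(j := P)) \<in> test_functions S"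
      by (rule tensor_test_function[OF _ _ sub]) (use b P in auto)
    from grad[OF j this] have "(LINT x|lebesgue_on S. f x * tensor (b(j := ?r)) x) = 0"
      using pderiv_at_tensor[OF b(1) P(1,2) j] by simp
    moreover have "tensor (b(j := ?r)) x = tensor b x - m * tensor (b(j := \<rho> j)) x" for x
    proof -
      have "tensor b x = b j (x \<bullet> j) * (\<Prod>i\<in>Basis - {j}. b i (x \<bullet> i))"
        using tensor_split[OF j, of b "b j" x] by simp
      moreover note tensor_split[OF j, of b ?r x] tensor_split[OF j, of b "\<rho> j" x]
      ultimately show ?thesis by (simp add: left_diff_distrib)
    qed
    moreover have "integrable (lebesgue_on S) (\<lambda>x. f x * tensor b x)"
      "integrable (lebesgue_on S) (\<lambda>x. f x * tensor (b(j := \<rho> j)) x)"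
      by (intro L1_loc_mult_test_integrable[OF f Sl] tensor_test_function[OF _ _ sub]; use b \<rho> in auto)+
    ultimately show ?thesis
      unfolding m_def[symmetric] by (simp add: right_diff_distrib mult.left_commute[of _ m])
  qed
  have "(LINT x|lebesgue_on S. f x * tensor b x) = (\<Prod>i\<in>A. integral\<^sup>L lebesgue (b i)) *
      (LINT x|lebesgue_on S. f x * tensor (\<lambda>i. if i \<in> A then \<rho> i else b i) x)" if "finite A" "A \<subseteq> Basis" for A
    using that
  proof (induction A rule: finite_induct)
    case (insert j A)
    let ?b = "\<lambda>i. if i \<in> A then \<rho> i else b i"
    have "?b(j := \<rho> j) = (\<lambda>i. if i \<in> insert j A then \<rho> i else b i)" by auto
    moreover have "(LINT x|lebesgue_on S. f x * tensor ?b x) = integral\<^sup>L lebesgue (?b j) * (LINT x|lebesgue_on S. f x * tensor (?b(j := \<rho> j)) x)"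
      by (rule step) (use insert b \<rho> in \<open>auto split: if_splits\<close>)
    ultimately show ?case using insert by simp
  qed simp
  from this[OF finite_Basis subset_refl] show ?thesis
    by (simp add: tensor_def cong: prod.cong)
qed

text \<open>By \<open>weak_gradient_zero_tensor\<close>, a box bump is paired with f to a multiple
  of F and with the constant 1 to the same multiple of K. So K f - F annihilates all bumps. Using
  the lemma for the constant 1 as well spares the evaluation of that multiple.\<close>

lemma weak_gradient_zero_box:
  fixes f :: "'a::euclidean_space \<Rightarrow> real"
  assumes f: "f \<in> L1_loc S" and S: "open S" and sub: "cbox c d \<subseteq> S" and cd: "\<And>i. i \<in> Basis \<Longrightarrow> c \<bullet> i < d \<bullet> i"
    and grad: "\<And>i \<phi>. i \<in> Basis \<Longrightarrow> \<phi> \<in> test_functions S \<Longrightarrow> (LINT x|lebesgue_on S. f x * pderiv_at i \<phi> x) = 0"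
  shows "\<exists>k. AE x in lebesgue_on (box c d). f x = k"
proof -
  have Sl: "S \<in> sets lebesgue" using S by auto
  have "\<forall>i\<in>Basis. \<exists>\<rho>. smooth \<rho> \<and> (\<forall>s. s < c \<bullet> i \<or> d \<bullet> i < s \<longrightarrow> \<rho> s = 0) \<and> integral\<^sup>L lebesgue \<rho> = 1"
    using unit_bump[OF cd] by metis
  then obtain \<rho> where "\<forall>i\<in>Basis. smooth (\<rho> i) \<and> (\<forall>s. s < c \<bullet> i \<or> d \<bullet> i < s \<longrightarrow> \<rho> i s = 0) \<and> integral\<^sup>L lebesgue (\<rho> i) = 1"
    by metis
  then have \<rho>: "\<And>i. i \<in> Basis \<Longrightarrow> smooth (\<rho> i)" "\<And>i s. i \<in> Basis \<Longrightarrow> s < c \<bullet> i \<or> d \<bullet> i < s \<Longrightarrow> \<rho> i s = 0"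
    "\<And>i. i \<in> Basis \<Longrightarrow> integral\<^sup>L lebesgue (\<rho> i) = 1" by blast+
  let ?F = "LINT x|lebesgue_on S. f x * tensor \<rho> x" and ?K = "LINT x|lebesgue_on S. 1 * tensor \<rho> x"
  have one: "(\<lambda>x. 1) \<in> L1_loc S" by (intro smooth_L1_loc smooth_const Sl)
  have grad1: "(LINT x|lebesgue_on S. 1 * pderiv_at i \<phi> x) = 0" if "\<phi> \<in> test_functions S" for i \<phi>
  proof -
    have "pderiv_at i (\<lambda>x :: 'a. 1 :: real) x = 0" for x by (rule pderiv_at_eqI) auto
    then show ?thesis using has_weak_derivD(3)[OF smooth_has_weak_deriv[OF smooth_const Sl] that, of 1 i] by simp
  qed
  have bump0: "box_bump a b n = (\<lambda>x. 0)" if "cbox a b = {}" for a b :: 'a and n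
    using that box_subset_cbox[of a b] by (auto intro!: box_bump_eq_0)
  have bump: "\<exists>m. (LINT x|lebesgue_on S. f x * box_bump a b n x) = m * ?F \<and> (LINT x|lebesgue_on S. 1 * box_bump a b n x) = m * ?K"
    if ab: "cbox a b \<subseteq> box c d" for a b n
  proof (cases "cbox a b = {}")
    case False
    let ?b = "\<lambda>i s. smooth_step (real n * (s - a \<bullet> i)) * smooth_step (real n * (b \<bullet> i - s))"
    have sm: "smooth (?b i)" for i
    proof -
      have "smooth (\<lambda>s. smooth_step (real n * s + - (real n * (a \<bullet> i))) * smooth_step (- real n * s + real n * (b \<bullet> i)))"
        by (intro smooth_mult smooth_compose_affine smooth_smooth_step) (auto intro: linearI simp: algebra_simps)
      then show ?thesis by (simp add: algebra_simps)
    qed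
    have out: "?b i s = 0" if "i \<in> Basis" "s < c \<bullet> i \<or> d \<bullet> i < s" for i s
    proof -
      have "a \<in> cbox a b" "b \<in> cbox a b" using False by (auto simp: box_ne_empty mem_box)
      then have "a \<in> box c d" "b \<in> box c d" using ab by auto
      then have "s - a \<bullet> i \<le> 0 \<or> b \<bullet> i - s \<le> 0" using that by (force simp: mem_box)
      then show ?thesis by (auto simp: smooth_step_eq_0_iff mult_nonneg_nonpos)
    qed
    show ?thesis
      unfolding box_bump_tensor
      using weak_gradient_zero_tensor[where b = ?b and \<rho> = \<rho>, OF f S sub cd grad \<rho> sm out]
        weak_gradient_zero_tensor[where b = ?b and \<rho> = \<rho>, OF one S sub cd grad1 \<rho> sm out]
      by (intro exI[of _ "\<Prod>i\<in>Basis. integral\<^sup>L lebesgue (?b i)"] conjI)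
  qed (auto simp: bump0 intro!: exI[of _ 0])
  have box: "box c d \<subseteq> S" using sub box_subset_cbox by blast
  have L: "k \<in> L1_loc (box c d)" if "k \<in> L1_loc S" for k :: "'a \<Rightarrow> real"
  proof -
    have "k \<in> borel_measurable (lebesgue_on (box c d))"
      using that by (intro measurable_restrict_mono[OF _ box]) (simp add: L1_loc_def)
    moreover have "integrable (lebesgue_on K) k" if "compact K" "K \<subseteq> box c d" for K
      using \<open>k \<in> L1_loc S\<close> that box unfolding L1_loc_def by blast
    ultimately show ?thesis unfolding L1_loc_def by blast
  qed
  have restr: "(LINT x|lebesgue_on (box c d). k x * box_bump a b n x) = (LINT x|lebesgue_on S. k x * box_bump a b n x)"
    if "cbox a b \<subseteq> box c d" for a b n and k :: "'a \<Rightarrow> real"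
    by (rule integral_lebesgue_on_eq_0_outside(1)[symmetric])
      (use that box Sl box_subset_cbox[of a b] in \<open>auto intro!: box_bump_eq_0\<close>)
  \<comment> \<open>If K were 0, the constant 1 would annihilate all bumps and vanish almost
    everywhere on a nonempty box.\<close>
  have K: "?K \<noteq> 0"
  proof
    assume K0: "?K = 0"
    have "AE x in lebesgue_on (box c d). (1 :: real) = 0"
    proof (rule fundamental_lemma_box_bumps[OF L[OF one]])
      fix a b n assume ab: "cbox a b \<subseteq> box c d"
      show "(LINT x|lebesgue_on (box c d). 1 * box_bump a b n x) = 0"
        unfolding restr[OF ab, of "\<lambda>x. 1"] using bump[OF ab, of n] K0 by auto
    qed (rule open_box)
    then have "AE x in lebesgue. x \<notin> box c d" by (simp add: AE_lebesgue_on_iff)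
    then have "negligible (box c d)" unfolding negligible_iff_null_sets completion.null_sets_iff_AE by simp
    then have "box c d = {}" unfolding negligible_interval .
    then show False using cd unfolding box_eq_empty by (meson not_le)
  qed
  have Kf: "(\<lambda>x. ?K * f x + (- ?F) * 1) \<in> L1_loc S" by (rule L1_loc_linear[OF f one])
  have "AE x in lebesgue_on (box c d). ?K * f x + (- ?F) * 1 = 0"
  proof (rule fundamental_lemma_box_bumps[OF L[OF Kf]])
    fix a b n assume ab: "cbox a b \<subseteq> box c d"
    obtain m where m: "(LINT x|lebesgue_on S. f x * box_bump a b n x) = m * ?F" "(LINT x|lebesgue_on S. 1 * box_bump a b n x) = m * ?K"
      using bump[OF ab] by blast
    have bt: "box_bump a b n \<in> test_functions S" using ab box by (intro box_bump_test_function) auto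
    have "(LINT x|lebesgue_on S. (?K * f x + (- ?F) * 1) * box_bump a b n x)
        = ?K * (LINT x|lebesgue_on S. f x * box_bump a b n x) - ?F * (LINT x|lebesgue_on S. 1 * box_bump a b n x)"
      using L1_loc_mult_test_integrable[OF f Sl bt] L1_loc_mult_test_integrable[OF one Sl bt]
      by (simp add: left_diff_distrib mult.assoc)
    also have "\<dots> = 0" unfolding m by simp
    finally show "(LINT x|lebesgue_on (box c d). (?K * f x + (- ?F) * 1) * box_bump a b n x) = 0"
      unfolding restr[OF ab, of "\<lambda>x. ?K * f x + (- ?F) * 1"] .
  qed (rule open_box)
  then have "AE x in lebesgue_on (box c d). f x = ?F / ?K"
    by eventually_elim (use K in \<open>simp add: field_simps\<close>)
  then show ?thesis by blast
qed

text \<open>The constants on small boxes must match where boxes overlap, since a nonempty open set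
  is not null. Grouping the boxes by their constant covers S by disjoint open sets, and
  connectedness leaves only one.\<close>

lemma weak_gradient_zero_connected:
  fixes f :: "'a::euclidean_space \<Rightarrow> real"
  assumes f: "f \<in> L1_loc S" and S: "open S" "connected S"
    and grad: "\<And>i \<phi>. i \<in> Basis \<Longrightarrow> \<phi> \<in> test_functions S \<Longrightarrow> (LINT x|lebesgue_on S. f x * pderiv_at i \<phi> x) = 0"
  shows "\<exists>k. AE x in lebesgue_on S. f x = k"
proof (cases "S = {}")
  case True
  then show ?thesis by (simp add: AE_lebesgue_on_iff)
next
  case False
  define B where "B k = {X. \<exists>c d. X = box c d \<and> cbox c d \<subseteq> S \<and> (AE x in lebesgue_on (box c d). f x = k)}" for k
  have opB: "open X" "X \<subseteq> S" if "X \<in> B k" for X k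
  proof -
    obtain c d where "X = box c d" "cbox c d \<subseteq> S" using \<open>X \<in> B k\<close> unfolding B_def by blast
    then show "open X" "X \<subseteq> S" using box_subset_cbox[of c d] by auto
  qed
  have cover: "\<exists>k. x \<in> \<Union>(B k)" if x: "x \<in> S" for x
  proof -
    obtain e where e: "e > 0" "cball x e \<subseteq> S" using S(1) x open_contains_cball by blast
    obtain c d where cd: "cbox c d \<subseteq> ball x e" "x \<in> box c d"
      by (rule open_contains_cbox[of "ball x e" x]) (use e(1) in auto)
    have sub: "cbox c d \<subseteq> S" using cd(1) e(2) by (meson ball_subset_cball subset_trans)
    have "\<exists>k. AE x in lebesgue_on (box c d). f x = k"
      by (rule weak_gradient_zero_box[OF f S(1) sub _ grad]) (use cd(2) in \<open>force simp: mem_box\<close>)+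
    then show ?thesis using cd(2) sub by (auto simp: B_def)
  qed
  have disj: "\<Union>(B k) \<inter> \<Union>(B k') = {}" if "k \<noteq> k'" for k k'
  proof (rule ccontr)
    assume "\<Union>(B k) \<inter> \<Union>(B k') \<noteq> {}"
    then obtain x X X' where X: "X \<in> B k" "X' \<in> B k'" "x \<in> X" "x \<in> X'" by blast
    have "AE y in lebesgue. y \<in> X \<longrightarrow> f y = k" "AE y in lebesgue. y \<in> X' \<longrightarrow> f y = k'"
      using X(1,2) by (auto simp: B_def AE_lebesgue_on_iff)
    then have "AE y in lebesgue. y \<notin> X \<inter> X'" by eventually_elim (use that in auto)
    then have "negligible (X \<inter> X')" unfolding negligible_iff_null_sets completion.null_sets_iff_AE by simp
    moreover have "open (X \<inter> X')" using opB(1)[OF X(1)] opB(1)[OF X(2)] by auto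
    ultimately show False using X(3,4) open_not_negligible by blast
  qed
  obtain x0 k where x0: "x0 \<in> S" "x0 \<in> \<Union>(B k)" using False cover by blast
  have "S \<subseteq> \<Union>(B k)"
  proof (rule ccontr)
    assume "\<not> S \<subseteq> \<Union>(B k)"
    then obtain y k' where y: "y \<in> S" "y \<in> \<Union>(B k')" "k' \<noteq> k" using cover by blast
    let ?C = "\<Union>k'\<in>-{k}. \<Union>(B k')"
    have "open (\<Union>(B k))" "open ?C" using opB(1) by (auto intro!: open_Union open_UN)
    moreover have "\<Union>(B k) \<inter> ?C \<inter> S = {}" using disj by blast
    moreover have "S \<subseteq> \<Union>(B k) \<union> ?C"
    proof
      fix x assume "x \<in> S"
      then obtain l where "x \<in> \<Union>(B l)" using cover by blast
      then show "x \<in> \<Union>(B k) \<union> ?C" by (cases "l = k") auto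
    qed
    moreover have "\<Union>(B k) \<inter> S \<noteq> {}" "?C \<inter> S \<noteq> {}" using x0 y by blast+
    ultimately show False using connectedD[OF S(2), of "\<Union>(B k)" ?C] by simp
  qed
  \<comment> \<open>The exceptional null sets are united over a countable subfamily of
    boxes.\<close>
  obtain D where D: "D \<subseteq> B k" "countable D" "\<Union>D = \<Union>(B k)" using Lindelof[of "B k"] opB(1) by blast
  have "AE x in lebesgue. \<forall>X\<in>D. x \<in> X \<longrightarrow> f x = k"
    by (subst AE_ball_countable[OF D(2)]) (use D(1) in \<open>auto simp: B_def AE_lebesgue_on_iff\<close>)
  then have "AE x in lebesgue. x \<in> S \<longrightarrow> f x = k"
    by eventually_elim (use \<open>S \<subseteq> \<Union>(B k)\<close> D(3) in blast)
  then show ?thesis using S(1) by (auto simp: AE_lebesgue_on_iff)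
qed

lemma fst_inner: "fst (x :: R3) \<bullet> i = x \<bullet> (i, 0)"
  by (simp add: inner_prod_def)

lemma Basis_R2: "(Basis :: R2 set) = {axis 1 1, axis 2 1}"
  by (auto simp: Basis_vec_def UNIV_2)

lemma sum_Basis_R2: "(\<Sum>i\<in>(Basis :: R2 set). F i) = F (axis 1 1) + F (axis 2 1)"
  unfolding Basis_R2 by (subst sum.insert) (auto simp: axis_eq_axis)

lemma L2_square_zero:
  assumes "f \<in> L2 S" "(LINT x|lebesgue_on S. (f x)\<^sup>2) \<le> 0"
  shows "AE x in lebesgue_on S. f x = 0"
proof -
  have "(LINT x|lebesgue_on S. (f x)\<^sup>2) = 0" using assms(2) by (intro antisym) auto
  then show ?thesis by (simp add: integral_nonneg_eq_0_iff_AE[OF L2_square_integrable[OF assms(1)]])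
qed

lemma H1_linear:
  assumes "f \<in> H1 S" "g \<in> H1 S" "open S"
  shows "(\<lambda>x. a * f x + b * g x) \<in> H1 S"
  unfolding H1_def
proof (intro CollectI conjI ballI)
  show "(\<lambda>x. a * f x + b * g x) \<in> L2 S" by (intro L2_linear H1_L2 assms)
  fix v :: 'a assume v: "v \<in> Basis"
  show "\<exists>d\<in>L2 S. has_weak_deriv S v (\<lambda>x. a * f x + b * g x) d"
    using has_weak_deriv_linear[OF H1_wderiv(1)[OF assms(1) v assms(3)] H1_wderiv(1)[OF assms(2) v assms(3)]]
      L2_linear[OF H1_wderiv(2)[OF assms(1) v assms(3)] H1_wderiv(2)[OF assms(2) v assms(3)]] assms(3)
    by (intro bexI[of _ "\<lambda>x. a * wderiv S v f x + b * wderiv S v g x"]) auto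
qed

context column_domain begin

subsection \<open>Column representations of differences\<close>

lemma col_prim_diff:
  assumes "integrable (lebesgue_on \<Omega>) g1" "integrable (lebesgue_on \<Omega>) g2"
  shows "AE z' in lebesgue_on \<omega>. \<forall>s\<in>{0..h z'}.
    col_prim (\<lambda>z. g1 z - g2 z) (z', s) = col_prim g1 (z', s) - col_prim g2 (z', s)"
  using column_Fubini(1)[OF assms(1)] column_Fubini(1)[OF assms(2)]
proof eventually_elim
  case (elim z')
  show ?case
  proof
    fix s assume s: "s \<in> {0..h z'}"
    have "integrable (lebesgue_on {0..s}) (\<lambda>t. g1 (z', t))" "integrable (lebesgue_on {0..s}) (\<lambda>t. g2 (z', t))"
      using s by (auto intro!: integrable_lebesgue_on_subset[OF elim(1)] integrable_lebesgue_on_subset[OF elim(2)])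
    then show "col_prim (\<lambda>z. g1 z - g2 z) (z', s) = col_prim g1 (z', s) - col_prim g2 (z', s)"
      by (simp add: col_prim_def)
  qed
qed

lemma has_column_rep_diff:
  assumes 1: "has_column_rep f1 c1 g1" and 2: "has_column_rep f2 c2 g2"
  shows "has_column_rep (\<lambda>z. f1 z - f2 z) (\<lambda>z'. c1 z' - c2 z') (\<lambda>z. g1 z - g2 z)"
    and "AE z' in lebesgue_on \<omega>. col_top (\<lambda>z'. c1 z' - c2 z') (\<lambda>z. g1 z - g2 z) z' = col_top c1 g1 z' - col_top c2 g2 z'"
proof -
  have i: "integrable (lebesgue_on \<Omega>) g1" "integrable (lebesgue_on \<Omega>) g2"
    "integrable (lebesgue_on \<omega>) c1" "integrable (lebesgue_on \<omega>) c2"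
    and ae: "AE z in lebesgue_on \<Omega>. f1 z = c1 (fst z) + col_prim g1 z" "AE z in lebesgue_on \<Omega>. f2 z = c2 (fst z) + col_prim g2 z"
    using 1 2 by (auto simp: has_column_rep_def)
  note pd = col_prim_diff[OF i(1,2)]
  have mem: "AE z in lebesgue_on \<Omega>. z \<in> \<Omega>" by (simp add: AE_lebesgue_on_iff)
  have "AE z in lebesgue_on \<Omega>. f1 z - f2 z = (c1 (fst z) - c2 (fst z)) + col_prim (\<lambda>z. g1 z - g2 z) z"
    using ae column_AE_fst[OF pd] mem
  proof eventually_elim
    case (elim z)
    have "snd z \<in> {0..h (fst z)}" using elim(4) by (simp add: mem_dom)
    with elim(3) have "col_prim (\<lambda>z. g1 z - g2 z) z = col_prim g1 z - col_prim g2 z"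
      using bspec[OF elim(3), of "snd z"] by simp
    with elim(1,2) show ?case by simp
  qed
  then show "has_column_rep (\<lambda>z. f1 z - f2 z) (\<lambda>z'. c1 z' - c2 z') (\<lambda>z. g1 z - g2 z)"
    using i by (simp add: has_column_rep_def)
  have mem': "AE z' in lebesgue_on \<omega>. z' \<in> \<omega>" by (simp add: AE_lebesgue_on_iff)
  show "AE z' in lebesgue_on \<omega>. col_top (\<lambda>z'. c1 z' - c2 z') (\<lambda>z. g1 z - g2 z) z' = col_top c1 g1 z' - col_top c2 g2 z'"
    using pd mem'
  proof eventually_elim
    case (elim z')
    have "h z' \<in> {0..h z'}" using height_pos[OF elim(2)] by simp
    with elim(1) show ?case by (simp add: col_top_def)
  qed
qed

lemma has_column_rep_uminus:
  assumes "has_column_rep f c g"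
  shows "has_column_rep (\<lambda>z. - f z) (\<lambda>z'. - c z') (\<lambda>z. - g z)"
proof -
  have "has_column_rep (\<lambda>z. 0) (\<lambda>z'. 0) (\<lambda>z. 0)" by (simp add: has_column_rep_def col_prim_def)
  from has_column_rep_diff(1)[OF this assms] show ?thesis by simp
qed

lemma has_column_rep_cong_bottom:
  assumes "has_column_rep f c g" "AE z' in lebesgue_on \<omega>. c z' = c' z'"
  shows "has_column_rep f c' g" "AE z' in lebesgue_on \<omega>. col_top c g z' = t z' \<Longrightarrow> AE z' in lebesgue_on \<omega>. col_top c' g z' = t z'"
proof -
  have i: "integrable (lebesgue_on \<Omega>) g" "integrable (lebesgue_on \<omega>) c" and ae: "AE z in lebesgue_on \<Omega>. f z = c (fst z) + col_prim g z"
    using assms(1) by (auto simp: has_column_rep_def)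
  have "AE z in lebesgue_on \<Omega>. f z = c' (fst z) + col_prim g z"
    using ae column_AE_fst[OF assms(2)] by eventually_elim simp
  then show "has_column_rep f c' g"
    using i integrable_lebesgue_on_cong_AE[OF i(2) assms(2)] by (simp add: has_column_rep_def)
  show "AE z' in lebesgue_on \<omega>. col_top c' g z' = t z'" if "AE z' in lebesgue_on \<omega>. col_top c g z' = t z'"
    using that assms(2) by eventually_elim (simp add: col_top_def)
qed

text \<open>With zero density the bottom value equals the top value, so a zero trace on the top
  suffices; nothing is known at the bottom in the slip regimes.\<close>

lemma column_rep_zero:
  assumes f: "has_column_rep f c g" and g: "AE z in lebesgue_on \<Omega>. g z = 0" and top: "AE z' in lebesgue_on \<omega>. col_top c g z' = 0"
  shows "AE z in lebesgue_on \<Omega>. f z = 0"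
proof -
  have p0: "AE z' in lebesgue_on \<omega>. \<forall>s\<in>{0..h z'}. col_prim g (z', s) = 0"
    using column_AE[OF g]
  proof eventually_elim
    case (elim z')
    show ?case
    proof
      fix s assume s: "s \<in> {0..h z'}"
      have "AE t in lebesgue_on {0..s}. g (z', t) = 0"
        by (rule AE_lebesgue_on_subset[OF elim]) (use s in auto)
      then show "col_prim g (z', s) = 0" unfolding col_prim_def by (simp add: integral_eq_zero_AE)
    qed
  qed
  have mem': "AE z' in lebesgue_on \<omega>. z' \<in> \<omega>" by (simp add: AE_lebesgue_on_iff)
  have good: "AE z' in lebesgue_on \<omega>. c z' = 0 \<and> (\<forall>s\<in>{0..h z'}. col_prim g (z', s) = 0)"
    using p0 top mem'
  proof eventually_elim
    case (elim z')
    have "h z' \<in> {0..h z'}" using height_pos[OF elim(3)] by simp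
    with elim show ?case by (simp add: col_top_def)
  qed
  have ae: "AE z in lebesgue_on \<Omega>. f z = c (fst z) + col_prim g z" using f by (simp add: has_column_rep_def)
  have mem: "AE z in lebesgue_on \<Omega>. z \<in> \<Omega>" by (simp add: AE_lebesgue_on_iff)
  show ?thesis
    using ae column_AE_fst[OF good] mem
  proof eventually_elim
    case (elim z)
    have "snd z \<in> {0..h (fst z)}" using elim(3) by (simp add: mem_dom)
    then show ?case using elim(1) conjunct2[OF elim(2)] conjunct1[OF elim(2)] by (metis add_0 prod.collapse)
  qed
qed

subsection \<open>The reduced rotation, flux and pressure gradient\<close>

text \<open>The component along k of the reduced rotation, in terms of the full three-dimensional
  field; see \<open>rot_z3_inner\<close>.\<close>

definition col_rot :: "(R3 \<Rightarrow> R3) \<Rightarrow> R2 \<Rightarrow> R3 \<Rightarrow> real" where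
  "col_rot a k z = (k \<bullet> axis 2 1) * wderiv \<Omega> e3 (\<lambda>y. a y \<bullet> e1) z - (k \<bullet> axis 1 1) * wderiv \<Omega> e3 (\<lambda>y. a y \<bullet> e2) z"

lemma rot_z3_inner: "rot_z3 \<Omega> (\<lambda>z. fst (a z)) z \<bullet> k = col_rot a k z"
proof -
  have "(\<lambda>y. fst (a y) $ 1) = (\<lambda>y. a y \<bullet> e1)" "(\<lambda>y. fst (a y) $ 2) = (\<lambda>y. a y \<bullet> e2)"
    by (simp_all add: e1_def e2_def inner_prod_def inner_axis)
  then show ?thesis
    by (simp add: rot_z3_def col_rot_def inner_vec_def sum_2 inner_axis axis_def)
qed

lemma e1_e2_Basis: "e1 \<in> Basis" "e2 \<in> Basis"
  by (simp_all add: e1_def e2_def Basis_prod_def)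

lemma col_rot_L2:
  assumes "\<And>i. i \<in> Basis \<Longrightarrow> (\<lambda>y. a y \<bullet> i) \<in> V_z3 \<Omega>"
  shows "col_rot a k \<in> L2 \<Omega>"
  unfolding col_rot_def[abs_def] by (intro L2_diff L2_cmult V_z3_wderiv(3) assms e1_e2_Basis)

text \<open>The absence of boundary terms is a hypothesis because it has two sources. In the
  momentum balance the microrotation vanishes at both ends and \<open>\<phi>\<close> may reach the
  bottom; in the spin balance it is \<open>\<phi>\<close> that vanishes.\<close>

lemma test_rot_z3_parts:
  assumes a: "\<And>i. i \<in> Basis \<Longrightarrow> (\<lambda>y. a y \<bullet> i) \<in> V_z3 \<Omega>" and \<phi>: "smooth \<phi>"
    and parts: "\<And>i. i \<in> Basis \<Longrightarrow> (LINT z|lebesgue_on \<Omega>. (a z \<bullet> i) * pderiv_at e3 \<phi> z) + (LINT z|lebesgue_on \<Omega>. wderiv \<Omega> e3 (\<lambda>y. a y \<bullet> i) z * \<phi> z) = 0"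
  shows "(LINT z|lebesgue_on \<Omega>. test_rot_z3 \<phi> (k, 0) z \<bullet> a z) = (LINT z|lebesgue_on \<Omega>. col_rot a k z * \<phi> z)"
proof -
  have i: "integrable (lebesgue_on \<Omega>) (\<lambda>z. (a z \<bullet> i) * pderiv_at e3 \<phi> z)"
    "integrable (lebesgue_on \<Omega>) (\<lambda>z. wderiv \<Omega> e3 (\<lambda>y. a y \<bullet> i) z * \<phi> z)" if "i \<in> Basis" for i
    by (intro integrable_mult_smooth L2_dom_integrable V_z3_wderiv a that smooth_pderiv_at \<phi> bounded_dom)+
  have k: "(k, 0 :: real) \<bullet> e1 = k \<bullet> axis 1 1" "(k, 0 :: real) \<bullet> e2 = k \<bullet> axis 2 1"
    by (simp_all add: e1_def e2_def inner_prod_def)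
  have "(LINT z|lebesgue_on \<Omega>. test_rot_z3 \<phi> (k, 0) z \<bullet> a z)
      = (LINT z|lebesgue_on \<Omega>. - (k \<bullet> axis 2 1) * ((a z \<bullet> e1) * pderiv_at e3 \<phi> z) + (k \<bullet> axis 1 1) * ((a z \<bullet> e2) * pderiv_at e3 \<phi> z))"
    by (rule Bochner_Integration.integral_cong)
      (auto simp: test_rot_z3_def k inner_add_left inner_commute[of _ "a _"] inner_add_right algebra_simps)
  also have "\<dots> = - (k \<bullet> axis 2 1) * (LINT z|lebesgue_on \<Omega>. (a z \<bullet> e1) * pderiv_at e3 \<phi> z)
      + (k \<bullet> axis 1 1) * (LINT z|lebesgue_on \<Omega>. (a z \<bullet> e2) * pderiv_at e3 \<phi> z)"
    using i(1)[OF e1_e2_Basis(1)] i(1)[OF e1_e2_Basis(2)] by simp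
  also have "\<dots> = (k \<bullet> axis 2 1) * (LINT z|lebesgue_on \<Omega>. wderiv \<Omega> e3 (\<lambda>y. a y \<bullet> e1) z * \<phi> z)
      - (k \<bullet> axis 1 1) * (LINT z|lebesgue_on \<Omega>. wderiv \<Omega> e3 (\<lambda>y. a y \<bullet> e2) z * \<phi> z)"
  proof -
    have "(LINT z|lebesgue_on \<Omega>. (a z \<bullet> i) * pderiv_at e3 \<phi> z) = - (LINT z|lebesgue_on \<Omega>. wderiv \<Omega> e3 (\<lambda>y. a y \<bullet> i) z * \<phi> z)"
      if "i \<in> Basis" for i using parts[OF that] by simp
    then show ?thesis using e1_e2_Basis by simp
  qed
  also have "\<dots> = (LINT z|lebesgue_on \<Omega>. col_rot a k z * \<phi> z)"
    using i(2)[OF e1_e2_Basis(1)] i(2)[OF e1_e2_Basis(2)] by (simp add: col_rot_def left_diff_distrib mult.assoc)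
  finally show ?thesis .
qed

lemma flux_Fubini:
  fixes a :: "R3 \<Rightarrow> R3"
  assumes a: "\<And>i. i \<in> Basis \<Longrightarrow> (\<lambda>z. a z \<bullet> i) \<in> L2 \<Omega>" and \<theta>: "\<theta> \<in> H1 \<omega>"
  shows "(LINT z'|lebesgue_on \<omega>. (\<Sum>i\<in>Basis. (LINT s|lebesgue_on {0..h z'}. fst (a (z', s)) \<bullet> i) * wderiv \<omega> i \<theta> z'))
    = (\<Sum>i\<in>Basis. LINT z|lebesgue_on \<Omega>. (a z \<bullet> (i, 0)) * wderiv \<omega> i \<theta> (fst z))"
proof -
  have i: "integrable (lebesgue_on \<Omega>) (\<lambda>z. (a z \<bullet> (i, 0)) * wderiv \<omega> i \<theta> (fst z))" if "i \<in> Basis" for i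
    by (intro L2_mult_integrable a[OF horizontal_Basis[OF that]] fst_L2 H1_wderiv[OF \<theta> that open_base])
  have "(\<Sum>i\<in>Basis. LINT z|lebesgue_on \<Omega>. (a z \<bullet> (i, 0)) * wderiv \<omega> i \<theta> (fst z))
      = (\<Sum>i\<in>Basis. LINT z'|lebesgue_on \<omega>. (LINT s|lebesgue_on {0..h z'}. fst (a (z', s)) \<bullet> i) * wderiv \<omega> i \<theta> z')"
    by (intro sum.cong refl) (simp add: column_Fubini(3)[OF i] fst_inner)
  also have "\<dots> = (LINT z'|lebesgue_on \<omega>. (\<Sum>i\<in>Basis. (LINT s|lebesgue_on {0..h z'}. fst (a (z', s)) \<bullet> i) * wderiv \<omega> i \<theta> z'))"
    by (rule Bochner_Integration.integral_sum[symmetric]) (use column_Fubini(2)[OF i] in \<open>simp add: fst_inner\<close>)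
  finally show ?thesis by simp
qed

lemma pressure_weak_deriv:
  assumes q: "q \<in> H1 \<omega>" and p: "AE z in lebesgue_on \<Omega>. p z = q (fst z)" and k: "k \<in> Basis"
  shows "has_weak_deriv \<Omega> (k, 0) p (wderiv \<Omega> (k, 0) p)"
    and "AE z in lebesgue_on \<Omega>. wderiv \<Omega> (k, 0) p z = wderiv \<omega> k q (fst z)"
    and "wderiv \<Omega> (k, 0) p \<in> L2 \<Omega>"
proof -
  note W = H1_wderiv[OF q k open_base]
  have wd: "has_weak_deriv \<Omega> (k, 0) p (\<lambda>z. wderiv \<omega> k q (fst z))"
    by (rule has_weak_deriv_cong_AE[OF fst_has_weak_deriv[OF H1_L2[OF q] W(2,1)]])
      (use p in \<open>auto elim: eventually_mono\<close>)
  show "has_weak_deriv \<Omega> (k, 0) p (wderiv \<Omega> (k, 0) p)" by (rule has_weak_deriv_wderiv[OF wd])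
  show "AE z in lebesgue_on \<Omega>. wderiv \<Omega> (k, 0) p z = wderiv \<omega> k q (fst z)" by (rule wderiv_AE_eq[OF wd open_dom])
  show "wderiv \<Omega> (k, 0) p \<in> L2 \<Omega>" by (rule wderiv_L2[OF wd open_dom fst_L2[OF W(2)]])
qed

text \<open>Integrating over columns gives integrability of the square of c times the height, and
  the height is bounded below.\<close>

lemma column_constant_L2:
  assumes c: "integrable (lebesgue_on \<omega>) c" and L: "(\<lambda>z. c (fst z)) \<in> L2 \<Omega>"
  shows "c \<in> L2 \<omega>"
proof -
  have "integrable (lebesgue_on \<omega>) (\<lambda>z'. LINT s|lebesgue_on {0..h z'}. (c z')\<^sup>2)"
    using column_Fubini(2)[OF L2_square_integrable[OF L]] by simp
  moreover have "(LINT s|lebesgue_on {0..h z'}. (c z')\<^sup>2) = h z' * (c z')\<^sup>2" if "z' \<in> \<omega>" for z'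
    using height_pos[OF that] by (simp add: measure_restrict_space)
  ultimately have i: "integrable (lebesgue_on \<omega>) (\<lambda>z'. h z' * (c z')\<^sup>2)"
    by (subst (asm) Bochner_Integration.integrable_cong[OF refl, where g = "\<lambda>z'. h z' * (c z')\<^sup>2"]) auto
  have "integrable (lebesgue_on \<omega>) (\<lambda>z'. (h z' * (c z')\<^sup>2) * (1 / h z'))"
  proof (rule integrable_mult_bounded[OF i])
    have "continuous_on \<omega> (\<lambda>z'. 1 / h z')"
      using height_pos by (intro continuous_intros continuous_height) (auto simp: less_imp_neq[THEN not_sym])
    then show "(\<lambda>z'. 1 / h z') \<in> borel_measurable (lebesgue_on \<omega>)"
      by (rule continuous_imp_measurable_on_sets_lebesgue) simp
    show "\<bar>1 / h z'\<bar> \<le> 1 / hmin" if "z' \<in> \<omega>" for z'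
      using hmin_le[OF that] hmin_pos by (simp add: frac_le)
  qed
  then have "integrable (lebesgue_on \<omega>) (\<lambda>z'. (c z')\<^sup>2)"
    by (subst (asm) Bochner_Integration.integrable_cong[OF refl, where g = "\<lambda>z'. (c z')\<^sup>2"])
      (auto dest: height_pos)
  then show ?thesis using borel_measurable_integrable[OF c] by (simp add: L2_def)
qed

text \<open>Every column has positive length, so a base point at which the property fails would
  carry a non-null set of failures above it.\<close>

lemma base_AE_of_column_AE:
  assumes "AE z in lebesgue_on \<Omega>. Q (fst z)"
  shows "AE z' in lebesgue_on \<omega>. Q z'"
proof -
  have mem: "AE z' in lebesgue_on \<omega>. z' \<in> \<omega>" by (simp add: AE_lebesgue_on_iff)
  show ?thesis using column_AE[OF assms] mem
  proof eventually_elim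
    case (elim z')
    show ?case
    proof (rule ccontr)
      assume "\<not> Q z'"
      with elim(1) have "AE s in lebesgue. s \<notin> {0..h z'}" by (simp add: AE_lebesgue_on_iff)
      then have "negligible (cbox 0 (h z'))" unfolding negligible_iff_null_sets completion.null_sets_iff_AE by simp
      then have "box 0 (h z') = {}" using negligible_interval(1)[of 0 "h z'"] by simp
      then show False using height_pos[OF elim(2)] by simp
    qed
  qed
qed

end

subsection \<open>The energy of a difference of solutions\<close>

context column_domain begin

lemma column_product_top_zero:
  assumes 1: "has_column_rep f1 c1 g1" "AE z' in lebesgue_on \<omega>. col_top c1 g1 z' = 0" and 2: "has_column_rep f2 c2 g2"
    and L: "f1 \<in> L2 \<Omega>" "g1 \<in> L2 \<Omega>" "f2 \<in> L2 \<Omega>" "g2 \<in> L2 \<Omega>"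
  shows "(LINT z|lebesgue_on \<Omega>. f1 z * g2 z) + (LINT z|lebesgue_on \<Omega>. g1 z * f2 z) = - (LINT z'|lebesgue_on \<omega>. c1 z' * c2 z')"
proof -
  have i: "integrable (lebesgue_on \<Omega>) (\<lambda>z. f1 z * g2 z)" "integrable (lebesgue_on \<Omega>) (\<lambda>z. g1 z * f2 z)"
    by (intro L2_mult_integrable L)+
  have "(LINT z|lebesgue_on \<Omega>. f1 z * g2 z) + (LINT z|lebesgue_on \<Omega>. g1 z * f2 z)
      = (LINT z'|lebesgue_on \<omega>. col_top c1 g1 z' * col_top c2 g2 z' - c1 z' * c2 z')"
    using column_product[OF 1(1) 2 i] i by simp
  also have "\<dots> = (LINT z'|lebesgue_on \<omega>. - (c1 z' * c2 z'))"
    by (rule integral_lebesgue_on_cong_AE[OF eventually_mono[OF 1(2)]]) auto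
  finally show ?thesis by simp
qed

text \<open>The density is a weak derivative, and weak derivatives are unique. This is how a
  vanishing shear forces the pressure gradient to vanish.\<close>

lemma column_rep_deriv_zero:
  assumes f: "has_column_rep f c g" and 0: "AE z in lebesgue_on \<Omega>. f z = 0"
  shows "AE z in lebesgue_on \<Omega>. g z = 0"
proof -
  have g: "has_weak_deriv \<Omega> e3 (\<lambda>z. 0) g"
    by (rule has_weak_deriv_cong_AE[OF has_column_rep_weak_deriv[OF f] 0]) auto
  have "has_column_rep (\<lambda>z. 0) (\<lambda>z'. 0) (\<lambda>z. 0)" by (simp add: has_column_rep_def col_prim_def)
  from has_weak_deriv_unique[OF g has_column_rep_weak_deriv[OF this] open_dom] show ?thesis .
qed

text \<open>Testing the two balance laws with the difference itself; the coupling terms are absorbed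
  by \<open>(A\<^sub>2 + 2 W\<^sub>1)\<^sup>2 \<ge> 0\<close> and \<open>(A\<^sub>1 - 2 W\<^sub>2)\<^sup>2 \<ge> 0\<close>, which is where \<open>N\<^sup>2 < 1\<close> enters.\<close>

lemma micropolar_energy:
  fixes N Rc :: real and U1 U2 A1 A2 W1 W2 D1 D2 Q1 Q2 :: "R3 \<Rightarrow> real"
  assumes N: "N\<^sup>2 < 1" and Rc: "0 < Rc"
    and L: "U1 \<in> L2 \<Omega>" "U2 \<in> L2 \<Omega>" "A1 \<in> L2 \<Omega>" "A2 \<in> L2 \<Omega>" "W1 \<in> L2 \<Omega>" "W2 \<in> L2 \<Omega>" "D1 \<in> L2 \<Omega>" "D2 \<in> L2 \<Omega>"
      "Q1 \<in> L2 \<Omega>" "Q2 \<in> L2 \<Omega>"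
    and U: "has_column_rep U1 c1 A1" "AE z' in lebesgue_on \<omega>. col_top c1 A1 z' = 0"
      "has_column_rep U2 c2 A2" "AE z' in lebesgue_on \<omega>. col_top c2 A2 z' = 0"
    and A: "has_column_rep A1 \<beta>1 (\<lambda>z. Q1 z + 2 * N\<^sup>2 * D2 z)" "has_column_rep A2 \<beta>2 (\<lambda>z. Q2 z - 2 * N\<^sup>2 * D1 z)"
    and W: "has_column_rep W1 (\<lambda>z'. 0) D1" "AE z' in lebesgue_on \<omega>. col_top (\<lambda>z'. 0) D1 z' = 0"
      "has_column_rep W2 (\<lambda>z'. 0) D2" "AE z' in lebesgue_on \<omega>. col_top (\<lambda>z'. 0) D2 z' = 0"
    and D: "has_column_rep D1 \<delta>1 (\<lambda>z. (4 * N\<^sup>2 * W1 z + 2 * N\<^sup>2 * A2 z) / Rc)"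
      "has_column_rep D2 \<delta>2 (\<lambda>z. (4 * N\<^sup>2 * W2 z - 2 * N\<^sup>2 * A1 z) / Rc)"
    and bot: "AE z' in lebesgue_on \<omega>. 0 \<le> c1 z' * \<beta>1 z'" "AE z' in lebesgue_on \<omega>. 0 \<le> c2 z' * \<beta>2 z'"
    and flux: "(LINT z|lebesgue_on \<Omega>. U1 z * Q1 z) + (LINT z|lebesgue_on \<Omega>. U2 z * Q2 z) = 0"
  shows "AE z in lebesgue_on \<Omega>. U1 z = 0 \<and> U2 z = 0 \<and> W1 z = 0 \<and> W2 z = 0 \<and> Q1 z = 0 \<and> Q2 z = 0"
proof -
  let ?I = "\<lambda>f. LINT z|lebesgue_on \<Omega>. f z"
  note [simp] = L2_mult_integrable[OF L(1) L(9)] L2_mult_integrable[OF L(1) L(8)] L2_mult_integrable[OF L(2) L(10)]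
    L2_mult_integrable[OF L(2) L(7)] L2_mult_integrable[OF L(4) L(5)] L2_mult_integrable[OF L(3) L(6)]
    L2_square_integrable[OF L(3)] L2_square_integrable[OF L(4)] L2_square_integrable[OF L(5)] L2_square_integrable[OF L(6)]
    L2_square_integrable[OF L(7)] L2_square_integrable[OF L(8)]
  have LE: "(\<lambda>z. Q1 z + 2 * N\<^sup>2 * D2 z) \<in> L2 \<Omega>" "(\<lambda>z. Q2 z - 2 * N\<^sup>2 * D1 z) \<in> L2 \<Omega>"
    "(\<lambda>z. (4 * N\<^sup>2 * W1 z + 2 * N\<^sup>2 * A2 z) / Rc) \<in> L2 \<Omega>" "(\<lambda>z. (4 * N\<^sup>2 * W2 z - 2 * N\<^sup>2 * A1 z) / Rc) \<in> L2 \<Omega>"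
    using L2_linear[OF L(9,8), of 1 "2 * N\<^sup>2"] L2_linear[OF L(10,7), of 1 "- 2 * N\<^sup>2"]
      L2_linear[OF L(5,4), of "4 * N\<^sup>2 / Rc" "2 * N\<^sup>2 / Rc"] L2_linear[OF L(6,3), of "4 * N\<^sup>2 / Rc" "- 2 * N\<^sup>2 / Rc"]
    by (simp_all add: add_divide_distrib diff_divide_distrib)
  have b: "0 \<le> (LINT z'|lebesgue_on \<omega>. c1 z' * \<beta>1 z')" "0 \<le> (LINT z'|lebesgue_on \<omega>. c2 z' * \<beta>2 z')"
    by (intro integral_nonneg_AE bot)+
  \<comment> \<open>The bottom contributes minus the integral of \<open>c1 \<beta>1\<close>, which
    has a sign. Passing to an inequality lets one computation serve all three friction
    regimes.\<close>
  have a1: "?I (\<lambda>z. U1 z * Q1 z) + 2 * N\<^sup>2 * ?I (\<lambda>z. U1 z * D2 z) + ?I (\<lambda>z. (A1 z)\<^sup>2) \<le> 0"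
    using column_product_top_zero[OF U(1,2) A(1) L(1,3) L(3) LE(1)] b(1)
    by (simp add: distrib_left power2_eq_square mult.left_commute[of "U1 _"])
  have a2: "?I (\<lambda>z. U2 z * Q2 z) - 2 * N\<^sup>2 * ?I (\<lambda>z. U2 z * D1 z) + ?I (\<lambda>z. (A2 z)\<^sup>2) \<le> 0"
    using column_product_top_zero[OF U(3,4) A(2) L(2,4) L(4) LE(2)] b(2)
    by (simp add: right_diff_distrib power2_eq_square mult.left_commute[of "U2 _"])
  have "(\<lambda>z. W1 z * ((4 * N\<^sup>2 * W1 z + 2 * N\<^sup>2 * A2 z) / Rc)) = (\<lambda>z. (4 * N\<^sup>2 / Rc) * (W1 z)\<^sup>2 + (2 * N\<^sup>2 / Rc) * (A2 z * W1 z))"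
    by (simp add: fun_eq_iff power2_eq_square algebra_simps add_divide_distrib)
  note eq = column_product_top_zero[OF W(1,2) D(1) L(5,7,7) LE(3), unfolded this]
  have "(4 * N\<^sup>2 / Rc) * ?I (\<lambda>z. (W1 z)\<^sup>2) + (2 * N\<^sup>2 / Rc) * ?I (\<lambda>z. A2 z * W1 z) + ?I (\<lambda>z. (D1 z)\<^sup>2) = 0"
    using eq by (simp add: power2_eq_square[of "D1 _", symmetric])
  then have d1: "4 * N\<^sup>2 * ?I (\<lambda>z. (W1 z)\<^sup>2) + 2 * N\<^sup>2 * ?I (\<lambda>z. A2 z * W1 z) + Rc * ?I (\<lambda>z. (D1 z)\<^sup>2) = 0"
    using Rc by (simp add: field_simps)
  have "(\<lambda>z. W2 z * ((4 * N\<^sup>2 * W2 z - 2 * N\<^sup>2 * A1 z) / Rc)) = (\<lambda>z. (4 * N\<^sup>2 / Rc) * (W2 z)\<^sup>2 - (2 * N\<^sup>2 / Rc) * (A1 z * W2 z))"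
    by (simp add: fun_eq_iff power2_eq_square algebra_simps diff_divide_distrib)
  note eq = column_product_top_zero[OF W(3,4) D(2) L(6,8,8) LE(4), unfolded this]
  have "(4 * N\<^sup>2 / Rc) * ?I (\<lambda>z. (W2 z)\<^sup>2) - (2 * N\<^sup>2 / Rc) * ?I (\<lambda>z. A1 z * W2 z) + ?I (\<lambda>z. (D2 z)\<^sup>2) = 0"
    using eq by (simp add: power2_eq_square[of "D2 _", symmetric])
  then have d2: "4 * N\<^sup>2 * ?I (\<lambda>z. (W2 z)\<^sup>2) - 2 * N\<^sup>2 * ?I (\<lambda>z. A1 z * W2 z) + Rc * ?I (\<lambda>z. (D2 z)\<^sup>2) = 0"
    using Rc by (simp add: field_simps)
  \<comment> \<open>The coupling terms of the two balances are exchanged by integration by parts. No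
    boundary term arises: U vanishes on the top and W on the bottom.\<close>
  have x: "?I (\<lambda>z. U1 z * D2 z) = - ?I (\<lambda>z. A1 z * W2 z)" "?I (\<lambda>z. U2 z * D1 z) = - ?I (\<lambda>z. A2 z * W1 z)"
    using column_product_top_zero[OF U(1,2) W(3) L(1,3,6,8)] column_product_top_zero[OF U(3,4) W(1) L(2,4,5,7)] by auto
  have "0 \<le> ?I (\<lambda>z. (A2 z + 2 * W1 z)\<^sup>2)" "0 \<le> ?I (\<lambda>z. (A1 z - 2 * W2 z)\<^sup>2)" by simp_all
  moreover have "(\<lambda>z. (A2 z + 2 * W1 z)\<^sup>2) = (\<lambda>z. (A2 z)\<^sup>2 + 4 * (A2 z * W1 z) + 4 * (W1 z)\<^sup>2)"
    "(\<lambda>z. (A1 z - 2 * W2 z)\<^sup>2) = (\<lambda>z. (A1 z)\<^sup>2 - 4 * (A1 z * W2 z) + 4 * (W2 z)\<^sup>2)"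
    by (simp_all add: fun_eq_iff power2_eq_square algebra_simps)
  ultimately have s: "0 \<le> ?I (\<lambda>z. (A2 z)\<^sup>2) + 4 * ?I (\<lambda>z. A2 z * W1 z) + 4 * ?I (\<lambda>z. (W1 z)\<^sup>2)"
    "0 \<le> ?I (\<lambda>z. (A1 z)\<^sup>2) - 4 * ?I (\<lambda>z. A1 z * W2 z) + 4 * ?I (\<lambda>z. (W2 z)\<^sup>2)" by simp_all
  have pos: "0 \<le> ?I (\<lambda>z. (A1 z)\<^sup>2)" "0 \<le> ?I (\<lambda>z. (A2 z)\<^sup>2)" "0 \<le> ?I (\<lambda>z. (D1 z)\<^sup>2)" "0 \<le> ?I (\<lambda>z. (D2 z)\<^sup>2)" by simp_all
  \<comment> \<open>After adding the four relations the terms in A and W read A^2 \<mp> 4 N^2 A W +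
    4 N^2 W^2. Splitting off N^2 A^2 completes N^2 times a square and leaves (1 - N^2) A^2.\<close>
  have "(1 - N\<^sup>2) * (?I (\<lambda>z. (A1 z)\<^sup>2) + ?I (\<lambda>z. (A2 z)\<^sup>2)) + Rc * (?I (\<lambda>z. (D1 z)\<^sup>2) + ?I (\<lambda>z. (D2 z)\<^sup>2)) \<le> 0"
    using a1 a2 d1 d2 flux mult_left_mono[OF s(1), of "N\<^sup>2"] mult_left_mono[OF s(2), of "N\<^sup>2"] unfolding x
    by (simp add: algebra_simps)
  moreover have "0 \<le> (1 - N\<^sup>2) * (?I (\<lambda>z. (A1 z)\<^sup>2) + ?I (\<lambda>z. (A2 z)\<^sup>2))" "0 \<le> Rc * (?I (\<lambda>z. (D1 z)\<^sup>2) + ?I (\<lambda>z. (D2 z)\<^sup>2))"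
    using N Rc pos by simp_all
  ultimately have "(1 - N\<^sup>2) * (?I (\<lambda>z. (A1 z)\<^sup>2) + ?I (\<lambda>z. (A2 z)\<^sup>2)) = 0" "Rc * (?I (\<lambda>z. (D1 z)\<^sup>2) + ?I (\<lambda>z. (D2 z)\<^sup>2)) = 0"
    by linarith+
  then have "?I (\<lambda>z. (A1 z)\<^sup>2) + ?I (\<lambda>z. (A2 z)\<^sup>2) = 0" "?I (\<lambda>z. (D1 z)\<^sup>2) + ?I (\<lambda>z. (D2 z)\<^sup>2) = 0" using N Rc by simp_all
  then have "?I (\<lambda>z. (A1 z)\<^sup>2) \<le> 0" "?I (\<lambda>z. (A2 z)\<^sup>2) \<le> 0" "?I (\<lambda>z. (D1 z)\<^sup>2) \<le> 0" "?I (\<lambda>z. (D2 z)\<^sup>2) \<le> 0" using pos by linarith+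
  then have A0: "AE z in lebesgue_on \<Omega>. A1 z = 0" "AE z in lebesgue_on \<Omega>. A2 z = 0"
    and D0: "AE z in lebesgue_on \<Omega>. D1 z = 0" "AE z in lebesgue_on \<Omega>. D2 z = 0"
    using L2_square_zero[OF L(3)] L2_square_zero[OF L(4)] L2_square_zero[OF L(7)] L2_square_zero[OF L(8)] by simp_all
  \<comment> \<open>The vertical derivative of A is Q up to a multiple of D, so Q vanishes once A
    and D do.\<close>
  show ?thesis
    using column_rep_zero[OF U(1) A0(1) U(2)] column_rep_zero[OF U(3) A0(2) U(4)]
      column_rep_zero[OF W(1) D0(1) W(2)] column_rep_zero[OF W(3) D0(2) W(4)]
      column_rep_deriv_zero[OF A(1) A0(1)] column_rep_deriv_zero[OF A(2) A0(2)] D0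
    by eventually_elim auto
qed

end

subsection \<open>The limit belongs to the limit class\<close>

context thin_film_limit begin

lemma velocity_rep:
  assumes "v \<in> Basis"
  obtains c where "has_column_rep (\<lambda>z. u z \<bullet> v) c (wderiv \<Omega> e3 (\<lambda>z. u z \<bullet> v))"
    "AE z' in lebesgue_on \<omega>. col_top c (wderiv \<Omega> e3 (\<lambda>z. u z \<bullet> v)) z' = 0"
proof -
  note V = V_z3_wderiv[OF U_V_z3(2)[OF assms]]
  obtain c where c: "has_column_rep (\<lambda>z. u z \<bullet> v) c (wderiv \<Omega> e3 (\<lambda>z. u z \<bullet> v))"
    using has_column_rep_of_weak_deriv[OF V(1,3,2)] by blast
  show ?thesis by (rule that[OF c column_rep_top[OF c velocity_top[OF _ assms]]])
qed

lemma spin_rep: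
  assumes "v \<in> Basis"
  shows "has_column_rep (\<lambda>z. w z \<bullet> v) (\<lambda>z'. 0) (wderiv \<Omega> e3 (\<lambda>z. w z \<bullet> v))"
    and "AE z' in lebesgue_on \<omega>. col_top (\<lambda>z'. 0) (wderiv \<Omega> e3 (\<lambda>z. w z \<bullet> v)) z' = 0"
proof -
  note V = V_z3_wderiv[OF W_V_z3(2)[OF assms]]
  obtain c where c: "has_column_rep (\<lambda>z. w z \<bullet> v) c (wderiv \<Omega> e3 (\<lambda>z. w z \<bullet> v))"
    using has_column_rep_of_weak_deriv[OF V(1,3,2)] by blast
  have c0: "AE z' in lebesgue_on \<omega>. c z' = 0"
    by (rule column_rep_bottom[OF c]) (auto simp: spin_boundary[OF test_functions_smooth assms])
  show "has_column_rep (\<lambda>z. w z \<bullet> v) (\<lambda>z'. 0) (wderiv \<Omega> e3 (\<lambda>z. w z \<bullet> v))"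
    by (rule has_column_rep_cong_bottom(1)[OF c c0])
  show "AE z' in lebesgue_on \<omega>. col_top (\<lambda>z'. 0) (wderiv \<Omega> e3 (\<lambda>z. w z \<bullet> v)) z' = 0"
    by (rule has_column_rep_cong_bottom(2)[OF c c0 column_rep_top[OF c]])
      (rule spin_boundary[OF test_functions_smooth assms])
qed

text \<open>The component along e3 has zero vertical derivative by incompressibility and zero trace
  on the top.\<close>

lemma velocity_e3_zero: "AE z in lebesgue_on \<Omega>. u z \<bullet> e3 = 0"
proof -
  note V = V_z3_wderiv[OF U_V_z3(2)[OF e3_Basis]]
  obtain c where c: "has_column_rep (\<lambda>z. u z \<bullet> e3) c (wderiv \<Omega> e3 (\<lambda>z. u z \<bullet> e3))"
    "AE z' in lebesgue_on \<omega>. col_top c (wderiv \<Omega> e3 (\<lambda>z. u z \<bullet> e3)) z' = 0"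
    using velocity_rep[OF e3_Basis] by blast
  have "has_weak_deriv \<Omega> e3 (\<lambda>z. u z \<bullet> e3) (\<lambda>z. 0)"
    using has_weak_derivD(1)[OF V(2)] velocity_vertical smooth_L1_loc[OF smooth_const lebesgue_dom(1), of 0]
    by (simp add: has_weak_deriv_def)
  from column_rep_zero[OF c(1) wderiv_AE_eq[OF this open_dom] c(2)] show ?thesis .
qed

text \<open>The third component of the microrotation decouples: the reduced rotation and the source
  have no vertical part. It solves a homogeneous equation with zero boundary values, and
  multiplication by itself shows that its vertical derivative is 0.\<close>

lemma spin_e3_zero: "AE z in lebesgue_on \<Omega>. w z \<bullet> e3 = 0"
proof -
  let ?w = "\<lambda>z. w z \<bullet> e3" let ?d = "wderiv \<Omega> e3 ?w"
  note V = V_z3_wderiv[OF W_V_z3(2)[OF e3_Basis]]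
  have L: "(\<lambda>z. (4 * N\<^sup>2 / Rc) * ?w z) \<in> L2 \<Omega>" by (intro L2_cmult V)
  obtain \<delta> where \<delta>: "has_column_rep ?d \<delta> (\<lambda>z. (4 * N\<^sup>2 / Rc) * ?w z)"
  proof (rule has_column_rep_exists[OF L2_dom_integrable[OF V(3)] L2_dom_integrable[OF L]])
    fix \<phi> assume \<phi>: "\<phi> \<in> test_functions \<Omega>"
    have "test_rot_z3 \<phi> e3 z = 0" for z by (simp add: test_rot_z3_def e1_def e2_def e3_def zero_prod_def)
    then have "Rc * (LINT z|lebesgue_on \<Omega>. ?d z * pderiv_at e3 \<phi> z) + 4 * N\<^sup>2 * (LINT z|lebesgue_on \<Omega>. ?w z * \<phi> z) = 0"
      using spin_interior[OF \<phi> e3_Basis] by (simp add: e3_def)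
    moreover have "(LINT z|lebesgue_on \<Omega>. ((4 * N\<^sup>2 / Rc) * ?w z) * \<phi> z) = (4 * N\<^sup>2 / Rc) * (LINT z|lebesgue_on \<Omega>. ?w z * \<phi> z)"
      by (simp only: mult.assoc integral_mult_right_zero)
    ultimately show "(LINT z|lebesgue_on \<Omega>. ?d z * pderiv_at e3 \<phi> z) = - (LINT z|lebesgue_on \<Omega>. ((4 * N\<^sup>2 / Rc) * ?w z) * \<phi> z)"
      using Rc_pos by (simp add: field_simps)
  qed
  have "(4 * N\<^sup>2 / Rc) * (LINT z|lebesgue_on \<Omega>. (?w z)\<^sup>2) + (LINT z|lebesgue_on \<Omega>. (?d z)\<^sup>2) = 0"
    using column_product_top_zero[OF spin_rep[OF e3_Basis] \<delta> V(1,3,3) L]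
    unfolding mult.left_commute[of _ "4 * N\<^sup>2 / Rc"] integral_mult_right_zero power2_eq_square[of "w _ \<bullet> e3"]
      power2_eq_square[of "wderiv \<Omega> e3 (\<lambda>z. w z \<bullet> e3) _"] by simp
  moreover have "0 \<le> (4 * N\<^sup>2 / Rc) * (LINT z|lebesgue_on \<Omega>. (?w z)\<^sup>2)" using Rc_pos by simp
  ultimately have "(LINT z|lebesgue_on \<Omega>. (?d z)\<^sup>2) \<le> 0" by linarith
  from column_rep_zero[OF spin_rep(1)[OF e3_Basis] L2_square_zero[OF V(3) this] spin_rep(2)[OF e3_Basis]]
  show ?thesis .
qed

lemma pressure_column:
  obtains c where "c \<in> L2 \<omega>" "AE z in lebesgue_on \<Omega>. p z = c (fst z)"
proof -
  have p: "p \<in> L2 \<Omega>" using pressure_mean0 by (simp add: L2_mean0_def)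
  obtain c where c: "integrable (lebesgue_on \<omega>) c" "AE z in lebesgue_on \<Omega>. p z = c (fst z)"
    using vertically_constant[OF L2_dom_integrable[OF p] pressure_vertical] by blast
  show ?thesis by (rule that[OF column_constant_L2[OF c(1) L2_cong_AE[OF p c(2) lebesgue_dom(1)]] c(2)])
qed

text \<open>The momentum balance is tested with \<open>\<eta>(z') \<zeta>(z\<^sub>3)\<close>, where \<open>\<zeta>\<close> is a unit bump supported
  in \<open>[hmin / 4, hmin / 2]\<close>.\<close>

lemma pressure_H1:
  assumes c: "c \<in> L2 \<omega>" and pc: "AE z in lebesgue_on \<Omega>. p z = c (fst z)"
  shows "c \<in> H1 \<omega>"
  unfolding H1_def
proof (intro CollectI conjI ballI c)
  fix k :: R2 assume k: "k \<in> Basis"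
  note V = V_z3_wderiv[OF U_V_z3(2)[OF horizontal_Basis[OF k]]]
  have "hmin / 4 < hmin / 2" using hmin_pos by simp
  from unit_bump[OF this] obtain \<zeta> where \<zeta>: "smooth \<zeta>" "\<And>s. s < hmin / 4 \<or> hmin / 2 < s \<Longrightarrow> \<zeta> s = 0" "integral\<^sup>L lebesgue \<zeta> = 1"
    by metis
  have s\<zeta>: "smooth (pderiv_at 1 \<zeta>)" by (intro smooth_pderiv_at \<zeta>)
  have sm: "smooth (\<lambda>z :: R3. \<zeta> (snd z))" "smooth (\<lambda>z :: R3. pderiv_at 1 \<zeta> (snd z))"
    by (rule smooth_compose_linear[OF \<zeta>(1) linear_snd] smooth_compose_linear[OF s\<zeta> linear_snd])+
  define r where "r z = - (k \<bullet> axis 2 1) * (w z \<bullet> e1) + (k \<bullet> axis 1 1) * (w z \<bullet> e2)" for z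
  have r: "r \<in> L2 \<Omega>"
    unfolding r_def[abs_def] by (intro L2_linear V_z3_wderiv(1)[OF W_V_z3(2)] e1_e2_Basis)
  \<comment> \<open>Everything in the balance except the pressure, with the factor
    \<open>\<eta>\<close> taken out. The factor \<open>\<zeta>\<close> integrates to 1 over every
    column, so minus the column integral of M is the weak derivative of c.\<close>
  define M where "M z = wderiv \<Omega> e3 (\<lambda>z. u z \<bullet> (k, 0)) z * pderiv_at 1 \<zeta> (snd z)
    - (2 * N\<^sup>2) * (r z * pderiv_at 1 \<zeta> (snd z)) - (f (fst z) \<bullet> k) * \<zeta> (snd z)" for z
  have bdd: "(\<lambda>z. F z * m z) \<in> L2 \<Omega>" if F: "F \<in> L2 \<Omega>" and m: "smooth m" for F m
  proof -
    obtain C where "\<And>x. x \<in> \<Omega> \<Longrightarrow> \<bar>m x\<bar> \<le> C" using smooth_bounded_on[OF m bounded_dom] by blast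
    then show ?thesis by (intro L2_mult_bounded[OF F] smooth_measurable_lebesgue_on m)
  qed
  have LM: "M \<in> L2 \<Omega>"
    unfolding M_def[abs_def] by (intro L2_diff L2_cmult bdd sm V r fst_L2[OF f_L2[OF k]])
  let ?Mb = "\<lambda>z'. LINT s|lebesgue_on {0..h z'}. M (z', s)"
  have Mb: "?Mb \<in> L2 \<omega>" by (rule column_integral_L2(1)[OF LM])
  show "\<exists>d\<in>L2 \<omega>. has_weak_deriv \<omega> k c d"
  proof (intro bexI[of _ "\<lambda>z'. - ?Mb z'"] L2_uminus Mb)
    show "has_weak_deriv \<omega> k c (\<lambda>z'. - ?Mb z')"
      unfolding has_weak_deriv_def
    proof (intro conjI ballI)
      show "c \<in> L1_loc \<omega>" "(\<lambda>z'. - ?Mb z') \<in> L1_loc \<omega>"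
        by (intro L2_L1_loc c L2_uminus Mb lebesgue_dom)+
      fix \<eta> assume \<eta>: "\<eta> \<in> test_functions \<omega>"
      note s\<eta> = test_functions_smooth[OF \<eta>]
      have s\<eta>': "smooth (\<lambda>z :: R3. \<eta> (fst z))" "smooth (\<lambda>z :: R3. pderiv_at k \<eta> (fst z))"
        by (rule smooth_compose_linear[OF s\<eta> linear_fst] smooth_compose_linear[OF smooth_pderiv_at[OF s\<eta>] linear_fst])+
      let ?\<phi> = "\<lambda>z :: R3. \<eta> (fst z) * \<zeta> (snd z)"
      obtain K where K: "compact K" "K \<subseteq> \<omega>" "\<And>x. x \<notin> K \<Longrightarrow> \<eta> x = 0" using test_functionsE[OF \<eta>] by blast
      have \<phi>: "?\<phi> \<in> test_functions \<Omega>"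
      proof (rule test_functionsI)
        show "smooth ?\<phi>" by (intro smooth_fst_snd s\<eta> \<zeta>)
        show "compact (K \<times> {hmin / 4..hmin / 2})" by (intro compact_Times K compact_Icc)
        show "K \<times> {hmin / 4..hmin / 2} \<subseteq> \<Omega>" using K(2) hmin_le hmin_pos by (fastforce simp: mem_dom)
        show "?\<phi> z = 0" if "z \<notin> K \<times> {hmin / 4..hmin / 2}" for z
          using that K(3)[of "fst z"] \<zeta>(2)[of "snd z"] by (cases z) (auto simp: not_le)
      qed
      have d3: "pderiv_at e3 ?\<phi> z = \<eta> (fst z) * pderiv_at 1 \<zeta> (snd z)"
        and dk: "pderiv_at (k, 0) ?\<phi> z = pderiv_at k \<eta> (fst z) * \<zeta> (snd z)" for z
        by (simp_all add: pderiv_at_fst_snd[OF s\<eta> \<zeta>(1)] e3_def pderiv_at_0[OF s\<eta>] pderiv_at_0[OF \<zeta>(1)])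
      have rot: "test_rot_z3 ?\<phi> (k, 0) z \<bullet> w z = r z * (\<eta> (fst z) * pderiv_at 1 \<zeta> (snd z))" for z
        unfolding test_rot_z3_def d3 r_def
        by (simp add: e1_def e2_def inner_prod_def inner_add_left inner_commute[of _ "fst (w z)"] algebra_simps)
      have i: "integrable (lebesgue_on \<Omega>) (\<lambda>z. F z * (\<eta> (fst z) * m (snd z)))" if "F \<in> L2 \<Omega>" "smooth m" for F m
        by (intro integrable_mult_smooth[OF L2_dom_integrable[OF that(1)]] smooth_fst_snd s\<eta> that bounded_dom)
      have "(LINT z|lebesgue_on \<Omega>. M z * \<eta> (fst z)) = (LINT z|lebesgue_on \<Omega>. p z * pderiv_at (k, 0) ?\<phi> z)"
      proof -
        have "(LINT z|lebesgue_on \<Omega>. M z * \<eta> (fst z))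
            = (LINT z|lebesgue_on \<Omega>. wderiv \<Omega> e3 (\<lambda>z. u z \<bullet> (k, 0)) z * (\<eta> (fst z) * pderiv_at 1 \<zeta> (snd z))
              - (2 * N\<^sup>2) * (r z * (\<eta> (fst z) * pderiv_at 1 \<zeta> (snd z))) - (f (fst z) \<bullet> k) * (\<eta> (fst z) * \<zeta> (snd z)))"
          by (rule Bochner_Integration.integral_cong) (auto simp: M_def algebra_simps)
        also have "\<dots> = (LINT z|lebesgue_on \<Omega>. wderiv \<Omega> e3 (\<lambda>z. u z \<bullet> (k, 0)) z * (\<eta> (fst z) * pderiv_at 1 \<zeta> (snd z)))
            - 2 * N\<^sup>2 * (LINT z|lebesgue_on \<Omega>. r z * (\<eta> (fst z) * pderiv_at 1 \<zeta> (snd z)))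
            - (LINT z|lebesgue_on \<Omega>. (f (fst z) \<bullet> k) * (\<eta> (fst z) * \<zeta> (snd z)))"
          using i[OF V(3) s\<zeta>] i[OF r s\<zeta>] i[OF fst_L2[OF f_L2[OF k]] \<zeta>(1)] by simp
        also have "\<dots> = (LINT z|lebesgue_on \<Omega>. p z * pderiv_at (k, 0) ?\<phi> z)"
          using momentum_interior[OF \<phi> k] by (simp add: momentum_residual_def rot d3)
        finally show ?thesis .
      qed
      also have "\<dots> = (LINT z|lebesgue_on \<Omega>. c (fst z) * (pderiv_at k \<eta> (fst z) * \<zeta> (snd z)))"
        by (rule integral_lebesgue_on_cong_AE[OF eventually_mono[OF pc]]) (auto simp: dk)
      also have "\<dots> = (LINT z'|lebesgue_on \<omega>. c z' * pderiv_at k \<eta> z')"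
      proof -
        have one: "(LINT s|lebesgue_on {0..h z'}. \<zeta> s) = 1" if "z' \<in> \<omega>" for z'
        proof -
          have "\<zeta> s = 0" if "s \<notin> {0..h z'}" for s
            using that hmin_le[OF \<open>z' \<in> \<omega>\<close>] hmin_pos by (intro \<zeta>(2)) auto
          then show ?thesis
            using integral_lebesgue_on_eq_0_outside(1)[of "{0..h z'}" UNIV \<zeta>] \<zeta>(3) by (simp add: lebesgue_on_UNIV_eq)
        qed
        have "integrable (lebesgue_on \<Omega>) (\<lambda>z. c (fst z) * (pderiv_at k \<eta> (fst z) * \<zeta> (snd z)))"
          by (intro integrable_mult_smooth[OF L2_dom_integrable[OF fst_L2[OF c]]] smooth_fst_snd smooth_pderiv_at s\<eta> \<zeta> bounded_dom)
        from column_Fubini(3)[OF this]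
        have "(LINT z|lebesgue_on \<Omega>. c (fst z) * (pderiv_at k \<eta> (fst z) * \<zeta> (snd z)))
            = (LINT z'|lebesgue_on \<omega>. c z' * pderiv_at k \<eta> z' * (LINT s|lebesgue_on {0..h z'}. \<zeta> s))"
          by (simp add: mult.assoc[symmetric])
        also have "\<dots> = (LINT z'|lebesgue_on \<omega>. c z' * pderiv_at k \<eta> z')"
          by (rule Bochner_Integration.integral_cong) (auto simp: one)
        finally show ?thesis .
      qed
      finally have "(LINT z'|lebesgue_on \<omega>. c z' * pderiv_at k \<eta> z') = (LINT z|lebesgue_on \<Omega>. M z * \<eta> (fst z))" ..
      also have "\<dots> = (LINT z'|lebesgue_on \<omega>. ?Mb z' * \<eta> z')"
        using column_Fubini(3)[OF integrable_mult_smooth[OF L2_dom_integrable[OF LM] s\<eta>'(1) bounded_dom]] by simp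
      finally show "(LINT z'|lebesgue_on \<omega>. c z' * pderiv_at k \<eta> z') = - (LINT z'|lebesgue_on \<omega>. - ?Mb z' * \<eta> z')" by simp
    qed
  qed
qed

theorem limit_in_class: "in_limit_class \<omega> h u w p"
proof -
  obtain c where c: "c \<in> L2 \<omega>" "AE z in lebesgue_on \<Omega>. p z = c (fst z)" by (rule pressure_column)
  have "snd (x :: R3) = x \<bullet> e3" for x by (simp add: e3_def inner_prod_def)
  then show ?thesis
    using pressure_H1[OF c] c(2) U_V_z3(2) W_V_z3(2) pressure_mean0 velocity_e3_zero spin_e3_zero
    unfolding in_limit_class_def L2_mean0_H1_def Let_def by auto
qed

end

subsection \<open>Vertical profiles of solutions of the reduced system\<close>

context thin_film_limit begin

text \<open>The right-hand side when the balance is solved for the second vertical derivative of the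
  velocity; \<open>spin_source\<close> does the same for the microrotation.\<close>

definition momentum_source :: "(R3 \<Rightarrow> R3) \<Rightarrow> (R3 \<Rightarrow> real) \<Rightarrow> R2 \<Rightarrow> R3 \<Rightarrow> real" where
  "momentum_source r q k z = wderiv \<Omega> (k, 0) q z - 2 * N\<^sup>2 * col_rot r k z - f (fst z) \<bullet> k"

definition spin_source :: "(R3 \<Rightarrow> R3) \<Rightarrow> (R3 \<Rightarrow> R3) \<Rightarrow> R2 \<Rightarrow> R3 \<Rightarrow> real" where
  "spin_source v r k z = (4 * N\<^sup>2 * (r z \<bullet> (k, 0)) - 2 * N\<^sup>2 * col_rot v k z - g (fst z) \<bullet> k) / Rc"

text \<open>The friction coefficient in the limit: the value 0 turns the partial slip law into
  perfect slip, so one formula covers \<gamma> \<ge> -1.\<close>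

abbreviation slip :: real where "slip \<equiv> if \<gamma> = -1 then lam else 0"

text \<open>The content of the reduced system for one velocity component, with traces made explicit:
  \<open>c\<close> is the bottom value and \<open>\<beta>\<close> the bottom value of the vertical
  derivative. Existence and uniqueness both work with profiles instead of the distributional
  system.\<close>

definition velocity_profile ::
    "(R3 \<Rightarrow> R3) \<Rightarrow> (R3 \<Rightarrow> R3) \<Rightarrow> (R3 \<Rightarrow> real) \<Rightarrow> R2 \<Rightarrow> (R2 \<Rightarrow> real) \<Rightarrow> (R2 \<Rightarrow> real) \<Rightarrow> bool" where
  "velocity_profile v r q k c \<beta> \<longleftrightarrow>
     has_column_rep (\<lambda>z. v z \<bullet> (k, 0)) c (wderiv \<Omega> e3 (\<lambda>z. v z \<bullet> (k, 0))) \<and>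
     (AE z' in lebesgue_on \<omega>. col_top c (wderiv \<Omega> e3 (\<lambda>z. v z \<bullet> (k, 0))) z' = 0) \<and>
     has_column_rep (wderiv \<Omega> e3 (\<lambda>z. v z \<bullet> (k, 0))) \<beta> (momentum_source r q k) \<and>
     (AE z' in lebesgue_on \<omega>. if \<gamma> < -1 then c z' = 0 else \<beta> z' = slip * c z')"

definition spin_profile :: "(R3 \<Rightarrow> R3) \<Rightarrow> (R3 \<Rightarrow> R3) \<Rightarrow> R2 \<Rightarrow> (R2 \<Rightarrow> real) \<Rightarrow> bool" where
  "spin_profile v r k \<delta> \<longleftrightarrow>
     has_column_rep (\<lambda>z. r z \<bullet> (k, 0)) (\<lambda>z'. 0) (wderiv \<Omega> e3 (\<lambda>z. r z \<bullet> (k, 0))) \<and>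
     (AE z' in lebesgue_on \<omega>. col_top (\<lambda>z'. 0) (wderiv \<Omega> e3 (\<lambda>z. r z \<bullet> (k, 0))) z' = 0) \<and>
     has_column_rep (wderiv \<Omega> e3 (\<lambda>z. r z \<bullet> (k, 0))) \<delta> (spin_source v r k)"

lemma in_limit_classD:
  assumes "in_limit_class \<omega> h v r q"
  shows "i \<in> Basis \<Longrightarrow> (\<lambda>z. v z \<bullet> i) \<in> V_z3 \<Omega>" "i \<in> Basis \<Longrightarrow> (\<lambda>z. r z \<bullet> i) \<in> V_z3 \<Omega>" "q \<in> L2_mean0 \<Omega>"
    "\<exists>q'\<in>H1 \<omega>. AE z in lebesgue_on \<Omega>. q z = q' (fst z)"
    "AE z in lebesgue_on \<Omega>. snd (v z) = 0" "AE z in lebesgue_on \<Omega>. snd (r z) = 0"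
  using assms unfolding in_limit_class_def L2_mean0_H1_def Let_def by blast+

lemma sources_L2:
  assumes "in_limit_class \<omega> h v r q" and k: "k \<in> Basis"
  shows "momentum_source r q k \<in> L2 \<Omega>" "spin_source v r k \<in> L2 \<Omega>" "wderiv \<Omega> (k, 0) q \<in> L2 \<Omega>"
proof -
  note C = in_limit_classD[OF assms(1)]
  obtain q' where q': "q' \<in> H1 \<omega>" "AE z in lebesgue_on \<Omega>. q z = q' (fst z)" using C(4) by blast
  show p: "wderiv \<Omega> (k, 0) q \<in> L2 \<Omega>" by (rule pressure_weak_deriv(3)[OF q' k])
  show "momentum_source r q k \<in> L2 \<Omega>"
    unfolding momentum_source_def[abs_def]
    by (intro L2_diff L2_cmult p col_rot_L2 C(2) fst_L2[OF f_L2[OF k]])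
  have "(\<lambda>z. (1 / Rc) * (4 * N\<^sup>2 * (r z \<bullet> (k, 0)) - 2 * N\<^sup>2 * col_rot v k z - g (fst z) \<bullet> k)) \<in> L2 \<Omega>"
    by (intro L2_diff L2_cmult col_rot_L2 C(1) V_z3_wderiv(1)[OF C(2)] horizontal_Basis k fst_L2[OF g_L2[OF k]])
  then show "spin_source v r k \<in> L2 \<Omega>" unfolding spin_source_def[abs_def] by simp
qed

lemma source_integrals:
  assumes "in_limit_class \<omega> h v r q" and k: "k \<in> Basis" and \<phi>: "smooth \<phi>"
  shows "(LINT z|lebesgue_on \<Omega>. momentum_source r q k z * \<phi> z) = (LINT z|lebesgue_on \<Omega>. wderiv \<Omega> (k, 0) q z * \<phi> z)
      - 2 * N\<^sup>2 * (LINT z|lebesgue_on \<Omega>. col_rot r k z * \<phi> z) - (LINT z|lebesgue_on \<Omega>. (f (fst z) \<bullet> k) * \<phi> z)"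
    and "(LINT z|lebesgue_on \<Omega>. (f (fst z) \<bullet> k - wderiv \<Omega> (k, 0) q z) * \<phi> z)
      = (LINT z|lebesgue_on \<Omega>. (f (fst z) \<bullet> k) * \<phi> z) - (LINT z|lebesgue_on \<Omega>. wderiv \<Omega> (k, 0) q z * \<phi> z)"
    and "Rc * (LINT z|lebesgue_on \<Omega>. spin_source v r k z * \<phi> z) = 4 * N\<^sup>2 * (LINT z|lebesgue_on \<Omega>. (r z \<bullet> (k, 0)) * \<phi> z)
      - 2 * N\<^sup>2 * (LINT z|lebesgue_on \<Omega>. col_rot v k z * \<phi> z) - (LINT z|lebesgue_on \<Omega>. (g (fst z) \<bullet> k) * \<phi> z)"
proof -
  note C = in_limit_classD[OF assms(1)]
  have i: "integrable (lebesgue_on \<Omega>) (\<lambda>z. F z * \<phi> z)" if "F \<in> L2 \<Omega>" for F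
    by (intro integrable_mult_smooth[OF L2_dom_integrable[OF that]] \<phi> bounded_dom)
  note [simp] = i[OF sources_L2(3)[OF assms(1) k]] i[OF col_rot_L2[OF C(2)]] i[OF col_rot_L2[OF C(1)]]
    i[OF fst_L2[OF f_L2[OF k]]] i[OF fst_L2[OF g_L2[OF k]]] i[OF V_z3_wderiv(1)[OF C(2)[OF horizontal_Basis[OF k]]]]
  show "(LINT z|lebesgue_on \<Omega>. momentum_source r q k z * \<phi> z) = (LINT z|lebesgue_on \<Omega>. wderiv \<Omega> (k, 0) q z * \<phi> z)
      - 2 * N\<^sup>2 * (LINT z|lebesgue_on \<Omega>. col_rot r k z * \<phi> z) - (LINT z|lebesgue_on \<Omega>. (f (fst z) \<bullet> k) * \<phi> z)"
    by (simp add: momentum_source_def left_diff_distrib mult.assoc)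
  show "(LINT z|lebesgue_on \<Omega>. (f (fst z) \<bullet> k - wderiv \<Omega> (k, 0) q z) * \<phi> z)
      = (LINT z|lebesgue_on \<Omega>. (f (fst z) \<bullet> k) * \<phi> z) - (LINT z|lebesgue_on \<Omega>. wderiv \<Omega> (k, 0) q z * \<phi> z)"
    by (simp add: left_diff_distrib)
  have "Rc * (LINT z|lebesgue_on \<Omega>. spin_source v r k z * \<phi> z) = (LINT z|lebesgue_on \<Omega>. Rc * (spin_source v r k z * \<phi> z))"
    by simp
  also have "\<dots> = (LINT z|lebesgue_on \<Omega>. 4 * N\<^sup>2 * ((r z \<bullet> (k, 0)) * \<phi> z) - 2 * N\<^sup>2 * (col_rot v k z * \<phi> z) - (g (fst z) \<bullet> k) * \<phi> z)"
    using Rc_pos by (intro Bochner_Integration.integral_cong) (auto simp: spin_source_def field_simps)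
  finally show "Rc * (LINT z|lebesgue_on \<Omega>. spin_source v r k z * \<phi> z) = 4 * N\<^sup>2 * (LINT z|lebesgue_on \<Omega>. (r z \<bullet> (k, 0)) * \<phi> z)
      - 2 * N\<^sup>2 * (LINT z|lebesgue_on \<Omega>. col_rot v k z * \<phi> z) - (LINT z|lebesgue_on \<Omega>. (g (fst z) \<bullet> k) * \<phi> z)"
    by simp
qed

lemma momentum_equation_iff:
  assumes "in_limit_class \<omega> h v r q" and k: "k \<in> Basis" and \<phi>: "smooth \<phi>"
  shows "(LINT z|lebesgue_on \<Omega>. wderiv \<Omega> e3 (\<lambda>y. fst (v y) \<bullet> k) z * pderiv_at e3 \<phi> z)
      - 2 * N\<^sup>2 * (LINT z|lebesgue_on \<Omega>. (rot_z3 \<Omega> (\<lambda>z. fst (r z)) z \<bullet> k) * \<phi> z)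
      = (LINT z|lebesgue_on \<Omega>. (f (fst z) \<bullet> k - wderiv \<Omega> (k, 0) q z) * \<phi> z) \<longleftrightarrow>
    (LINT z|lebesgue_on \<Omega>. wderiv \<Omega> e3 (\<lambda>z. v z \<bullet> (k, 0)) z * pderiv_at e3 \<phi> z) = - (LINT z|lebesgue_on \<Omega>. momentum_source r q k z * \<phi> z)"
  unfolding fst_inner rot_z3_inner source_integrals(1,2)[OF assms] by linarith

lemma spin_equation_iff:
  assumes "in_limit_class \<omega> h v r q" and k: "k \<in> Basis" and \<phi>: "smooth \<phi>"
  shows "Rc * (LINT z|lebesgue_on \<Omega>. wderiv \<Omega> e3 (\<lambda>y. fst (r y) \<bullet> k) z * pderiv_at e3 \<phi> z)
      + 4 * N\<^sup>2 * (LINT z|lebesgue_on \<Omega>. (fst (r z) \<bullet> k) * \<phi> z)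
      - 2 * N\<^sup>2 * (LINT z|lebesgue_on \<Omega>. (rot_z3 \<Omega> (\<lambda>z. fst (v z)) z \<bullet> k) * \<phi> z)
      = (LINT z|lebesgue_on \<Omega>. (g (fst z) \<bullet> k) * \<phi> z) \<longleftrightarrow>
    (LINT z|lebesgue_on \<Omega>. wderiv \<Omega> e3 (\<lambda>z. r z \<bullet> (k, 0)) z * pderiv_at e3 \<phi> z) = - (LINT z|lebesgue_on \<Omega>. spin_source v r k z * \<phi> z)"
    (is "?L \<longleftrightarrow> ?X = - ?Y")
proof -
  have "?L \<longleftrightarrow> Rc * ?X = - (Rc * ?Y)"
    unfolding fst_inner rot_z3_inner source_integrals(3)[OF assms] by linarith
  also have "\<dots> \<longleftrightarrow> Rc * (?X + ?Y) = 0" unfolding distrib_left by linarith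
  also have "\<dots> \<longleftrightarrow> ?X + ?Y = 0" using Rc_pos by simp
  also have "\<dots> \<longleftrightarrow> ?X = - ?Y" by linarith
  finally show ?thesis .
qed

text \<open>By the balance equations the vertical derivative has a square-integrable vertical
  derivative of its own. So it too has a column representation, and the trace conditions become
  equations for \<open>c\<close> and \<open>\<beta>\<close>.\<close>

lemma profiles_of_reduced_system:
  assumes C: "in_limit_class \<omega> h v r q" and R: "reduced_system \<omega> h N Rc lam \<gamma> f g v r q" and k: "k \<in> Basis"
  shows "\<exists>c \<beta>. velocity_profile v r q k c \<beta>" "\<exists>\<delta>. spin_profile v r k \<delta>"
proof -
  note cl = in_limit_classD[OF C] and hk = horizontal_Basis[OF k]
  note V = V_z3_wderiv[OF cl(1)[OF hk]] and S = V_z3_wderiv[OF cl(2)[OF hk]] and src = sources_L2[OF C k]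
  have bc: "top_conditions \<omega> h v r" "bot_zero \<omega> h r" "\<gamma> > -1 \<Longrightarrow> bot_perfect_slip \<omega> h v"
    "\<gamma> = -1 \<Longrightarrow> bot_partial_slip \<omega> h lam v" "\<gamma> < -1 \<Longrightarrow> bot_zero \<omega> h v"
    and re: "reduced_equations \<omega> h N Rc f g v r q"
    using R unfolding reduced_system_def by (cases \<gamma> "-1 :: real" rule: linorder_cases; simp)+
  have eqs: "(LINT z|lebesgue_on \<Omega>. wderiv \<Omega> e3 (\<lambda>z. v z \<bullet> (k, 0)) z * pderiv_at e3 \<phi> z) = - (LINT z|lebesgue_on \<Omega>. momentum_source r q k z * \<phi> z)"
    "(LINT z|lebesgue_on \<Omega>. wderiv \<Omega> e3 (\<lambda>z. r z \<bullet> (k, 0)) z * pderiv_at e3 \<phi> z) = - (LINT z|lebesgue_on \<Omega>. spin_source v r k z * \<phi> z)"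
    if \<phi>: "\<phi> \<in> test_functions \<Omega>" for \<phi>
    using re \<phi> k momentum_equation_iff[OF C k test_functions_smooth[OF \<phi>]] spin_equation_iff[OF C k test_functions_smooth[OF \<phi>]]
    unfolding reduced_equations_def Let_def by blast+
  obtain c where c: "has_column_rep (\<lambda>z. v z \<bullet> (k, 0)) c (wderiv \<Omega> e3 (\<lambda>z. v z \<bullet> (k, 0)))"
    by (rule has_column_rep_of_weak_deriv[OF V(1,3,2)])
  obtain \<beta> where \<beta>: "has_column_rep (wderiv \<Omega> e3 (\<lambda>z. v z \<bullet> (k, 0))) \<beta> (momentum_source r q k)"
    by (rule has_column_rep_exists[OF L2_dom_integrable[OF V(3)] L2_dom_integrable[OF src(1)] eqs(1)])
  obtain d where d: "has_column_rep (\<lambda>z. r z \<bullet> (k, 0)) d (wderiv \<Omega> e3 (\<lambda>z. r z \<bullet> (k, 0)))"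
    by (rule has_column_rep_of_weak_deriv[OF S(1,3,2)])
  obtain \<delta> where \<delta>: "has_column_rep (wderiv \<Omega> e3 (\<lambda>z. r z \<bullet> (k, 0))) \<delta> (spin_source v r k)"
    by (rule has_column_rep_exists[OF L2_dom_integrable[OF S(3)] L2_dom_integrable[OF src(2)] eqs(2)])
  have top: "AE z' in lebesgue_on \<omega>. col_top c (wderiv \<Omega> e3 (\<lambda>z. v z \<bullet> (k, 0))) z' = 0"
    "AE z' in lebesgue_on \<omega>. col_top d (wderiv \<Omega> e3 (\<lambda>z. r z \<bullet> (k, 0))) z' = 0"
    using bc(1) k unfolding top_conditions_def fst_inner has_z3_trace_top[OF c, symmetric] has_z3_trace_top[OF d, symmetric]
    by blast+
  have d0: "AE z' in lebesgue_on \<omega>. d z' = 0"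
    using bc(2) k unfolding bot_zero_def fst_inner has_z3_trace_bottom[OF d, symmetric] by blast
  show "\<exists>\<delta>. spin_profile v r k \<delta>"
    unfolding spin_profile_def
    using has_column_rep_cong_bottom(1)[OF d d0] has_column_rep_cong_bottom(2)[OF d d0 top(2)] \<delta> by blast
  note tr = has_z3_trace_bottom[OF has_column_rep_uminus[OF \<beta>]]
  have "AE z' in lebesgue_on \<omega>. if \<gamma> < -1 then c z' = 0 else \<beta> z' = slip * c z'"
  proof (cases \<gamma> "-1 :: real" rule: linorder_cases)
    case less
    then have "AE z' in lebesgue_on \<omega>. c z' = 0"
      using bc(5) k unfolding bot_zero_def fst_inner has_z3_trace_bottom[OF c, symmetric] by blast
    then show ?thesis using less by simp
  next
    case equal
    then obtain t where "has_z3_trace \<omega> h (\<lambda>z'. 0) (\<lambda>z. v z \<bullet> (k, 0)) t"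
      "has_z3_trace \<omega> h (\<lambda>z'. 0) (\<lambda>z. - wderiv \<Omega> e3 (\<lambda>z. v z \<bullet> (k, 0)) z) (\<lambda>z'. - lam * t z')"
      using bc(4) k unfolding bot_partial_slip_def fst_inner by blast
    then have "AE z' in lebesgue_on \<omega>. c z' = t z'" "AE z' in lebesgue_on \<omega>. - \<beta> z' = - lam * t z'"
      unfolding has_z3_trace_bottom[OF c] tr .
    then show ?thesis by eventually_elim (simp add: equal)
  next
    case greater
    then have "AE z' in lebesgue_on \<omega>. - \<beta> z' = 0"
      using bc(3) k unfolding bot_perfect_slip_def fst_inner tr[symmetric] by blast
    then show ?thesis by eventually_elim (use greater in simp)
  qed
  then show "\<exists>c \<beta>. velocity_profile v r q k c \<beta>" unfolding velocity_profile_def using c top(1) \<beta> by blast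
qed

text \<open>A column representation contains both the weak derivative and the traces, so the
  equations and the boundary conditions are read off the profiles. Only the flux condition, which
  links the columns, is separate.\<close>

lemma reduced_system_of_profiles:
  assumes C: "in_limit_class \<omega> h v r q"
    and P: "\<And>k. k \<in> Basis \<Longrightarrow> \<exists>c \<beta>. velocity_profile v r q k c \<beta>" "\<And>k. k \<in> Basis \<Longrightarrow> \<exists>\<delta>. spin_profile v r k \<delta>"
    and flux: "\<And>\<theta>. \<theta> \<in> H1 \<omega> \<Longrightarrow> (\<Sum>i\<in>Basis. LINT z|lebesgue_on \<Omega>. (v z \<bullet> (i, 0)) * wderiv \<omega> i \<theta> (fst z)) = 0"
  shows "reduced_system \<omega> h N Rc lam \<gamma> f g v r q"
proof -
  have "reduced_equations \<omega> h N Rc f g v r q"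
    unfolding reduced_equations_def Let_def
  proof (intro conjI ballI)
    fix \<phi> and k :: R2 assume \<phi>: "\<phi> \<in> test_functions \<Omega>" and k: "k \<in> Basis"
    obtain c \<beta> \<delta> where "velocity_profile v r q k c \<beta>" "spin_profile v r k \<delta>" using P[OF k] by blast
    then have "has_weak_deriv \<Omega> e3 (wderiv \<Omega> e3 (\<lambda>z. v z \<bullet> (k, 0))) (momentum_source r q k)"
      "has_weak_deriv \<Omega> e3 (wderiv \<Omega> e3 (\<lambda>z. r z \<bullet> (k, 0))) (spin_source v r k)"
      unfolding velocity_profile_def spin_profile_def using has_column_rep_weak_deriv by blast+
    note eqs = this[THEN has_weak_derivD(3), OF \<phi>]
    show "(LINT z|lebesgue_on \<Omega>. wderiv \<Omega> e3 (\<lambda>y. fst (v y) \<bullet> k) z * pderiv_at e3 \<phi> z)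
      - 2 * N\<^sup>2 * (LINT z|lebesgue_on \<Omega>. (rot_z3 \<Omega> (\<lambda>z. fst (r z)) z \<bullet> k) * \<phi> z)
      = (LINT z|lebesgue_on \<Omega>. (f (fst z) \<bullet> k - wderiv \<Omega> (k, 0) q z) * \<phi> z)"
      unfolding momentum_equation_iff[OF C k test_functions_smooth[OF \<phi>]] by (rule eqs)
    show "Rc * (LINT z|lebesgue_on \<Omega>. wderiv \<Omega> e3 (\<lambda>y. fst (r y) \<bullet> k) z * pderiv_at e3 \<phi> z)
      + 4 * N\<^sup>2 * (LINT z|lebesgue_on \<Omega>. (fst (r z) \<bullet> k) * \<phi> z)
      - 2 * N\<^sup>2 * (LINT z|lebesgue_on \<Omega>. (rot_z3 \<Omega> (\<lambda>z. fst (v z)) z \<bullet> k) * \<phi> z)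
      = (LINT z|lebesgue_on \<Omega>. (g (fst z) \<bullet> k) * \<phi> z)"
      unfolding spin_equation_iff[OF C k test_functions_smooth[OF \<phi>]] by (rule eqs)
  next
    fix \<theta> assume \<theta>: "\<theta> \<in> H1 \<omega>"
    show "(LINT z'|lebesgue_on \<omega>. (\<Sum>i\<in>Basis. (LINT s|lebesgue_on {0..h z'}. fst (v (z', s)) \<bullet> i) * wderiv \<omega> i \<theta> z')) = 0"
      by (simp add: flux_Fubini[OF V_z3_wderiv(1)[OF in_limit_classD(1)[OF C]] \<theta>] flux[OF \<theta>])
  qed
  moreover have "top_conditions \<omega> h v r"
    unfolding top_conditions_def fst_inner
  proof (intro conjI ballI)
    fix k :: R2 assume "k \<in> Basis"
    then obtain c \<beta> \<delta> where "velocity_profile v r q k c \<beta>" "spin_profile v r k \<delta>" using P by blast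
    then show "has_z3_trace \<omega> h h (\<lambda>z. v z \<bullet> (k, 0)) (\<lambda>z'. 0)" "has_z3_trace \<omega> h h (\<lambda>z. r z \<bullet> (k, 0)) (\<lambda>z'. 0)"
      unfolding velocity_profile_def spin_profile_def by (auto simp: has_z3_trace_top)
  qed
  moreover have "bot_zero \<omega> h r"
    unfolding bot_zero_def fst_inner
  proof
    fix k :: R2 assume "k \<in> Basis"
    then obtain \<delta> where "spin_profile v r k \<delta>" using P(2) by blast
    then show "has_z3_trace \<omega> h (\<lambda>z'. 0) (\<lambda>z. r z \<bullet> (k, 0)) (\<lambda>z'. 0)"
      unfolding spin_profile_def by (auto simp: has_z3_trace_bottom)
  qed
  moreover have "bot_perfect_slip \<omega> h v" if "\<gamma> > -1"
    unfolding bot_perfect_slip_def fst_inner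
  proof
    fix k :: R2 assume "k \<in> Basis"
    then obtain c \<beta> where "velocity_profile v r q k c \<beta>" using P(1) by blast
    then show "has_z3_trace \<omega> h (\<lambda>z'. 0) (\<lambda>z. - wderiv \<Omega> e3 (\<lambda>z. v z \<bullet> (k, 0)) z) (\<lambda>z'. 0)"
      using that unfolding velocity_profile_def by (auto simp: has_z3_trace_bottom[OF has_column_rep_uminus])
  qed
  moreover have "bot_partial_slip \<omega> h lam v" if "\<gamma> = -1"
    unfolding bot_partial_slip_def fst_inner
  proof
    fix k :: R2 assume "k \<in> Basis"
    then obtain c \<beta> where "velocity_profile v r q k c \<beta>" using P(1) by blast
    then show "\<exists>t. has_z3_trace \<omega> h (\<lambda>z'. 0) (\<lambda>z. v z \<bullet> (k, 0)) t \<and>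
        has_z3_trace \<omega> h (\<lambda>z'. 0) (\<lambda>z. - wderiv \<Omega> e3 (\<lambda>z. v z \<bullet> (k, 0)) z) (\<lambda>z'. - lam * t z')"
      using that unfolding velocity_profile_def
      by (intro exI[of _ c]) (auto simp: has_z3_trace_bottom has_z3_trace_bottom[OF has_column_rep_uminus])
  qed
  moreover have "bot_zero \<omega> h v" if "\<gamma> < -1"
    unfolding bot_zero_def fst_inner
  proof
    fix k :: R2 assume "k \<in> Basis"
    then obtain c \<beta> where "velocity_profile v r q k c \<beta>" using P(1) by blast
    then show "has_z3_trace \<omega> h (\<lambda>z'. 0) (\<lambda>z. v z \<bullet> (k, 0)) (\<lambda>z'. 0)"
      using that unfolding velocity_profile_def by (auto simp: has_z3_trace_bottom)
  qed
  ultimately show ?thesis by (simp add: reduced_system_def)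
qed

subsection \<open>The limit solves the reduced system\<close>

lemma bottom_term_horizontal:
  assumes k: "k \<in> Basis"
  shows "bottom_term a \<phi> (k, 0) = (LINT z|lebesgue_on \<Omega>. (a z \<bullet> (k, 0)) * pderiv_at e3 \<phi> z)
    + (LINT z|lebesgue_on \<Omega>. wderiv \<Omega> e3 (\<lambda>z. a z \<bullet> (k, 0)) z * \<phi> z)"
  unfolding bottom_term_def
  by (subst sum.remove[OF finite_Basis k]) (auto simp: inner_Basis k intro!: sum.neutral split: if_splits)

text \<open>For test functions reaching the bottom, the residual is minus the boundary pairing of
  \<open>\<beta>\<close> with \<open>\<phi>\<close>, and the bottom term is minus that of
  \<open>c\<close>. Comparing them yields the friction law.\<close>

lemma limit_velocity_profile:
  assumes k: "k \<in> Basis"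
  shows "\<exists>c \<beta>. velocity_profile u w p k c \<beta>"
proof -
  note C = limit_in_class and hk = horizontal_Basis[OF k]
  note V = V_z3_wderiv[OF U_V_z3(2)[OF hk]] and src = sources_L2[OF C k]
  let ?u = "\<lambda>z. u z \<bullet> (k, 0)" let ?a = "wderiv \<Omega> e3 ?u"
  obtain c where c: "has_column_rep ?u c ?a" "AE z' in lebesgue_on \<omega>. col_top c ?a z' = 0"
    using velocity_rep[OF hk] by blast
  obtain q' where q': "q' \<in> H1 \<omega>" "AE z in lebesgue_on \<Omega>. p z = q' (fst z)" using in_limit_classD(4)[OF C] by blast
  have p: "p \<in> L2 \<Omega>" using pressure_mean0 by (simp add: L2_mean0_def)
  \<comment> \<open>Pressure and microrotation are integrated by parts up to the bottom without
    boundary terms: the pressure is differentiated horizontally, and w vanishes at both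
    ends.\<close>
  have residual: "momentum_residual \<phi> (k, 0) = (LINT z|lebesgue_on \<Omega>. ?a z * pderiv_at e3 \<phi> z)
      + (LINT z|lebesgue_on \<Omega>. momentum_source w p k z * \<phi> z)" if \<phi>: "\<phi> \<in> test_functions below_top" for \<phi>
  proof -
    note sm = test_functions_smooth[OF \<phi>]
    have "(LINT z|lebesgue_on \<Omega>. p z * pderiv_at (k, 0) \<phi> z) = - (LINT z|lebesgue_on \<Omega>. wderiv \<Omega> (k, 0) p z * \<phi> z)"
      by (rule horizontal_integration_by_parts[OF pressure_weak_deriv(1)[OF q' k] L2_dom_integrable[OF p]
            L2_dom_integrable[OF src(3)] below_top_vanishes_near_top[OF \<phi>]])
    moreover have "(LINT z|lebesgue_on \<Omega>. test_rot_z3 \<phi> (k, 0) z \<bullet> w z) = (LINT z|lebesgue_on \<Omega>. col_rot w k z * \<phi> z)"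
      by (rule test_rot_z3_parts[OF W_V_z3(2) sm spin_boundary[OF sm]])
    ultimately show ?thesis by (simp add: momentum_residual_def source_integrals(1)[OF C k sm])
  qed
  \<comment> \<open>The upper boundary term is absent since u has zero trace on the top.\<close>
  have bottom: "bottom_term u \<phi> (k, 0) = - (LINT z'|lebesgue_on \<omega>. c z' * \<phi> (z', 0))"
    if \<phi>: "\<phi> \<in> test_functions below_top" for \<phi>
  proof -
    have "bottom_term u \<phi> (k, 0) = (LINT z|lebesgue_on \<Omega>. ?u z * pderiv_at e3 \<phi> z) + (LINT z|lebesgue_on \<Omega>. ?a z * \<phi> z)"
      by (rule bottom_term_horizontal[OF k])
    also have "\<dots> = (LINT z'|lebesgue_on \<omega>. col_top c ?a z' * \<phi> (z', h z') - c z' * \<phi> (z', 0))"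
      by (rule column_integration_by_parts[OF c(1) test_functions_smooth[OF \<phi>]])
    also have "\<dots> = (LINT z'|lebesgue_on \<omega>. - (c z' * \<phi> (z', 0)))"
      by (rule integral_lebesgue_on_cong_AE[OF eventually_mono[OF c(2)]]) auto
    finally show ?thesis by simp
  qed
  have ci: "integrable (lebesgue_on \<omega>) c" using c(1) by (simp add: has_column_rep_def)
  have "(LINT z|lebesgue_on \<Omega>. ?a z * pderiv_at e3 \<phi> z) = - (LINT z|lebesgue_on \<Omega>. momentum_source w p k z * \<phi> z)"
    if "\<phi> \<in> test_functions \<Omega>" for \<phi>
    using residual[OF test_functions_mono[OF dom_subset_below_top that]] momentum_interior[OF that k] by simp
  from has_column_rep_exists[OF L2_dom_integrable[OF V(3)] L2_dom_integrable[OF src(1)] this]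
  obtain \<beta> where \<beta>: "has_column_rep ?a \<beta> (momentum_source w p k)" by blast
  have "AE z' in lebesgue_on \<omega>. if \<gamma> < -1 then c z' = 0 else \<beta> z' = slip * c z'"
  proof (cases "\<gamma> < -1")
    case True
    have "AE z' in lebesgue_on \<omega>. c z' = 0"
    proof (rule column_rep_bottom[OF c(1)])
      fix \<phi> assume \<phi>: "\<phi> \<in> test_functions below_top"
      have "bottom_term u \<phi> (k, 0) = (LINT z|lebesgue_on \<Omega>. ?u z * pderiv_at e3 \<phi> z) + (LINT z|lebesgue_on \<Omega>. ?a z * \<phi> z)"
        by (rule bottom_term_horizontal[OF k])
      then show "(LINT z|lebesgue_on \<Omega>. ?u z * pderiv_at e3 \<phi> z) + (LINT z|lebesgue_on \<Omega>. ?a z * \<phi> z)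
          = - (LINT z'|lebesgue_on \<omega>. 0 * \<phi> (z', 0))"
        using momentum_noslip[OF \<phi> k True] by simp
    qed simp
    then show ?thesis using True by simp
  next
    case False
    have "AE z' in lebesgue_on \<omega>. \<beta> z' = slip * c z'"
    proof (rule column_rep_bottom[OF \<beta>])
      show "integrable (lebesgue_on \<omega>) (\<lambda>z'. slip * c z')" using ci by simp
      fix \<phi> assume \<phi>: "\<phi> \<in> test_functions below_top"
      have "- (LINT z'|lebesgue_on \<omega>. slip * c z' * \<phi> (z', 0)) = slip * bottom_term u \<phi> (k, 0)"
        unfolding bottom[OF \<phi>] mult.assoc integral_mult_right_zero by simp
      then show "(LINT z|lebesgue_on \<Omega>. ?a z * pderiv_at e3 \<phi> z) + (LINT z|lebesgue_on \<Omega>. momentum_source w p k z * \<phi> z)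
          = - (LINT z'|lebesgue_on \<omega>. slip * c z' * \<phi> (z', 0))"
        using residual[OF \<phi>] momentum_slip[OF \<phi> k] False by simp
    qed
    then show ?thesis using False by simp
  qed
  then show ?thesis unfolding velocity_profile_def using c \<beta> by blast
qed

lemma limit_spin_profile:
  assumes k: "k \<in> Basis"
  shows "\<exists>\<delta>. spin_profile u w k \<delta>"
proof -
  note C = limit_in_class and hk = horizontal_Basis[OF k]
  note S = V_z3_wderiv[OF W_V_z3(2)[OF hk]] and src = sources_L2[OF C k]
  have "(LINT z|lebesgue_on \<Omega>. wderiv \<Omega> e3 (\<lambda>z. w z \<bullet> (k, 0)) z * pderiv_at e3 \<phi> z) = - (LINT z|lebesgue_on \<Omega>. spin_source u w k z * \<phi> z)"
    if \<phi>: "\<phi> \<in> test_functions \<Omega>" for \<phi>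
  proof -
    have "(LINT z|lebesgue_on \<Omega>. (u z \<bullet> i) * pderiv_at e3 \<phi> z) + (LINT z|lebesgue_on \<Omega>. wderiv \<Omega> e3 (\<lambda>z. u z \<bullet> i) z * \<phi> z) = 0"
      if "i \<in> Basis" for i
      using has_weak_derivD(3)[OF V_z3_wderiv(2)[OF U_V_z3(2)[OF that]] \<phi>] by simp
    from test_rot_z3_parts[OF U_V_z3(2) test_functions_smooth[OF \<phi>] this, of k] spin_interior[OF \<phi> hk]
    show ?thesis
      unfolding spin_equation_iff[OF C k test_functions_smooth[OF \<phi>], symmetric] fst_inner rot_z3_inner by simp
  qed
  from has_column_rep_exists[OF L2_dom_integrable[OF S(3)] L2_dom_integrable[OF src(2)] this]
  show ?thesis unfolding spin_profile_def using spin_rep[OF hk] by blast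
qed

theorem limit_reduced_system: "reduced_system \<omega> h N Rc lam \<gamma> f g u w p"
  by (intro reduced_system_of_profiles limit_in_class limit_velocity_profile limit_spin_profile flux_limit)

end

subsection \<open>Uniqueness\<close>

lemma (in column_domain) weak_gradient_eq_connected:
  assumes conn: "connected \<omega>" and q: "q1 \<in> H1 \<omega>" "q2 \<in> H1 \<omega>"
    and eq: "\<And>k. k \<in> Basis \<Longrightarrow> AE z' in lebesgue_on \<omega>. wderiv \<omega> k q1 z' = wderiv \<omega> k q2 z'"
  shows "\<exists>\<kappa>. AE z' in lebesgue_on \<omega>. q1 z' - q2 z' = \<kappa>"
proof (rule weak_gradient_zero_connected[OF _ open_base conn])
  show "(\<lambda>z'. q1 z' - q2 z') \<in> L1_loc \<omega>" by (intro L2_L1_loc L2_diff H1_L2 q lebesgue_dom)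
  fix k :: R2 and \<phi> assume k: "k \<in> Basis" and \<phi>: "\<phi> \<in> test_functions \<omega>"
  have "AE z' in lebesgue_on \<omega>. wderiv \<omega> k q1 z' * \<phi> z' = wderiv \<omega> k q2 z' * \<phi> z'"
    using eq[OF k] by eventually_elim simp
  then have "(LINT z'|lebesgue_on \<omega>. wderiv \<omega> k q1 z' * \<phi> z') = (LINT z'|lebesgue_on \<omega>. wderiv \<omega> k q2 z' * \<phi> z')"
    by (rule integral_lebesgue_on_cong_AE) simp
  moreover have "integrable (lebesgue_on \<omega>) (\<lambda>z'. F z' * pderiv_at k \<phi> z')" if "F \<in> H1 \<omega>" for F
    by (intro integrable_mult_smooth[OF L2_base_integrable[OF H1_L2[OF that]]] smooth_pderiv_at test_functions_smooth[OF \<phi>] bounded_base)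
  ultimately show "(LINT z'|lebesgue_on \<omega>. (q1 z' - q2 z') * pderiv_at k \<phi> z') = 0"
    using has_weak_derivD(3)[OF H1_wderiv(1)[OF q(1) k open_base] \<phi>] has_weak_derivD(3)[OF H1_wderiv(1)[OF q(2) k open_base] \<phi>] q
    by (simp add: left_diff_distrib)
qed

lemma (in column_domain) mean0_constant_zero:
  fixes q :: "R3 \<Rightarrow> real"
  assumes ae: "AE z in lebesgue_on \<Omega>. q z = \<kappa>" and mean: "(LINT z|lebesgue_on \<Omega>. q z) = 0"
  shows "AE z in lebesgue_on \<Omega>. q z = 0"
proof -
  have "(LINT z|lebesgue_on \<Omega>. \<kappa>) = 0"
    using integral_lebesgue_on_cong_AE[OF ae lebesgue_dom(1)] mean by simp
  \<comment> \<open>Multiplying by \<open>\<kappa>\<close> avoids dividing by the measure of the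
    domain, which is 0 when the base is empty.\<close>
  then have "(LINT z|lebesgue_on \<Omega>. \<kappa>\<^sup>2) \<le> 0" by (auto simp: power2_eq_square)
  from L2_square_zero[OF smooth_dom_L2[OF smooth_const] this] ae show ?thesis by eventually_elim simp
qed

context thin_film_limit begin

lemma slip_nonneg: "0 \<le> slip"
  using lam_pos by simp

text \<open>The boundary laws are linear and homogeneous, so differences obey them too. In the
  no-slip regime the difference of the bottom values is 0; otherwise \<open>\<beta>\<close> is a
  nonnegative multiple of it. Either way the product has the sign that the energy estimate
  wants.\<close>

lemma velocity_profile_diff:
  assumes P: "velocity_profile v1 r1 q1 k c1 \<beta>1" "velocity_profile v2 r2 q2 k c2 \<beta>2"
  defines "c \<equiv> \<lambda>z'. c1 z' - c2 z'" and "\<beta> \<equiv> \<lambda>z'. \<beta>1 z' - \<beta>2 z'"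
    and "A \<equiv> \<lambda>z. wderiv \<Omega> e3 (\<lambda>z. v1 z \<bullet> (k, 0)) z - wderiv \<Omega> e3 (\<lambda>z. v2 z \<bullet> (k, 0)) z"
  shows "has_column_rep (\<lambda>z. v1 z \<bullet> (k, 0) - v2 z \<bullet> (k, 0)) c A" "AE z' in lebesgue_on \<omega>. col_top c A z' = 0"
    "has_column_rep A \<beta> (\<lambda>z. momentum_source r1 q1 k z - momentum_source r2 q2 k z)"
    "AE z' in lebesgue_on \<omega>. 0 \<le> c z' * \<beta> z'"
proof -
  note P = P[unfolded velocity_profile_def]
  show "has_column_rep (\<lambda>z. v1 z \<bullet> (k, 0) - v2 z \<bullet> (k, 0)) c A"
    "has_column_rep A \<beta> (\<lambda>z. momentum_source r1 q1 k z - momentum_source r2 q2 k z)"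
    unfolding c_def \<beta>_def A_def
    by (rule has_column_rep_diff(1)[OF P(1)[THEN conjunct1] P(2)[THEN conjunct1]]
        has_column_rep_diff(1)[OF P(1)[THEN conjunct2, THEN conjunct2, THEN conjunct1] P(2)[THEN conjunct2, THEN conjunct2, THEN conjunct1]])+
  have "AE z' in lebesgue_on \<omega>. col_top c A z' = col_top c1 (wderiv \<Omega> e3 (\<lambda>z. v1 z \<bullet> (k, 0))) z'
      - col_top c2 (wderiv \<Omega> e3 (\<lambda>z. v2 z \<bullet> (k, 0))) z'"
    unfolding c_def A_def by (rule has_column_rep_diff(2)[OF P(1)[THEN conjunct1] P(2)[THEN conjunct1]])
  moreover have "AE z' in lebesgue_on \<omega>. col_top c1 (wderiv \<Omega> e3 (\<lambda>z. v1 z \<bullet> (k, 0))) z' = 0"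
    "AE z' in lebesgue_on \<omega>. col_top c2 (wderiv \<Omega> e3 (\<lambda>z. v2 z \<bullet> (k, 0))) z' = 0" using P by blast+
  ultimately show "AE z' in lebesgue_on \<omega>. col_top c A z' = 0" by eventually_elim simp
  have "AE z' in lebesgue_on \<omega>. if \<gamma> < -1 then c1 z' = 0 else \<beta>1 z' = slip * c1 z'"
    "AE z' in lebesgue_on \<omega>. if \<gamma> < -1 then c2 z' = 0 else \<beta>2 z' = slip * c2 z'" using P by blast+
  then show "AE z' in lebesgue_on \<omega>. 0 \<le> c z' * \<beta> z'"
  proof eventually_elim
    case (elim z')
    show ?case
    proof (cases "\<gamma> < -1")
      case False
      with elim have "\<beta> z' = slip * c z'" by (simp add: \<beta>_def c_def right_diff_distrib)
      then have "c z' * \<beta> z' = slip * (c z')\<^sup>2" by (simp add: power2_eq_square)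
      then show ?thesis using slip_nonneg by simp
    qed (use elim in \<open>simp add: c_def\<close>)
  qed
qed

lemma spin_profile_diff:
  assumes P: "spin_profile v1 r1 k \<delta>1" "spin_profile v2 r2 k \<delta>2"
  defines "D \<equiv> \<lambda>z. wderiv \<Omega> e3 (\<lambda>z. r1 z \<bullet> (k, 0)) z - wderiv \<Omega> e3 (\<lambda>z. r2 z \<bullet> (k, 0)) z"
  shows "has_column_rep (\<lambda>z. r1 z \<bullet> (k, 0) - r2 z \<bullet> (k, 0)) (\<lambda>z'. 0) D" "AE z' in lebesgue_on \<omega>. col_top (\<lambda>z'. 0) D z' = 0"
    "has_column_rep D (\<lambda>z'. \<delta>1 z' - \<delta>2 z') (\<lambda>z. spin_source v1 r1 k z - spin_source v2 r2 k z)"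
proof -
  note P = P[unfolded spin_profile_def]
  have rep: "has_column_rep (\<lambda>z. r1 z \<bullet> (k, 0)) (\<lambda>z'. 0) (wderiv \<Omega> e3 (\<lambda>z. r1 z \<bullet> (k, 0)))"
    "has_column_rep (\<lambda>z. r2 z \<bullet> (k, 0)) (\<lambda>z'. 0) (wderiv \<Omega> e3 (\<lambda>z. r2 z \<bullet> (k, 0)))" using P by blast+
  note d = has_column_rep_diff[OF rep]
  show "has_column_rep (\<lambda>z. r1 z \<bullet> (k, 0) - r2 z \<bullet> (k, 0)) (\<lambda>z'. 0) D" using d(1) by (simp add: D_def)
  show "has_column_rep D (\<lambda>z'. \<delta>1 z' - \<delta>2 z') (\<lambda>z. spin_source v1 r1 k z - spin_source v2 r2 k z)"
    unfolding D_def by (rule has_column_rep_diff(1)[OF P(1)[THEN conjunct2, THEN conjunct2] P(2)[THEN conjunct2, THEN conjunct2]])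
  have "AE z' in lebesgue_on \<omega>. col_top (\<lambda>z'. 0) (wderiv \<Omega> e3 (\<lambda>z. r1 z \<bullet> (k, 0))) z' = 0"
    "AE z' in lebesgue_on \<omega>. col_top (\<lambda>z'. 0) (wderiv \<Omega> e3 (\<lambda>z. r2 z \<bullet> (k, 0))) z' = 0" using P by blast+
  with d(2) show "AE z' in lebesgue_on \<omega>. col_top (\<lambda>z'. 0) D z' = 0"
    unfolding D_def by eventually_elim simp
qed

text \<open>Differences of profiles satisfy the homogeneous equations and boundary laws, the
  situation of \<open>micropolar_energy\<close>. Uniqueness is up to null sets, the sense in which
  the limit class determines its functions.\<close>

theorem reduced_system_unique:
  assumes conn: "connected \<omega>" and N: "N\<^sup>2 < 1"
    and C1: "in_limit_class \<omega> h v1 r1 q1" and R1: "reduced_system \<omega> h N Rc lam \<gamma> f g v1 r1 q1"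
    and C2: "in_limit_class \<omega> h v2 r2 q2" and R2: "reduced_system \<omega> h N Rc lam \<gamma> f g v2 r2 q2"
  shows "AE z in lebesgue_on \<Omega>. v1 z = v2 z \<and> r1 z = r2 z \<and> q1 z = q2 z"
proof -
  let ?k1 = "axis 1 1 :: R2" and ?k2 = "axis 2 1 :: R2"
  have kB: "?k1 \<in> Basis" "?k2 \<in> Basis" by (simp_all add: Basis_R2)
  note cl1 = in_limit_classD[OF C1] and cl2 = in_limit_classD[OF C2]
  obtain p1 where p1: "p1 \<in> H1 \<omega>" "AE z in lebesgue_on \<Omega>. q1 z = p1 (fst z)" using cl1(4) by blast
  obtain p2 where p2: "p2 \<in> H1 \<omega>" "AE z in lebesgue_on \<Omega>. q2 z = p2 (fst z)" using cl2(4) by blast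
  define U where "U k z = v1 z \<bullet> (k, 0) - v2 z \<bullet> (k, 0)" for k z
  define W where "W k z = r1 z \<bullet> (k, 0) - r2 z \<bullet> (k, 0)" for k z
  define A where "A k z = wderiv \<Omega> e3 (\<lambda>z. v1 z \<bullet> (k, 0)) z - wderiv \<Omega> e3 (\<lambda>z. v2 z \<bullet> (k, 0)) z" for k z
  define D where "D k z = wderiv \<Omega> e3 (\<lambda>z. r1 z \<bullet> (k, 0)) z - wderiv \<Omega> e3 (\<lambda>z. r2 z \<bullet> (k, 0)) z" for k z
  define Q where "Q k z = wderiv \<Omega> (k, 0) q1 z - wderiv \<Omega> (k, 0) q2 z" for k z
  have L: "U k \<in> L2 \<Omega>" "W k \<in> L2 \<Omega>" "A k \<in> L2 \<Omega>" "D k \<in> L2 \<Omega>" "Q k \<in> L2 \<Omega>" if "k \<in> Basis" for k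
    unfolding U_def[abs_def] W_def[abs_def] A_def[abs_def] D_def[abs_def] Q_def[abs_def]
    by (intro L2_diff V_z3_wderiv(1,3) cl1(1,2) cl2(1,2) horizontal_Basis that sources_L2(3)[OF C1 that] sources_L2(3)[OF C2 that])+
  \<comment> \<open>The data f and g cancel, and the reduced rotation couples each component to the
    other one with opposite signs.\<close>
  have src: "(\<lambda>z. momentum_source r1 q1 ?k1 z - momentum_source r2 q2 ?k1 z) = (\<lambda>z. Q ?k1 z + 2 * N\<^sup>2 * D ?k2 z)"
    "(\<lambda>z. momentum_source r1 q1 ?k2 z - momentum_source r2 q2 ?k2 z) = (\<lambda>z. Q ?k2 z - 2 * N\<^sup>2 * D ?k1 z)"
    "(\<lambda>z. spin_source v1 r1 ?k1 z - spin_source v2 r2 ?k1 z) = (\<lambda>z. (4 * N\<^sup>2 * W ?k1 z + 2 * N\<^sup>2 * A ?k2 z) / Rc)"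
    "(\<lambda>z. spin_source v1 r1 ?k2 z - spin_source v2 r2 ?k2 z) = (\<lambda>z. (4 * N\<^sup>2 * W ?k2 z - 2 * N\<^sup>2 * A ?k1 z) / Rc)"
    by (simp_all add: momentum_source_def spin_source_def col_rot_def Q_def D_def W_def A_def e1_def e2_def
        inner_axis_axis fun_eq_iff algebra_simps diff_divide_distrib add_divide_distrib)
  obtain c11 b11 where P11: "velocity_profile v1 r1 q1 ?k1 c11 b11" using profiles_of_reduced_system(1)[OF C1 R1 kB(1)] by blast
  obtain c12 b12 where P12: "velocity_profile v1 r1 q1 ?k2 c12 b12" using profiles_of_reduced_system(1)[OF C1 R1 kB(2)] by blast
  obtain c21 b21 where P21: "velocity_profile v2 r2 q2 ?k1 c21 b21" using profiles_of_reduced_system(1)[OF C2 R2 kB(1)] by blast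
  obtain c22 b22 where P22: "velocity_profile v2 r2 q2 ?k2 c22 b22" using profiles_of_reduced_system(1)[OF C2 R2 kB(2)] by blast
  obtain d11 where S11: "spin_profile v1 r1 ?k1 d11" using profiles_of_reduced_system(2)[OF C1 R1 kB(1)] by blast
  obtain d12 where S12: "spin_profile v1 r1 ?k2 d12" using profiles_of_reduced_system(2)[OF C1 R1 kB(2)] by blast
  obtain d21 where S21: "spin_profile v2 r2 ?k1 d21" using profiles_of_reduced_system(2)[OF C2 R2 kB(1)] by blast
  obtain d22 where S22: "spin_profile v2 r2 ?k2 d22" using profiles_of_reduced_system(2)[OF C2 R2 kB(2)] by blast
  note V1 = velocity_profile_diff[OF P11 P21, folded U_def A_def, unfolded src]
    and V2 = velocity_profile_diff[OF P12 P22, folded U_def A_def, unfolded src]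
    and W1 = spin_profile_diff[OF S11 S21, folded W_def D_def, unfolded src]
    and W2 = spin_profile_diff[OF S12 S22, folded W_def D_def, unfolded src]
  \<comment> \<open>The difference of the pressures is inserted as test function into the flux
    conditions of both solutions.\<close>
  let ?\<theta> = "\<lambda>z'. p1 z' - p2 z'"
  have \<theta>: "?\<theta> \<in> H1 \<omega>" using H1_linear[OF p1(1) p2(1) open_base, of 1 "-1"] by simp
  have Q_AE: "AE z in lebesgue_on \<Omega>. Q k z = wderiv \<omega> k p1 (fst z) - wderiv \<omega> k p2 (fst z)" if "k \<in> Basis" for k
    using pressure_weak_deriv(2)[OF p1 that] pressure_weak_deriv(2)[OF p2 that] by eventually_elim (simp add: Q_def)
  have \<theta>_AE: "AE z' in lebesgue_on \<omega>. wderiv \<omega> k ?\<theta> z' = wderiv \<omega> k p1 z' - wderiv \<omega> k p2 z'" if k: "k \<in> Basis" for k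
    using wderiv_AE_eq[OF has_weak_deriv_linear[where a = 1 and b = "-1", OF H1_wderiv(1)[OF p1(1) k open_base]
          H1_wderiv(1)[OF p2(1) k open_base] lebesgue_dom(2)] open_base] by simp
  have fl: "(\<Sum>k\<in>Basis. LINT z|lebesgue_on \<Omega>. (v z \<bullet> (k, 0)) * Q k z) = 0"
    if C: "in_limit_class \<omega> h v r q" and R: "reduced_system \<omega> h N Rc lam \<gamma> f g v r q" for v r q
  proof -
    have "(\<Sum>k\<in>Basis. LINT z|lebesgue_on \<Omega>. (v z \<bullet> (k, 0)) * wderiv \<omega> k ?\<theta> (fst z)) = 0"
      using R \<theta> flux_Fubini[OF V_z3_wderiv(1)[OF in_limit_classD(1)[OF C]] \<theta>]
      unfolding reduced_system_def reduced_equations_def Let_def by simp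
    moreover have "(LINT z|lebesgue_on \<Omega>. (v z \<bullet> (k, 0)) * Q k z) = (LINT z|lebesgue_on \<Omega>. (v z \<bullet> (k, 0)) * wderiv \<omega> k ?\<theta> (fst z))"
      if k: "k \<in> Basis" for k
    proof (rule integral_lebesgue_on_cong_AE)
      show "AE z in lebesgue_on \<Omega>. (v z \<bullet> (k, 0)) * Q k z = (v z \<bullet> (k, 0)) * wderiv \<omega> k ?\<theta> (fst z)"
        using Q_AE[OF k] column_AE_fst[OF \<theta>_AE[OF k]] by eventually_elim simp
    qed simp
    ultimately show ?thesis by simp
  qed
  have UQ: "(LINT z|lebesgue_on \<Omega>. U k z * Q k z) = (LINT z|lebesgue_on \<Omega>. (v1 z \<bullet> (k, 0)) * Q k z) - (LINT z|lebesgue_on \<Omega>. (v2 z \<bullet> (k, 0)) * Q k z)"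
    if k: "k \<in> Basis" for k
    unfolding U_def left_diff_distrib
    by (intro Bochner_Integration.integral_diff L2_mult_integrable V_z3_wderiv(1) cl1(1) cl2(1) horizontal_Basis k L(5))
  have flux: "(LINT z|lebesgue_on \<Omega>. U ?k1 z * Q ?k1 z) + (LINT z|lebesgue_on \<Omega>. U ?k2 z * Q ?k2 z) = 0"
    unfolding UQ[OF kB(1)] UQ[OF kB(2)] using fl[OF C1 R1] fl[OF C2 R2] unfolding sum_Basis_R2 by linarith
  have zero: "AE z in lebesgue_on \<Omega>. U ?k1 z = 0 \<and> U ?k2 z = 0 \<and> W ?k1 z = 0 \<and> W ?k2 z = 0 \<and> Q ?k1 z = 0 \<and> Q ?k2 z = 0"
    by (rule micropolar_energy[OF N Rc_pos L(1)[OF kB(1)] L(1)[OF kB(2)] L(3)[OF kB(1)] L(3)[OF kB(2)] L(2)[OF kB(1)] L(2)[OF kB(2)]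
          L(4)[OF kB(1)] L(4)[OF kB(2)] L(5)[OF kB(1)] L(5)[OF kB(2)] V1(1,2) V2(1,2) V1(3) V2(3) W1(1,2) W2(1,2) W1(3) W2(3) V1(4) V2(4) flux])
  \<comment> \<open>Q vanishes in the domain, and since columns are not null the two gradients agree
    on the base.\<close>
  have "AE z' in lebesgue_on \<omega>. wderiv \<omega> k p1 z' = wderiv \<omega> k p2 z'" if k: "k \<in> Basis" for k
  proof (rule base_AE_of_column_AE)
    show "AE z in lebesgue_on \<Omega>. wderiv \<omega> k p1 (fst z) = wderiv \<omega> k p2 (fst z)"
      using zero Q_AE[OF k] by eventually_elim (use k in \<open>auto simp: Basis_R2\<close>)
  qed
  from weak_gradient_eq_connected[OF conn p1(1) p2(1) this]
  obtain \<kappa> where "AE z' in lebesgue_on \<omega>. p1 z' - p2 z' = \<kappa>" by blast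
  from column_AE_fst[OF this] p1(2) p2(2) have \<kappa>: "AE z in lebesgue_on \<Omega>. q1 z - q2 z = \<kappa>"
    by eventually_elim simp
  have qq: "AE z in lebesgue_on \<Omega>. q1 z - q2 z = 0"
    by (rule mean0_constant_zero[OF \<kappa>]) (use cl1(3) cl2(3) L2_dom_integrable in \<open>simp add: L2_mean0_def\<close>)
  have eqI: "x = y" if "x \<bullet> (?k1, 0) - y \<bullet> (?k1, 0) = 0" "x \<bullet> (?k2, 0) - y \<bullet> (?k2, 0) = 0" "snd x = 0" "snd y = 0" for x y :: R3
  proof -
    have "fst x \<bullet> k = fst y \<bullet> k" if "k \<in> Basis" for k
      using \<open>x \<bullet> (?k1, 0) - y \<bullet> (?k1, 0) = 0\<close> \<open>x \<bullet> (?k2, 0) - y \<bullet> (?k2, 0) = 0\<close> that by (auto simp: Basis_R2 fst_inner)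
    then have "fst x = fst y" by (rule euclidean_eqI)
    then show ?thesis using that(3,4) by (simp add: prod_eq_iff)
  qed
  show ?thesis
    using qq zero cl1(5,6) cl2(5,6)
  proof eventually_elim
    case (elim z)
    have "v1 z = v2 z" by (rule eqI) (use elim in \<open>simp_all add: U_def\<close>)
    moreover have "r1 z = r2 z" by (rule eqI) (use elim in \<open>simp_all add: W_def\<close>)
    ultimately show ?case using elim(1) by simp
  qed
qed

end

theorem theorem5p1:
  fixes \<omega> :: "R2 set" and h :: "R2 \<Rightarrow> real" and hmin hmax N Rc lam \<gamma> :: real
    and f g :: "R2 \<Rightarrow> R2"
    and u\<epsilon> w\<epsilon> :: "real \<Rightarrow> R3 \<Rightarrow> R3" and p\<epsilon> :: "real \<Rightarrow> R3 \<Rightarrow> real"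
    and \<epsilon> :: "nat \<Rightarrow> real"
    and u w :: "R3 \<Rightarrow> R3" and p :: "R3 \<Rightarrow> real"
  assumes "bounded \<omega>" "connected \<omega>" "open \<omega>" "lipschitz_boundary \<omega>"
    and "h \<in> W1inf \<omega>" "continuous_on \<omega> h"
    and "0 < hmin" "\<And>x'. x' \<in> \<omega> \<Longrightarrow> hmin \<le> h x' \<and> h x' < hmax"
    and "0 < N" "0 < Rc" "0 < lam" "N\<^sup>2 < 1"
    and "\<And>i. i \<in> Basis \<Longrightarrow> (\<lambda>x'. f x' \<bullet> i) \<in> L2 \<omega>"
    and "\<And>i. i \<in> Basis \<Longrightarrow> (\<lambda>x'. g x' \<bullet> i) \<in> L2 \<omega>"
    and "\<And>e. 0 < e \<Longrightarrow> micropolar_solution \<omega> h N Rc lam \<gamma> f g e (u\<epsilon> e) (w\<epsilon> e) (p\<epsilon> e)"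
    and "\<And>n. 0 < \<epsilon> n" "\<epsilon> \<longlonglongrightarrow> 0"
    and "limit_triplet \<omega> h \<epsilon> u\<epsilon> w\<epsilon> p\<epsilon> u w p"
  shows "in_limit_class \<omega> h u w p \<and> reduced_system \<omega> h N Rc lam \<gamma> f g u w p \<and>
    (\<forall>v r q. in_limit_class \<omega> h v r q \<and> reduced_system \<omega> h N Rc lam \<gamma> f g v r q \<longrightarrow>
       (AE z in lebesgue_on (dom_under \<omega> h). v z = u z \<and> r z = w z \<and> q z = p z))"
proof -
  interpret thin_film_limit \<omega> h hmin hmax N Rc lam \<gamma> f g u\<epsilon> w\<epsilon> p\<epsilon> \<epsilon> u w p
    using assms by unfold_locales auto
  show ?thesis
    using limit_in_class limit_reduced_system
      reduced_system_unique[OF assms(2) assms(12) _ _ limit_in_class limit_reduced_system] by blast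
qed

end
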